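(* If $\eta_1<1/2$ and $\eta_2<1/2$, then $$\|H_{\mathrm d}(\cdot)\|_{\mathrm H}\le\sqrt{2\sigma_1^2(\xi_1+\xi_2)+2(\zeta_1+\zeta_2)+(\xi_1+\xi_2)(\zeta_1+\zeta_2)}=:\epsilon_{\mathrm d,\mathrm H},$$ $$\|H_{\mathrm d}(\cdot)\|_{\mathcal{H}_2}\le\sqrt{\min\{r,m\}}\Big[\sigma_1^2\big(\|\widehat B_1\|_2+\|\widetilde B_1\|_2\big)\|B\|_2\,\epsilon_b+\big(2\|\widehat B_1^{\mathrm T}\|_2\|\widetilde B_1\|_2\,\zeta_1+\|\widetilde B_1^{\mathrm T}\|_2^2\,\zeta_2\big)\Big]^{1/2}=:\epsilon_{\mathrm d,2},$$ where $H_{\mathrm d}(s)=H_{\mathrm{bt}}(s)-\widetilde H_{\mathrm{bt}}(s)$, and $m$ and $p$ are the numbers of columns of $B$ and $C$, respectively.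
   Context: **System.** $A\in\mathbb{R}^{n\times n}$, $B\in\mathbb{R}^{n\times m}$, $C\in\mathbb{R}^{n\times p}$ define the system $x'=Ax+Bu$, $y=C^{\mathrm T}x$, assumed stable (all eigenvalues of $A$ have negative real part), controllable and observable. The Gramians $P,Q\succ0$ solve $AP+PA^{\mathrm T}+BB^{\mathrm T}=0$ and $A^{\mathrm T}Q+QA+CC^{\mathrm T}=0$. **Approximate Gramians.** $\widetilde S\in\mathbb{R}^{n\times\widetilde r_1}$, $\widetilde R\in\mathbb{R}^{n\times\widetilde r_2}$, $\widetilde P=\widetilde S\widetilde S^{\mathrm T}$, $\widetilde Q=\widetilde R\widetilde R^{\mathrm T}$ satisfy $0\preceq\widetilde P\preceq P$, $0\preceq\widetilde Q\preceq Q$, $\|P-\widetilde P\|_2\le\epsilon_1$, $\|Q-\widetilde Q\|_2\le\epsilon_2$. $E\in\mathbb{R}^{n\times p_1}$, $F\in\mathbb{R}^{n\times p_2}$ are such that $P=\widetilde P+EE^{\mathrm T}$, $Q=\widetilde Q+FF^{\mathrm T}$. Put $S=[\widetilde S,E]\in\mathbb{R}^{n\times m_1}$, $R=[\widetilde R,F]\in\mathbb{R}^{n\times m_2}$ ($m_i=\widetilde r_i+p_i$), so $P=SS^{\mathrm T}$, $Q=RR^{\mathrm T}$; it is arranged that $m_1\ge m_2$ (append zero columns to $E$ if needed). $1\le r\le n$ is the reduction order, with $\widetilde r_1,\widetilde r_2\ge r$. Let $G=S^{\mathrm T}R$ and $\widetilde G=\begin{bmatrix}\widetilde S^{\mathrm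 T}\widetilde R&0\\0&0\end{bmatrix}\in\mathbb{R}^{m_1\times m_2}$. **SVD of $G$.** $G=U\Sigma V^{\mathrm T}$ with $U=[U_1,U_2]$, $V=[V_1,V_2]$ orthogonal, $U_1\in\mathbb{R}^{m_1\times r}$, $V_1\in\mathbb{R}^{m_2\times r}$, $\Sigma=\begin{bmatrix}\Sigma_1&0\\0&\Sigma_2\end{bmatrix}\in\mathbb{R}^{m_1\times m_2}$ rectangular diagonal with diagonal entries $\sigma_1\ge\cdots\ge\sigma_{m_2}\ge0$, $\Sigma_1=\mathrm{diag}(\sigma_1,\dots,\sigma_r)$; convention $\sigma_i=0$ for $i>m_2$. **Quantities and standing assumption.** $\varepsilon=\max\{\sqrt{\|P\|_2\epsilon_2},\sqrt{\|Q\|_2\epsilon_1}\}+\sqrt{\epsilon_1\epsilon_2}$, $\delta=\sigma_r-\sigma_{r+1}$, $\underline\delta=\delta-2\varepsilon$, $\underline\sigma_r=\sigma_r-\varepsilon$. It is assumed that $\underline\delta>0$ and $\varepsilon/\underline\delta<1/2$. **Decomposition of $\widetilde G$.** Fix $\Omega\in\mathbb{R}^{(m_2-r)\times r}$, $\Gamma\in\mathbb{R}^{(m_1-r)\times r}$ with $\max\{\|\Omega\|_2,\|\Gamma\|_2\}\le2\varepsilon/\underline\delta$ such that, with $\check U_1=(U_1-U_2\Gamma)(I+\Gamma^{\mathrm T}\Gamma)^{-1/2}$, $\check U_2=(U_1\Gamma^{\mathrm T}+U_2)(I+\Gamma\Gamma^{\mathrm T})^{-1/2}$, $\check V_1=(V_1+V_2\Omega)(I+\Omega^{\mathrm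 T}\Omega)^{-1/2}$, $\check V_2=(-V_1\Omega^{\mathrm T}+V_2)(I+\Omega\Omega^{\mathrm T})^{-1/2}$, one has $\widetilde G=[\check U_1,\check U_2]\begin{bmatrix}\check\Sigma_1&0\\0&\check\Sigma_2\end{bmatrix}[\check V_1,\check V_2]^{\mathrm T}$ with $\check\Sigma_1\in\mathbb{R}^{r\times r}$ (such $\Omega,\Gamma$ exist and $\check\Sigma_1$ is nonsingular under the standing assumption). **Reduced models.** $X_1=SU_1$, $Y_1=RV_1\Sigma_1^{-1}$ (exact balanced truncation) and $\widetilde X_1=[\widetilde S,0_{n\times(m_1-\widetilde r_1)}]\check U_1$, $\widetilde Y_1=[\widetilde R,0_{n\times(m_2-\widetilde r_2)}]\check V_1\check\Sigma_1^{-1}$ (approximate balanced truncation). $\widehat A_{11}=Y_1^{\mathrm T}AX_1$, $\widehat B_1=Y_1^{\mathrm T}B$, $\widehat C_1=X_1^{\mathrm T}C$; $\widetilde A_{11}=\widetilde Y_1^{\mathrm T}A\widetilde X_1$, $\widetilde B_1=\widetilde Y_1^{\mathrm T}B$, $\widetilde C_1=\widetilde X_1^{\mathrm T}C$. Transfer functions: $H_{\mathrm{bt}}(s)=\widehat C_1^{\mathrm T}(sI_r-\widehat A_{11})^{-1}\widehat B_1$ and $\widetilde H_{\mathrm{bt}}(s)=\widetilde C_1^{\mathrm T}(sI_r-\widetilde A_{11})^{-1}\widetilde B_1$. **Error constants.** $\epsilon_x=\sqrt{\epsilon_1}+\sqrt{\|P\|_2}\,\frac{2\varepsilon}{\underline\delta}$;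 $\epsilon_y=\frac{\sqrt{\epsilon_2}}{\sigma_r}+\frac{\sqrt{\|Q\|_2}}{\sigma_r}\Big(1+\frac{\underline\delta}{2\underline\sigma_r}+\frac{2\sigma_1}{\underline\sigma_r}\Big)\frac{2\varepsilon}{\underline\delta}$; $\epsilon_a=\sqrt{\|P\|_2}\,\epsilon_y+\frac{\sqrt{\|Q\|_2}}{\sigma_r}\epsilon_x$; $\epsilon_b=\epsilon_y$; $\epsilon_c=\epsilon_x$; $\epsilon_{b2}=\sqrt{\|Q\|_2}\big(\frac1{\underline\sigma_r}+\frac1{\sigma_r}\big)\epsilon_y$; $\epsilon_{c2}=2\sqrt{\|P\|_2}\,\epsilon_x$. $K_1=\int_0^\infty e^{\widehat A_{11}t}e^{\widehat A_{11}^{\mathrm T}t}dt$, $K_2=\int_0^\infty e^{\widehat A_{11}^{\mathrm T}t}e^{\widehat A_{11}t}dt$ (well defined since $\widehat A_{11}$ is stable); $\eta_i=\|A\|_2\|K_i\|_2\epsilon_a$, $i=1,2$. $\xi_1=\frac{\|K_1\|_2}{1-\eta_1}\big(\|\widehat B_1\|_2\|B\|_2\epsilon_b+\|A\|_2\epsilon_a\big)$; $\xi_2=\frac{\|K_1\|_2}{1-2\eta_1}\big(\|BB^{\mathrm T}\|_2\epsilon_{b2}+2\|A\|_2\epsilon_a\big)$; $\zeta_1=\frac{\|K_2\|_2}{1-\eta_2}\big(\|\widehat C_1\|_2\|C\|_2\epsilon_c+\|A\|_2\epsilon_a\big)$; $\zeta_2=\frac{\|K_2\|_2}{1-2\eta_2}\big(\|CC^{\mathrm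 T}\|_2\epsilon_{c2}+2\|A\|_2\epsilon_a\big)$. **Norms.** For a transfer function $\mathsf C^{\mathrm T}(sI-\mathsf A)^{-1}\mathsf B$ with $\mathsf A$ stable and Gramians $\mathsf P,\mathsf Q$ solving $\mathsf A\mathsf P+\mathsf P\mathsf A^{\mathrm T}+\mathsf B\mathsf B^{\mathrm T}=0$, $\mathsf A^{\mathrm T}\mathsf Q+\mathsf Q\mathsf A+\mathsf C\mathsf C^{\mathrm T}=0$, the Hankel norm is $\|\cdot\|_{\mathrm H}=\sqrt{\lambda_{\max}(\mathsf P\mathsf Q)}$ and the $\mathcal H_2$-norm is $\|\cdot\|_{\mathcal H_2}=\sqrt{\mathrm{tr}(\mathsf B^{\mathrm T}\mathsf Q\mathsf B)}=\sqrt{\mathrm{tr}(\mathsf C^{\mathrm T}\mathsf P\mathsf C)}$. $H_{\mathrm d}$ is realized by $\mathsf A=\begin{bmatrix}\widehat A_{11}&\\&\widetilde A_{11}\end{bmatrix}$, $\mathsf B=\begin{bmatrix}\widehat B_1\\\widetilde B_1\end{bmatrix}$, $\mathsf C=\begin{bmatrix}\widehat C_1\\-\widetilde C_1\end{bmatrix}$. *)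

theory Defs
  imports
    "HOL-Analysis.Henstock_Kurzweil_Integration"
    "Jordan_Normal_Form.Gauss_Jordan_Elimination"
    "Jordan_Normal_Form.Char_Poly"
begin

(* For a non-invertible argument the value is unspecified. *)
definition mat_inv :: "'a::field mat \<Rightarrow> 'a mat" where
  "mat_inv M = the (mat_inverse M)"

definition append_cols :: "'a::zero mat \<Rightarrow> 'a mat \<Rightarrow> 'a mat" (infixr \<open>@\<^sub>c\<close> 65) where
  "M @\<^sub>c N = four_block_mat M N (0\<^sub>m 0 (dim_col M)) (0\<^sub>m 0 (dim_col N))"

(* Rectangular diagonal matrix; the sequence d is indexed from 1. *)
definition rect_diag :: "nat \<Rightarrow> nat \<Rightarrow> (nat \<Rightarrow> real) \<Rightarrow> real mat" where
  "rect_diag k l d = mat k l (\<lambda>(i, j). if i = j then d (i + 1) else 0)"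

definition mat_trace :: "real mat \<Rightarrow> real" where
  "mat_trace M = (\<Sum>i<dim_row M. M $$ (i, i))"

definition vnorm :: "real vec \<Rightarrow> real" where
  "vnorm v = sqrt (scalar_prod v v)"

(* The closed unit ball (rather than the sphere) makes the norm 0 for matrices without columns. *)
definition spec_norm :: "real mat \<Rightarrow> real" where
  "spec_norm M = Sup {vnorm (M *\<^sub>v v) | v. v \<in> carrier_vec (dim_col M) \<and> vnorm v \<le> 1}"

definition pos_semidef :: "nat \<Rightarrow> real mat \<Rightarrow> bool" where
  "pos_semidef n M \<longleftrightarrow> M \<in> carrier_mat n n \<and> transpose_mat M = M \<and>
     (\<forall>v\<in>carrier_vec n. scalar_prod v (M *\<^sub>v v) \<ge> 0)"

definition pos_def :: "nat \<Rightarrow> real mat \<Rightarrow> bool" where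
  "pos_def n M \<longleftrightarrow> M \<in> carrier_mat n n \<and> transpose_mat M = M \<and>
     (\<forall>v\<in>carrier_vec n. v \<noteq> 0\<^sub>v n \<longrightarrow> scalar_prod v (M *\<^sub>v v) > 0)"

(* The principal square root: a positive semidefinite matrix has exactly one positive
   semidefinite square root. *)
definition mat_sqrt :: "real mat \<Rightarrow> real mat" where
  "mat_sqrt M = (THE X. pos_semidef (dim_row M) X \<and> X * X = M)"

definition mat_exp :: "real mat \<Rightarrow> real mat" where
  "mat_exp M = mat (dim_row M) (dim_row M) (\<lambda>(i, j). \<Sum>k. (M ^\<^sub>m k) $$ (i, j) / fact k)"

definition mat_integral :: "nat \<Rightarrow> nat \<Rightarrow> (real \<Rightarrow> real mat) \<Rightarrow> real mat" where
  "mat_integral k l f = mat k l (\<lambda>(i, j). integral {0..} (\<lambda>t. f t $$ (i, j)))"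

abbreviation cmat :: "real mat \<Rightarrow> complex mat" where
  "cmat \<equiv> map_mat complex_of_real"

definition stable_mat :: "real mat \<Rightarrow> bool" where
  "stable_mat A \<longleftrightarrow> (\<forall>l. eigenvalue (cmat A) l \<longrightarrow> Re l < 0)"

(* Solutions of x' = A x + f; at end points of J the derivative is one-sided. *)
definition solves_on :: "real mat \<Rightarrow> (real \<Rightarrow> real vec) \<Rightarrow> real set \<Rightarrow> (real \<Rightarrow> real vec) \<Rightarrow> bool" where
  "solves_on A f J x \<longleftrightarrow> (\<forall>t\<in>J. x t \<in> carrier_vec (dim_row A) \<and>
     (\<forall>i<dim_row A.
        ((\<lambda>s. x s $ i) has_real_derivative (A *\<^sub>v x t + f t) $ i) (at t within J)))"

definition controllable :: "real mat \<Rightarrow> real mat \<Rightarrow> bool" where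
  "controllable A B \<longleftrightarrow>
     (\<forall>x0\<in>carrier_vec (dim_row A). \<forall>x1\<in>carrier_vec (dim_row A).
        \<exists>T>0. \<exists>u x. (\<forall>t\<in>{0..T}. u t \<in> carrier_vec (dim_col B)) \<and>
          (\<forall>j<dim_col B. continuous_on {0..T} (\<lambda>t. u t $ j)) \<and>
          solves_on A (\<lambda>t. B *\<^sub>v u t) {0..T} x \<and> x 0 = x0 \<and> x T = x1)"

(* By linearity it suffices that zero is the only initial state with zero free response. *)
definition observable :: "real mat \<Rightarrow> real mat \<Rightarrow> bool" where
  "observable A C \<longleftrightarrow>
     (\<forall>x. solves_on A (\<lambda>t. 0\<^sub>v (dim_row A)) {0..} x \<and>
          (\<forall>t\<ge>0. transpose_mat C *\<^sub>v x t = 0\<^sub>v (dim_col C)) \<longrightarrow> x 0 = 0\<^sub>v (dim_row A))"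

definition is_ctrl_gramian :: "real mat \<Rightarrow> real mat \<Rightarrow> real mat \<Rightarrow> bool" where
  "is_ctrl_gramian A B P \<longleftrightarrow> P \<in> carrier_mat (dim_row A) (dim_row A) \<and>
     A * P + P * transpose_mat A + B * transpose_mat B = 0\<^sub>m (dim_row A) (dim_row A)"

definition is_obs_gramian :: "real mat \<Rightarrow> real mat \<Rightarrow> real mat \<Rightarrow> bool" where
  "is_obs_gramian A C Q \<longleftrightarrow> Q \<in> carrier_mat (dim_row A) (dim_row A) \<and>
     transpose_mat A * Q + Q * A + C * transpose_mat C = 0\<^sub>m (dim_row A) (dim_row A)"

(* For stable A both Lyapunov equations have exactly one solution. *)
definition ctrl_gramian :: "real mat \<Rightarrow> real mat \<Rightarrow> real mat" where
  "ctrl_gramian A B = (THE P. is_ctrl_gramian A B P)"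

definition obs_gramian :: "real mat \<Rightarrow> real mat \<Rightarrow> real mat" where
  "obs_gramian A C = (THE Q. is_obs_gramian A C Q)"

(* The output is y = transpose C x, so C has as many rows as A. *)
definition transfer_function :: "real mat \<Rightarrow> real mat \<Rightarrow> real mat \<Rightarrow> complex \<Rightarrow> complex mat" where
  "transfer_function A B C s =
     cmat (transpose_mat C) * mat_inv (s \<cdot>\<^sub>m 1\<^sub>m (dim_row A) - cmat A) * cmat B"

(* The eigenvalues of A are excluded because the resolvent does not exist there. *)
definition stable_realization ::
  "real mat \<Rightarrow> real mat \<Rightarrow> real mat \<Rightarrow> (complex \<Rightarrow> complex mat) \<Rightarrow> bool" where
  "stable_realization A B C H \<longleftrightarrow> stable_mat A \<and>
     (\<forall>s. \<not> eigenvalue (cmat A) s \<longrightarrow> H s = transfer_function A B C s)"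

(* The norms are meaningful for stable A. The eigenvalues of the product of two positive
   semidefinite matrices are real, so the real spectrum is the whole spectrum. *)
definition hankel_norm :: "real mat \<Rightarrow> real mat \<Rightarrow> real mat \<Rightarrow> real" where
  "hankel_norm A B C = sqrt (Max {l. eigenvalue (ctrl_gramian A B * obs_gramian A C) l})"

definition h2_norm :: "real mat \<Rightarrow> real mat \<Rightarrow> real mat \<Rightarrow> real" where
  "h2_norm A B C = sqrt (mat_trace (transpose_mat B * obs_gramian A C * B))"

end

theory Submission
  imports Defs "HOL-Analysis.Operator_Norm" "Jordan_Normal_Form.Spectral_Radius"
begin

text \<open>Blockwise comparison with the exact truncation, whose Gramians are the identity and \<open>\<Sigma>1\<^sup>2\<close>,
  bounds the Gramians of the error system by perturbation of Lyapunov equations. A first-order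
  perturbation of the observability equation costs \<open>\<sigma> 1\<^sup>2 * spec_norm A * \<epsilon>a\<close>, whereas \<open>\<zeta>1\<close> and \<open>\<zeta>2\<close> lack the
  factor \<open>\<sigma> 1\<^sup>2\<close>. A second-order effect makes up for it. The product \<open>X1 * transpose_mat Y1\<close> is a spectral
  projector of \<open>P * Q\<close>; hence, after the change of basis by the square root of
  \<open>1 + transpose_mat \<Gamma> * \<Gamma>\<close>, which leaves the transfer function alone, the approximate bases deviate from
  the exact ones only to second order in \<open>\<epsilon>\<close>. With \<open>\<phi> = \<epsilon> / \<delta>_low\<close> the errors on the controllability side
  then are at most \<open>\<phi> * \<xi>1\<close> and \<open>\<phi> * \<xi>2\<close>, and those on the observability side exceed \<open>\<zeta>1\<close> and \<open>\<zeta>2\<close> by at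
  most a small multiple of \<open>\<phi> * \<sigma> 1\<^sup>2\<close>. The equation \<open>Ah + transpose_mat Ah + Bh * transpose_mat Bh = 0\<close>
  gives \<open>1 \<le> spec_norm K1 * spec_norm (Bh * transpose_mat Bh)\<close> and thereby \<open>18 * \<phi> \<le> \<xi>1 + \<xi>2\<close>, so that the
  slack on the controllability side absorbs this excess.\<close>

text \<open>Why second order: \<open>P * Yt\<close> and \<open>Q * Xt\<close> reproduce
  \<open>Xt\<close> and \<open>Yt * (sc * tp sc)\<close> up to terms that contain \<open>E\<close>
  or \<open>F\<close> twice. The projector passes through \<open>P\<close> and \<open>Q\<close>, so
  the parts \<open>Nx\<close>, \<open>Ny\<close> of the approximate bases off it satisfy two coupled
  linear equations with sources of size \<epsilon>^2. Their homogeneous part acts through the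
  discarded singular values only, which lie below the singular values of \<open>\<Sigma>c1\<close>;
  hence they can be solved. Why the errors combine as claimed: in rescaled coordinates the Gramians
  of the error system are perturbations of e e^T and f M f^T with e = (1, 1), f = (1, -1), M =
  \<Sigma>1^2, and e^T f = 0. So the leading term of their product vanishes, and that of the H2
  trace is quadratic in the input error. Both truncations must first be shown stable. For the exact
  one the gap in the singular values enters: an imaginary eigenvalue would be inherited by
  \<open>A\<close>. For the approximate one the Lyapunov function \<open>K2\<close> of the exact one
  survives the perturbation. The constant 18 is 6 from \<xi>1 plus 12 from \<xi>2.\<close>

section \<open>The algebra of finitely supported matrices\<close>

text \<open>Padding with zeros embeds the real matrices of all sizes into one normed algebra. A matrix has
  size \<open>n \<times> m\<close> if it is fixed by the idempotents \<open>ide n\<close> from the left and \<open>ide m\<close> from the right. The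
  norm is the Frobenius norm; the spectral norm \<open>opn\<close> is the operator norm of left multiplication.\<close>

typedef fmat = "{f :: nat \<Rightarrow> nat \<Rightarrow> real. \<exists>N. \<forall>i j. N \<le> i \<or> N \<le> j \<longrightarrow> f i j = 0}"
  morphisms ent Abs_fmat
  by (rule exI[of _ "\<lambda>_ _. 0"]) auto

setup_lifting type_definition_fmat

definition fbound :: "fmat \<Rightarrow> nat \<Rightarrow> bool" where
  "fbound a N \<longleftrightarrow> (\<forall>i j. N \<le> i \<or> N \<le> j \<longrightarrow> ent a i j = 0)"

lemma fbound_ex: "\<exists>N. fbound a N"
  using ent[of a] by (auto simp: fbound_def)

lemma fbound_mono: "fbound a N \<Longrightarrow> N \<le> M \<Longrightarrow> fbound a M"
  by (auto simp: fbound_def)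

lemma fbound_ex2: "\<exists>N. fbound a N \<and> fbound b N"
proof -
  obtain N M where "fbound a N" "fbound b M" using fbound_ex by blast
  then have "fbound a (max N M)" "fbound b (max N M)" by (auto intro: fbound_mono)
  then show ?thesis by blast
qed

lemma fbound_ex3: "\<exists>N. fbound a N \<and> fbound b N \<and> fbound c N"
proof -
  obtain N M where "fbound a N" "fbound b N" "fbound c M" using fbound_ex fbound_ex2 by metis
  then have "fbound a (max N M)" "fbound b (max N M)" "fbound c (max N M)"
    by (auto intro: fbound_mono)
  then show ?thesis by blast
qed

lemma fmat_eqI: "(\<And>i j. ent a i j = ent b i j) \<Longrightarrow> a = b"
  by (metis ent_inject ext)

instantiation fmat :: real_vector
begin

lift_definition zero_fmat :: fmat is "\<lambda>_ _. 0" by auto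
lift_definition plus_fmat :: "fmat \<Rightarrow> fmat \<Rightarrow> fmat" is "\<lambda>f g i j. f i j + g i j"
proof -
  fix f g :: "nat \<Rightarrow> nat \<Rightarrow> real"
  assume "\<exists>N. \<forall>i j. N \<le> i \<or> N \<le> j \<longrightarrow> f i j = 0" "\<exists>N. \<forall>i j. N \<le> i \<or> N \<le> j \<longrightarrow> g i j = 0"
  then obtain N M where "\<forall>i j. N \<le> i \<or> N \<le> j \<longrightarrow> f i j = 0" "\<forall>i j. M \<le> i \<or> M \<le> j \<longrightarrow> g i j = 0"
    by blast
  then show "\<exists>N. \<forall>i j. N \<le> i \<or> N \<le> j \<longrightarrow> f i j + g i j = 0"
    by (intro exI[of _ "max N M"]) auto
qed
lift_definition minus_fmat :: "fmat \<Rightarrow> fmat \<Rightarrow> fmat" is "\<lambda>f g i j. f i j - g i j"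
proof -
  fix f g :: "nat \<Rightarrow> nat \<Rightarrow> real"
  assume "\<exists>N. \<forall>i j. N \<le> i \<or> N \<le> j \<longrightarrow> f i j = 0" "\<exists>N. \<forall>i j. N \<le> i \<or> N \<le> j \<longrightarrow> g i j = 0"
  then obtain N M where "\<forall>i j. N \<le> i \<or> N \<le> j \<longrightarrow> f i j = 0" "\<forall>i j. M \<le> i \<or> M \<le> j \<longrightarrow> g i j = 0"
    by blast
  then show "\<exists>N. \<forall>i j. N \<le> i \<or> N \<le> j \<longrightarrow> f i j - g i j = 0"
    by (intro exI[of _ "max N M"]) auto
qed
lift_definition uminus_fmat :: "fmat \<Rightarrow> fmat" is "\<lambda>f i j. - f i j" by auto
lift_definition scaleR_fmat :: "real \<Rightarrow> fmat \<Rightarrow> fmat" is "\<lambda>c f i j. c * f i j" by fastforce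

instance
  by standard (transfer; auto simp: algebra_simps)+

end

lemmas ent_simps [simp] = zero_fmat.rep_eq plus_fmat.rep_eq minus_fmat.rep_eq
  uminus_fmat.rep_eq scaleR_fmat.rep_eq

lemma ent_sum: "ent (\<Sum>x\<in>X. f x) i j = (\<Sum>x\<in>X. ent (f x) i j)"
  by (induction X rule: infinite_finite_induct) auto

instantiation fmat :: times
begin

text \<open>Summing over the support of a row of the left factor keeps the sum finite without the
  choice of a size bound.\<close>

lift_definition times_fmat :: "fmat \<Rightarrow> fmat \<Rightarrow> fmat"
  is "\<lambda>f g i j. \<Sum>k | f i k \<noteq> 0. f i k * g k j"
proof -
  fix f g :: "nat \<Rightarrow> nat \<Rightarrow> real"
  assume "\<exists>N. \<forall>i j. N \<le> i \<or> N \<le> j \<longrightarrow> f i j = 0" "\<exists>N. \<forall>i j. N \<le> i \<or> N \<le> j \<longrightarrow> g i j = 0"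
  then obtain N M where "\<forall>i j. N \<le> i \<or> N \<le> j \<longrightarrow> f i j = 0" "\<forall>i j. M \<le> i \<or> M \<le> j \<longrightarrow> g i j = 0"
    by blast
  then show "\<exists>N. \<forall>i j. N \<le> i \<or> N \<le> j \<longrightarrow> (\<Sum>k | f i k \<noteq> 0. f i k * g k j) = 0"
    by (intro exI[of _ "max N M"]) auto
qed

instance ..

end

text \<open>Only the inner index has to be bounded, so \<open>N\<close> can be the inner dimension
  of two embedded matrices, whatever their outer sizes.\<close>

lemma ent_times:
  assumes "\<And>k. N \<le> k \<Longrightarrow> ent a i k = 0 \<or> ent b k j = 0"
  shows "ent (a * b) i j = (\<Sum>k<N. ent a i k * ent b k j)"
proof -
  obtain M where M: "fbound a M" using fbound_ex by blast
  have fin: "finite {k. ent a i k \<noteq> 0}"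
    by (rule finite_subset[of _ "{..<M}"]) (use M in \<open>force simp: fbound_def not_le[symmetric]\<close>)+
  have "ent (a * b) i j = (\<Sum>k | ent a i k \<noteq> 0. ent a i k * ent b k j)"
    by (simp add: times_fmat.rep_eq)
  also have "\<dots> = (\<Sum>k\<in>{k. ent a i k \<noteq> 0} \<union> {..<N}. ent a i k * ent b k j)"
    by (rule sum.mono_neutral_left) (use fin in auto)
  also have "\<dots> = (\<Sum>k<N. ent a i k * ent b k j)"
    by (rule sum.mono_neutral_right) (use fin assms in \<open>auto simp: not_less\<close>)
  finally show ?thesis .
qed

lemma ent_times_fbound: "fbound a N \<Longrightarrow> ent (a * b) i j = (\<Sum>k<N. ent a i k * ent b k j)"
  by (rule ent_times) (auto simp: fbound_def)

lemma ent_times_fbound': "fbound b N \<Longrightarrow> ent (a * b) i j = (\<Sum>k<N. ent a i k * ent b k j)"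
  by (rule ent_times) (auto simp: fbound_def)

instance fmat :: real_algebra
proof
  fix a b c :: fmat and r :: real
  obtain N where N: "fbound a N" "fbound b N" "fbound c N" using fbound_ex3 by blast
  show "a * b * c = a * (b * c)"
  proof (rule fmat_eqI)
    fix i j
    have "ent (a * b * c) i j = (\<Sum>k<N. (\<Sum>l<N. ent a i l * ent b l k) * ent c k j)"
      by (simp add: ent_times_fbound' [OF N(3)] ent_times_fbound[OF N(1)])
    also have "\<dots> = (\<Sum>l<N. \<Sum>k<N. ent a i l * (ent b l k * ent c k j))"
      by (subst sum.swap) (simp add: sum_distrib_right mult.assoc)
    also have "\<dots> = ent (a * (b * c)) i j"
      by (simp add: ent_times_fbound' [OF N(3)] ent_times_fbound[OF N(1)] sum_distrib_left)
    finally show "ent (a * b * c) i j = ent (a * (b * c)) i j" .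
  qed
  show "(a + b) * c = a * c + b * c"
    by (rule fmat_eqI) (simp add: ent_times_fbound' [OF N(3)] algebra_simps sum.distrib)
  show "a * (b + c) = a * b + a * c"
    by (rule fmat_eqI) (simp add: ent_times_fbound [OF N(1)] algebra_simps sum.distrib)
  show "scaleR r a * b = scaleR r (a * b)"
    by (rule fmat_eqI) (simp add: ent_times_fbound' [OF N(2)] algebra_simps sum_distrib_left)
  show "a * scaleR r b = scaleR r (a * b)"
    by (rule fmat_eqI) (simp add: ent_times_fbound [OF N(1)] algebra_simps sum_distrib_left)
qed

instantiation fmat :: real_inner
begin

definition inner_fmat :: "fmat \<Rightarrow> fmat \<Rightarrow> real" where
  "inner_fmat a b = (\<Sum>(i, j) | ent a i j \<noteq> 0. ent a i j * ent b i j)"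
definition norm_fmat :: "fmat \<Rightarrow> real" where "norm_fmat a = sqrt (inner a a)"
definition dist_fmat :: "fmat \<Rightarrow> fmat \<Rightarrow> real" where "dist_fmat a b = norm (a - b)"
definition sgn_fmat :: "fmat \<Rightarrow> fmat" where "sgn_fmat a = inverse (norm a) *\<^sub>R a"
definition uniformity_fmat :: "(fmat \<times> fmat) filter" where
  "uniformity_fmat = (INF e\<in>{0<..}. principal {(x, y). dist x y < e})"
definition open_fmat :: "fmat set \<Rightarrow> bool" where
  "open_fmat S = (\<forall>x\<in>S. \<forall>\<^sub>F (x', y) in uniformity. x' = x \<longrightarrow> y \<in> S)"

lemma inner_fbound':
  assumes "fbound a N \<or> fbound b N"
  shows "inner a b = (\<Sum>i<N. \<Sum>j<N. ent a i j * ent b i j)"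
proof -
  obtain M where M: "fbound a M" using fbound_ex by blast
  have fin: "finite {(i, j). ent a i j \<noteq> 0}"
    by (rule finite_subset[of _ "{..<M} \<times> {..<M}"])
       (use M in \<open>force simp: fbound_def not_le[symmetric]\<close>)+
  have "inner a b = (\<Sum>(i, j)\<in>{(i, j). ent a i j \<noteq> 0}. ent a i j * ent b i j)"
    by (simp add: inner_fmat_def)
  also have "\<dots> = (\<Sum>(i, j)\<in>{(i, j). ent a i j \<noteq> 0} \<union> ({..<N} \<times> {..<N}). ent a i j * ent b i j)"
    by (rule sum.mono_neutral_left) (use fin in auto)
  also have "\<dots> = (\<Sum>(i, j)\<in>{..<N} \<times> {..<N}. ent a i j * ent b i j)"
    by (rule sum.mono_neutral_right) (use fin assms in \<open>force simp: fbound_def not_le[symmetric]\<close>)+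
  finally show ?thesis by (simp add: sum.cartesian_product)
qed

instance
proof
  fix a b c :: fmat and r :: real
  obtain N where N: "fbound a N" "fbound b N" "fbound c N" using fbound_ex3 by blast
  show "dist a b = norm (a - b)" "sgn a = inverse (norm a) *\<^sub>R a" "norm a = sqrt (inner a a)"
    by (simp_all add: dist_fmat_def sgn_fmat_def norm_fmat_def)
  show "(uniformity :: (fmat \<times> fmat) filter) = (INF e\<in>{0<..}. principal {(x, y). dist x y < e})"
    by (simp add: uniformity_fmat_def)
  show "open S \<longleftrightarrow> (\<forall>x\<in>S. \<forall>\<^sub>F (x', y) in uniformity. x' = x \<longrightarrow> y \<in> S)" for S :: "fmat set"
    by (simp add: open_fmat_def)
  show "inner a b = inner b a"
    using N by (simp add: inner_fbound'[of a N b] inner_fbound'[of b N a] mult.commute)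
  show "inner (a + b) c = inner a c + inner b c"
    using N by (simp add: inner_fbound'[of _ N c] algebra_simps sum.distrib)
  show "inner (r *\<^sub>R a) b = r * inner a b"
    using N by (simp add: inner_fbound'[of _ N b] algebra_simps sum_distrib_left)
  show "0 \<le> inner a a"
    using N by (simp add: inner_fbound'[of _ N a] sum_nonneg)
  show "inner a a = 0 \<longleftrightarrow> a = 0"
  proof
    assume "inner a a = 0"
    then have *: "\<And>i j. i < N \<Longrightarrow> j < N \<Longrightarrow> ent a i j = 0"
      using N by (simp add: inner_fbound'[of _ N a] sum_nonneg_eq_0_iff sum_nonneg)
    show "a = 0"
      by (rule fmat_eqI) (use * N(1) in \<open>auto simp: fbound_def, metis not_le\<close>)
  qed (simp add: inner_fmat_def)
qed

end

lemma inner_fbound: "fbound a N \<Longrightarrow> inner a b = (\<Sum>i<N. \<Sum>j<N. ent a i j * ent b i j)"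
  by (rule inner_fbound') auto

lemma fbound_times: "fbound a N \<Longrightarrow> fbound b N \<Longrightarrow> fbound (a * b) N"
  by (subst fbound_def) (auto simp: ent_times_fbound fbound_def)

text \<open>Submultiplicativity of the Frobenius norm is the Cauchy-Schwarz inequality in every
  entry of the product.\<close>

instance fmat :: real_normed_algebra
proof
  fix a b :: fmat
  obtain N where N: "fbound a N" "fbound b N" using fbound_ex2 by blast
  have "(norm (a * b))\<^sup>2 = (\<Sum>i<N. \<Sum>j<N. (\<Sum>k<N. ent a i k * ent b k j)\<^sup>2)"
    unfolding power2_norm_eq_inner inner_fbound[OF fbound_times[OF N]]
    by (simp add: power2_eq_square ent_times_fbound[OF N(1)])
  also have "\<dots> \<le> (\<Sum>i<N. \<Sum>j<N. (\<Sum>k<N. (ent a i k)\<^sup>2) * (\<Sum>k<N. (ent b k j)\<^sup>2))"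
    by (intro sum_mono Cauchy_Schwarz_ineq_sum)
  also have "\<dots> = (\<Sum>i<N. \<Sum>k<N. (ent a i k)\<^sup>2) * (\<Sum>j<N. \<Sum>k<N. (ent b k j)\<^sup>2)"
    by (simp add: sum_product)
  also have "(\<Sum>j<N. \<Sum>k<N. (ent b k j)\<^sup>2) = (\<Sum>k<N. \<Sum>j<N. (ent b k j)\<^sup>2)"
    by (rule sum.swap)
  also have "(\<Sum>i<N. \<Sum>k<N. (ent a i k)\<^sup>2) * \<dots> = (norm a * norm b)\<^sup>2"
    unfolding power_mult_distrib power2_norm_eq_inner inner_fbound[OF N(1)] inner_fbound[OF N(2)]
    by (simp add: power2_eq_square)
  finally show "norm (a * b) \<le> norm a * norm b"
    by (rule power2_le_imp_le) simp
qed

section \<open>Transposition as the adjoint\<close>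

lift_definition tp :: "fmat \<Rightarrow> fmat" is "\<lambda>f i j. f j i" by blast

lemma ent_tp [simp]: "ent (tp a) i j = ent a j i"
  by transfer simp

lemma tp_tp [simp]: "tp (tp a) = a"
  by (rule fmat_eqI) simp

lemma tp_simps [simp]:
  "tp 0 = 0" "tp (a + b) = tp a + tp b" "tp (a - b) = tp a - tp b" "tp (- a) = - tp a"
  "tp (c *\<^sub>R a) = c *\<^sub>R tp a"
  by (rule fmat_eqI; simp)+

lemma fbound_tp [simp]: "fbound (tp a) N \<longleftrightarrow> fbound a N"
  by (auto simp: fbound_def)

lemma tp_mult [simp]: "tp (a * b) = tp b * tp a"
proof (rule fmat_eqI)
  fix i j
  obtain N where N: "fbound a N" using fbound_ex by blast
  then show "ent (tp (a * b)) i j = ent (tp b * tp a) i j"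
    by (simp add: ent_times_fbound ent_times_fbound'[of "tp a"] mult.commute)
qed

lemma tp_sum: "tp (\<Sum>x\<in>X. f x) = (\<Sum>x\<in>X. tp (f x))"
  by (induction X rule: infinite_finite_induct) auto

lemma inner_tp: "inner (tp a) b = inner a (tp b)"
proof -
  obtain N where N: "fbound a N" using fbound_ex by blast
  then have N': "fbound (tp a) N" by simp
  show ?thesis
    unfolding inner_fbound[OF N] inner_fbound[OF N'] by (subst sum.swap) simp
qed

lemma norm_tp [simp]: "norm (tp a) = norm a"
  by (simp add: norm_eq_sqrt_inner inner_tp)

text \<open>Quadratic forms are taken below at arbitrary elements \<open>x\<close>, that is, at all
  columns of \<open>x\<close> at once; this relation is what lets factors be moved across
  them.\<close>

lemma inner_mult_left: "inner (a * b) c = inner b (tp a * c)"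
proof -
  obtain N where N: "fbound a N" "fbound b N" "fbound c N" using fbound_ex3 by blast
  have "inner (a * b) c = (\<Sum>i<N. \<Sum>j<N. \<Sum>k<N. ent a i k * ent b k j * ent c i j)"
    unfolding inner_fbound[OF fbound_times[OF N(1,2)]] ent_times_fbound[OF N(1)]
    by (simp add: sum_distrib_right)
  also have "\<dots> = (\<Sum>i<N. \<Sum>k<N. \<Sum>j<N. ent a i k * ent b k j * ent c i j)"
    by (intro sum.cong refl sum.swap)
  also have "\<dots> = (\<Sum>k<N. \<Sum>i<N. \<Sum>j<N. ent a i k * ent b k j * ent c i j)"
    by (rule sum.swap)
  also have "\<dots> = (\<Sum>k<N. \<Sum>j<N. \<Sum>i<N. ent a i k * ent b k j * ent c i j)"
    by (intro sum.cong refl sum.swap)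
  also have "\<dots> = inner b (tp a * c)"
    unfolding inner_fbound[OF N(2)] ent_times_fbound'[OF N(3)]
    by (simp add: sum_distrib_left mult_ac)
  finally show ?thesis .
qed

lemma inner_mult_right: "inner a (b * c) = inner (a * tp c) b"
  using inner_mult_left[of "tp c" "tp b" "tp a"]
  by (metis inner_commute inner_tp tp_mult tp_tp)

section \<open>The spectral norm as an operator norm\<close>

definition opn :: "fmat \<Rightarrow> real" where "opn a = onorm (\<lambda>x. a * x)"

lemma norm_mult_opn: "norm (a * x) \<le> opn a * norm x"
  unfolding opn_def by (rule onorm) (rule bounded_linear_mult_right)

lemma opn_nonneg [simp]: "0 \<le> opn a"
  unfolding opn_def by (rule onorm_pos_le) (rule bounded_linear_mult_right)

lemma opn_leI: "0 \<le> c \<Longrightarrow> (\<And>x. norm (a * x) \<le> c * norm x) \<Longrightarrow> opn a \<le> c"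
  unfolding opn_def by (rule onorm_bound)

lemma opn_mult: "opn (a * b) \<le> opn a * opn b"
proof (rule opn_leI)
  fix x
  have "norm (a * b * x) \<le> opn a * norm (b * x)"
    by (simp add: mult.assoc norm_mult_opn)
  also have "\<dots> \<le> opn a * (opn b * norm x)"
    by (intro mult_left_mono norm_mult_opn) simp
  finally show "norm (a * b * x) \<le> opn a * opn b * norm x" by (simp add: mult.assoc)
qed simp

lemma opn_add: "opn (a + b) \<le> opn a + opn b"
proof (rule opn_leI)
  fix x
  have "norm ((a + b) * x) \<le> norm (a * x) + norm (b * x)"
    by (simp add: distrib_right norm_triangle_ineq)
  then show "norm ((a + b) * x) \<le> (opn a + opn b) * norm x"
    using norm_mult_opn[of a x] norm_mult_opn[of b x] by (simp add: distrib_right)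
qed simp

lemma opn_minus [simp]: "opn (- a) = opn a"
  by (simp add: opn_def onorm_neg)

lemma opn_diff: "opn (a - b) \<le> opn a + opn b"
  using opn_add[of a "- b"] by simp

lemma opn_0 [simp]: "opn 0 = 0"
  by (intro order_antisym opn_leI) auto

lemma opn_tp_le: "opn (tp a) \<le> opn a"
proof (rule opn_leI)
  fix x
  have "(norm (tp a * x))\<^sup>2 = inner x (a * (tp a * x))"
    by (simp add: power2_norm_eq_inner inner_mult_left)
  also have "\<dots> \<le> norm x * norm (a * (tp a * x))"
    by (rule norm_cauchy_schwarz)
  also have "\<dots> \<le> norm x * (opn a * norm (tp a * x))"
    by (intro mult_left_mono norm_mult_opn) simp
  finally have "norm (tp a * x) * norm (tp a * x) \<le> (opn a * norm x) * norm (tp a * x)"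
    by (simp add: power2_eq_square mult_ac)
  then show "norm (tp a * x) \<le> opn a * norm x"
    by (cases "norm (tp a * x) = 0") (auto simp: mult_le_cancel_right)
qed simp

lemma opn_tp [simp]: "opn (tp a) = opn a"
  using opn_tp_le[of a] opn_tp_le[of "tp a"] by simp

lemma abs_inner_opn: "\<bar>inner x (a * y)\<bar> \<le> opn a * norm x * norm y"
proof -
  have "\<bar>inner x (a * y)\<bar> \<le> norm x * norm (a * y)" by (rule Cauchy_Schwarz_ineq2)
  also have "\<dots> \<le> norm x * (opn a * norm y)" by (intro mult_left_mono norm_mult_opn) simp
  finally show ?thesis by (simp add: mult_ac)
qed

lemma opn_le_innerI:
  assumes "0 \<le> c" "\<And>x y. inner x (a * y) \<le> c * norm x * norm y"
  shows "opn a \<le> c"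
proof (rule opn_leI)
  fix x
  have "norm (a * x) * norm (a * x) \<le> c * norm x * norm (a * x)"
    using assms(2)[of "a * x" x] by (simp add: power2_norm_eq_inner mult_ac flip: power2_eq_square)
  then show "norm (a * x) \<le> c * norm x"
    by (cases "norm (a * x) = 0") (use assms(1) in \<open>auto simp: mult_le_cancel_right\<close>)
qed (use assms in auto)

lemma opn_sqrtI:
  assumes "\<And>x. inner x (a * tp a * x) \<le> c * (norm x)\<^sup>2"
  shows "opn a \<le> sqrt \<bar>c\<bar>"
proof -
  have "opn (tp a) \<le> sqrt \<bar>c\<bar>"
  proof (rule opn_leI)
    fix x
    have "(norm (tp a * x))\<^sup>2 \<le> \<bar>c\<bar> * (norm x)\<^sup>2"
      using assms[of x] by (simp add: power2_norm_eq_inner inner_mult_left mult.assoc)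
        (meson abs_ge_self inner_ge_zero mult_right_mono order_trans)
    also have "\<dots> = (sqrt \<bar>c\<bar> * norm x)\<^sup>2" by (simp add: power_mult_distrib)
    finally show "norm (tp a * x) \<le> sqrt \<bar>c\<bar> * norm x"
      by (rule power2_le_imp_le) simp
  qed simp
  then show ?thesis by simp
qed

text \<open>The isometry that puts \<open>b\<close> coordinates below \<open>a\<close> zeros.
  Multiplication by \<open>sh a b\<close> from the left shifts rows down, by its transpose from the
  right shifts columns, so a block matrix is a sum of shifted blocks. For \<open>a = 0\<close> it is
  the identity of size \<open>b\<close>.\<close>

lift_definition sh :: "nat \<Rightarrow> nat \<Rightarrow> fmat" is "\<lambda>a b i j. if i = a + j \<and> j < b then 1 else 0"
  subgoal for a b by (rule exI[of _ "a + b"]) auto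
  done

abbreviation ide :: "nat \<Rightarrow> fmat" where "ide \<equiv> sh 0"

lemma ent_sh: "ent (sh a b) i j = (if i = a + j \<and> j < b then 1 else 0)"
  by transfer simp

lemma fbound_sh: "fbound (sh a b) (a + b)"
  by (auto simp: fbound_def ent_sh)

lemma tp_ide [simp]: "tp (ide n) = ide n"
  by (rule fmat_eqI) (auto simp: ent_sh)

lemma ent_sh_mult: "ent (sh a b * x) i j = (if a \<le> i \<and> i < a + b then ent x (i - a) j else 0)"
proof -
  have *: "ent (sh a b * x) i j = (\<Sum>k<a + b. ent (sh a b) i k * ent x k j)"
    by (rule ent_times_fbound[OF fbound_sh])
  show ?thesis
  proof (cases "a \<le> i \<and> i < a + b")
    case True
    have "(\<Sum>k<a + b. ent (sh a b) i k * ent x k j) = (\<Sum>k\<in>{i - a}. ent (sh a b) i k * ent x k j)"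
      by (rule sum.mono_neutral_right) (use True in \<open>auto simp: ent_sh\<close>)
    moreover have "i - a < b" "a + (i - a) = i" using True by auto
    ultimately show ?thesis using True * by (simp add: ent_sh)
  next
    case False
    have "(\<Sum>k<a + b. ent (sh a b) i k * ent x k j) = 0"
      by (rule sum.neutral) (use False in \<open>auto simp: ent_sh\<close>)
    then show ?thesis unfolding * using False by auto
  qed
qed

lemma ent_ide_mult: "ent (ide n * x) i j = (if i < n then ent x i j else 0)"
  by (simp add: ent_sh_mult)

lemma ent_mult_ide: "ent (x * ide n) i j = (if j < n then ent x i j else 0)"
  using ent_ide_mult[of n "tp x" j i] by (metis ent_tp tp_ide tp_mult tp_tp)

lemma ent_mult_tp_sh: "ent (x * tp (sh a b)) i j = (if a \<le> j \<and> j < a + b then ent x i (j - a) else 0)"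
  using ent_sh_mult[of a b "tp x" j i] by (metis ent_tp tp_mult tp_tp)

lemma ent_tp_sh_mult: "ent (tp (sh a b) * x) i j = (if i < b then ent x (i + a) j else 0)"
proof -
  have *: "ent (tp (sh a b) * x) i j = (\<Sum>k<a + b. ent (tp (sh a b)) i k * ent x k j)"
    by (rule ent_times_fbound) (simp add: fbound_sh)
  show ?thesis
  proof (cases "i < b")
    case True
    have "(\<Sum>k<a + b. ent (tp (sh a b)) i k * ent x k j) = (\<Sum>k\<in>{i + a}. ent (tp (sh a b)) i k * ent x k j)"
      by (rule sum.mono_neutral_right) (use True in \<open>auto simp: ent_sh\<close>)
    then show ?thesis using True * by (simp add: ent_sh add.commute)
  next
    case False
    have "(\<Sum>k<a + b. ent (tp (sh a b)) i k * ent x k j) = 0"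
      by (rule sum.neutral) (use False in \<open>auto simp: ent_sh\<close>)
    then show ?thesis using False * by simp
  qed
qed

lemma tp_sh_sh: "tp (sh a b) * sh a b = ide b"
  by (rule fmat_eqI) (auto simp: ent_tp_sh_mult ent_sh)

lemma tp_sh_sh_0: "a + b \<le> a' \<Longrightarrow> tp (sh a b) * sh a' b' = 0"
  by (rule fmat_eqI) (auto simp: ent_tp_sh_mult ent_sh)

lemma tp_sh_sh_0': "a + b \<le> a' \<Longrightarrow> tp (sh a' b') * sh a b = 0"
  by (rule fmat_eqI) (auto simp: ent_tp_sh_mult ent_sh)

lemma ide_ide: "ide a * ide b = ide (min a b)"
  by (rule fmat_eqI) (auto simp: ent_ide_mult ent_sh)

lemma ide_idem [simp]: "ide a * ide a = ide a"
  by (simp add: ide_ide)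

lemma ide_split: "ide (a + b) = ide a + sh a b * tp (sh a b)"
  by (rule fmat_eqI) (auto simp: ent_sh_mult ent_sh)

lemma sh_ide [simp]: "sh a b * ide b = sh a b"
  by (rule fmat_eqI) (auto simp: ent_mult_ide ent_sh)

lemma ide_sh: "a + b \<le> n \<Longrightarrow> ide n * sh a b = sh a b"
  by (rule fmat_eqI) (auto simp: ent_ide_mult ent_sh)

lemma opn_ide_le: "opn (ide n) \<le> 1"
proof (rule opn_leI)
  fix x
  have "(norm (ide n * x))\<^sup>2 = inner x (ide n * x)"
    by (simp add: power2_norm_eq_inner inner_mult_left flip: mult.assoc)
  also have "\<dots> \<le> norm x * norm (ide n * x)" by (rule norm_cauchy_schwarz)
  finally show "norm (ide n * x) \<le> 1 * norm x"
    by (cases "norm (ide n * x) = 0") (auto simp: power2_eq_square mult_le_cancel_right)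
qed simp

lemma opn_isometry_le:
  assumes "tp a * a = ide n"
  shows "opn a \<le> 1"
proof (rule opn_leI)
  fix x
  have "(norm (a * x))\<^sup>2 = inner x (ide n * x)"
    by (simp add: power2_norm_eq_inner inner_mult_left assms flip: mult.assoc)
  also have "\<dots> \<le> norm x * norm (ide n * x)" by (rule norm_cauchy_schwarz)
  also have "\<dots> \<le> norm x * (1 * norm x)"
    by (intro mult_left_mono order_trans[OF norm_mult_opn] mult_right_mono opn_ide_le) auto
  finally have "(norm (a * x))\<^sup>2 \<le> (norm x)\<^sup>2" by (simp add: power2_eq_square)
  then have "norm (a * x) \<le> norm x" by (rule power2_le_imp_le) simp
  then show "norm (a * x) \<le> 1 * norm x" by simp
qed simp

definition cm :: "nat \<Rightarrow> nat \<Rightarrow> fmat \<Rightarrow> bool" where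
  "cm n m x \<longleftrightarrow> ide n * x = x \<and> x * ide m = x"

lemma cm_iff: "cm n m x \<longleftrightarrow> (\<forall>i j. n \<le> i \<or> m \<le> j \<longrightarrow> ent x i j = 0)"
proof
  assume "cm n m x"
  then have eq: "ide n * x = x" "x * ide m = x" unfolding cm_def by blast+
  show "\<forall>i j. n \<le> i \<or> m \<le> j \<longrightarrow> ent x i j = 0"
  proof (intro allI impI)
    fix i j assume "n \<le> i \<or> m \<le> j"
    then show "ent x i j = 0"
      using ent_ide_mult[of n x i j, unfolded eq] ent_mult_ide[of x m i j, unfolded eq]
      by (auto split: if_splits)
  qed
next
  assume *: "\<forall>i j. n \<le> i \<or> m \<le> j \<longrightarrow> ent x i j = 0"
  have "ide n * x = x" "x * ide m = x"
    by (rule fmat_eqI; use * in \<open>simp add: ent_ide_mult ent_mult_ide not_less\<close>)+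
  then show "cm n m x" unfolding cm_def by blast
qed

text \<open>The last two forms absorb an idempotent inside a right-nested product, so that sizes act
  as rewrite rules next to \<open>mult.assoc\<close>.\<close>

lemma cmD: 
  assumes "cm n m x"
  shows "ide n * x = x" "x * ide m = x" "ide n * (x * y) = x * y" "x * (ide m * z) = x * z"
proof -
  show *: "ide n * x = x" "x * ide m = x" using assms unfolding cm_def by blast+
  show "ide n * (x * y) = x * y" unfolding mult.assoc[symmetric] *(1) ..
  show "x * (ide m * z) = x * z" unfolding mult.assoc[symmetric] *(2) ..
qed

lemma cm_mult [intro]: "cm n m x \<Longrightarrow> cm m l y \<Longrightarrow> cm n l (x * y)"
  by (subst cm_def) (simp add: cmD mult.assoc)

lemma cm_tp [intro]: "cm n m x \<Longrightarrow> cm m n (tp x)"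
  by (simp add: cm_iff)

lemma cm_add [intro]: "cm n m x \<Longrightarrow> cm n m y \<Longrightarrow> cm n m (x + y)"
  by (simp add: cm_iff)

lemma cm_diff [intro]: "cm n m x \<Longrightarrow> cm n m y \<Longrightarrow> cm n m (x - y)"
  by (simp add: cm_iff)

lemma cm_uminus [intro]: "cm n m x \<Longrightarrow> cm n m (- x)"
  by (simp add: cm_iff)

lemma cm_scaleR [intro]: "cm n m x \<Longrightarrow> cm n m (c *\<^sub>R x)"
  by (simp add: cm_iff)

lemma cm_ide [intro]: "cm n n (ide n)"
  by (simp add: cm_def)

lemma cm_sh: "a + b \<le> n \<Longrightarrow> cm n b (sh a b)"
  by (simp add: cm_def ide_sh)

section \<open>Embedding of matrices and vectors\<close>

lift_definition em :: "real mat \<Rightarrow> fmat"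
  is "\<lambda>M i j. if i < dim_row M \<and> j < dim_col M then M $$ (i, j) else 0"
  subgoal for M by (rule exI[of _ "max (dim_row M) (dim_col M)"]) auto
  done

lemma ent_em: "ent (em M) i j = (if i < dim_row M \<and> j < dim_col M then M $$ (i, j) else 0)"
  by (simp add: em.rep_eq)

lemma cm_em: "M \<in> carrier_mat n m \<Longrightarrow> cm n m (em M)"
  by (auto simp: cm_iff ent_em)

lemma em_mult: "dim_col M = dim_row N \<Longrightarrow> em (M * N) = em M * em N"
  by (rule fmat_eqI, subst ent_times[of "dim_col M"])
     (auto simp: ent_em scalar_prod_def atLeast0LessThan)

lemma em_transpose: "em (transpose_mat M) = tp (em M)"
  by (rule fmat_eqI) (auto simp: ent_em)

lemma em_add: "dim_row M = dim_row N \<Longrightarrow> dim_col M = dim_col N \<Longrightarrow> em (M + N) = em M + em N"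
  by (rule fmat_eqI) (auto simp: ent_em)

lemma em_diff: "dim_row M = dim_row N \<Longrightarrow> dim_col M = dim_col N \<Longrightarrow> em (M - N) = em M - em N"
  by (rule fmat_eqI) (auto simp: ent_em)

lemma em_uminus: "em (- M) = - em M"
  by (rule fmat_eqI) (auto simp: ent_em)

lemma em_smult: "em (c \<cdot>\<^sub>m M) = c *\<^sub>R em M"
  by (rule fmat_eqI) (auto simp: ent_em)

lemma em_one [simp]: "em (1\<^sub>m n) = ide n"
  by (rule fmat_eqI) (auto simp: ent_em ent_sh)

lemma em_zero [simp]: "em (0\<^sub>m n m) = 0"
  by (rule fmat_eqI) (auto simp: ent_em)

text \<open>Padding with zeros forgets the size, so injectivity holds within one carrier.\<close>

lemma em_inject:
  assumes "M \<in> carrier_mat n m" "N \<in> carrier_mat n m" "em M = em N"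
  shows "M = N"
proof (rule eq_matI)
  fix i j assume "i < dim_row N" "j < dim_col N"
  then show "M $$ (i, j) = N $$ (i, j)"
    using arg_cong[OF assms(3), of "\<lambda>x. ent x i j"] assms(1,2) by (auto simp: ent_em)
qed (use assms in auto)

lemma em_four_block:
  assumes "M1 \<in> carrier_mat a b" "M2 \<in> carrier_mat a b'" "M3 \<in> carrier_mat a' b" "M4 \<in> carrier_mat a' b'"
  shows "em (four_block_mat M1 M2 M3 M4) =
    em M1 + em M2 * tp (sh b b') + sh a a' * em M3 + sh a a' * em M4 * tp (sh b b')"
  by (rule fmat_eqI) (use assms in \<open>auto simp: ent_em ent_sh_mult ent_mult_tp_sh\<close>)

lemma em_append_cols:
  assumes "M \<in> carrier_mat a b" "N \<in> carrier_mat a b'"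
  shows "em (M @\<^sub>c N) = em M + em N * tp (sh b b')" "M @\<^sub>c N \<in> carrier_mat a (b + b')"
  using assms by (auto simp: append_cols_def em_four_block[where a' = 0])

lemma em_append_rows:
  assumes "M \<in> carrier_mat a b" "N \<in> carrier_mat a' b"
  shows "em (M @\<^sub>r N) = em M + sh a a' * em N" "M @\<^sub>r N \<in> carrier_mat (a + a') b"
  using assms by (auto simp: append_rows_def em_four_block[where b' = 0])

definition fm :: "nat \<Rightarrow> nat \<Rightarrow> fmat \<Rightarrow> real mat" where
  "fm n m x = mat n m (\<lambda>(i, j). ent x i j)"

lemma dim_fm [simp]: "dim_row (fm n m x) = n" "dim_col (fm n m x) = m"
  by (simp_all add: fm_def)

lemma fm_carrier [simp]: "fm n m x \<in> carrier_mat n m"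
  by (simp add: fm_def)

lemma em_fm: "cm n m x \<Longrightarrow> em (fm n m x) = x"
  by (rule fmat_eqI) (auto simp: ent_em fm_def cm_iff not_less)

lemma mat_trace_em: "M \<in> carrier_mat n n \<Longrightarrow> mat_trace M = inner (ide n) (em M)"
  by (subst inner_fbound[of _ n], use fbound_sh[of 0 n] in simp)
     (auto simp: mat_trace_def ent_sh ent_em if_distrib[of "\<lambda>c. c * _"] cong: if_cong)

lemma norm_ide: "(norm (ide n))\<^sup>2 = n"
  unfolding power2_norm_eq_inner
  by (subst inner_fbound[of _ n], use fbound_sh[of 0 n] in simp)
     (auto simp: ent_sh if_distrib[of "\<lambda>c. c * _"] cong: if_cong)

text \<open>A bound on the trace: \<open>ide n\<close> is idempotent with squared norm
  \<open>n\<close>, so one copy can stand on either side of \<open>x\<close> in the Cauchy-Schwarz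
  inequality.\<close>

lemma abs_inner_ide: "\<bar>inner (ide n) x\<bar> \<le> n * opn x"
proof -
  have "inner (ide n) x = inner (ide n) (x * ide n)"
    by (simp add: inner_mult_right)
  also have "\<bar>\<dots>\<bar> \<le> opn x * norm (ide n) * norm (ide n)" by (rule abs_inner_opn)
  also have "\<dots> = n * opn x" using norm_ide[of n] by (simp add: power2_eq_square mult_ac)
  finally show ?thesis .
qed

lift_definition ev :: "real vec \<Rightarrow> fmat"
  is "\<lambda>v i j. if j = 0 \<and> i < dim_vec v then v $ i else 0"
  subgoal for v by (rule exI[of _ "Suc (dim_vec v)"]) auto
  done

lemma ent_ev: "ent (ev v) i j = (if j = 0 \<and> i < dim_vec v then v $ i else 0)"
  by (simp add: ev.rep_eq)

lemma cm_ev: "v \<in> carrier_vec n \<Longrightarrow> cm n 1 (ev v)"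
  by (auto simp: cm_iff ent_ev)

lemma ev_mult: "v \<in> carrier_vec (dim_col M) \<Longrightarrow> ev (M *\<^sub>v v) = em M * ev v"
  by (rule fmat_eqI, subst ent_times[of "dim_col M"])
     (auto simp: ent_em ent_ev scalar_prod_def atLeast0LessThan)

lemma inner_ev:
  assumes "dim_vec v = dim_vec w"
  shows "inner (ev v) (ev w) = scalar_prod v w"
proof -
  have "inner (ev v) (ev w) = (\<Sum>i<Suc (dim_vec v). \<Sum>j<Suc (dim_vec v). ent (ev v) i j * ent (ev w) i j)"
    by (rule inner_fbound) (auto simp: fbound_def ent_ev)
  also have "\<dots> = (\<Sum>i<Suc (dim_vec v). ent (ev v) i 0 * ent (ev w) i 0)"
  proof (rule sum.cong[OF refl])
    fix i
    have "(\<Sum>j<Suc (dim_vec v). ent (ev v) i j * ent (ev w) i j) =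
        (\<Sum>j\<in>{0}. ent (ev v) i j * ent (ev w) i j)"
      by (rule sum.mono_neutral_right) (auto simp: ent_ev)
    then show "(\<Sum>j<Suc (dim_vec v). ent (ev v) i j * ent (ev w) i j) = ent (ev v) i 0 * ent (ev w) i 0"
      by simp
  qed
  also have "\<dots> = scalar_prod v w"
    by (simp add: ent_ev scalar_prod_def atLeast0LessThan assms)
  finally show ?thesis .
qed

lemma vnorm_ev: "vnorm v = norm (ev v)"
  by (simp add: vnorm_def norm_eq_sqrt_inner inner_ev)

lemma norm_columns:
  assumes "fbound x N"
  shows "(norm x)\<^sup>2 = (\<Sum>j<N. (vnorm (vec N (\<lambda>i. ent x i j)))\<^sup>2)"
  unfolding power2_norm_eq_inner inner_fbound[OF assms]
  by (subst sum.swap) (simp add: vnorm_def scalar_prod_def atLeast0LessThan sum_nonneg)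

text \<open>Left multiplication acts on each column separately and squared Frobenius norms add up
  over columns. So the best constant for single vectors, which defines \<open>spec_norm\<close>, is
  also the best one for whole matrices.\<close>

lemma spec_norm_em: "spec_norm M = opn (em M)"
proof (rule antisym)
  have le: "vnorm (M *\<^sub>v v) \<le> opn (em M)" if "v \<in> carrier_vec (dim_col M)" "vnorm v \<le> 1" for v
  proof -
    have "vnorm (M *\<^sub>v v) \<le> opn (em M) * vnorm v"
      using that(1) by (simp add: vnorm_ev ev_mult norm_mult_opn)
    also have "\<dots> \<le> opn (em M) * 1" using that(2) by (intro mult_left_mono) auto
    finally show ?thesis by simp
  qed
  have mem0: "0\<^sub>v (dim_col M) \<in> carrier_vec (dim_col M)" "vnorm (0\<^sub>v (dim_col M)) \<le> 1"
    by (auto simp: vnorm_def)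
  show "spec_norm M \<le> opn (em M)"
    unfolding spec_norm_def by (rule cSup_least) (use mem0 le in blast)+
  have bdd: "bdd_above {vnorm (M *\<^sub>v v) | v. v \<in> carrier_vec (dim_col M) \<and> vnorm v \<le> 1}"
    by (rule bdd_aboveI[of _ "opn (em M)"]) (use le in blast)
  have up: "vnorm (M *\<^sub>v v) \<le> spec_norm M" if "v \<in> carrier_vec (dim_col M)" "vnorm v \<le> 1" for v
    unfolding spec_norm_def by (rule cSup_upper[OF _ bdd]) (use that in blast)
  have nonneg: "0 \<le> spec_norm M"
    using up[OF mem0] by (rule order_trans[rotated]) (simp add: vnorm_ev)
  have ev_smult: "ev (c \<cdot>\<^sub>v v) = c *\<^sub>R ev v" for c and v :: "real vec"
    by (rule fmat_eqI) (simp add: ent_ev)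
  have up': "vnorm (M *\<^sub>v v) \<le> spec_norm M * vnorm v" if v: "v \<in> carrier_vec (dim_col M)" for v
  proof (cases "vnorm v = 0")
    case True
    then have "ev v = 0" by (simp add: vnorm_ev)
    then show ?thesis using v by (simp add: vnorm_ev ev_mult)
  next
    case False
    then have pos: "vnorm v > 0" by (simp add: vnorm_ev)
    have w: "(1 / vnorm v) \<cdot>\<^sub>v v \<in> carrier_vec (dim_col M)" using v by simp
    have "vnorm ((1 / vnorm v) \<cdot>\<^sub>v v) = 1" using pos by (simp add: vnorm_ev ev_smult)
    then have "vnorm (M *\<^sub>v ((1 / vnorm v) \<cdot>\<^sub>v v)) \<le> spec_norm M" using up[OF w] by simp
    moreover have "vnorm (M *\<^sub>v ((1 / vnorm v) \<cdot>\<^sub>v v)) = vnorm (M *\<^sub>v v) / vnorm v"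
      using v w pos by (simp add: vnorm_ev ev_mult ev_smult)
    ultimately show ?thesis using pos by (simp add: divide_simps)
  qed
  show "opn (em M) \<le> spec_norm M"
  proof (rule opn_leI[OF nonneg])
    fix x
    obtain K where K: "fbound x K" using fbound_ex by blast
    define N where "N = max K (max (dim_row M) (dim_col M))"
    have N: "fbound x N" "fbound (em M) N"
      using fbound_mono[OF K, of N] by (auto simp: N_def fbound_def ent_em)
    define v where "v = (\<lambda>j. vec (dim_col M) (\<lambda>i. ent x i j))"
    have v: "v j \<in> carrier_vec (dim_col M)" for j by (simp add: v_def)
    have ent_v: "ent (em M * x) i j = ent (em M * ev (v j)) i 0" for i j
      by (simp add: ent_times[of "dim_col M" "em M"] ent_em ent_ev v_def)
    have "(norm (em M * x))\<^sup>2 = (\<Sum>j<N. (vnorm (M *\<^sub>v v j))\<^sup>2)"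
      unfolding norm_columns[OF fbound_times[OF N(2,1)]]
    proof (intro sum.cong refl arg_cong[of _ _ "\<lambda>z. z\<^sup>2"])
      fix j
      have "ev (vec N (\<lambda>i. ent (em M * x) i j)) = ev (M *\<^sub>v v j)"
        unfolding ev_mult[OF v]
        by (rule fmat_eqI)
           (use fbound_times[OF N(2,1)] in \<open>auto simp: ent_ev ent_v ent_times[of "dim_col M" "em M"] ent_em N_def fbound_def\<close>)
      then show "vnorm (vec N (\<lambda>i. ent (em M * x) i j)) = vnorm (M *\<^sub>v v j)"
        by (simp add: vnorm_ev)
    qed
    also have "\<dots> \<le> (\<Sum>j<N. (spec_norm M)\<^sup>2 * (vnorm (v j))\<^sup>2)"
      by (intro sum_mono) (simp add: vnorm_ev flip: power_mult_distrib,
          use up'[OF v] in \<open>simp add: vnorm_ev power_mono\<close>)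
    also have "\<dots> = (spec_norm M)\<^sup>2 * (\<Sum>j<N. (vnorm (v j))\<^sup>2)"
      by (simp add: sum_distrib_left)
    also have "(\<Sum>j<N. (vnorm (v j))\<^sup>2) \<le> (norm x)\<^sup>2"
      unfolding norm_columns[OF N(1)]
    proof (intro sum_mono)
      fix j
      have "(\<Sum>i<dim_col M. (ent x i j)\<^sup>2) \<le> (\<Sum>i<N. (ent x i j)\<^sup>2)"
        by (rule sum_mono2) (auto simp: N_def)
      then show "(vnorm (v j))\<^sup>2 \<le> (vnorm (vec N (\<lambda>i. ent x i j)))\<^sup>2"
        by (simp add: vnorm_def v_def scalar_prod_def atLeast0LessThan sum_nonneg power2_eq_square)
    qed
    finally have "(norm (em M * x))\<^sup>2 \<le> (spec_norm M * norm x)\<^sup>2"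
      by (simp add: power_mult_distrib mult_left_mono)
    then show "norm (em M * x) \<le> spec_norm M * norm x"
      by (rule power2_le_imp_le) (simp add: nonneg)
  qed
qed

section \<open>Inverses and positive semidefinite square roots\<close>

lemma mat_inv_correct:
  fixes A :: "'a::field mat"
  assumes A: "A \<in> carrier_mat n n" and det: "det A \<noteq> 0"
  shows "mat_inv A \<in> carrier_mat n n" "A * mat_inv A = 1\<^sub>m n" "mat_inv A * A = 1\<^sub>m n"
proof -
  have "A \<in> Units (ring_mat TYPE('a) n ())"
    by (rule det_non_zero_imp_unit[OF A det])
  then obtain B where B: "mat_inverse A = Some B"
    using mat_inverse(1)[OF A, where b = "()"] by (cases "mat_inverse A") auto
  show "mat_inv A \<in> carrier_mat n n" "A * mat_inv A = 1\<^sub>m n" "mat_inv A * A = 1\<^sub>m n"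
    using mat_inverse(2)[OF A B] by (auto simp: mat_inv_def B)
qed

lemma det_nonzeroI:
  assumes A: "A \<in> carrier_mat n n" and inj: "\<And>x. cm n 1 x \<Longrightarrow> em A * x = 0 \<Longrightarrow> x = 0"
  shows "det A \<noteq> 0"
proof
  assume "det A = 0"
  then obtain v where v: "v \<in> carrier_vec n" "v \<noteq> 0\<^sub>v n" "A *\<^sub>v v = 0\<^sub>v n"
    using det_0_iff_vec_prod_zero[OF A] by blast
  have "em A * ev v = ev (0\<^sub>v n)" using v A by (subst ev_mult[symmetric]) auto
  also have "\<dots> = 0" by (rule fmat_eqI) (simp add: ent_ev)
  finally have ev0: "ev v = 0" using inj[OF cm_ev[OF v(1)]] by simp
  have "v $ i = 0" if "i < n" for i
  proof -
    have "v $ i = ent (ev v) i 0" using that v(1) by (auto simp: ent_ev)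
    then show ?thesis by (simp add: ev0)
  qed
  then show False using v by auto
qed

lemma em_mat_inv:
  assumes A: "A \<in> carrier_mat n n" and inj: "\<And>x. cm n 1 x \<Longrightarrow> em A * x = 0 \<Longrightarrow> x = 0"
  shows "mat_inv A \<in> carrier_mat n n" "em A * em (mat_inv A) = ide n" "em (mat_inv A) * em A = ide n"
proof -
  note i = mat_inv_correct[OF A det_nonzeroI[OF A inj]]
  show c: "mat_inv A \<in> carrier_mat n n" by (rule i(1))
  show "em A * em (mat_inv A) = ide n" "em (mat_inv A) * em A = ide n"
    using i A by (auto simp flip: em_mult)
qed

text \<open>Replaces compactness of the unit sphere, which fails in the infinite-dimensional space
  \<open>fmat\<close>, when an eigenvector has to be found.\<close>

lemma kernel_or_inverse:
  assumes "cm n n M"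
  shows "(\<exists>N. N * M = ide n) \<or> (\<exists>x. cm n 1 x \<and> x \<noteq> 0 \<and> M * x = 0)"
proof (rule disjCI)
  assume *: "\<not> (\<exists>x. cm n 1 x \<and> x \<noteq> 0 \<and> M * x = 0)"
  have "em (mat_inv (fm n n M)) * em (fm n n M) = ide n"
    by (rule em_mat_inv(3)) (use * in \<open>auto simp: em_fm[OF assms]\<close>)
  then show "\<exists>N. N * M = ide n" by (auto simp: em_fm[OF assms])
qed

section \<open>Positive semidefinite elements and their square roots\<close>

definition psd :: "fmat \<Rightarrow> bool" where
  "psd a \<longleftrightarrow> tp a = a \<and> (\<forall>x. 0 \<le> inner x (a * x))"

text \<open>Evaluate the nonnegative form of \<open>K\<close> at
  \<open>v - (1 / k) *\<^sub>R (K * v)\<close> with \<open>k = opn K\<close>.\<close>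

lemma psd_norm_mult_le:
  assumes "psd K"
  shows "(norm (K * v))\<^sup>2 \<le> opn K * inner v (K * v)"
proof (cases "opn K = 0")
  case True
  then show ?thesis using norm_mult_opn[of K v] by simp
next
  case False
  define k where "k = opn K"
  have k: "k > 0" using False opn_nonneg[of K] by (simp add: k_def less_le)
  define w where "w = K * v"
  have sym: "inner w (K * v) = inner v (K * w)"
    using assms by (metis inner_commute inner_mult_left psd_def)
  have "0 \<le> inner (v - (1 / k) *\<^sub>R w) (K * (v - (1 / k) *\<^sub>R w))"
    using assms by (simp add: psd_def)
  also have "\<dots> = inner v (K * v) - (2 / k) * inner w w + (1 / k) * (1 / k) * inner w (K * w)"
    by (simp add: right_diff_distrib inner_diff_left inner_diff_right sym[symmetric])
       (simp add: w_def algebra_simps)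
  finally have *: "0 \<le> inner v (K * v) - (2 / k) * inner w w + (1 / k) * (1 / k) * inner w (K * w)" .
  have "inner w (K * w) \<le> k * inner w w"
    using abs_inner_opn[of w K w] by (simp add: k_def power2_norm_eq_inner mult.assoc flip: power2_eq_square)
  then have "(1 / k) * (1 / k) * inner w (K * w) \<le> (1 / k) * (1 / k) * (k * inner w w)"
    using k by (intro mult_left_mono) auto
  then have "(1 / k) * (1 / k) * inner w (K * w) \<le> inner w w / k" using k by simp
  with * have "0 \<le> inner v (K * v) - (2 / k) * inner w w + inner w w / k" by linarith
  then have "inner w w \<le> k * inner v (K * v)" using k by (simp add: field_simps)
  then show ?thesis by (simp add: power2_norm_eq_inner w_def k_def)
qed

lemma psd_null: "psd K \<Longrightarrow> inner v (K * v) = 0 \<Longrightarrow> K * v = 0"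
  using psd_norm_mult_le[of K v] by simp

text \<open>\<mu> is the infimum of the Rayleigh quotient of \<open>H\<close> on the range of the
  projector \<open>p\<close>. It is attained: if \<open>H - \<mu> *\<^sub>R p\<close> were
  invertible on that range, the quotient would stay away from \<mu>.\<close>

lemma min_eigenvector:
  assumes p: "cm n n p" "p * p = p" "tp p = p" "p \<noteq> 0"
    and H: "tp H = H" "p * H = H"
  obtains x \<mu> where "cm n 1 x" "p * x = x" "norm x = 1" "H * x = \<mu> *\<^sub>R x"
    "\<And>v. p * v = v \<Longrightarrow> \<mu> * (norm v)\<^sup>2 \<le> inner v (H * v)"
proof -
  have Hp: "H * p = H" using arg_cong[OF H(2), of tp] by (simp add: H(1) p(3))
  have cmH: "cm n n H"
  proof -
    have "ide n * H = H" using cmD(3)[OF p(1), of H] by (simp add: H)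
    moreover from arg_cong[OF this, of tp] have "H * ide n = H" by (simp add: H)
    ultimately show ?thesis by (simp add: cm_def)
  qed
  define S where "S = {inner v (H * v) | v. p * v = v \<and> norm v = 1}"
  define \<mu> where "\<mu> = Inf S"
  have S0: "S \<noteq> {}"
  proof -
    have "p * ((1 / norm p) *\<^sub>R p) = (1 / norm p) *\<^sub>R p" "norm ((1 / norm p) *\<^sub>R p) = 1"
      using p by auto
    then show ?thesis unfolding S_def by blast
  qed
  have "- opn H \<le> inner v (H * v)" if "norm v = 1" for v
    using abs_inner_opn[of v H v] that by simp
  then have bdd: "bdd_below S" unfolding S_def by (intro bdd_belowI[of _ "- opn H"]) auto
  have low: "\<mu> * (norm v)\<^sup>2 \<le> inner v (H * v)" if v: "p * v = v" for v
  proof (cases "v = 0")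
    case False
    define u where "u = (1 / norm v) *\<^sub>R v"
    have "p * u = u" "norm u = 1" using v False by (auto simp: u_def)
    then have "\<mu> \<le> inner u (H * u)"
      unfolding \<mu>_def by (intro cInf_lower bdd) (auto simp: S_def)
    also have "\<dots> = inner v (H * v) / (norm v)\<^sup>2"
      by (simp add: u_def power2_eq_square)
    finally show ?thesis using False by (simp add: field_simps)
  qed simp
  define K where "K = H - \<mu> *\<^sub>R p"
  have psdK: "psd K"
  proof -
    have "0 \<le> inner x (K * x)" for x
    proof -
      have "inner x (K * x) = inner (p * x) (H * (p * x)) - \<mu> * inner (p * x) (p * x)"
        by (simp add: K_def left_diff_distrib inner_diff_right inner_mult_left p H Hp flip: mult.assoc)
      then show ?thesis
        using low[of "p * x"] by (simp add: p power2_norm_eq_inner flip: mult.assoc)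
    qed
    then show ?thesis by (simp add: psd_def K_def H p)
  qed
  \<comment> \<open>\<open>M\<close> is \<open>K\<close> on the range of \<open>p\<close> and the
    identity on the complementary part of \<open>ide n\<close>, so its kernel lies in the range of
    \<open>p\<close>.\<close>
  define M where "M = K + (ide n - p)"
  have "cm n n M" unfolding M_def K_def using p(1) cmH by auto
  from kernel_or_inverse[OF this] show thesis
  proof (elim disjE exE conjE)
    fix N assume N: "N * M = ide n"
    \<comment> \<open>If \<open>N\<close> inverts \<open>M\<close>, then
      \<open>v = N * (K * v)\<close> for \<open>v\<close> in the range of \<open>p\<close>, and
      \<open>psd_norm_mult_le\<close> bounds \<open>K * v\<close> by the excess of the quotient over
      \<mu>. This excess is then at least \<open>1 / k\<close>, against the choice of \<mu>.\<close>
    define k where "k = (opn N)\<^sup>2 * opn K"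
    have one: "1 \<le> k * (inner v (H * v) - \<mu>)" if v: "p * v = v" "norm v = 1" for v
    proof -
      have iv: "ide n * v = v" using cmD(3)[OF p(1), of v] v by simp
      have "M * v = K * v" using iv v by (simp add: M_def algebra_simps)
      then have "v = N * (K * v)" using N iv by (metis mult.assoc)
      then have "1 \<le> opn N * norm (K * v)" using norm_mult_opn[of N "K * v"] v by simp
      then have "1 \<le> (opn N * norm (K * v))\<^sup>2" by simp
      also have "\<dots> = (opn N)\<^sup>2 * (norm (K * v))\<^sup>2" by (simp add: power_mult_distrib)
      also have "\<dots> \<le> (opn N)\<^sup>2 * (opn K * inner v (K * v))"
        by (intro mult_left_mono psd_norm_mult_le psdK) simp
      also have "inner v (K * v) = inner v (H * v) - \<mu>"
        using v by (simp add: K_def left_diff_distrib inner_diff_right flip: power2_norm_eq_inner)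
      finally show ?thesis by (simp add: k_def mult.assoc)
    qed
    have kpos: "k > 0"
    proof -
      obtain v where v: "p * v = v" "norm v = 1" using S0 unfolding S_def by blast
      have "k \<noteq> 0" using one[OF v] by auto
      moreover have "k \<ge> 0" by (simp add: k_def)
      ultimately show ?thesis by simp
    qed
    have "\<mu> + 1 / k \<le> Inf S"
    proof (rule cInf_greatest[OF S0])
      fix s assume "s \<in> S"
      then obtain v where v: "p * v = v" "norm v = 1" "s = inner v (H * v)" unfolding S_def by blast
      show "\<mu> + 1 / k \<le> s" using one[OF v(1,2)] kpos unfolding v(3) by (simp add: field_simps)
    qed
    then show thesis using kpos by (simp add: \<mu>_def)
  next
    fix x assume x: "cm n 1 x" "x \<noteq> 0" "M * x = 0"
    have "p * (M * x) = K * x"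
      using cmD(1)[OF x(1)] cmD(2)[OF p(1)]
      by (simp add: M_def K_def algebra_simps H p flip: mult.assoc)
    then have Kx: "K * x = 0" using x by simp
    then have "x - p * x = 0" using x cmD(1)[OF x(1)] by (simp add: M_def algebra_simps)
    then have px: "p * x = x" by simp
    have Hx: "H * x = \<mu> *\<^sub>R x" using Kx px by (simp add: K_def algebra_simps)
    show thesis
    proof (rule that[of "(1 / norm x) *\<^sub>R x" \<mu>])
      show "cm n 1 ((1 / norm x) *\<^sub>R x)" using x by auto
      show "norm ((1 / norm x) *\<^sub>R x) = 1" using x by simp
      show "p * ((1 / norm x) *\<^sub>R x) = (1 / norm x) *\<^sub>R x" using px by simp
      show "H * ((1 / norm x) *\<^sub>R x) = \<mu> *\<^sub>R ((1 / norm x) *\<^sub>R x)" using Hx by simp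
    qed (rule low)
  qed
qed

lemma tp_mult_columns:
  assumes "cm n 1 x" "cm n 1 y"
  shows "tp x * y = inner x y *\<^sub>R ide 1"
proof (rule fmat_eqI)
  fix i j
  have c: "cm 1 1 (tp x * y)" using assms by auto
  show "ent (tp x * y) i j = ent (inner x y *\<^sub>R ide 1) i j"
  proof (cases "i = 0 \<and> j = 0")
    case True
    have "inner x y = inner (x * ide 1) y" using cmD(2)[OF assms(1)] by simp
    also have "\<dots> = inner (ide 1) (tp x * y)" by (rule inner_mult_left)
    also have "\<dots> = ent (tp x * y) 0 0"
      by (subst inner_fbound[of _ 1]) (use fbound_sh[of 0 1] in \<open>auto simp: ent_sh\<close>)
    finally show ?thesis using True by (simp add: ent_sh)
  next
    case False
    then have "ent (tp x * y) i j = 0" using c by (auto simp: cm_iff)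
    then show ?thesis using False by (auto simp: ent_sh)
  qed
qed

text \<open>Induction on the rank of the projector \<open>p\<close>, expressed as its trace. One
  unit eigenvector \<open>x\<close> with eigenvalue \<mu> is split off, the root of the rest is
  taken, and \<open>sqrt \<mu>\<close> times the rank-one projector \<open>e\<close> is
  added.\<close>

lemma psd_sqrt_exists:
  assumes "cm n n p" "p * p = p" "tp p = p" "inner (ide n) p = real k" "p * H = H" "psd H"
  shows "\<exists>X. p * X = X \<and> psd X \<and> X * X = H"
  using assms
proof (induction k arbitrary: p H)
  case 0
  have "inner p p = inner (p * ide n) p" using 0(1) by (simp add: cmD)
  also have "\<dots> = inner (ide n) (p * p)" using 0(3) by (simp add: inner_mult_left)
  finally have "p = 0" using 0 by simp
  then show ?case using 0 by (intro exI[of _ 0]) (auto simp: psd_def)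
next
  case (Suc k)
  note p = Suc.prems(1-3)
  have H: "tp H = H" using Suc.prems by (simp add: psd_def)
  have Hp: "H * p = H" using arg_cong[OF Suc.prems(5), of tp] by (simp add: H p(3))
  have "p \<noteq> 0" using Suc.prems(4) by auto
  from min_eigenvector[OF p this H Suc.prems(5)] obtain x \<mu> where
    x: "cm n 1 x" "p * x = x" "norm x = 1" "H * x = \<mu> *\<^sub>R x" by blast
  have "inner x (H * x) = \<mu>" using x by (simp flip: power2_norm_eq_inner)
  then have \<mu>: "0 \<le> \<mu>" using Suc.prems(6) unfolding psd_def by metis
  define e where "e = x * tp x"
  have xx: "tp x * x = ide 1" using tp_mult_columns[OF x(1) x(1)] x(3) by (simp flip: power2_norm_eq_inner)
  have ee: "e * e = e"
    unfolding e_def by (metis cmD(2)[OF x(1)] mult.assoc xx)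
  have te: "tp e = e" by (simp add: e_def)
  have pe: "p * e = e" using x by (simp add: e_def flip: mult.assoc)
  have ep: "e * p = e" using arg_cong[OF pe, of tp] by (simp add: p te)
  have He: "H * e = \<mu> *\<^sub>R e" using x by (simp add: e_def flip: mult.assoc)
  have eH: "e * H = \<mu> *\<^sub>R e" using arg_cong[OF He, of tp] by (simp add: H te)
  define p' where "p' = p - e"
  define H' where "H' = H - \<mu> *\<^sub>R e"
  have cme: "cm n n e" unfolding e_def using x(1) by auto
  have p'H: "p' * H' = H'" by (simp add: p'_def H'_def algebra_simps Suc.prems(5) eH pe ee)
  have "p' * (H * p') = H'" by (simp add: p'_def H'_def algebra_simps Hp Suc.prems(5) eH He pe ee)
  then have "inner v (H' * v) = inner (p' * v) (H * (p' * v))" for v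
    by (metis inner_mult_left mult.assoc p'_def p(3) te tp_simps(3))
  then have "psd H'" using Suc.prems(6) H te by (auto simp: psd_def H'_def)
  moreover have "inner (ide n) p' = real k"
  proof -
    have "inner (ide n) e = inner (ide n * x) x"
      by (simp add: e_def inner_mult_right)
    then have "inner (ide n) e = 1" using x by (simp add: cmD flip: power2_norm_eq_inner)
    then show ?thesis using Suc.prems(4) by (simp add: p'_def inner_diff_right)
  qed
  moreover have "cm n n p'" "p' * p' = p'" "tp p' = p'"
    using p cme by (auto simp: p'_def algebra_simps ee pe ep te)
  ultimately obtain X where X: "p' * X = X" "psd X" "X * X = H'"
    using Suc.IH[of p' H'] p'H by blast
  have tX: "tp X = X" using X by (simp add: psd_def)
  have "e * X = e * (p' * X)" by (simp add: X)
  also have "\<dots> = (e * p') * X" by (simp add: mult.assoc)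
  also have "\<dots> = 0" by (simp add: p'_def algebra_simps ep ee)
  finally have eX: "e * X = 0" .
  have Xe: "X * e = 0" using arg_cong[OF eX, of tp] by (simp add: tX te)
  have pX: "p * X = X" using X(1) eX by (simp add: p'_def algebra_simps)
  show ?case
  proof (intro exI[of _ "X + sqrt \<mu> *\<^sub>R e"] conjI)
    show "p * (X + sqrt \<mu> *\<^sub>R e) = X + sqrt \<mu> *\<^sub>R e" by (simp add: distrib_left pX pe)
    show "(X + sqrt \<mu> *\<^sub>R e) * (X + sqrt \<mu> *\<^sub>R e) = H"
      by (simp add: distrib_left distrib_right eX Xe ee X(3) \<mu> H'_def)
    have "inner v (e * v) = inner (e * v) (e * v)" for v
      by (simp add: inner_mult_left te ee flip: mult.assoc)
    then have "0 \<le> inner v ((X + sqrt \<mu> *\<^sub>R e) * v)" for v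
      using X(2) \<mu> by (simp add: psd_def distrib_right inner_add_right)
    then show "psd (X + sqrt \<mu> *\<^sub>R e)" by (simp add: psd_def tX te)
  qed
qed

text \<open>For \<open>D = X - Y\<close> the hypothesis reads \<open>X * D + D * Y = 0\<close>.
  Pairing it with \<open>D\<close> gives a vanishing sum of the nonnegative forms of
  \<open>X\<close> and \<open>Y\<close> at \<open>D\<close>; so \<open>X * D = Y * D = 0\<close>,
  hence \<open>D * D = 0\<close>, and \<open>D\<close> is symmetric.\<close>

lemma psd_sqrt_unique:
  assumes "psd X" "psd Y" "X * X = Y * Y"
  shows "X = Y"
proof -
  define D where "D = X - Y"
  have tD: "tp D = D" using assms by (simp add: D_def psd_def)
  have eq: "X * D + D * Y = 0" using assms(3) by (simp add: D_def algebra_simps)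
  have "inner D (D * Y) = inner D (tp (D * Y))" by (metis inner_tp tD)
  also have "\<dots> = inner D (Y * D)" using assms(2) by (simp add: tD psd_def)
  finally have "inner D (X * D) + inner D (Y * D) = 0"
    using arg_cong[OF eq, of "inner D"] by (simp add: inner_add_right)
  moreover have "0 \<le> inner D (X * D)" "0 \<le> inner D (Y * D)" using assms by (auto simp: psd_def)
  ultimately have "inner D (X * D) = 0" "inner D (Y * D) = 0" by auto
  then have "X * D = 0" "Y * D = 0" using assms psd_null by auto
  then have DD: "D * D = 0" by (simp add: D_def algebra_simps)
  obtain n where n: "fbound D n" using fbound_ex by blast
  then have cD: "cm n n D" by (auto simp: cm_iff fbound_def)
  have "inner D D = inner (D * ide n) D" using cD by (simp add: cmD)
  also have "\<dots> = 0" by (simp add: inner_mult_left tD DD)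
  finally show ?thesis by (simp add: D_def)
qed

text \<open>Carries \<open>pos_semidef\<close>, stated for vectors, over to \<open>psd\<close>,
  stated for elements with many columns.\<close>

lemma inner_columns:
  assumes M: "M \<in> carrier_mat n n" and N: "fbound x N" "n \<le> N"
  shows "inner x (em M * x) =
    (\<Sum>j<N. scalar_prod (vec n (\<lambda>i. ent x i j)) (M *\<^sub>v vec n (\<lambda>i. ent x i j)))"
proof -
  have "inner x (em M * x) = (\<Sum>j<N. \<Sum>i<N. ent x i j * ent (em M * x) i j)"
    unfolding inner_fbound[OF N(1)] by (rule sum.swap)
  also have "\<dots> = (\<Sum>j<N. \<Sum>i<n. ent x i j * ent (em M * x) i j)"
  proof (rule sum.cong[OF refl])
    fix j
    have "ent (em M * x) i j = 0" if "n \<le> i" for i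
      using that M by (subst ent_times[of n]) (auto simp: ent_em)
    then show "(\<Sum>i<N. ent x i j * ent (em M * x) i j) = (\<Sum>i<n. ent x i j * ent (em M * x) i j)"
      by (intro sum.mono_neutral_right) (use N(2) in \<open>auto simp: not_less\<close>)
  qed
  also have "\<dots> = (\<Sum>j<N. scalar_prod (vec n (\<lambda>i. ent x i j)) (M *\<^sub>v vec n (\<lambda>i. ent x i j)))"
    using M by (intro sum.cong refl) (auto simp: scalar_prod_def atLeast0LessThan
        ent_times[of n "em M"] ent_em intro!: sum.cong)
  finally show ?thesis .
qed

lemma pos_semidef_psd:
  assumes "pos_semidef n M"
  shows "psd (em M)"
proof -
  have M: "M \<in> carrier_mat n n" using assms by (simp add: pos_semidef_def)
  have "0 \<le> inner x (em M * x)" for x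
  proof -
    obtain K where "fbound x K" using fbound_ex by blast
    then have N: "fbound x (max K n)" "n \<le> max K n" by (auto intro: fbound_mono)
    show ?thesis unfolding inner_columns[OF M N]
      using assms by (intro sum_nonneg) (auto simp: pos_semidef_def)
  qed
  then show ?thesis
    using assms unfolding psd_def pos_semidef_def by (metis em_transpose)
qed

lemma psd_pos_semidef:
  assumes "psd (em M)" "M \<in> carrier_mat n n"
  shows "pos_semidef n M"
  unfolding pos_semidef_def
proof (intro conjI ballI)
  show "M\<^sup>T = M" 
    using assms by (intro em_inject[of _ n n]) (auto simp: em_transpose psd_def)
  fix v :: "real vec" assume v: "v \<in> carrier_vec n"
  have "scalar_prod v (M *\<^sub>v v) = inner (ev v) (em M * ev v)"
    using v assms by (subst ev_mult[symmetric]) (auto simp: inner_ev)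
  then show "0 \<le> scalar_prod v (M *\<^sub>v v)" using assms by (simp add: psd_def)
qed (use assms in auto)

lemma mat_sqrt_correct:
  assumes M: "pos_semidef n M"
  shows "pos_semidef n (mat_sqrt M)" "mat_sqrt M * mat_sqrt M = M"
proof -
  have Mc: "M \<in> carrier_mat n n" using M by (simp add: pos_semidef_def)
  have "inner (ide n) (ide n) = real n" using norm_ide[of n] by (simp add: power2_norm_eq_inner)
  then obtain X where X: "ide n * X = X" "psd X" "X * X = em M"
    using psd_sqrt_exists[of n "ide n" n "em M"] pos_semidef_psd[OF M] cm_em[OF Mc] 
    by (auto simp: cmD)
  have "X * ide n = X" using arg_cong[OF X(1), of tp] X(2) by (simp add: psd_def)
  then have cX: "cm n n X" using X by (simp add: cm_def)
  have ex: "pos_semidef n (fm n n X) \<and> fm n n X * fm n n X = M"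
  proof
    show "pos_semidef n (fm n n X)" by (rule psd_pos_semidef) (simp_all add: em_fm[OF cX] X)
    show "fm n n X * fm n n X = M"
      by (rule em_inject[OF _ Mc]) (auto simp: em_mult em_fm[OF cX] X)
  qed
  have "\<exists>!X. pos_semidef n X \<and> X * X = M"
  proof (rule ex1I[of _ "fm n n X"], rule ex)
    fix Y assume Y: "pos_semidef n Y \<and> Y * Y = M"
    then have Yc: "Y \<in> carrier_mat n n" by (simp add: pos_semidef_def)
    have "em Y * em Y = em M" using Y Yc by (simp flip: em_mult)
    then have "em Y = X" using psd_sqrt_unique[of "em Y" X] X pos_semidef_psd Y by auto
    then show "Y = fm n n X"
      by (intro em_inject[OF Yc fm_carrier]) (simp add: em_fm[OF cX])
  qed
  from theI'[OF this] show "pos_semidef n (mat_sqrt M)" "mat_sqrt M * mat_sqrt M = M"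
    using Mc unfolding mat_sqrt_def by auto
qed

text \<open>The inverse of \<open>Z\<close> is the matrix of cosines of the principal angles between the column space of
  \<open>U1 + U2 * g\<close> and that of \<open>U1\<close>, for an orthogonal matrix with blocks \<open>U1\<close> and \<open>U2\<close>.\<close>

lemma cos_factor:
  fixes g :: "real mat"
  assumes g: "g \<in> carrier_mat k r"
  defines "Z \<equiv> mat_sqrt (1\<^sub>m r + g\<^sup>T * g)"
  shows "Z \<in> carrier_mat r r" "mat_inv Z \<in> carrier_mat r r"
    "tp (em Z) = em Z" "tp (em (mat_inv Z)) = em (mat_inv Z)"
    "em Z * em Z = ide r + tp (em g) * em g"
    "em Z * em (mat_inv Z) = ide r" "em (mat_inv Z) * em Z = ide r"
proof -
  let ?M = "1\<^sub>m r + g\<^sup>T * g"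
  have Mc: "?M \<in> carrier_mat r r" using g by auto
  have eM: "em ?M = ide r + tp (em g) * em g"
    using g by (simp add: em_add em_mult em_transpose)
  have form: "inner x (em ?M * x) = (norm (ide r * x))\<^sup>2 + (norm (em g * x))\<^sup>2" for x
  proof -
    have "inner (ide r * x) (ide r * x) = inner x (ide r * x)"
      by (simp add: inner_mult_left flip: mult.assoc)
    then show ?thesis
      by (simp add: eM distrib_right inner_add_right power2_norm_eq_inner mult.assoc inner_mult_left)
  qed
  have "psd (em ?M)" unfolding psd_def form by (simp add: eM)
  note Z = mat_sqrt_correct[OF psd_pos_semidef[OF this Mc], folded Z_def]
  show Zc: "Z \<in> carrier_mat r r" using Z by (simp add: pos_semidef_def)
  show tZ: "tp (em Z) = em Z" using pos_semidef_psd[OF Z(1)] by (simp add: psd_def)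
  show ZZ: "em Z * em Z = ide r + tp (em g) * em g"
    using Zc Z(2) eM by (simp flip: em_mult)
  have inj: "x = 0" if "cm r 1 x" "em Z * x = 0" for x
  proof -
    have "em ?M * x = em Z * (em Z * x)" using ZZ eM by (simp flip: mult.assoc)
    then have "(norm (ide r * x))\<^sup>2 + (norm (em g * x))\<^sup>2 = 0"
      using form[of x] that by simp
    then have "ide r * x = 0" by (simp add: sum_power2_eq_zero_iff)
    then show ?thesis using that by (simp add: cmD)
  qed
  show Wc: "mat_inv Z \<in> carrier_mat r r" and ZW: "em Z * em (mat_inv Z) = ide r"
    and "em (mat_inv Z) * em Z = ide r"
    using em_mat_inv[OF Zc inj] by auto
  have "tp (em (mat_inv Z)) = tp (em (mat_inv Z)) * (em Z * em (mat_inv Z))"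
    using cm_tp[OF cm_em[OF Wc]] by (simp add: ZW cmD)
  also have "\<dots> = tp (em Z * em (mat_inv Z)) * em (mat_inv Z)" by (simp add: tZ mult.assoc)
  also have "\<dots> = em (mat_inv Z)" using cm_em[OF Wc] by (simp add: ZW cmD del: tp_mult)
  finally show "tp (em (mat_inv Z)) = em (mat_inv Z)" .
qed

section \<open>Entrywise calculus\<close>

lemma bounded_linear_tp: "bounded_linear tp"
  by (rule bounded_linear_intro[of _ 1]) auto

lemma abs_ent_le_norm: "\<bar>ent x i j\<bar> \<le> norm x"
proof -
  obtain K where "fbound x K" using fbound_ex by blast
  define N where "N = K + i + j + 1"
  have N: "fbound x N" "i < N" "j < N"
    using fbound_mono[OF \<open>fbound x K\<close>, of N] by (auto simp: N_def)
  have "(ent x i j)\<^sup>2 \<le> (\<Sum>j'<N. (ent x i j')\<^sup>2)"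
    by (rule member_le_sum) (use N in auto)
  also have "\<dots> \<le> (\<Sum>i'<N. \<Sum>j'<N. (ent x i' j')\<^sup>2)"
    by (rule member_le_sum[of i _ "\<lambda>i'. \<Sum>j'<N. (ent x i' j')\<^sup>2"]) (use N in \<open>auto intro: sum_nonneg\<close>)
  also have "\<dots> = (norm x)\<^sup>2"
    unfolding power2_norm_eq_inner inner_fbound[OF N(1)] by (simp add: power2_eq_square)
  finally show ?thesis by (simp add: abs_le_square_iff[symmetric])
qed

lemma bounded_linear_ent: "bounded_linear (\<lambda>x. ent x i j)"
  by (rule bounded_linear_intro[of _ 1]) (auto simp: abs_ent_le_norm)

text \<open>The fixed size is essential: it makes \<open>f\<close> a finite combination of the
  matrix units \<open>u i j\<close>. In \<open>fmat\<close> at large, differentiability of the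
  entries does not imply differentiability in norm.\<close>

lemma has_vector_derivative_entI:
  assumes f: "\<And>s. cm n m (f s)" and d: "cm n m d"
    and D: "\<And>i j. i < n \<Longrightarrow> j < m \<Longrightarrow> ((\<lambda>s. ent (f s) i j) has_real_derivative ent d i j) (at t)"
  shows "(f has_vector_derivative d) (at t)"
proof -
  define u where "u = (\<lambda>i j. sh i 1 * tp (sh j 1))"
  have ent_u: "ent (u i j) k l = (if k = i \<and> l = j then 1 else 0)" for i j k l
    by (auto simp: u_def ent_sh_mult ent_sh)
  have expand: "x = (\<Sum>i<n. \<Sum>j<m. ent x i j *\<^sub>R u i j)" if "cm n m x" for x
  proof (rule fmat_eqI)
    fix k l
    have "ent (\<Sum>i<n. \<Sum>j<m. ent x i j *\<^sub>R u i j) k l =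
        (\<Sum>i<n. \<Sum>j<m. if k = i then if l = j then ent x i j else 0 else 0)"
      by (auto simp: ent_sum ent_u intro!: sum.cong)
    also have "\<dots> = (\<Sum>i<n. if k = i then \<Sum>j<m. if l = j then ent x i j else 0 else 0)"
      by (intro sum.cong) auto
    also have "\<dots> = ent x k l"
      using that by (auto simp: cm_iff sum.delta' not_less)
    finally show "ent x k l = ent (\<Sum>i<n. \<Sum>j<m. ent x i j *\<^sub>R u i j) k l" by simp
  qed
  have "((\<lambda>s. \<Sum>i<n. \<Sum>j<m. ent (f s) i j *\<^sub>R u i j) has_vector_derivative
      (\<Sum>i<n. \<Sum>j<m. ent d i j *\<^sub>R u i j)) (at t)"
  proof (intro has_vector_derivative_sum)
    fix i j assume "i \<in> {..<n}" "j \<in> {..<m}"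
    then have "((\<lambda>s. ent (f s) i j) has_vector_derivative ent d i j) (at t)"
      using D by (simp add: has_real_derivative_iff_has_vector_derivative)
    then show "((\<lambda>s. ent (f s) i j *\<^sub>R u i j) has_vector_derivative ent d i j *\<^sub>R u i j) (at t)"
      by (rule bounded_linear.has_vector_derivative[OF bounded_linear_scaleR_left])
  qed
  then show ?thesis using expand[OF d] expand[OF f] by simp
qed

section \<open>The matrix exponential\<close>

lemma em_pow_Suc:
  assumes "A \<in> carrier_mat n n"
  shows "em (A ^\<^sub>m Suc k) = em (A ^\<^sub>m k) * em A"
  using assms by (simp add: em_mult)

lemma em_pow_commute:
  assumes "A \<in> carrier_mat n n"
  shows "em (A ^\<^sub>m k) * em A = em A * em (A ^\<^sub>m k)"
proof (induction k)
  case 0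
  show ?case using cm_em[OF assms] assms by (simp add: cmD)
next
  case (Suc k)
  then show ?case by (simp add: em_pow_Suc[OF assms] mult.assoc del: pow_mat.simps)
qed

lemma em_pow_smult:
  assumes "A \<in> carrier_mat n n"
  shows "em ((t \<cdot>\<^sub>m A) ^\<^sub>m k) = t ^ k *\<^sub>R em (A ^\<^sub>m k)"
proof (induction k)
  case 0
  show ?case using assms by simp
next
  case (Suc k)
  have "t \<cdot>\<^sub>m A \<in> carrier_mat n n" using assms by simp
  from em_pow_Suc[OF this, of k] show ?case
    by (simp add: em_pow_Suc[OF assms] Suc em_smult mult_ac del: pow_mat.simps)
qed

lemma em_pow_transpose:
  assumes "A \<in> carrier_mat n n"
  shows "em (A\<^sup>T ^\<^sub>m k) = tp (em (A ^\<^sub>m k))"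
proof (induction k)
  case 0
  show ?case using assms by simp
next
  case (Suc k)
  have "A\<^sup>T \<in> carrier_mat n n" using assms by simp
  from em_pow_Suc[OF this, of k] show ?case
    by (simp add: em_pow_Suc[OF assms] Suc em_transpose em_pow_commute[OF assms] flip: tp_mult del: pow_mat.simps tp_mult)
qed

lemma norm_em_pow_le:
  assumes "A \<in> carrier_mat n n"
  shows "norm (em (A ^\<^sub>m k)) \<le> norm (ide n) * norm (em A) ^ k"
proof (induction k)
  case 0
  show ?case using assms by simp
next
  case (Suc k)
  have "norm (em (A ^\<^sub>m Suc k)) \<le> norm (em (A ^\<^sub>m k)) * norm (em A)"
    unfolding em_pow_Suc[OF assms] by (rule norm_mult_ineq)
  also have "\<dots> \<le> norm (ide n) * norm (em A) ^ k * norm (em A)"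
    using Suc by (intro mult_right_mono) auto
  finally show ?case by (simp add: mult_ac)
qed

text \<open>The space \<open>fmat\<close> is not complete, so the exponential is treated as a family
  of scalar power series in \<open>t\<close>.\<close>

lemma ent_em_mat_exp:
  assumes A: "A \<in> carrier_mat n n"
  shows "ent (em (mat_exp (t \<cdot>\<^sub>m A))) i j = (\<Sum>k. (ent (em (A ^\<^sub>m k)) i j / fact k) * t ^ k)"
proof -
  have dims: "dim_row ((t \<cdot>\<^sub>m A) ^\<^sub>m k) = n" "dim_col ((t \<cdot>\<^sub>m A) ^\<^sub>m k) = n"
      "dim_row (A ^\<^sub>m k) = n" "dim_col (A ^\<^sub>m k) = n" for k
    using A by auto
  have entry: "((t \<cdot>\<^sub>m A) ^\<^sub>m k) $$ (i, j) = t ^ k * ent (em (A ^\<^sub>m k)) i j" if "i < n" "j < n" for k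
    using arg_cong[OF em_pow_smult[OF A], of "\<lambda>x. ent x i j" t k] that
    by (simp only: ent_em[of "(t \<cdot>\<^sub>m A) ^\<^sub>m k"] dims ent_simps simp_thms if_True)
  show ?thesis
  proof (cases "i < n \<and> j < n")
    case True
    have "ent (em (mat_exp (t \<cdot>\<^sub>m A))) i j = (\<Sum>k. ((t \<cdot>\<^sub>m A) ^\<^sub>m k) $$ (i, j) / fact k)"
      using True A by (simp add: ent_em mat_exp_def)
    then show ?thesis using entry True by (simp add: mult_ac)
  next
    case False
    then have "ent (em (A ^\<^sub>m k)) i j = 0" for k
      unfolding ent_em dims by auto
    then show ?thesis using False A by (auto simp: ent_em mat_exp_def)
  qed
qed

lemma summable_mat_exp:
  assumes A: "A \<in> carrier_mat n n"
  shows "summable (\<lambda>k. (ent (em (A ^\<^sub>m k)) i j / fact k) * t ^ k)"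
proof (rule summable_comparison_test')
  show "summable (\<lambda>k. norm (ide n) * ((norm (em A) * \<bar>t\<bar>) ^ k /\<^sub>R fact k))"
    by (intro summable_mult summable_exp_generic)
  fix k :: nat
  have "\<bar>ent (em (A ^\<^sub>m k)) i j\<bar> \<le> norm (ide n) * norm (em A) ^ k"
    using abs_ent_le_norm norm_em_pow_le[OF A] by (rule order_trans)
  then have "\<bar>ent (em (A ^\<^sub>m k)) i j\<bar> * (\<bar>t\<bar> ^ k / fact k) \<le> norm (ide n) * norm (em A) ^ k * (\<bar>t\<bar> ^ k / fact k)"
    by (intro mult_right_mono) auto
  then show "norm ((ent (em (A ^\<^sub>m k)) i j / fact k) * t ^ k) \<le> norm (ide n) * ((norm (em A) * \<bar>t\<bar>) ^ k /\<^sub>R fact k)"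
    by (simp add: abs_mult power_abs power_mult_distrib field_simps)
qed

lemma em_mat_exp_transpose:
  assumes A: "A \<in> carrier_mat n n"
  shows "em (mat_exp (t \<cdot>\<^sub>m A\<^sup>T)) = tp (em (mat_exp (t \<cdot>\<^sub>m A)))"
proof -
  have "A\<^sup>T \<in> carrier_mat n n" using A by simp
  then show ?thesis
    by (intro fmat_eqI) (simp only: ent_tp ent_em_mat_exp[OF A] ent_em_mat_exp em_pow_transpose[OF A])
qed

lemma mat_exp_carrier: "A \<in> carrier_mat n n \<Longrightarrow> mat_exp (t \<cdot>\<^sub>m A) \<in> carrier_mat n n"
  by (simp add: mat_exp_def)

lemma em_mat_exp_0:
  assumes A: "A \<in> carrier_mat n n"
  shows "em (mat_exp (0 \<cdot>\<^sub>m A)) = ide n"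
proof (rule fmat_eqI)
  fix i j
  have "(\<Sum>k. (ent (em (A ^\<^sub>m k)) i j / fact k) * 0 ^ k) = (\<Sum>k\<in>{0}. (ent (em (A ^\<^sub>m k)) i j / fact k) * 0 ^ k)"
    by (rule suminf_finite) auto
  then show "ent (em (mat_exp (0 \<cdot>\<^sub>m A))) i j = ent (ide n) i j"
    unfolding ent_em_mat_exp[OF A] using A by simp
qed

text \<open>Multiplication by \<open>em A\<close> from either side shifts the power series of every
  entry by one place, and so does termwise differentiation.\<close>

lemma em_mat_exp_derivative:
  assumes A: "A \<in> carrier_mat n n"
  defines "\<Phi> \<equiv> \<lambda>t. em (mat_exp (t \<cdot>\<^sub>m A))"
  shows "(\<Phi> has_vector_derivative \<Phi> t * em A) (at t)" "\<Phi> t * em A = em A * \<Phi> t"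
proof -
  have diffs: "diffs (\<lambda>k. ent (em (A ^\<^sub>m k)) i j / fact k) k = ent (em (A ^\<^sub>m Suc k)) i j / fact k" for i j k
    by (simp add: diffs_def del: pow_mat.simps)
  have sums: "summable (\<lambda>k. (ent (em (A ^\<^sub>m k)) i l / fact k) * t ^ k * c)" for i l c
    by (intro summable_mult2 summable_mat_exp[OF A])
  have R: "ent (\<Phi> t * em A) i j = (\<Sum>k. (ent (em (A ^\<^sub>m Suc k)) i j / fact k) * t ^ k)" for i j
  proof -
    have "ent (\<Phi> t * em A) i j = (\<Sum>l<n. ent (\<Phi> t) i l * ent (em A) l j)"
      by (rule ent_times) (use A in \<open>auto simp: ent_em\<close>)
    also have "\<dots> = (\<Sum>l<n. \<Sum>k. (ent (em (A ^\<^sub>m k)) i l / fact k) * t ^ k * ent (em A) l j)"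
      unfolding \<Phi>_def ent_em_mat_exp[OF A]
      by (intro sum.cong refl suminf_mult2 summable_mat_exp[OF A])
    also have "\<dots> = (\<Sum>k. \<Sum>l<n. (ent (em (A ^\<^sub>m k)) i l / fact k) * t ^ k * ent (em A) l j)"
      by (rule suminf_sum[symmetric]) (rule sums)
    also have "\<dots> = (\<Sum>k. (ent (em (A ^\<^sub>m Suc k)) i j / fact k) * t ^ k)"
    proof (rule suminf_cong)
      fix k
      have "ent (em (A ^\<^sub>m Suc k)) i j = (\<Sum>l<n. ent (em (A ^\<^sub>m k)) i l * ent (em A) l j)"
        unfolding em_pow_Suc[OF A] by (rule ent_times) (use A in \<open>auto simp: ent_em\<close>)
      then show "(\<Sum>l<n. (ent (em (A ^\<^sub>m k)) i l / fact k) * t ^ k * ent (em A) l j) = (ent (em (A ^\<^sub>m Suc k)) i j / fact k) * t ^ k"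
        by (simp add: sum_distrib_left sum_divide_distrib mult_ac sum_distrib_right del: pow_mat.simps)
    qed
    finally show ?thesis .
  qed
  have L: "ent (em A * \<Phi> t) i j = (\<Sum>k. (ent (em (A ^\<^sub>m Suc k)) i j / fact k) * t ^ k)" for i j
  proof -
    have "ent (em A * \<Phi> t) i j = (\<Sum>l<n. ent (em A) i l * ent (\<Phi> t) l j)"
      by (rule ent_times) (use A in \<open>auto simp: ent_em\<close>)
    also have "\<dots> = (\<Sum>l<n. \<Sum>k. (ent (em (A ^\<^sub>m k)) l j / fact k) * t ^ k * ent (em A) i l)"
      unfolding \<Phi>_def ent_em_mat_exp[OF A] mult.commute[of "ent (em A) _ _"]
      by (intro sum.cong refl suminf_mult2 summable_mat_exp[OF A])
    also have "\<dots> = (\<Sum>k. \<Sum>l<n. (ent (em (A ^\<^sub>m k)) l j / fact k) * t ^ k * ent (em A) i l)"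
      by (rule suminf_sum[symmetric]) (rule sums)
    also have "\<dots> = (\<Sum>k. (ent (em (A ^\<^sub>m Suc k)) i j / fact k) * t ^ k)"
    proof (rule suminf_cong)
      fix k
      have "ent (em (A ^\<^sub>m Suc k)) i j = (\<Sum>l<n. ent (em A) i l * ent (em (A ^\<^sub>m k)) l j)"
        unfolding em_pow_Suc[OF A] em_pow_commute[OF A] by (rule ent_times) (use A in \<open>auto simp: ent_em\<close>)
      then show "(\<Sum>l<n. (ent (em (A ^\<^sub>m k)) l j / fact k) * t ^ k * ent (em A) i l) = (ent (em (A ^\<^sub>m Suc k)) i j / fact k) * t ^ k"
        by (simp add: sum_distrib_left sum_divide_distrib mult_ac sum_distrib_right del: pow_mat.simps)
    qed
    finally show ?thesis .
  qed
  show "\<Phi> t * em A = em A * \<Phi> t" by (rule fmat_eqI) (simp only: L R)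
  have cm: "cm n n (\<Phi> s)" for s unfolding \<Phi>_def by (intro cm_em mat_exp_carrier A)
  show "(\<Phi> has_vector_derivative \<Phi> t * em A) (at t)"
  proof (rule has_vector_derivative_entI[OF cm])
    show "cm n n (\<Phi> t * em A)" using cm cm_em[OF A] by auto
    fix i j
    show "((\<lambda>s. ent (\<Phi> s) i j) has_real_derivative ent (\<Phi> t * em A) i j) (at t)"
      unfolding R using termdiffs_strong_converges_everywhere[OF summable_mat_exp[OF A], of i j t]
      by (simp add: diffs \<Phi>_def ent_em_mat_exp[OF A])
  qed
qed

section \<open>Lyapunov equations\<close>

text \<open>\<Phi> is the semigroup exp(t a) of a stable \<open>a\<close>, captured by its
  differential equation, commutation with \<open>a\<close> and exponential decay. In this abstract
  form it passes to the transpose.\<close>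

definition expdecay :: "nat \<Rightarrow> fmat \<Rightarrow> (real \<Rightarrow> fmat) \<Rightarrow> bool" where
  "expdecay n a \<Phi> \<longleftrightarrow> cm n n a \<and> \<Phi> 0 = ide n \<and> (\<forall>t. cm n n (\<Phi> t)) \<and>
     (\<forall>t. (\<Phi> has_vector_derivative \<Phi> t * a) (at t)) \<and> (\<forall>t. \<Phi> t * a = a * \<Phi> t) \<and>
     (\<exists>C c. c > 0 \<and> (\<forall>t\<ge>0. norm (\<Phi> t) \<le> C * exp (- c * t)))"

lemma expdecay_tp:
  assumes "expdecay n a \<Phi>"
  shows "expdecay n (tp a) (\<lambda>t. tp (\<Phi> t))"
proof -
  have "((\<lambda>t. tp (\<Phi> t)) has_vector_derivative tp (\<Phi> t) * tp a) (at t)" for t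
  proof -
    have "((\<lambda>t. tp (\<Phi> t)) has_vector_derivative tp (\<Phi> t * a)) (at t)"
      by (rule bounded_linear.has_vector_derivative[OF bounded_linear_tp])
         (use assms in \<open>unfold expdecay_def, blast\<close>)
    moreover have "tp (\<Phi> t * a) = tp (\<Phi> t) * tp a" using assms by (simp add: expdecay_def)
    ultimately show ?thesis by simp
  qed
  moreover have "tp (\<Phi> t) * tp a = tp a * tp (\<Phi> t)" for t
    using assms unfolding expdecay_def by (metis tp_mult)
  ultimately show ?thesis using assms by (auto simp: expdecay_def)
qed

text \<open>Along trajectories of the adjoint semigroup the form of \<open>X\<close> has minus the
  form of \<open>W\<close> as derivative and tends to 0. Comparison of monotone functions of
  \<open>t\<close> can then replace the integral representation of \<open>X\<close>.\<close>

lemma expdecay_form: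
  assumes e: "expdecay n a \<Phi>" and eq: "a * X + X * tp a + W = 0" and X: "cm n n X"
  defines "p \<equiv> \<lambda>u t. tp (\<Phi> t) * u"
  shows "((\<lambda>t. inner (p u t) (X * p v t)) has_real_derivative - inner (p u t) (W * p v t)) (at t)"
    "((\<lambda>t. inner (p u t) (X * p v t)) \<longlongrightarrow> 0) at_top"
    "inner (p u 0) (X * p v 0) = inner u (X * v)"
proof -
  have e': "(\<Phi> has_vector_derivative \<Phi> t * a) (at t)" for t using e unfolding expdecay_def by blast
  have p': "(p u has_vector_derivative tp a * p u t) (at t)" for u t
  proof -
    have "((\<lambda>t. tp (\<Phi> t) * u) has_vector_derivative tp (\<Phi> t * a) * u) (at t)"
      by (intro has_vector_derivative_mult_left
          bounded_linear.has_vector_derivative[OF bounded_linear_tp] e')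
    then show ?thesis by (simp add: p_def mult.assoc)
  qed
  have "((\<lambda>t. inner (p u t) (X * p v t)) has_vector_derivative
      inner (p u t) (X * (tp a * p v t)) + inner (tp a * p u t) (X * p v t)) (at t)"
    by (rule bounded_bilinear.has_vector_derivative[OF bounded_bilinear_inner p'
          has_vector_derivative_mult_right[OF p']])
  also have "inner (p u t) (X * (tp a * p v t)) + inner (tp a * p u t) (X * p v t)
      = inner (p u t) ((a * X + X * tp a) * p v t)"
    by (simp add: inner_mult_left distrib_right inner_add_right mult.assoc)
  also have "a * X + X * tp a = - W" using eq by (simp add: add_eq_0_iff2 add_eq_0_iff)
  finally show "((\<lambda>t. inner (p u t) (X * p v t)) has_real_derivative - inner (p u t) (W * p v t)) (at t)"
    by (simp add: has_real_derivative_iff_has_vector_derivative)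
  obtain C c where c: "c > 0" "\<And>t. t \<ge> 0 \<Longrightarrow> norm (\<Phi> t) \<le> C * exp (- c * t)"
    using e by (auto simp: expdecay_def)
  have pn: "norm (p u t) \<le> C * exp (- c * t) * norm u" if "t \<ge> 0" for u t
  proof -
    have "norm (p u t) \<le> norm (tp (\<Phi> t)) * norm u" unfolding p_def by (rule norm_mult_ineq)
    also have "\<dots> \<le> C * exp (- c * t) * norm u" using c(2)[OF that] by (intro mult_right_mono) auto
    finally show ?thesis .
  qed
  show "((\<lambda>t. inner (p u t) (X * p v t)) \<longlongrightarrow> 0) at_top"
  proof (rule Lim_null_comparison)
    show "\<forall>\<^sub>F t in at_top. norm (inner (p u t) (X * p v t)) \<le>
        opn X * (C * exp (- c * t) * norm u) * (C * exp (- c * t) * norm v)"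
    proof (rule eventually_mono[OF eventually_ge_at_top[of 0]])
      fix t :: real assume t: "0 \<le> t"
      have "norm (inner (p u t) (X * p v t)) \<le> opn X * norm (p u t) * norm (p v t)"
        using abs_inner_opn by simp
      also have "\<dots> \<le> opn X * (C * exp (- c * t) * norm u) * (C * exp (- c * t) * norm v)"
        by (intro mult_mono mult_nonneg_nonneg pn t order_trans[OF norm_ge_zero pn[OF t]]) auto
      finally show "norm (inner (p u t) (X * p v t)) \<le>
        opn X * (C * exp (- c * t) * norm u) * (C * exp (- c * t) * norm v)" .
    qed
    have "((\<lambda>t. exp (- c * t)) \<longlongrightarrow> 0) at_top" using c(1) by real_asymp
    then have "((\<lambda>t. opn X * (C * exp (- c * t) * norm u) * (C * exp (- c * t) * norm v)) \<longlongrightarrow>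
        opn X * (C * 0 * norm u) * (C * 0 * norm v)) at_top"
      by (intro tendsto_intros)
    then show "((\<lambda>t. opn X * (C * exp (- c * t) * norm u) * (C * exp (- c * t) * norm v)) \<longlongrightarrow> 0) at_top"
      by simp
  qed
  have "inner (ide n * u) (X * (ide n * v)) = inner u (ide n * (X * v))"
    using X by (simp add: inner_mult_left cmD)
  then show "inner (p u 0) (X * p v 0) = inner u (X * v)"
    using e X by (simp add: p_def expdecay_def cmD)
qed

lemma nonneg_at_0_if_decreasing_to_0:
  fixes g :: "real \<Rightarrow> real"
  assumes "\<And>t. (g has_real_derivative g' t) (at t)" "\<And>t. g' t \<le> 0" "(g \<longlongrightarrow> 0) at_top"
  shows "0 \<le> g 0"
proof (rule tendsto_upperbound[OF assms(3)])
  show "\<forall>\<^sub>F t in at_top. g t \<le> g 0"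
  proof (rule eventually_mono[OF eventually_ge_at_top[of 0]])
    fix t :: real assume "0 \<le> t"
    then show "g t \<le> g 0"
      by (rule DERIV_nonpos_imp_nonincreasing) (use assms(1,2) in auto)
  qed
qed simp

lemma lyapunov_nonneg:
  assumes e: "expdecay n a \<Phi>" and eq: "a * X + X * tp a + W = 0" and X: "cm n n X"
    and W: "\<And>x. 0 \<le> inner x (W * x)"
  shows "0 \<le> inner x (X * x)"
  using nonneg_at_0_if_decreasing_to_0[OF expdecay_form(1)[OF e eq X, of x x] _ expdecay_form(2)[OF e eq X]]
    W expdecay_form(3)[OF e eq X] by simp

text \<open>\<open>K\<close> is the solution for the identity as source. Twice the bilinear form of
  \<open>W\<close> at \<open>u\<close>, \<open>v\<close> is at most \<open>opn W\<close> times the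
  sum of the squared norms; integrated along trajectories this becomes \<open>half\<close>. Two
  vectors are needed because \<open>X\<close> and \<open>W\<close> may be nonsymmetric, as for the
  cross blocks of the error Gramians.\<close>

lemma lyapunov_opn_le:
  assumes e: "expdecay n a \<Phi>" and K: "a * K + K * tp a + ide n = 0" "cm n n K"
    and eq: "a * X + X * tp a + W = 0" and X: "cm n n X"
  shows "opn X \<le> opn K * opn W"
proof -
  define p where "p = (\<lambda>u t. tp (\<Phi> t) * u)"
  have p: "p u t = tp (\<Phi> t) * u" for u t by (simp add: p_def)
  note fK = expdecay_form[OF e K, folded p] and fX = expdecay_form[OF e eq X, folded p]
  have idp: "ide n * p u t = p u t" for u t
  proof -
    have "cm n n (tp (\<Phi> t))" using e by (auto simp: expdecay_def)
    then show ?thesis by (simp add: p_def cmD)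
  qed
  have half: "2 * inner u (X * v) \<le> opn W * (inner u (K * u) + inner v (K * v))" for u v
  proof -
    define g where "g = (\<lambda>t. opn W * (inner (p u t) (K * p u t) + inner (p v t) (K * p v t))
      - 2 * inner (p u t) (X * p v t))"
    define g' where "g' = (\<lambda>t. opn W * (- inner (p u t) (ide n * p u t) + - inner (p v t) (ide n * p v t))
      - 2 * (- inner (p u t) (W * p v t)))"
    have "(g has_real_derivative g' t) (at t)" for t
      unfolding g_def g'_def by (intro DERIV_diff DERIV_cmult DERIV_add fK fX)
    moreover have "g' t \<le> 0" for t
    proof -
      have "2 * inner (p u t) (W * p v t) \<le> opn W * (2 * (norm (p u t) * norm (p v t)))"
        using abs_inner_opn[of "p u t" W "p v t"] by (simp add: mult.assoc)
      also have "\<dots> \<le> opn W * ((norm (p u t))\<^sup>2 + (norm (p v t))\<^sup>2)"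
        using sum_squares_bound[of "norm (p u t)" "norm (p v t)"]
        by (intro mult_left_mono) (simp_all add: mult.assoc)
      finally show ?thesis
        by (simp add: g'_def idp power2_norm_eq_inner algebra_simps)
    qed
    moreover have "(g \<longlongrightarrow> opn W * (0 + 0) - 2 * 0) at_top"
      unfolding g_def by (intro tendsto_intros fK fX)
    ultimately have "0 \<le> g 0" using nonneg_at_0_if_decreasing_to_0[of g g'] by simp
    then show ?thesis by (simp add: g_def fK fX)
  qed
  show ?thesis
  proof (rule opn_le_innerI)
    fix u v
    show "inner u (X * v) \<le> opn K * opn W * norm u * norm v"
    proof (cases "u = 0 \<or> v = 0")
      case False
      \<comment> \<open>For unit vectors the arithmetic mean in \<open>half\<close> is as good as
        the product of the norms.\<close>
      define u' v' where "u' = (1 / norm u) *\<^sub>R u" and "v' = (1 / norm v) *\<^sub>R v"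
      have n1: "norm u' = 1" "norm v' = 1" using False by (auto simp: u'_def v'_def)
      have "inner x (K * x) \<le> opn K" if "norm x = 1" for x
        using abs_inner_opn[of x K x] that by simp
      then have "inner u' (K * u') + inner v' (K * v') \<le> 2 * opn K" using n1 by (smt (verit))
      then have "opn W * (inner u' (K * u') + inner v' (K * v')) \<le> opn W * (2 * opn K)"
        by (intro mult_left_mono) auto
      also have "opn W * (2 * opn K) = 2 * (opn K * opn W)" by simp
      finally have "inner u' (X * v') \<le> opn K * opn W" using half[of u' v'] by linarith
      then show ?thesis using False by (simp add: u'_def v'_def field_simps)
    qed auto
  qed simp
qed

text \<open>Adding the dominating exponential \<open>e\<close> makes the integrand nonnegative. Its
  integrals over \<open>{0..y}\<close> are then increasing and bounded, so the improper integral is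
  their limit; that of \<open>e\<close> is subtracted again.\<close>

lemma decaying_integral:
  fixes f :: "real \<Rightarrow> real"
  assumes cont: "continuous_on UNIV f" and c: "c > 0" and bd: "\<And>t. t \<ge> 0 \<Longrightarrow> \<bar>f t\<bar> \<le> C * exp (- c * t)"
  shows "\<exists>l. (f has_integral l) {0..} \<and> ((\<lambda>y. integral {0..y} f) \<longlongrightarrow> l) at_top"
proof -
  define e where "e = (\<lambda>t. C * exp (- c * t))"
  define g where "g = (\<lambda>t. f t + e t)"
  have ie: "(e has_integral (C / c - C * exp (- c * y) / c)) {0..y}" if "y \<ge> 0" for y
  proof -
    have "(e has_integral (- C * exp (- c * y) / c - (- C * exp (- c * 0) / c))) {0..y}"
      unfolding e_def using that c
      by (intro fundamental_theorem_of_calculus)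
         (auto intro!: derivative_eq_intros simp flip: has_real_derivative_iff_has_vector_derivative)
    then show ?thesis by simp
  qed
  have conte: "continuous_on UNIV e" unfolding e_def by (intro continuous_intros)
  have int: "f integrable_on {0..y}" "e integrable_on {0..y}" "g integrable_on {0..y}" for y
    unfolding g_def
    by (intro integrable_continuous_interval continuous_on_add continuous_on_subset[OF cont]
        continuous_on_subset[OF conte]; simp)+
  have C: "C \<ge> 0" using bd[of 0] by auto
  have lime: "((\<lambda>y. integral {0..y} e) \<longlongrightarrow> C / c) at_top"
  proof -
    have "((\<lambda>y. C / c - C * exp (- c * y) / c) \<longlongrightarrow> C / c) at_top"
      using c by real_asymp
    moreover have "\<forall>\<^sub>F y in at_top. C / c - C * exp (- c * y) / c = integral {0..y} e"
      by (rule eventually_mono[OF eventually_ge_at_top[of 0]]) (simp add: integral_unique[OF ie])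
    ultimately show ?thesis by (rule Lim_transform_eventually)
  qed
  have g0: "0 \<le> g t" and g2: "g t \<le> 2 * e t" if "t \<ge> 0" for t
    using bd[OF that] by (auto simp: g_def e_def abs_le_iff)
  define G where "G = (\<lambda>y. integral {0..y} g)"
  have mono: "G x \<le> G y" if "x \<le> y" for x y
    unfolding G_def by (rule integral_subset_le) (use that int g0 in auto)
  have bdG: "G y \<le> 2 * (C / c)" for y
  proof (cases "y \<ge> 0")
    case True
    have "G y \<le> integral {0..y} (\<lambda>t. 2 * e t)"
      unfolding G_def by (rule integral_le) (use int g2 in auto)
    also have "\<dots> = 2 * (C / c - C * exp (- c * y) / c)"
      using ie[OF True] by (simp add: integral_unique)
    also have "\<dots> \<le> 2 * (C / c)" using C c by simp
    finally show ?thesis .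
  qed (use C c in \<open>simp add: G_def\<close>)
  define l where "l = Sup (range G)"
  have bdd: "bdd_above (range G)" using bdG by (intro bdd_aboveI[of _ "2 * (C / c)"]) blast
  have limG: "(G \<longlongrightarrow> l) at_top"
  proof (rule order_tendstoI)
    fix a assume "a < l"
    then obtain x where "a < G x" unfolding l_def using less_cSup_iff[OF _ bdd] by auto
    then show "\<forall>\<^sub>F y in at_top. a < G y"
      by (intro eventually_mono[OF eventually_ge_at_top[of x]]) (use mono in \<open>force\<close>)
  next
    fix a assume "l < a"
    moreover have "G y \<le> l" for y unfolding l_def by (rule cSup_upper[OF _ bdd]) simp
    ultimately show "\<forall>\<^sub>F y in at_top. G y < a" by (auto intro: always_eventually le_less_trans)
  qed
  have "(g has_integral l) {0..}"
    by (rule has_integral_to_inf) (use int limG g0 in \<open>auto simp: G_def\<close>)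
  moreover have "(e has_integral C / c) {0..}"
    by (rule has_integral_to_inf) (use int lime C in \<open>auto simp: e_def\<close>)
  ultimately have "((\<lambda>t. g t - e t) has_integral (l - C / c)) {0..}"
    by (rule has_integral_diff)
  moreover have "(\<lambda>t. g t - e t) = f" by (simp add: g_def)
  ultimately have 1: "(f has_integral (l - C / c)) {0..}" by simp
  have "G y - integral {0..y} e = integral {0..y} f" for y
    unfolding G_def g_def using int by (simp add: integral_add)
  moreover have "((\<lambda>y. G y - integral {0..y} e) \<longlongrightarrow> l - C / c) at_top"
    by (intro tendsto_diff limG lime)
  ultimately have "((\<lambda>y. integral {0..y} f) \<longlongrightarrow> l - C / c) at_top" by simp
  with 1 show ?thesis by blast
qed

text \<open>The solution is the integral of \<open>\<Phi> t * w * tp (\<Phi> t)\<close>, formed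
  entry by entry. The integral formula is part of the claim because \<open>K1\<close> and
  \<open>K2\<close> are defined by such integrals.\<close>

lemma lyapunov_solution:
  assumes e: "expdecay n a \<Phi>" and w: "cm n n w"
  shows "\<exists>X. cm n n X \<and> a * X + X * tp a + w = 0 \<and>
    (\<forall>i j. ((\<lambda>t. ent (\<Phi> t * w * tp (\<Phi> t)) i j) has_integral ent X i j) {0..})"
proof -
  define f where "f = (\<lambda>t. \<Phi> t * w * tp (\<Phi> t))"
  have a: "cm n n a" and cm\<Phi>: "cm n n (\<Phi> t)" and d\<Phi>: "(\<Phi> has_vector_derivative \<Phi> t * a) (at t)"
    and com: "\<Phi> t * a = a * \<Phi> t" for t
    using e by (auto simp: expdecay_def)
  have cmf: "cm n n (f t)" for t unfolding f_def using w cm\<Phi> by auto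
  obtain C c where c: "c > 0" and C: "\<And>t. t \<ge> 0 \<Longrightarrow> norm (\<Phi> t) \<le> C * exp (- c * t)"
    using e by (auto simp: expdecay_def)
  have f': "(f has_vector_derivative a * f t + f t * tp a) (at t)" for t
  proof -
    have "(f has_vector_derivative \<Phi> t * w * tp (\<Phi> t * a) + (\<Phi> t * a * w) * tp (\<Phi> t)) (at t)"
      unfolding f_def
      by (intro has_vector_derivative_mult has_vector_derivative_mult_left d\<Phi>
          bounded_linear.has_vector_derivative[OF bounded_linear_tp])
    also have "\<Phi> t * w * tp (\<Phi> t * a) + (\<Phi> t * a * w) * tp (\<Phi> t) = a * f t + f t * tp a"
      by (simp only: com tp_mult) (simp add: f_def com mult.assoc flip: tp_mult)
    finally show ?thesis .
  qed
  have fn: "norm (f t) \<le> C\<^sup>2 * norm w * exp (- (2 * c) * t)" if "t \<ge> 0" for t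
  proof -
    have "norm (f t) \<le> norm (\<Phi> t * w) * norm (tp (\<Phi> t))" unfolding f_def by (rule norm_mult_ineq)
    also have "\<dots> \<le> (norm (\<Phi> t) * norm w) * norm (\<Phi> t)"
      by (simp add: norm_mult_ineq mult_right_mono)
    also have "\<dots> = norm w * (norm (\<Phi> t))\<^sup>2" by (simp add: power2_eq_square)
    also have "\<dots> \<le> norm w * (C * exp (- c * t))\<^sup>2"
      by (intro mult_left_mono power_mono C that) auto
    also have "\<dots> = C\<^sup>2 * norm w * exp (- (2 * c) * t)"
      by (simp add: power_mult_distrib flip: exp_double)
    finally show ?thesis .
  qed
  have contf: "continuous_on UNIV f"
    by (intro continuous_at_imp_continuous_on ballI)
       (rule has_vector_derivative_continuous, rule f')
  have cont_ent: "continuous_on UNIV (\<lambda>t. ent (h t) i j)" if "continuous_on UNIV h" for h :: "real \<Rightarrow> fmat" and i j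
    by (rule bounded_linear.continuous_on[OF bounded_linear_ent that])
  have "\<forall>i j. \<exists>l. ((\<lambda>t. ent (f t) i j) has_integral l) {0..}"
  proof (intro allI)
    fix i j
    have "\<exists>l. ((\<lambda>t. ent (f t) i j) has_integral l) {0..} \<and>
        ((\<lambda>y. integral {0..y} (\<lambda>t. ent (f t) i j)) \<longlongrightarrow> l) at_top"
      by (rule decaying_integral[OF cont_ent[OF contf], of "2 * c" _ _ "C\<^sup>2 * norm w"])
         (use c order_trans[OF abs_ent_le_norm fn] in auto)
    then show "\<exists>l. ((\<lambda>t. ent (f t) i j) has_integral l) {0..}" by blast
  qed
  then obtain x where x: "\<And>i j. ((\<lambda>t. ent (f t) i j) has_integral x i j) {0..}" by metis
  have x0: "x i j = 0" if "n \<le> i \<or> n \<le> j" for i j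
  proof -
    have "ent (f t) i j = 0" for t using cmf[of t] that by (auto simp: cm_iff)
    then have "((\<lambda>t. 0) has_integral x i j) {0..}" using x[of i j] by simp
    then show ?thesis by (metis has_integral_0 has_integral_unique)
  qed
  define X where "X = Abs_fmat x"
  have entX: "ent X = x" unfolding X_def using x0 by (intro Abs_fmat_inverse) blast
  have cmX: "cm n n X" using x0 by (auto simp: cm_iff entX)
  have "ent (a * X + X * tp a) i j = ent (- w) i j" for i j
  proof -
    \<comment> \<open>\<open>F\<close> is an entry of the derivative of \<open>f\<close>. Its
      integral is evaluated twice: by linearity from the integrals \<open>x\<close>, and as the
      limit of \<open>f y - f 0\<close>, where \<open>f 0 = w\<close>.\<close>
    define F where "F = (\<lambda>t. ent (a * f t + f t * tp a) i j)"
    have F_sum: "F t = (\<Sum>l<n. ent a i l * ent (f t) l j) + (\<Sum>l<n. ent (f t) i l * ent (tp a) l j)" for t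
      unfolding F_def using a cmf[of t] by (auto simp: ent_times[of n] cm_iff)
    have "(F has_integral ((\<Sum>l<n. ent a i l * x l j) + (\<Sum>l<n. x i l * ent (tp a) l j))) {0..}"
      unfolding F_sum by (intro has_integral_add has_integral_sum has_integral_mult_right
          has_integral_mult_left x) auto
    also have "(\<Sum>l<n. ent a i l * x l j) + (\<Sum>l<n. x i l * ent (tp a) l j) = ent (a * X + X * tp a) i j"
      using a cmX by (auto simp: ent_times[of n] cm_iff entX)
    finally have F1: "(F has_integral ent (a * X + X * tp a) i j) {0..}" .
    have contF: "continuous_on UNIV F"
      unfolding F_def by (intro cont_ent continuous_intros contf)
    have bF: "\<bar>F t\<bar> \<le> (2 * norm a * (C\<^sup>2 * norm w)) * exp (- (2 * c) * t)" if "t \<ge> 0" for t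
    proof -
      have "\<bar>F t\<bar> \<le> norm (a * f t + f t * tp a)" unfolding F_def by (rule abs_ent_le_norm)
      also have "\<dots> \<le> norm a * norm (f t) + norm (f t) * norm (tp a)"
        by (intro norm_triangle_mono norm_mult_ineq)
      also have "\<dots> = 2 * norm a * norm (f t)" by simp
      also have "\<dots> \<le> 2 * norm a * (C\<^sup>2 * norm w * exp (- (2 * c) * t))"
        by (intro mult_left_mono fn that) auto
      finally show ?thesis by (simp add: mult_ac)
    qed
    have c2: "2 * c > 0" using c by simp
    have "\<exists>l. (F has_integral l) {0..} \<and> ((\<lambda>y. integral {0..y} F) \<longlongrightarrow> l) at_top"
      by (rule decaying_integral[OF contF c2 bF])
    then obtain l where
      l: "(F has_integral l) {0..} \<and> ((\<lambda>y. integral {0..y} F) \<longlongrightarrow> l) at_top" ..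
    have "(F has_integral (ent (f y) i j - ent (f 0) i j)) {0..y}" if "y \<ge> 0" for y
      unfolding F_def
      by (rule fundamental_theorem_of_calculus[OF that])
         (rule has_vector_derivative_at_within,
          rule bounded_linear.has_vector_derivative[OF bounded_linear_ent f'])
    then have ev: "\<forall>\<^sub>F y in at_top. integral {0..y} F = ent (f y) i j - ent (f 0) i j"
      by (intro eventually_mono[OF eventually_ge_at_top[of 0]]) (auto simp: integral_unique)
    have "((\<lambda>y. ent (f y) i j) \<longlongrightarrow> 0) at_top"
    proof (rule Lim_null_comparison)
      show "\<forall>\<^sub>F y in at_top. norm (ent (f y) i j) \<le> C\<^sup>2 * norm w * exp (- (2 * c) * y)"
        by (intro eventually_mono[OF eventually_ge_at_top[of 0]])
           (use order_trans[OF abs_ent_le_norm fn] in auto)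
      show "((\<lambda>y. C\<^sup>2 * norm w * exp (- (2 * c) * y)) \<longlongrightarrow> 0) at_top" using c by real_asymp
    qed
    then have "((\<lambda>y. ent (f y) i j - ent (f 0) i j) \<longlongrightarrow> 0 - ent (f 0) i j) at_top"
      by (intro tendsto_intros)
    then have "((\<lambda>y. integral {0..y} F) \<longlongrightarrow> 0 - ent (f 0) i j) at_top"
      by (rule Lim_transform_eventually) (use ev in \<open>auto elim: eventually_mono\<close>)
    then have "l = - ent (f 0) i j" using tendsto_unique[OF _ conjunct2[OF l]] by simp
    moreover have "f 0 = w" using e w by (simp add: f_def expdecay_def cmD)
    moreover have "l = ent (a * X + X * tp a) i j" using conjunct1[OF l] F1 by (rule has_integral_unique)
    ultimately show ?thesis by simp
  qed
  then have "a * X + X * tp a = - w" by (rule fmat_eqI)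
  then show ?thesis using cmX x entX by (intro exI[of _ X]) (auto simp: f_def)
qed

lemma lyapunov_unique:
  assumes e: "expdecay n a \<Phi>"
    and "a * X + X * tp a + w = 0" "cm n n X" "a * Y + Y * tp a + w = 0" "cm n n Y"
  shows "X = Y"
proof -
  obtain K where K: "cm n n K" "a * K + K * tp a + ide n = 0"
    using lyapunov_solution[OF e cm_ide] by blast
  have "a * (X - Y) + (X - Y) * tp a + 0 = (a * X + X * tp a + w) - (a * Y + Y * tp a + w)"
    by (simp add: algebra_simps)
  also have "\<dots> = 0" by (simp add: assms)
  finally have "opn (X - Y) \<le> opn K * opn 0"
    using lyapunov_opn_le[OF e K(2,1)] assms by blast
  then have "opn (X - Y) \<le> 0" by simp
  moreover have "X - Y = (X - Y) * ide n" using assms by (simp add: cmD left_diff_distrib)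
  ultimately have "norm (X - Y) \<le> 0"
    using norm_mult_opn[of "X - Y" "ide n"] 
    by (metis mult_nonneg_nonneg mult_nonpos_nonneg norm_ge_zero order_trans)
  then show ?thesis by simp
qed

section \<open>Stability and Lyapunov functions\<close>

lemma eigenvalue_cmat_pair:
  assumes A: "A \<in> carrier_mat n n" and l: "eigenvalue (cmat A) l"
  obtains x y where "cm n 1 x" "cm n 1 y" "x \<noteq> 0 \<or> y \<noteq> 0"
    "em A * x = Re l *\<^sub>R x - Im l *\<^sub>R y" "em A * y = Im l *\<^sub>R x + Re l *\<^sub>R y"
proof -
  obtain v where v: "v \<in> carrier_vec n" "v \<noteq> 0\<^sub>v n" "cmat A *\<^sub>v v = l \<cdot>\<^sub>v v"
    using l A unfolding eigenvalue_def eigenvector_def by auto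
  define vx vy where "vx = map_vec Re v" and "vy = map_vec Im v"
  have vc: "vx \<in> carrier_vec n" "vy \<in> carrier_vec n" using v by (auto simp: vx_def vy_def)
  have row: "(\<Sum>j<n. complex_of_real (A $$ (i, j)) * v $ j) = l * v $ i" if "i < n" for i
    using arg_cong[OF v(3), of "\<lambda>w. w $ i"] that A v(1)
    by (simp add: scalar_prod_def atLeast0LessThan)
  have "em A * ev vx = Re l *\<^sub>R ev vx - Im l *\<^sub>R ev vy"
  proof (rule fmat_eqI)
    fix i j
    have "(A *\<^sub>v vx) $ i = Re l * Re (v $ i) - Im l * Im (v $ i)" if "i < n"
      using arg_cong[OF row[OF that], of Re] that A v(1)
      by (simp add: scalar_prod_def atLeast0LessThan vx_def)
    then show "ent (em A * ev vx) i j = ent (Re l *\<^sub>R ev vx - Im l *\<^sub>R ev vy) i j"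
      using A vc v(1) by (subst ev_mult[symmetric]) (auto simp: ent_ev vx_def vy_def)
  qed
  moreover have "em A * ev vy = Im l *\<^sub>R ev vx + Re l *\<^sub>R ev vy"
  proof (rule fmat_eqI)
    fix i j
    have "(A *\<^sub>v vy) $ i = Im l * Re (v $ i) + Re l * Im (v $ i)" if "i < n"
      using arg_cong[OF row[OF that], of Im] that A v(1)
      by (simp add: scalar_prod_def atLeast0LessThan vy_def)
    then show "ent (em A * ev vy) i j = ent (Im l *\<^sub>R ev vx + Re l *\<^sub>R ev vy) i j"
      using A vc v(1) by (subst ev_mult[symmetric]) (auto simp: ent_ev vx_def vy_def)
  qed
  moreover have "ev vx \<noteq> 0 \<or> ev vy \<noteq> 0"
  proof (rule ccontr)
    assume "\<not> ?thesis"
    then have 0: "ev vx = 0" "ev vy = 0" by auto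
    have "v $ i = 0" if "i < n" for i
    proof (rule complex_eqI)
      have "Re (v $ i) = ent (ev vx) i 0" "Im (v $ i) = ent (ev vy) i 0"
        using that v(1) by (auto simp: ent_ev vx_def vy_def)
      then show "Re (v $ i) = Re 0" "Im (v $ i) = Im 0" by (simp_all add: 0)
    qed
    then show False using v by auto
  qed
  ultimately show thesis using that cm_ev[OF vc(1)] cm_ev[OF vc(2)] by blast
qed

text \<open>For a complex eigenvector the contributions of its real part \<open>x\<close> and
  imaginary part \<open>y\<close> are added; the terms with \<open>Im l\<close> cancel by symmetry
  of \<open>L\<close>, and \<open>Re l\<close> times a nonnegative number remains.\<close>

lemma stable_matI:
  assumes A: "A \<in> carrier_mat n n" and L: "tp L = L"
    and neg: "\<And>x. cm n 1 x \<Longrightarrow> x \<noteq> 0 \<Longrightarrow> inner x (L * (em A * x)) < 0"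
    and nonneg: "\<And>x. cm n 1 x \<Longrightarrow> 0 \<le> inner x (L * x)"
  shows "stable_mat A"
  unfolding stable_mat_def
proof (intro allI impI)
  fix l assume "eigenvalue (cmat A) l"
  then obtain x y where xy: "cm n 1 x" "cm n 1 y" "x \<noteq> 0 \<or> y \<noteq> 0"
    "em A * x = Re l *\<^sub>R x - Im l *\<^sub>R y" "em A * y = Im l *\<^sub>R x + Re l *\<^sub>R y"
    by (rule eigenvalue_cmat_pair[OF A])
  have le: "inner z (L * (em A * z)) \<le> 0" if "cm n 1 z" for z
    using neg[OF that] by (cases "z = 0") auto
  have sym: "inner y (L * x) = inner x (L * y)"
    by (metis L inner_commute inner_mult_left)
  have "inner x (L * (em A * x)) + inner y (L * (em A * y)) < 0"
    using xy(3) neg[OF xy(1)] neg[OF xy(2)] le[OF xy(1)] le[OF xy(2)] by fastforce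
  also have "inner x (L * (em A * x)) + inner y (L * (em A * y)) =
      Re l * (inner x (L * x) + inner y (L * y))"
    unfolding xy(4,5) by (simp add: inner_diff_right inner_add_right distrib_left right_diff_distrib sym algebra_simps)
  finally show "Re l < 0"
    using nonneg[OF xy(1)] nonneg[OF xy(2)] by (simp add: mult_less_0_iff)
qed

text \<open>An explicit Euler step maps the open left half plane, for small \<open>h\<close>, into
  the unit disc. This reduces stability of a differential equation to decay of matrix powers, which
  the spectral radius controls. The choice of \<open>h\<close> makes h^2 |l|^2 smaller than -2 h Re
  l.\<close>

lemma contractive_step:
  fixes S :: "complex set"
  assumes fin: "finite S" and neg: "\<And>l. l \<in> S \<Longrightarrow> Re l < 0"
  obtains h \<theta> where "0 < h" "0 < \<theta>" "\<theta> < 1" "\<And>l. l \<in> S \<Longrightarrow> norm (1 + of_real h * l) < \<theta>"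
proof -
  define h where "h = Min (insert 1 ((\<lambda>l. - Re l / ((norm l)\<^sup>2 + 1)) ` S))"
  have h: "0 < h" unfolding h_def using fin neg by (subst Min_gr_iff) (auto intro!: divide_neg_pos add_nonneg_pos)
  have lt1: "norm (1 + of_real h * l) < 1" if "l \<in> S" for l
  proof -
    have "h \<le> - Re l / ((norm l)\<^sup>2 + 1)" unfolding h_def using fin that by (intro Min_le) auto
    moreover have "(norm l)\<^sup>2 + 1 > 0" by (simp add: add_nonneg_pos)
    ultimately have "h * ((norm l)\<^sup>2 + 1) \<le> - Re l" by (simp only: pos_le_divide_eq)
    then have "h * (norm l)\<^sup>2 < - 2 * Re l" using neg[OF that] h by (simp add: distrib_left)
    then have "h * (h * (norm l)\<^sup>2) < h * (- 2 * Re l)" using h by (rule mult_strict_left_mono)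
    moreover have "(norm (1 + of_real h * l))\<^sup>2 = 1 + 2 * (h * Re l) + h * (h * (norm l)\<^sup>2)"
      unfolding cmod_power2 by (simp add: power2_eq_square algebra_simps)
    ultimately have "(norm (1 + of_real h * l))\<^sup>2 < 1" by (simp add: algebra_simps)
    then show ?thesis by (simp add: power_less_one_iff abs_square_less_1)
  qed
  define \<theta>0 where "\<theta>0 = Max (insert 0 ((\<lambda>l. norm (1 + of_real h * l)) ` S))"
  have "\<theta>0 < 1" unfolding \<theta>0_def using fin lt1 by (subst Max_less_iff) auto
  moreover have "0 \<le> \<theta>0" unfolding \<theta>0_def using fin by (intro Max_ge) auto
  moreover have "norm (1 + of_real h * l) \<le> \<theta>0" if "l \<in> S" for l
    unfolding \<theta>0_def using fin that by (intro Max_ge) auto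
  ultimately show thesis
    using h by (intro that[of h "(\<theta>0 + 1) / 2"]) (force simp: field_simps)+
qed

lemma stable_mat_powers:
  assumes A: "A \<in> carrier_mat n n" and st: "stable_mat A" and n: "n > 0"
  obtains h F where "0 < h" "F 0 = ide n" "\<And>k. F (Suc k) = F k * (ide n + h *\<^sub>R em A)"
    "(\<lambda>k. norm (F k)) \<longlonglongrightarrow> 0"
proof -
  have Ac: "cmat A \<in> carrier_mat n n" using A by simp
  obtain h \<theta> where h: "0 < h" and \<theta>: "0 < \<theta>" "\<theta> < 1"
    and lt: "\<And>l. l \<in> spectrum (cmat A) \<Longrightarrow> norm (1 + of_real h * l) < \<theta>"
    by (rule contractive_step[OF card_finite_spectrum(1)[OF Ac]])
       (use st in \<open>auto simp: stable_mat_def spectrum_def\<close>)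
  \<comment> \<open>A spectral radius below 1 yields only that the powers of \<open>M\<close> are
    bounded. Dividing by \<theta> beforehand leaves the factor \<open>\<theta> ^ k\<close>, which
    makes the powers of the Euler step tend to 0.\<close>
  define M where "M = (1 / \<theta>) \<cdot>\<^sub>m (1\<^sub>m n + h \<cdot>\<^sub>m A)"
  have M: "M \<in> carrier_mat n n" "cmat M \<in> carrier_mat n n" using A by (auto simp: M_def)
  have ev: "norm \<mu> < 1" if \<mu>: "\<mu> \<in> spectrum (cmat M)" for \<mu>
  proof -
    obtain v where v: "v \<in> carrier_vec n" "v \<noteq> 0\<^sub>v n" "cmat M *\<^sub>v v = \<mu> \<cdot>\<^sub>v v"
      using \<mu> M unfolding spectrum_def eigenvalue_def eigenvector_def by auto
    define l where "l = (of_real \<theta> * \<mu> - 1) / of_real h"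
    have "cmat A *\<^sub>v v = l \<cdot>\<^sub>v v"
    proof (rule eq_vecI)
      fix i assume "i < dim_vec (l \<cdot>\<^sub>v v)"
      then have i: "i < n" using v by simp
      have "\<mu> * v $ i = (\<Sum>j<n. complex_of_real (M $$ (i, j)) * v $ j)"
        using arg_cong[OF v(3), of "\<lambda>w. w $ i"] i M(1) v(1)
        by (simp add: scalar_prod_def atLeast0LessThan)
      also have "\<dots> = (\<Sum>j<n. (1 / of_real \<theta>) * ((if i = j then v $ j else 0) + of_real h * (of_real (A $$ (i, j)) * v $ j)))"
        using i A by (intro sum.cong) (auto simp: M_def algebra_simps)
      also have "\<dots> = (1 / of_real \<theta>) * ((\<Sum>j<n. if i = j then v $ j else 0) + of_real h * (\<Sum>j<n. of_real (A $$ (i, j)) * v $ j))"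
        by (simp only: sum_distrib_left sum.distrib[symmetric])
      also have "(\<Sum>j<n. if i = j then v $ j else 0) = v $ i" using i by (simp add: sum.delta')
      also have "(\<Sum>j<n. of_real (A $$ (i, j)) * v $ j) = (cmat A *\<^sub>v v) $ i"
        using i A v(1) by (simp add: scalar_prod_def atLeast0LessThan)
      finally show "(cmat A *\<^sub>v v) $ i = (l \<cdot>\<^sub>v v) $ i"
        using i v(1) h \<theta> by (simp add: l_def field_simps)
    qed (use A v in auto)
    then have "l \<in> spectrum (cmat A)"
      using v A unfolding spectrum_def eigenvalue_def eigenvector_def by auto
    from lt[OF this] have "norm (of_real \<theta> * \<mu>) < \<theta>" using h by (simp add: l_def)
    then show ?thesis using \<theta> by (simp add: norm_mult)
  qed
  have "spectral_radius (cmat M) < 1"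
    using spectral_radius_mem_max(1)[OF M(2) n] ev by auto
  then obtain c where c: "\<And>k. norm_bound (cmat M ^\<^sub>m k) c"
    using spectral_radius_jnf_norm_bound_less_1_upper_triangular[OF M(2)] by blast
  have bd: "norm (em (M ^\<^sub>m k)) \<le> sqrt (n * (n * c\<^sup>2))" for k
  proof -
    have Mk: "M ^\<^sub>m k \<in> carrier_mat n n" using M by simp
    have entb: "(ent (em (M ^\<^sub>m k)) i j)\<^sup>2 \<le> c\<^sup>2" if "i < n" "j < n" for i j
    proof -
      have "cmat (M ^\<^sub>m k) = cmat M ^\<^sub>m k" by (rule of_real_hom.mat_hom_pow[OF M(1)])
      moreover have "dim_row (cmat M ^\<^sub>m k) = n" "dim_col (cmat M ^\<^sub>m k) = n"
        using pow_carrier_mat[OF M(2), of k] by blast+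
      ultimately have "norm (cmat (M ^\<^sub>m k) $$ (i, j)) \<le> c"
        using c[of k, unfolded norm_bound_def, rule_format, of i j] that by (simp only:)
      moreover have "cmat (M ^\<^sub>m k) $$ (i, j) = of_real ((M ^\<^sub>m k) $$ (i, j))"
        by (rule index_map_mat(1)) (use that carrier_matD[OF Mk] in simp_all)
      ultimately have "\<bar>(M ^\<^sub>m k) $$ (i, j)\<bar> \<le> c" by (simp only: norm_of_real)
      then show ?thesis using that Mk by (auto simp: ent_em abs_le_square_iff[symmetric])
    qed
    have "fbound (em (M ^\<^sub>m k)) n" using cm_em[OF Mk] by (auto simp: cm_iff fbound_def)
    then have "(norm (em (M ^\<^sub>m k)))\<^sup>2 = (\<Sum>i<n. \<Sum>j<n. (ent (em (M ^\<^sub>m k)) i j)\<^sup>2)"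
      unfolding power2_norm_eq_inner by (simp add: inner_fbound power2_eq_square)
    also have "\<dots> \<le> (\<Sum>i<n. \<Sum>j<n. c\<^sup>2)" by (intro sum_mono entb) auto
    finally have "(norm (em (M ^\<^sub>m k)))\<^sup>2 \<le> n * (n * c\<^sup>2)" by simp
    then show ?thesis by (rule real_le_rsqrt)
  qed
  define F where "F = (\<lambda>k. \<theta> ^ k *\<^sub>R em (M ^\<^sub>m k))"
  have eM: "\<theta> *\<^sub>R em M = ide n + h *\<^sub>R em A"
    using A \<theta> by (simp add: M_def em_smult em_add)
  show thesis
  proof (rule that[of h F])
    show "F 0 = ide n" using M(1) by (simp add: F_def)
    show "F (Suc k) = F k * (ide n + h *\<^sub>R em A)" for k
      unfolding eM[symmetric] by (simp add: F_def em_pow_Suc[OF M(1)] mult_ac del: pow_mat.simps)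
    show "(\<lambda>k. norm (F k)) \<longlonglongrightarrow> 0"
    proof (rule Lim_null_comparison)
      show "\<forall>\<^sub>F k in sequentially. norm (norm (F k)) \<le> \<theta> ^ k * sqrt (n * (n * c\<^sup>2))"
        using bd \<theta> by (intro always_eventually allI) (simp add: F_def mult_left_mono)
      have "(\<lambda>k. \<theta> ^ k * sqrt (n * (n * c\<^sup>2))) \<longlonglongrightarrow> 0 * sqrt (n * (n * c\<^sup>2))"
        by (intro tendsto_mult LIMSEQ_power_zero tendsto_const) (use \<theta> in auto)
      then show "(\<lambda>k. \<theta> ^ k * sqrt (n * (n * c\<^sup>2))) \<longlonglongrightarrow> 0" by simp
    qed
  qed (rule h)
qed

text \<open>\<open>L\<close> is a partial sum of the discrete Lyapunov series of the Euler step, cut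
  where the next power has norm below 1/2. The sum telescopes: one step lowers the form by at least
  3/4 of the squared norm, and dropping the nonnegative term in h^2 gives the decay rate in
  continuous time.\<close>

lemma stable_mat_lyapunov_function:
  assumes A: "A \<in> carrier_mat n n" and st: "stable_mat A"
  obtains L c where "tp L = L" "0 < c" "\<And>x. ide n * x = x \<Longrightarrow> (norm x)\<^sup>2 \<le> inner x (L * x)"
    "\<And>x. ide n * x = x \<Longrightarrow> inner x (L * (em A * x)) \<le> - c * (norm x)\<^sup>2"
proof (cases "n = 0")
  case True
  have "ide 0 * x = 0" for x by (rule fmat_eqI) (simp add: ent_ide_mult)
  then show thesis using True by (intro that[of 0 1]) auto
next
  case False
  obtain h F where h: "0 < h" and F: "F 0 = ide n" "\<And>k. F (Suc k) = F k * (ide n + h *\<^sub>R em A)"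
    and lim: "(\<lambda>k. norm (F k)) \<longlonglongrightarrow> 0"
    using stable_mat_powers[OF A st] False by auto
  have "\<forall>\<^sub>F k in sequentially. norm (F k) < 1 / 2"
    using order_tendstoD(2)[OF lim, of "1/2"] by simp
  then obtain K where K: "norm (F (Suc K)) < 1 / 2"
    unfolding eventually_sequentially by (meson le_SucI order_refl)
  define L where "L = (\<Sum>k\<le>K. tp (F k) * F k)"
  have tL: "tp L = L" by (simp add: L_def tp_sum)
  have form: "inner x (L * x) = (\<Sum>k\<le>K. (norm (F k * x))\<^sup>2)" for x
    by (simp add: L_def sum_distrib_right inner_sum_right power2_norm_eq_inner inner_mult_left mult.assoc)
  have low: "(norm x)\<^sup>2 \<le> inner x (L * x)" if x: "ide n * x = x" for x
  proof -
    have "(norm (F 0 * x))\<^sup>2 \<le> (\<Sum>k\<le>K. (norm (F k * x))\<^sup>2)" by (rule member_le_sum) auto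
    then show ?thesis using x by (simp add: form F)
  qed
  have neg: "inner x (L * (em A * x)) \<le> - (1 / (4 * h)) * (norm x)\<^sup>2" if x: "ide n * x = x" for x
  proof -
    define y where "y = x + h *\<^sub>R (em A * x)"
    have Fy: "F k * y = F (Suc k) * x" for k
      using x by (simp add: F(2) y_def mult.assoc distrib_left distrib_right flip: mult.assoc)
        (metis x mult.assoc)
    have "inner y (L * y) = (\<Sum>k\<le>K. (norm (F (Suc k) * x))\<^sup>2)" by (simp add: form Fy)
    then have "(norm (F 0 * x))\<^sup>2 + inner y (L * y) = (\<Sum>k\<le>Suc K. (norm (F k * x))\<^sup>2)"
      by (simp only: sum.atMost_Suc_shift)
    also have "\<dots> = inner x (L * x) + (norm (F (Suc K) * x))\<^sup>2" by (simp add: form)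
    finally have "(norm x)\<^sup>2 + inner y (L * y) = inner x (L * x) + (norm (F (Suc K) * x))\<^sup>2"
      using x by (simp add: F(1))
    moreover have "(norm (F (Suc K) * x))\<^sup>2 \<le> (1 / 2 * norm x)\<^sup>2"
      using K by (intro power_mono order_trans[OF norm_mult_ineq] mult_right_mono) auto
    moreover have "inner y (L * y) = inner x (L * x) + 2 * h * inner x (L * (em A * x))
        + h * h * inner (em A * x) (L * (em A * x))"
    proof -
      have "inner (em A * x) (L * x) = inner x (L * (em A * x))"
        by (metis tL inner_commute inner_mult_left)
      then show ?thesis
        by (simp add: y_def distrib_left inner_add_left inner_add_right algebra_simps)
    qed
    moreover have "0 \<le> h * h * inner (em A * x) (L * (em A * x))"
      using h by (simp add: form sum_nonneg)
    ultimately have "2 * h * inner x (L * (em A * x)) \<le> - (3 / 4) * (norm x)\<^sup>2"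
      by (simp add: power2_eq_square)
    also have "\<dots> \<le> - (1 / 2) * (norm x)\<^sup>2" by simp
    finally show ?thesis using h by (simp add: field_simps)
  qed
  show thesis using that[OF tL _ low neg] h by simp
qed

lemma stable_mat_expdecay:
  assumes A: "A \<in> carrier_mat n n" and st: "stable_mat A"
  shows "expdecay n (em A) (\<lambda>t. em (mat_exp (t \<cdot>\<^sub>m A)))"
proof -
  define \<Phi> where "\<Phi> = (\<lambda>t. em (mat_exp (t \<cdot>\<^sub>m A)))"
  have \<Phi>: "\<Phi> t = em (mat_exp (t \<cdot>\<^sub>m A))" for t by (simp add: \<Phi>_def)
  note d\<Phi> = em_mat_exp_derivative[OF A, folded \<Phi>]
  have cm: "cm n n (\<Phi> t)" for t unfolding \<Phi>_def by (intro cm_em mat_exp_carrier A)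
  have \<Phi>0: "\<Phi> 0 = ide n" unfolding \<Phi>_def by (rule em_mat_exp_0[OF A])
  have "\<exists>L c. tp L = L \<and> 0 < c \<and> (\<forall>x. ide n * x = x \<longrightarrow> (norm x)\<^sup>2 \<le> inner x (L * x)) \<and>
    (\<forall>x. ide n * x = x \<longrightarrow> inner x (L * (em A * x)) \<le> - c * (norm x)\<^sup>2)"
    by (rule stable_mat_lyapunov_function[OF A st]) blast
  then obtain L c where L: "tp L = L" "0 < c" "\<And>x. ide n * x = x \<Longrightarrow> (norm x)\<^sup>2 \<le> inner x (L * x)"
    "\<And>x. ide n * x = x \<Longrightarrow> inner x (L * (em A * x)) \<le> - c * (norm x)\<^sup>2"
    by (elim exE conjE) blast
  \<comment> \<open>With this rate \<open>k * V t\<close> is at most \<open>c\<close> times the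
    squared norm of \<open>\<Phi> t\<close>, so that \<open>V t * exp (2 * k * t)\<close> decreases.
    The summand 1 covers \<open>opn L = 0\<close>, which occurs for \<open>n = 0\<close>.\<close>
  define k where "k = c / (opn L + 1)"
  have k: "k > 0" using L(2) by (simp add: k_def add_nonneg_pos)
  define V where "V = (\<lambda>t. inner (\<Phi> t) (L * \<Phi> t))"
  define g where "g = (\<lambda>t. V t * exp (2 * k * t))"
  have V': "(V has_real_derivative 2 * inner (\<Phi> t) (L * (em A * \<Phi> t))) (at t)" for t
  proof -
    have "(V has_vector_derivative
        inner (\<Phi> t) (L * (\<Phi> t * em A)) + inner (\<Phi> t * em A) (L * \<Phi> t)) (at t)"
      unfolding V_def
      by (rule bounded_bilinear.has_vector_derivative[OF bounded_bilinear_inner d\<Phi>(1)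
            has_vector_derivative_mult_right[OF d\<Phi>(1)]])
    moreover have "inner (em A * \<Phi> t) (L * \<Phi> t) = inner (\<Phi> t) (L * (em A * \<Phi> t))"
      by (metis L(1) inner_commute inner_mult_left)
    ultimately show ?thesis by (simp add: d\<Phi>(2) has_real_derivative_iff_has_vector_derivative)
  qed
  have g': "(g has_real_derivative 2 * inner (\<Phi> t) (L * (em A * \<Phi> t)) * exp (2 * k * t) + V t * (exp (2 * k * t) * (2 * k))) (at t)" for t
    unfolding g_def by (auto intro!: derivative_eq_intros V')
  have g'_le: "2 * inner (\<Phi> t) (L * (em A * \<Phi> t)) * exp (2 * k * t) + V t * (exp (2 * k * t) * (2 * k)) \<le> 0" for t
  proof -
    have "inner (\<Phi> t) (L * (em A * \<Phi> t)) \<le> - c * (norm (\<Phi> t))\<^sup>2" by (rule L(4)[OF cmD(1)[OF cm]])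
    moreover have "k * V t \<le> c * (norm (\<Phi> t))\<^sup>2"
    proof -
      have "V t \<le> opn L * (norm (\<Phi> t))\<^sup>2"
        using abs_inner_opn[of "\<Phi> t" L "\<Phi> t"] by (simp add: V_def power2_eq_square mult.assoc)
      also have "\<dots> \<le> (opn L + 1) * (norm (\<Phi> t))\<^sup>2" by (intro mult_right_mono) auto
      finally have "k * V t \<le> k * ((opn L + 1) * (norm (\<Phi> t))\<^sup>2)" using k by (intro mult_left_mono) auto
      also have "k * ((opn L + 1) * (norm (\<Phi> t))\<^sup>2) = c * (norm (\<Phi> t))\<^sup>2"
      proof -
        have "opn L + 1 > 0" by (simp add: add_nonneg_pos)
        then show ?thesis by (simp add: k_def)
      qed
      finally show ?thesis .
    qed
    ultimately have "2 * exp (2 * k * t) * (inner (\<Phi> t) (L * (em A * \<Phi> t)) + k * V t) \<le> 0"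
      by (intro mult_nonneg_nonpos) auto
    then show ?thesis by (simp add: algebra_simps)
  qed
  have bd: "norm (\<Phi> t) \<le> sqrt (V 0) * exp (- k * t)" if t: "t \<ge> 0" for t
  proof -
    have "g t \<le> g 0"
      by (rule DERIV_nonpos_imp_nonincreasing[OF t]) (use g' g'_le in blast)
    then have "V t * exp (2 * k * t) \<le> V 0" by (simp add: g_def)
    then have "V t \<le> V 0 / exp (2 * k * t)" by (simp add: pos_le_divide_eq)
    then have "V t \<le> V 0 * exp (- (2 * k * t))" by (simp add: exp_minus divide_inverse)
    moreover have "(norm (\<Phi> t))\<^sup>2 \<le> V t" unfolding V_def by (rule L(3)[OF cmD(1)[OF cm]])
    moreover have "0 \<le> V 0" unfolding V_def
      by (rule order_trans[OF zero_le_power2 L(3)[OF cmD(1)[OF cm]]])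
    ultimately have "(norm (\<Phi> t))\<^sup>2 \<le> (sqrt (V 0) * exp (- k * t))\<^sup>2"
      by (simp add: power_mult_distrib mult.assoc flip: exp_double)
    then show ?thesis by (rule power2_le_imp_le) (use \<open>0 \<le> V 0\<close> in simp)
  qed
  show ?thesis
    unfolding \<Phi>_def[symmetric] expdecay_def
    using cm_em[OF A] \<Phi>0 cm d\<Phi> bd k by blast
qed

text \<open>Turns an equation for a product into a rewrite rule for right-nested products with a
  further factor.\<close>

lemma mult_extend: "a * b = c \<Longrightarrow> a * (b * x) = c * (x :: fmat)"
  by (simp flip: mult.assoc)

section \<open>Exact balanced truncation\<close>

text \<open>\<open>s\<close>, \<open>s'\<close> and \<open>s1\<close> stand for
  \<open>\<sigma> r\<close>, \<open>\<sigma> (r + 1)\<close> and \<open>\<sigma> 1\<close>;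
  \<open>k1\<close> and \<open>k2\<close> count the discarded left and right singular vectors, and
  \<open>Si\<close> is the inverse of \<open>Sg\<close>.\<close>

locale balanced_truncation =
  fixes n m p m1 m2 k1 k2 r :: nat
    and a b c P Q S R U1 U2 V1 V2 Sg Si Sg2 :: fmat
    and s s' s1 :: real
  assumes dims: "cm n n a" "cm n m b" "cm n p c" "cm n m1 S" "cm n m2 R"
      "cm m1 r U1" "cm m1 k1 U2" "cm m2 r V1" "cm m2 k2 V2" "cm r r Sg" "cm r r Si" "cm k1 k2 Sg2"
    and PS: "P = S * tp S" and QR: "Q = R * tp R"
    and lyap_P: "a * P + P * tp a + b * tp b = 0" and lyap_Q: "tp a * Q + Q * a + c * tp c = 0"
    and svd: "tp S * R = U1 * Sg * tp V1 + U2 * Sg2 * tp V2"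
    and U11: "tp U1 * U1 = ide r" and U12: "tp U1 * U2 = 0"
    and U22: "tp U2 * U2 = ide k1" and UU: "U1 * tp U1 + U2 * tp U2 = ide m1"
    and V11: "tp V1 * V1 = ide r" and V12: "tp V1 * V2 = 0"
    and V22: "tp V2 * V2 = ide k2" and VV: "V1 * tp V1 + V2 * tp V2 = ide m2"
    and tSg: "tp Sg = Sg" and SiSg: "Si * Sg = ide r" and SgSi: "Sg * Si = ide r"
    and Sg_diag: "\<And>i j. i \<noteq> j \<Longrightarrow> ent Sg i j = 0" and Sg_ge: "\<And>i. i < r \<Longrightarrow> s \<le> ent Sg i i"
    and opn_Si: "opn Si \<le> 1 / s" and opn_Sg: "opn Sg \<le> s1" and opn_Sg2: "opn Sg2 \<le> s'"
    and s': "0 \<le> s'" and gap: "s' < s"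
begin

definition X1 :: fmat where "X1 = S * U1"
definition Y1 :: fmat where "Y1 = R * V1 * Si"
definition ah :: fmat where "ah = tp Y1 * a * X1"
definition bh :: fmat where "bh = tp Y1 * b"
definition ch :: fmat where "ch = tp X1 * c"

lemma U21: "tp U2 * U1 = 0" using arg_cong[OF U12, of tp] by simp
lemma V21: "tp V2 * V1 = 0" using arg_cong[OF V12, of tp] by simp

lemma tSi: "tp Si = Si"
proof -
  have "tp Si = tp Si * (Sg * Si)" using cm_tp[OF dims(11)] by (simp add: SgSi cmD)
  also have "\<dots> = tp (Sg * Si) * Si" by (simp add: tSg mult.assoc)
  also have "\<dots> = Si" using dims(11) by (simp add: SgSi cmD del: tp_mult)
  finally show ?thesis .
qed

lemma svd': "tp R * S = V1 * Sg * tp U1 + V2 * tp Sg2 * tp U2"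
  using arg_cong[OF svd, of tp] by (simp add: tSg mult.assoc)

lemmas rws = mult.assoc distrib_left distrib_right
  U11 V11 U12 V12 U21 V21 U22 V22 SiSg SgSi svd svd'
  U11[THEN mult_extend] V11[THEN mult_extend] U12[THEN mult_extend] V12[THEN mult_extend]
  U21[THEN mult_extend] V21[THEN mult_extend] U22[THEN mult_extend] V22[THEN mult_extend]
  SiSg[THEN mult_extend] SgSi[THEN mult_extend] svd[THEN mult_extend] svd'[THEN mult_extend]
  dims[THEN cmD(1)] dims[THEN cmD(2)] dims[THEN cmD(3)] dims[THEN cmD(4)]
  dims[THEN cm_tp, THEN cmD(1)] dims[THEN cm_tp, THEN cmD(2)] dims[THEN cm_tp, THEN cmD(3)]
  dims[THEN cm_tp, THEN cmD(4)]
  tSg tSi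

lemma cm_X1: "cm n r X1"
  unfolding X1_def by (rule cm_mult[OF dims(4,6)])

lemma cm_Y1: "cm n r Y1"
  unfolding Y1_def by (rule cm_mult[OF cm_mult[OF dims(5,8)] dims(11)])

lemma cm_ah: "cm r r ah"
  unfolding ah_def by (rule cm_mult[OF cm_mult[OF cm_tp[OF cm_Y1] dims(1)] cm_X1])

lemma cm_bh: "cm r m bh"
  unfolding bh_def by (rule cm_mult[OF cm_tp[OF cm_Y1] dims(2)])

lemma cm_ch: "cm r p ch"
  unfolding ch_def by (rule cm_mult[OF cm_tp[OF cm_X1] dims(3)])

lemmas cm_red = cm_X1 cm_Y1 cm_ah cm_bh cm_ch

lemma tP: "tp P = P" and tQ: "tp Q = Q" by (simp_all add: PS QR)

lemma Y1X1: "tp Y1 * X1 = ide r" by (simp add: X1_def Y1_def rws)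

lemma X1Y1: "tp X1 * Y1 = ide r" using arg_cong[OF Y1X1, of tp] by simp

lemma PY1: "P * Y1 = X1" by (simp add: X1_def Y1_def PS rws)

text \<open>Together with \<open>PY1\<close>: \<open>P * Q * X1 = X1 * (Sg * Sg)\<close>. So the
  columns of \<open>X1\<close> span the dominant invariant subspace of \<open>P * Q\<close>, and
  \<open>X1 * tp Y1\<close> projects onto it.\<close>

lemma QX1: "Q * X1 = Y1 * (Sg * Sg)"  by (simp add: X1_def Y1_def QR rws)

lemma tp_Y1_P: "tp Y1 * P = tp X1" using arg_cong[OF PY1, of tp] by (simp add: tP)

lemma tp_X1_Q: "tp X1 * Q = Sg * Sg * tp Y1"
  using arg_cong[OF QX1, of tp] by (simp add: tQ tSg mult.assoc)

lemma lyap_red_ctrl: "ah + tp ah + bh * tp bh = 0"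
proof -
  have "tp Y1 * (a * P + P * tp a + b * tp b) * Y1 = 0" by (simp add: lyap_P)
  then show ?thesis
    by (simp add: ah_def bh_def distrib_left distrib_right mult.assoc PY1 tp_Y1_P[THEN mult_extend])
qed

lemma lyap_red_obs: "tp ah * (Sg * Sg) + Sg * Sg * ah + ch * tp ch = 0"
proof -
  have "tp X1 * (tp a * Q + Q * a + c * tp c) * X1 = 0" by (simp add: lyap_Q)
  then show ?thesis
    by (simp add: ah_def ch_def distrib_left distrib_right mult.assoc QX1 tp_X1_Q[THEN mult_extend])
qed

text \<open>The coordinates \<open>w\<close> of \<open>u\<close> along the discarded singular
  vectors form an eigenvector of \<open>tp Sg2 * Sg2\<close> for \<mu> or vanish. As that matrix has
  norm at most s'^2 < \<mu>, they vanish.\<close>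

lemma eigenspace_PQ_in_range:
  assumes u: "P * (Q * u) = \<mu> *\<^sub>R u" and \<mu>: "s\<^sup>2 \<le> \<mu>"
  shows "X1 * (tp Y1 * u) = u"
proof -
  have "s > 0" using s' gap by linarith
  then have \<mu>0: "\<mu> > 0" using \<mu> by (meson less_le_trans zero_less_power)
  define w where "w = tp V2 * (tp R * u)"
  have "tp Sg2 * (Sg2 * w) = tp V2 * (tp R * (P * (Q * u)))"
    by (simp add: w_def PS QR rws)
  also have "\<dots> = \<mu> *\<^sub>R w" by (simp add: u w_def)
  finally have "\<mu> * norm w = norm (tp Sg2 * (Sg2 * w))" using \<mu>0 by simp
  also have "\<dots> \<le> opn Sg2 * (opn Sg2 * norm w)"
    by (rule order_trans[OF norm_mult_opn]) (simp add: mult_left_mono norm_mult_opn)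
  also have "\<dots> \<le> s' * (s' * norm w)"
    by (intro mult_mono opn_Sg2 mult_nonneg_nonneg s') auto
  finally have "(\<mu> - s' * s') * norm w \<le> 0" by (simp add: algebra_simps)
  moreover have "s' * s' < \<mu>"
    using \<mu> gap s' by (smt (verit) power2_eq_square power_strict_mono zero_less_numeral)
  ultimately have "w = 0" by (simp add: mult_le_0_iff)
  have "tp R * u = (V1 * tp V1 + V2 * tp V2) * (tp R * u)"
    unfolding VV by (simp add: rws)
  also have "\<dots> = V1 * (tp V1 * (tp R * u)) + V2 * w" by (simp add: w_def distrib_right mult.assoc)
  finally have Ru: "tp R * u = V1 * (tp V1 * (tp R * u))" using \<open>w = 0\<close> by simp
  define z where "z = Sg * (tp V1 * (tp R * u))"
  have "\<mu> *\<^sub>R u = S * (tp S * (R * (tp R * u)))" using u by (simp add: PS QR mult.assoc)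
  also have "\<dots> = S * (tp S * (R * (V1 * (tp V1 * (tp R * u)))))" using Ru by simp
  also have "\<dots> = X1 * z" by (simp add: z_def X1_def rws)
  finally have "u = (1 / \<mu>) *\<^sub>R (X1 * z)" using \<mu>0 by (metis inverse_eq_divide real_vector_affinity_eq
        scaleR_one scaleR_scaleR left_inverse less_irrefl)
  then have "u = X1 * ((1 / \<mu>) *\<^sub>R z)" by simp
  then show ?thesis using cm_red(1) by (simp add: Y1X1[THEN mult_extend] cmD)
qed

text \<open>The real and imaginary parts of the eigenvectors of \<open>ah\<close> for the eigenvalue \<open>\<i> * \<omega>\<close>.\<close>

definition V :: "real \<Rightarrow> (fmat \<times> fmat) set" where
  "V \<omega> = {(x, y). ide r * x = x \<and> ide r * y = y \<and> ah * x = - \<omega> *\<^sub>R y \<and> ah * y = \<omega> *\<^sub>R x}"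

lemma inner_bh:
  shows "2 * inner x (ah * x) = - (norm (tp bh * x))\<^sup>2"
proof -
  have "inner x ((ah + tp ah + bh * tp bh) * x) = 0" by (simp add: lyap_red_ctrl)
  moreover have "inner x (tp ah * x) = inner x (ah * x)" by (metis inner_commute inner_mult_left tp_tp)
  moreover have "inner x (bh * (tp bh * x)) = (norm (tp bh * x))\<^sup>2"
    by (simp add: power2_norm_eq_inner inner_mult_left)
  ultimately show ?thesis by (simp add: distrib_right inner_add_right mult.assoc)
qed

lemma inner_ch: "2 * inner x (Sg * (Sg * (ah * x))) = - (norm (tp ch * x))\<^sup>2"
proof -
  have "inner x ((tp ah * (Sg * Sg) + Sg * Sg * ah + ch * tp ch) * x) = 0" by (simp add: lyap_red_obs)
  moreover have "inner x (tp ah * (Sg * (Sg * x))) = inner x (Sg * (Sg * (ah * x)))"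
    by (metis inner_commute inner_mult_left tp_tp tSg)
  moreover have "inner x (ch * (tp ch * x)) = (norm (tp ch * x))\<^sup>2"
    by (simp add: power2_norm_eq_inner inner_mult_left)
  ultimately show ?thesis by (simp add: distrib_right inner_add_right mult.assoc)
qed

lemma bh_null:
  assumes "inner x (ah * x) + inner y (ah * y) = 0"
  shows "tp bh * x = 0" "tp bh * y = 0"
proof -
  have "(norm (tp bh * x))\<^sup>2 + (norm (tp bh * y))\<^sup>2 = 0"
    using inner_bh[of x] inner_bh[of y] assms by linarith
  then show "tp bh * x = 0" "tp bh * y = 0" by (simp_all add: sum_power2_eq_zero_iff)
qed

lemma tp_ah_eq: "tp bh * x = 0 \<Longrightarrow> tp ah * x = - (ah * x)"
proof -
  assume "tp bh * x = 0"
  have "(ah + tp ah + bh * tp bh) * x = 0" by (simp add: lyap_red_ctrl)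
  then show ?thesis using \<open>tp bh * x = 0\<close> by (simp add: distrib_right mult.assoc add_eq_0_iff)
qed

text \<open>On an imaginary eigenvalue the forms of \<open>ah\<close> and of
  \<open>Sg * Sg * ah\<close>, added over the real and imaginary part, are zero. The Lyapunov
  equations then leave only the squared input and output terms.\<close>

lemma V_null:
  assumes "(x, y) \<in> V \<omega>"
  shows "tp bh * x = 0" "tp bh * y = 0" "tp ch * x = 0" "tp ch * y = 0"
proof -
  have xy: "ah * x = - \<omega> *\<^sub>R y" "ah * y = \<omega> *\<^sub>R x" using assms by (auto simp: V_def)
  have "inner x (ah * x) + inner y (ah * y) = 0" by (simp add: xy inner_commute)
  then show "tp bh * x = 0" "tp bh * y = 0" by (rule bh_null)+
  have "inner x (Sg * (Sg * y)) = inner y (Sg * (Sg * x))" by (metis inner_commute inner_mult_left tSg)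
  then have "inner x (Sg * (Sg * (ah * x))) + inner y (Sg * (Sg * (ah * y))) = 0" by (simp add: xy)
  then have "(norm (tp ch * x))\<^sup>2 + (norm (tp ch * y))\<^sup>2 = 0"
    using inner_ch[of x] inner_ch[of y] by linarith
  then show "tp ch * x = 0" "tp ch * y = 0" by (simp_all add: sum_power2_eq_zero_iff)
qed

text \<open>As the output term vanishes, the observability equation makes the images under
  \<open>Sg * Sg\<close> eigenvectors of \<open>tp ah\<close>. The input term vanishes for these
  too, and the controllability equation turns them back into eigenvectors of
  \<open>ah\<close>.\<close>

lemma V_Sg2:
  assumes "(x, y) \<in> V \<omega>"
  shows "(Sg * (Sg * x), Sg * (Sg * y)) \<in> V \<omega>"
proof -
  note null = V_null[OF assms]
  have xy: "ah * x = - \<omega> *\<^sub>R y" "ah * y = \<omega> *\<^sub>R x" using assms by (auto simp: V_def)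
  have obs: "tp ah * (Sg * (Sg * z)) = - (Sg * (Sg * (ah * z)))" if "tp ch * z = 0" for z
  proof -
    have "(tp ah * (Sg * Sg) + Sg * Sg * ah + ch * tp ch) * z = 0" by (simp add: lyap_red_obs)
    then show ?thesis using that by (simp add: distrib_right mult.assoc add_eq_0_iff2)
  qed
  define x' y' where "x' = Sg * (Sg * x)" and "y' = Sg * (Sg * y)"
  have t: "tp ah * x' = \<omega> *\<^sub>R y'" "tp ah * y' = - \<omega> *\<^sub>R x'"
    using obs[OF null(3)] obs[OF null(4)] by (simp_all add: x'_def y'_def xy)
  have sw: "inner z (ah * z) = inner z (tp ah * z)" for z by (metis inner_commute inner_mult_left tp_tp)
  have "inner x' (ah * x') + inner y' (ah * y') = 0" by (simp add: sw t inner_commute)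
  from bh_null[OF this, THEN tp_ah_eq] t
  have "ah * x' = - \<omega> *\<^sub>R y'" "ah * y' = \<omega> *\<^sub>R x'" by (metis minus_minus scaleR_minus_left)+
  then show ?thesis using dims(10) by (simp add: V_def x'_def y'_def cmD)
qed

lemma ent_Sg_mult: "ent (Sg * x) i j = (if i < r then ent Sg i i * ent x i j else 0)"
proof -
  have "ent (Sg * x) i j = (\<Sum>k<r. ent Sg i k * ent x k j)"
    by (rule ent_times) (use dims(10) in \<open>auto simp: cm_iff\<close>)
  also have "\<dots> = (\<Sum>k<r. if k = i then ent Sg i i * ent x i j else 0)"
    by (intro sum.cong) (auto simp: Sg_diag)
  finally show ?thesis by simp
qed

text \<open>The diagonal matrix \<open>Sg * Sg\<close> leaves \<open>V \<omega>\<close> invariant. A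
  nonzero element with fewest nonzero rows must be an eigenvector: subtracting \<mu> times the
  element for a diagonal entry \<mu> clears a row without filling another.\<close>

lemma V_eigenvector:
  assumes "(x, y) \<in> V \<omega>" "(x, y) \<noteq> (0, 0)"
  obtains x y \<mu> where "(x, y) \<in> V \<omega>" "(x, y) \<noteq> (0, 0)" "s\<^sup>2 \<le> \<mu>"
    "Sg * (Sg * x) = \<mu> *\<^sub>R x" "Sg * (Sg * y) = \<mu> *\<^sub>R y"
proof -
  define supp where "supp = (\<lambda>(x, y). {i. \<exists>j. ent x i j \<noteq> 0 \<or> ent y i j \<noteq> 0})"
  obtain z where z: "z \<in> V \<omega> \<and> z \<noteq> (0, 0)"
    and min: "\<And>w. w \<in> V \<omega> \<and> w \<noteq> (0, 0) \<Longrightarrow> card (supp z) \<le> card (supp w)"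
    using ex_has_least_nat[of "\<lambda>z. z \<in> V \<omega> \<and> z \<noteq> (0, 0)" "(x, y)" "\<lambda>z. card (supp z)"] assms by blast
  obtain x y where xy: "z = (x, y)" by (cases z)
  have low: "ent x i j = 0" "ent y i j = 0" if "r \<le> i" for i j
    using z that ent_ide_mult[of r x i j] ent_ide_mult[of r y i j] unfolding xy V_def by auto
  have sub: "supp z \<subseteq> {..<r}" unfolding supp_def xy using low by (auto simp: not_le[symmetric])
  obtain i where i: "i \<in> supp z"
    using z unfolding xy supp_def by (auto, (metis fmat_eqI ent_simps(1))+)
  have ir: "i < r" using i sub by auto
  define \<mu> where "\<mu> = (ent Sg i i)\<^sup>2"
  define x' y' where "x' = Sg * (Sg * x) - \<mu> *\<^sub>R x" and "y' = Sg * (Sg * y) - \<mu> *\<^sub>R y"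
  have V': "(x', y') \<in> V \<omega>"
    using V_Sg2[of x y \<omega>] z unfolding xy V_def x'_def y'_def
    by (auto simp: right_diff_distrib scaleR_diff_right)
  have "supp (x', y') \<subset> supp z"
  proof -
    have "ent x' k j = ((ent Sg k k)\<^sup>2 - \<mu>) * ent x k j" "ent y' k j = ((ent Sg k k)\<^sup>2 - \<mu>) * ent y k j" for k j
      using low[of k j] by (cases "k < r"; simp add: x'_def y'_def ent_Sg_mult power2_eq_square algebra_simps)+
    then show ?thesis using i unfolding supp_def xy by (auto simp: \<mu>_def)
  qed
  then have "card (supp (x', y')) < card (supp z)"
    by (rule psubset_card_mono[rotated]) (rule finite_subset[OF sub], simp)
  then have "(x', y') = (0, 0)" using min[of "(x', y')"] V' by fastforce
  then have "Sg * (Sg * x) = \<mu> *\<^sub>R x" "Sg * (Sg * y) = \<mu> *\<^sub>R y" by (auto simp: x'_def y'_def)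
  moreover have "s\<^sup>2 \<le> \<mu>" unfolding \<mu>_def using Sg_ge[OF ir] s' gap by (intro power_mono) auto
  ultimately show thesis using that z unfolding xy by blast
qed

text \<open>A common eigenvector of \<open>ah\<close> and \<open>Sg * Sg\<close> lifts through
  \<open>X1\<close> to an eigenvector of \<open>a\<close> for the same imaginary eigenvalue, which
  the Lyapunov function of \<open>a\<close> excludes.\<close>

lemma truncation_no_imaginary_eigenvalue:
  assumes "0 < e" and L: "tp L = L" "\<And>x. ide n * x = x \<Longrightarrow> inner x (L * (a * x)) \<le> - e * (norm x)\<^sup>2"
    and xy: "(x, y) \<in> V \<omega>"
  shows "(x, y) = (0, 0)"
proof (rule ccontr)
  assume "(x, y) \<noteq> (0, 0)"
  from V_eigenvector[OF xy this] obtain x y \<mu> where xy: "(x, y) \<in> V \<omega>" "(x, y) \<noteq> (0, 0)" "s\<^sup>2 \<le> \<mu>"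
    and \<mu>: "Sg * (Sg * x) = \<mu> *\<^sub>R x" "Sg * (Sg * y) = \<mu> *\<^sub>R y" .
  \<comment> \<open>The full Lyapunov equations, applied to \<open>Y1 * z\<close> and
    \<open>X1 * z\<close>, show that \<open>a * (X1 * z)\<close> is an eigenvector of
    \<open>P * Q\<close> for \<mu> or zero. It therefore lies in the range of \<open>X1\<close>,
    where \<open>tp Y1\<close> recovers the coordinates \<open>ah * z\<close>.\<close>
  have lift: "a * (X1 * z) = X1 * (ah * z)" if "tp bh * z = 0" "tp ch * z = 0" "Sg * (Sg * z) = \<mu> *\<^sub>R z" for z
  proof -
    have Pz: "a * (X1 * z) = - (P * (tp a * (Y1 * z)))"
    proof -
      have "tp b * (Y1 * z) = 0" using that(1) by (simp add: bh_def mult.assoc)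
      moreover have "(a * P + P * tp a + b * tp b) * (Y1 * z) = 0" by (simp add: lyap_P)
      ultimately show ?thesis
        by (simp add: distrib_right mult.assoc PY1[THEN mult_extend] add_eq_0_iff2)
    qed
    have Qz: "Q * (a * (X1 * z)) = - \<mu> *\<^sub>R (tp a * (Y1 * z))"
    proof -
      have "tp c * (X1 * z) = 0" using that(2) by (simp add: ch_def mult.assoc)
      moreover have "(tp a * Q + Q * a + c * tp c) * (X1 * z) = 0" by (simp add: lyap_Q)
      ultimately show ?thesis
        by (simp add: distrib_right mult.assoc QX1[THEN mult_extend] that(3) add_eq_0_iff)
    qed
    have "P * (Q * (a * (X1 * z))) = \<mu> *\<^sub>R (a * (X1 * z))"
      unfolding Qz by (simp add: Pz)
    from eigenspace_PQ_in_range[OF this xy(3)] show ?thesis by (simp add: ah_def mult.assoc)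
  qed
  note null = V_null[OF xy(1)]
  define u v where "u = X1 * x" and "v = X1 * y"
  have au: "a * u = - \<omega> *\<^sub>R v" "a * v = \<omega> *\<^sub>R u"
    using lift[OF null(1,3) \<mu>(1)] lift[OF null(2,4) \<mu>(2)] xy(1) by (auto simp: u_def v_def V_def)
  have id: "ide n * u = u" "ide n * v = v" using cm_red(1) by (auto simp: u_def v_def cmD)
  have sym: "inner u (L * v) = inner v (L * u)" by (metis L(1) inner_commute inner_mult_left)
  have "inner u (L * (a * u)) + inner v (L * (a * v)) = 0" by (simp add: au sym)
  then have "e * ((norm u)\<^sup>2 + (norm v)\<^sup>2) \<le> 0" using L(2)[OF id(1)] L(2)[OF id(2)] by (simp add: algebra_simps)
  then have "(norm u)\<^sup>2 + (norm v)\<^sup>2 \<le> 0" using \<open>0 < e\<close> by (simp only: mult_le_0_iff) linarith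
  then have "u = 0" "v = 0" by (simp_all add: sum_power2_le_zero_iff)
  moreover have "tp Y1 * u = x" "tp Y1 * v = y"
    using xy(1) by (auto simp: u_def v_def V_def Y1X1[THEN mult_extend])
  ultimately show False using xy(2) by auto
qed

lemma truncation_stable:
  assumes A: "em A = a" "A \<in> carrier_mat n n" "stable_mat A" and Ah: "em Ah = ah" "Ah \<in> carrier_mat r r"
  shows "stable_mat Ah"
  unfolding stable_mat_def
proof (intro allI impI, rule ccontr)
  fix l assume "eigenvalue (cmat Ah) l" and nonneg: "\<not> Re l < 0"
  then obtain x y where xy: "cm r 1 x" "cm r 1 y" "x \<noteq> 0 \<or> y \<noteq> 0"
    "ah * x = Re l *\<^sub>R x - Im l *\<^sub>R y" "ah * y = Im l *\<^sub>R x + Re l *\<^sub>R y"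
    using eigenvalue_cmat_pair[OF Ah(2), unfolded Ah(1)] by metis
  have "2 * (inner x (ah * x) + inner y (ah * y)) = 2 * Re l * ((norm x)\<^sup>2 + (norm y)\<^sup>2)"
    unfolding xy by (simp add: inner_diff_right inner_add_right power2_norm_eq_inner inner_commute algebra_simps)
  then have "2 * Re l * ((norm x)\<^sup>2 + (norm y)\<^sup>2) \<le> 0"
    using inner_bh[of x] inner_bh[of y] by (smt (verit) zero_le_power2)
  moreover have "(norm x)\<^sup>2 + (norm y)\<^sup>2 > 0"
    using xy(3) by (auto simp: sum_power2_gt_zero_iff)
  ultimately have "Re l \<le> 0" by (simp add: mult_le_0_iff)
  then have "Re l = 0" using nonneg by linarith
  then have "(x, y) \<in> V (Im l)" using xy by (auto simp: V_def cmD)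
  have "\<exists>L e. tp L = L \<and> 0 < e \<and> (\<forall>x. ide n * x = x \<longrightarrow> inner x (L * (a * x)) \<le> - e * (norm x)\<^sup>2)"
    by (rule stable_mat_lyapunov_function[OF A(2,3)]) (unfold A(1), blast)
  then obtain L e where "tp L = L" "0 < e" "\<And>x. ide n * x = x \<Longrightarrow> inner x (L * (a * x)) \<le> - e * (norm x)\<^sup>2"
    by blast
  from truncation_no_imaginary_eigenvalue[OF this(2,1,3) \<open>(x, y) \<in> V (Im l)\<close>] xy(3)
  show False by auto
qed

end

section \<open>Second-order perturbation bounds for the truncation bases\<close>

lemma opn_mult_le: "opn a \<le> x \<Longrightarrow> opn b \<le> y \<Longrightarrow> opn (a * b) \<le> x * y"
  by (rule order_trans[OF opn_mult]) (meson mult_mono opn_nonneg order_trans)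

lemma opn_add_le: "opn a \<le> x \<Longrightarrow> opn b \<le> y \<Longrightarrow> opn (a + b) \<le> x + y"
  by (rule order_trans[OF opn_add]) linarith

lemma opn_diff_le: "opn a \<le> x \<Longrightarrow> opn b \<le> y \<Longrightarrow> opn (a - b) \<le> x + y"
  by (rule order_trans[OF opn_diff]) linarith

lemma inner_gram: "inner x (tp a * (a * x)) = (norm (a * x))\<^sup>2"
  by (simp add: power2_norm_eq_inner inner_mult_left)

text \<open>The squared norm of \<open>Z * x\<close> is that of \<open>ide r * x\<close> plus that
  of \<open>g * x\<close>, so \<open>Z\<close> stretches by factors between 1 and the square root of
  2; 3/2 is a rational bound for the latter.\<close>

lemma cos_factor_bounds:
  assumes W: "tp W = W" and Z: "tp Z = Z" "Z * Z = ide r + tp g * g" "Z * W = ide r" "W * Z = ide r"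
    and c: "cm r r Z" "cm r r W" and g: "opn g \<le> 1"
  shows "opn W \<le> 1" "opn Z \<le> 3 / 2" "ide r * x = x \<Longrightarrow> 2 / 3 * norm x \<le> norm (W * x)"
proof -
  have nZ: "(norm (Z * x))\<^sup>2 = (norm (ide r * x))\<^sup>2 + (norm (g * x))\<^sup>2" for x
  proof -
    have "(norm (Z * x))\<^sup>2 = inner x ((ide r * ide r + tp g * g) * x)"
      using inner_gram[of x Z] by (simp add: Z flip: mult.assoc)
    also have "\<dots> = inner x (tp (ide r) * (ide r * x)) + inner x (tp g * (g * x))"
      by (simp add: distrib_right inner_add_right mult.assoc ide_idem[THEN mult_extend])
    finally show ?thesis by (simp only: inner_gram)
  qed
  have ide_le: "norm (ide r * x) \<le> norm x" for x
    using norm_mult_opn[of "ide r" x] opn_ide_le[of r] by (meson mult_left_le_one_le norm_ge_zero opn_nonneg order_trans)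
  have g_le: "norm (g * x) \<le> norm x" for x
    using norm_mult_opn[of g x] g by (meson mult_left_le_one_le norm_ge_zero opn_nonneg order_trans)
  have Z_le: "norm (Z * x) \<le> 3 / 2 * norm x" for x
  proof -
    have "(norm (Z * x))\<^sup>2 \<le> (norm x)\<^sup>2 + (norm x)\<^sup>2"
      unfolding nZ by (intro add_mono power_mono ide_le g_le) auto
    also have "\<dots> \<le> (3 / 2 * norm x)\<^sup>2" by (simp add: power_mult_distrib power2_eq_square)
    finally show ?thesis by (rule power2_le_imp_le) simp
  qed
  then show "opn Z \<le> 3 / 2" by (intro opn_leI) auto
  show "opn W \<le> 1"
  proof (rule opn_leI)
    fix x
    have "(norm (W * x))\<^sup>2 \<le> (norm (Z * (W * x)))\<^sup>2"
      unfolding nZ using c by (simp add: cmD)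
    then have "norm (W * x) \<le> norm (Z * (W * x))" by (rule power2_le_imp_le) simp
    also have "Z * (W * x) = ide r * x" by (simp add: Z flip: mult.assoc)
    also have "norm \<dots> \<le> 1 * norm x" using ide_le by simp
    finally show "norm (W * x) \<le> 1 * norm x" .
  qed simp
  show "2 / 3 * norm x \<le> norm (W * x)" if "ide r * x = x"
  proof -
    have "x = Z * (W * x)" using that by (simp add: Z flip: mult.assoc)
    then have "norm x \<le> 3 / 2 * norm (W * x)" using Z_le[of "W * x"] by simp
    then show ?thesis by simp
  qed
qed

text \<open>Substituting the first inequality into the second makes a factor v + s' appear on both
  sides. Later \<open>x\<close> and \<open>y\<close> are the norms of \<open>nx\<close> and
  \<open>ny\<close>, \<open>v\<close> is \<open>w\<close>, and \<open>e\<close> is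
  \<epsilon>^2.\<close>

lemma coupled_bounds:
  fixes x y s' v e :: real
  assumes "0 \<le> s'" "s' < v" "x \<le> s' * y + e / v" "v\<^sup>2 * y \<le> s' * x + e"
  shows "y \<le> e / (v * (v - s'))" "x \<le> e / (v - s')"
proof -
  have v: "v > 0" using assms by linarith
  have "v\<^sup>2 * y \<le> s' * (s' * y + e / v) + e"
    using assms(4) mult_left_mono[OF assms(3,1)] by linarith
  then have "(v + s') * ((v - s') * y) \<le> (v + s') * (e / v)"
    using v by (simp add: field_simps power2_eq_square)
  then have *: "(v - s') * y \<le> e / v" using assms(1) v by (subst (asm) mult_le_cancel_left_pos) auto
  then show y: "y \<le> e / (v * (v - s'))" using v assms(2) by (simp add: field_simps)
  have "x \<le> s' * (e / (v * (v - s'))) + e / v"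
    using assms(3) mult_left_mono[OF y assms(1)] by linarith
  also have "\<dots> = e / (v - s')" using v assms(2) by (simp add: divide_simps) (simp add: algebra_simps)
  finally show "x \<le> e / (v - s')" .
qed

text \<open>Trades one of the two factors \<epsilon> for a bound in terms of \<epsilon> / d. In the
  variable u = v - s' = d + \<epsilon> / 2 the claim follows from 2 \<epsilon> < d and v \<ge>
  u.\<close>

lemma base_scalar_bound:
  fixes s s' \<epsilon> d v :: real
  assumes "0 \<le> \<epsilon>" "0 \<le> s'" "4 * \<epsilon> < s - s'" "d = s - s' - 2 * \<epsilon>" "v = s - 3 / 2 * \<epsilon>"
  shows "9 / 2 * \<epsilon> / (v * (v - s')) \<le> 8 / 5 / d"
proof -
  define u where "u = d + \<epsilon> / 2"
  have d: "2 * \<epsilon> < d" "0 < d" and u: "v - s' = u" "0 < u" "u \<le> v" using assms by (auto simp: u_def)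
  have "9 / 2 * \<epsilon> * d \<le> 8 / 5 * (u * u)"
  proof -
    have "29 / 10 * \<epsilon> * d \<le> 8 / 5 * d * d"
      using d by (intro mult_right_mono) auto
    moreover have "u * u = d * d + \<epsilon> * d + \<epsilon> * \<epsilon> / 4" by (simp add: u_def field_simps)
    ultimately show ?thesis using zero_le_square[of \<epsilon>] by linarith
  qed
  also have "\<dots> \<le> 8 / 5 * (v * u)" using u by (intro mult_left_mono mult_right_mono) auto
  finally show ?thesis using u d by (simp add: divide_simps mult_ac)
qed

lemma left_base_scalar_bound:
  fixes s s' \<epsilon> d v :: real
  assumes "0 \<le> \<epsilon>" "0 \<le> s'" "4 * \<epsilon> < s - s'" "d = s - s' - 2 * \<epsilon>" "v = s - 3 / 2 * \<epsilon>"
  shows "4 / (v\<^sup>2 * (v - s')) \<le> 9 / 2 / (d\<^sup>2 * s)"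
proof -
  have d: "2 * \<epsilon> < d" "0 < d" using assms by auto
  have v: "v - s' = d + \<epsilon> / 2" "v = d + \<epsilon> / 2 + s'" "s = d + 2 * \<epsilon> + s'" using assms by auto
  \<comment> \<open>Certificate of nonnegativity: the difference of the cleared denominators, as a
    polynomial in \<open>s'\<close>, has nonnegative coefficients. The constant one has a negative
    term in d^2 \<epsilon>, which the completed square absorbs.\<close>
  have "0 \<le> d * (1 / 32 * (4 * d - 5 * \<epsilon>)\<^sup>2) + 83 / 32 * d * \<epsilon>\<^sup>2 + 9 / 16 * \<epsilon> ^ 3
      + s' * (5 * d\<^sup>2 + 9 * d * \<epsilon> + 9 / 4 * \<epsilon>\<^sup>2) + 9 / 2 * s'\<^sup>2 * (d + \<epsilon> / 2)"
    using assms d by (intro add_nonneg_nonneg mult_nonneg_nonneg) auto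
  also have "\<dots> = 9 / 2 * (v\<^sup>2 * (v - s')) - 4 * (d\<^sup>2 * s)"
    unfolding v(1) unfolding v(2,3) by (simp add: power2_eq_square power3_eq_cube field_simps)
  finally have "4 * (d\<^sup>2 * s) \<le> 9 / 2 * (v\<^sup>2 * (v - s'))" by simp
  moreover have "0 < d\<^sup>2 * s" "0 < v\<^sup>2 * (v - s')" using assms d by auto
  ultimately show ?thesis by (simp add: divide_simps mult_ac)
qed

lemma product_scalar_bound:
  fixes s s' \<epsilon> d v :: real
  assumes "0 \<le> \<epsilon>" "0 \<le> s'" "4 * \<epsilon> < s - s'" "d = s - s' - 2 * \<epsilon>" "v = s - 3 / 2 * \<epsilon>"
  shows "17 / 2 / (v\<^sup>2 * (v - s')) \<le> (4 + (2 * \<epsilon> + d / 2) / (s - \<epsilon>)) * 2 / (s * d\<^sup>2)"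
proof -
  have d: "2 * \<epsilon> < d" "0 < d" using assms by auto
  have v: "v - s' = d + \<epsilon> / 2" "v = d + \<epsilon> / 2 + s'" "s = d + 2 * \<epsilon> + s'" using assms by auto
  have pos: "0 < v" "0 < s" "0 < v - s'" "0 < s - \<epsilon>" using v assms d by linarith+
  have "0 \<le> d * (1 / 48 * (4 * d - 5 * \<epsilon>)\<^sup>2) + 433 / 48 * d * \<epsilon>\<^sup>2 + 11 / 6 * \<epsilon> ^ 3
      + s' * (25 / 3 * d\<^sup>2 + 79 / 4 * d * \<epsilon> + 17 / 3 * \<epsilon>\<^sup>2) + 8 * s'\<^sup>2 * (d + \<epsilon> / 2)"
    using assms d by (intro add_nonneg_nonneg mult_nonneg_nonneg) auto
  also have "\<dots> = (8 * v\<^sup>2 + 5 / 6 * (4 * \<epsilon> + d) * v) * (v - s') - 17 / 2 * (s * d\<^sup>2)"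
    unfolding v(1) unfolding v(2,3) by (simp add: power2_eq_square power3_eq_cube field_simps)
  finally have 1: "17 / 2 * (s * d\<^sup>2) \<le> (8 * v\<^sup>2 + 5 / 6 * (4 * \<epsilon> + d) * v) * (v - s')" by simp
  \<comment> \<open>From 4 \<epsilon> < s. This brings in the denominator
    \<open>s - \<epsilon>\<close> of the error constants in place of \<open>v\<close>.\<close>
  have "5 / 6 * (s - \<epsilon>) \<le> v" using assms d by simp
  then have "5 / 6 \<le> v / (s - \<epsilon>)" using pos by (simp add: field_simps)
  then have "(8 * v\<^sup>2 + 5 / 6 * (4 * \<epsilon> + d) * v) * (v - s') \<le> (8 * v\<^sup>2 + v / (s - \<epsilon>) * (4 * \<epsilon> + d) * v) * (v - s')"
    using pos assms d by (intro mult_right_mono add_left_mono) auto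
  also have "\<dots> = (4 + (2 * \<epsilon> + d / 2) / (s - \<epsilon>)) * 2 * (v\<^sup>2 * (v - s'))"
    using pos by (simp add: field_simps power2_eq_square)
  finally have 2: "17 / 2 * (s * d\<^sup>2) \<le> (4 + (2 * \<epsilon> + d / 2) / (s - \<epsilon>)) * 2 * (v\<^sup>2 * (v - s'))"
    by (rule order_trans[OF 1])
  have "0 < s * d\<^sup>2" "0 < v\<^sup>2 * (v - s')" using pos d by auto
  then show ?thesis using 2 by (simp only: pos_divide_le_eq) (simp add: pos_le_divide_eq)
qed

text \<open>\<open>j1\<close> and \<open>j2\<close> address the columns appended for
  \<open>E\<close> and \<open>F\<close>. \<open>g\<close> and \<open>h\<close> are \<Gamma> and
  \<Omega>, \<open>W\<close> and \<open>W'\<close> the inverses of the roots \<open>Z\<close> and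
  \<open>Z'\<close>, and \<open>sc\<close> is \<open>\<Sigma>c1\<close>. \<alpha>, \<beta>,
  \<open>e1\<close>, \<open>e2\<close> bound the factors of \<open>P\<close>, \<open>Q\<close>,
  \<open>P - Pt\<close> and \<open>Q - Qt\<close>.\<close>

locale perturbed_truncation = balanced_truncation +
  fixes St Rt E F j1 j2 g h W Z W' Z' sc :: fmat
    and p1 p2 :: nat and \<alpha> \<beta> e1 e2 \<epsilon> :: real
  assumes S: "S = St + E * tp j1" and R: "R = Rt + F * tp j2"
    and j: "St * j1 = 0" "Rt * j2 = 0" "tp j1 * j1 = ide p1" "tp j2 * j2 = ide p2"
    and jc: "cm m1 p1 j1" "cm m2 p2 j2"
    and EF: "cm n p1 E" "cm n p2 F"
    and opns: "opn S \<le> \<alpha>" "opn St \<le> \<alpha>" "opn R \<le> \<beta>" "opn Rt \<le> \<beta>" "opn E \<le> e1" "opn F \<le> e2"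
    and \<epsilon>: "\<epsilon> = max (\<alpha> * e2) (\<beta> * e1) + e1 * e2"
    and \<epsilon>_gap: "4 * \<epsilon> < s - s'"
    and r: "r > 0"
    and gh: "opn g \<le> 1" "opn h \<le> 1" "cm k1 r g" "cm k2 r h"
    and Z: "cm r r Z" "cm r r W" "tp W = W" "tp Z = Z" "Z * Z = ide r + tp g * g" "Z * W = ide r" "W * Z = ide r"
    and Z': "cm r r Z'" "cm r r W'" "tp W' = W'" "tp Z' = Z'" "Z' * Z' = ide r + tp h * h" "Z' * W' = ide r" "W' * Z' = ide r"
    and cm_sc: "cm r r sc"
    and sc: "tp St * Rt * ((V1 + V2 * h) * W') = (U1 - U2 * g) * W * sc"
      "tp Rt * St * ((U1 - U2 * g) * W) = (V1 + V2 * h) * W' * tp sc"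
begin

definition Uc :: fmat where "Uc = (U1 - U2 * g) * W"
definition Vc :: fmat where "Vc = (V1 + V2 * h) * W'"

lemma sc': "tp St * (Rt * Vc) = Uc * sc" "tp Rt * (St * Uc) = Vc * tp sc"
  using sc by (simp_all add: Uc_def Vc_def mult.assoc)

lemmas rws2 = rws right_diff_distrib left_diff_distrib Z(3,4,6,7) Z'(3,4,6,7)
  Z(6,7)[THEN mult_extend] Z'(6,7)[THEN mult_extend]
  Z(1,2)[THEN cmD(1)] Z(1,2)[THEN cmD(2)] Z(1,2)[THEN cmD(3)] Z(1,2)[THEN cmD(4)]
  Z'(1,2)[THEN cmD(1)] Z'(1,2)[THEN cmD(2)] Z'(1,2)[THEN cmD(3)] Z'(1,2)[THEN cmD(4)]
  gh(3,4)[THEN cmD(1)] gh(3,4)[THEN cmD(2)] gh(3,4)[THEN cmD(3)] gh(3,4)[THEN cmD(4)]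
  cm_sc[THEN cmD(1)] cm_sc[THEN cmD(2)] cm_sc[THEN cmD(3)] cm_sc[THEN cmD(4)]
  cm_sc[THEN cm_tp, THEN cmD(1)] cm_sc[THEN cm_tp, THEN cmD(2)] cm_sc[THEN cm_tp, THEN cmD(3)] cm_sc[THEN cm_tp, THEN cmD(4)]

lemma cm_Uc: "cm m1 r Uc" and cm_Vc: "cm m2 r Vc"
  unfolding Uc_def Vc_def
  by (rule cm_mult[OF cm_diff[OF dims(6) cm_mult[OF dims(7) gh(3)]] Z(2)],
      rule cm_mult[OF cm_add[OF dims(8) cm_mult[OF dims(9) gh(4)]] Z'(2)])

lemma Uc_iso: "tp Uc * Uc = ide r"
proof -
  have "tp Uc * Uc = W * (ide r + tp g * g) * W"
    by (simp add: Uc_def rws2)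
  also have "\<dots> = (W * Z) * (Z * W)" by (simp only: Z(5)[symmetric] mult.assoc)
  finally show ?thesis by (simp add: Z)
qed

lemma Vc_iso: "tp Vc * Vc = ide r"
proof -
  have "tp Vc * Vc = W' * (ide r + tp h * h) * W'"
    by (simp add: Vc_def rws2)
  also have "\<dots> = (W' * Z') * (Z' * W')" by (simp only: Z'(5)[symmetric] mult.assoc)
  finally show ?thesis by (simp add: Z')
qed

lemma U1_Uc: "tp U1 * Uc = W" and V1_Vc: "tp V1 * Vc = W'"
  by (simp_all add: Uc_def Vc_def rws2)

lemma Uc_expand: "Uc = U1 * W - U2 * (g * W)" by (simp add: Uc_def rws2)

lemma e_nonneg: "0 \<le> e1" "0 \<le> e2" "0 \<le> \<alpha>" "0 \<le> \<beta>"
  using opns opn_nonneg order_trans by metis+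

lemma \<epsilon>_bounds: "\<alpha> * e2 \<le> \<epsilon>" "\<beta> * e1 \<le> \<epsilon>" "0 \<le> \<epsilon>"
proof -
  have "0 \<le> e1 * e2" "0 \<le> \<alpha> * e2" using e_nonneg by auto
  then show "\<alpha> * e2 \<le> \<epsilon>" "\<beta> * e1 \<le> \<epsilon>" "0 \<le> \<epsilon>" unfolding \<epsilon> by linarith+
qed

lemma s_pos: "0 < s" using s' gap by linarith

lemma opn_tp_le1: "tp x * x = ide k \<Longrightarrow> opn x \<le> 1" "tp x * x = ide k \<Longrightarrow> opn (tp x) \<le> 1"
  by (simp_all add: opn_isometry_le)

text \<open>The two off-diagonal blocks of the perturbation have orthogonal ranges and orthogonal
  row spaces, so that their norms combine to a maximum and not to a sum.\<close>

lemma opn_perturbation: "opn (tp S * R - tp St * Rt) \<le> \<epsilon>"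
proof -
  define M where "M = max (\<alpha> * e2) (\<beta> * e1)"
  have M0: "0 \<le> M" using e_nonneg by (simp add: M_def le_max_iff_disj)
  define D where "D = tp St * F * tp j2 + j1 * tp E * Rt"
  have eq: "tp S * R - tp St * Rt = D + j1 * (tp E * F) * tp j2"
    by (simp add: S R D_def algebra_simps)
  have opn_j: "opn j1 \<le> 1" "opn (tp j2) \<le> 1" using opn_tp_le1[OF j(3)] opn_tp_le1[OF j(4)] by auto
  have "opn D \<le> M"
  proof (rule opn_leI)
    fix x
    \<comment> \<open>\<open>Rt\<close> annihilates the range of \<open>j2\<close>, so it sees only
      \<open>y\<close>, and the squared norms of \<open>tp j2 * x\<close> and \<open>y\<close> add
      up to that of \<open>x\<close>.\<close>
    define y where "y = x - j2 * (tp j2 * x)"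
    have Ry: "Rt * x = Rt * y" by (simp add: y_def right_diff_distrib j(2)[THEN mult_extend])
    define p q where "p = tp St * (F * (tp j2 * x))" and "q = j1 * (tp E * (Rt * y))"
    have Dx: "D * x = p + q" by (simp add: D_def p_def q_def distrib_right mult.assoc Ry)
    have "inner p q = 0"
      by (simp add: p_def q_def inner_mult_left j(1)[THEN mult_extend])
    then have "(norm (D * x))\<^sup>2 = (norm p)\<^sup>2 + (norm q)\<^sup>2"
      by (simp add: Dx power2_norm_eq_inner inner_add_left inner_add_right inner_commute)
    also have "norm p \<le> M * norm (tp j2 * x)"
    proof -
      have "norm p \<le> opn (tp St * F) * norm (tp j2 * x)"
        unfolding p_def mult.assoc[symmetric] by (subst mult.assoc) (rule norm_mult_opn)
      also have "\<dots> \<le> M * norm (tp j2 * x)"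
        using opn_mult_le[of "tp St" \<alpha> F e2] opns by (intro mult_right_mono) (auto simp: M_def)
      finally show ?thesis .
    qed
    then have "(norm p)\<^sup>2 \<le> (M * norm (tp j2 * x))\<^sup>2" by (intro power_mono) auto
    also have "norm q \<le> M * norm y"
    proof -
      have "norm q \<le> opn (j1 * (tp E * Rt)) * norm y"
        unfolding q_def mult.assoc[symmetric] by (rule norm_mult_opn)
      also have "opn (j1 * (tp E * Rt)) \<le> 1 * (e1 * \<beta>)"
        by (intro opn_mult_le) (use opns opn_j in auto)
      also have "1 * (e1 * \<beta>) \<le> M" by (simp add: M_def mult.commute)
      finally show ?thesis by (simp add: mult_right_mono)
    qed
    then have "(norm q)\<^sup>2 \<le> (M * norm y)\<^sup>2" by (intro power_mono) auto
    also have "(M * norm (tp j2 * x))\<^sup>2 + (M * norm y)\<^sup>2 = M\<^sup>2 * ((norm (tp j2 * x))\<^sup>2 + (norm y)\<^sup>2)"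
      by (simp add: power_mult_distrib distrib_left)
    also have "(norm (tp j2 * x))\<^sup>2 + (norm y)\<^sup>2 = (norm x)\<^sup>2"
    proof -
      have "inner (j2 * (tp j2 * x)) (j2 * (tp j2 * x)) = inner (tp j2 * x) (tp j2 * (j2 * (tp j2 * x)))"
        by (rule inner_mult_left)
      also have "tp j2 * (j2 * (tp j2 * x)) = tp j2 * (x :: fmat)"
      proof -
        have "tp j2 * (j2 * (tp j2 * x)) = ide p2 * (tp j2 * x)" by (simp add: j(4)[THEN mult_extend])
        also have "\<dots> = tp j2 * x" by (rule cmD(3)[OF cm_tp[OF jc(2)]])
        finally show ?thesis .
      qed
      finally have 1: "inner (j2 * (tp j2 * x)) (j2 * (tp j2 * x)) = (norm (tp j2 * x))\<^sup>2"
        by (simp add: power2_norm_eq_inner)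
      have 2: "inner x (j2 * (tp j2 * x)) = (norm (tp j2 * x))\<^sup>2"
        using inner_gram[of x "tp j2"] by simp
      have "inner y y = inner x x - inner (tp j2 * x) (tp j2 * x)"
        unfolding y_def
        by (simp add: inner_diff_left inner_diff_right 1 2 inner_commute[of "j2 * (tp j2 * x)" x] power2_norm_eq_inner)
      then show ?thesis by (simp add: power2_norm_eq_inner)
    qed
    finally have "(norm (D * x))\<^sup>2 \<le> (M * norm x)\<^sup>2" by (simp add: power_mult_distrib)
    then show "norm (D * x) \<le> M * norm x" by (rule power2_le_imp_le) (simp add: M0)
  qed (rule M0)
  moreover have "opn (j1 * (tp E * F) * tp j2) \<le> 1 * (e1 * e2) * 1"
    by (intro opn_mult_le) (use opns opn_j in auto)
  ultimately show ?thesis unfolding eq \<epsilon> M_def[symmetric] by (intro opn_add_le) auto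
qed

lemma norm_Sg_ge: "ide r * x = x \<Longrightarrow> s * norm x \<le> norm (Sg * x)"
proof -
  assume "ide r * x = x"
  then have "x = Si * (Sg * x)" by (simp add: SiSg flip: mult.assoc)
  then have "norm x \<le> opn Si * norm (Sg * x)" using norm_mult_opn[of Si "Sg * x"] by simp
  also have "\<dots> \<le> 1 / s * norm (Sg * x)" by (intro mult_right_mono opn_Si) auto
  finally show ?thesis using s_pos by (simp add: field_simps)
qed

text \<open>For a singular pair of \<open>sc\<close> with singular value \<open>t\<close>, compressing the two singular equations
  to the exact singular subspaces gives \<open>s * p - \<epsilon> \<le> t * q\<close> and \<open>s * q - \<epsilon> \<le> t * p\<close> with
  \<open>p, q \<ge> 2 / 3\<close>; adding them yields \<open>s - t \<le> 3 / 2 * \<epsilon>\<close>.\<close>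

lemma norm_sc_ge:
  assumes "ide r * v = v"
  shows "(s - 3 / 2 * \<epsilon>) * norm v \<le> norm (sc * v)"
proof -
  define H where "H = tp S * R - tp St * Rt"
  have H: "opn H \<le> \<epsilon>" unfolding H_def by (rule opn_perturbation)
  have ide0: "ide r \<noteq> 0"
  proof
    assume "ide r = 0"
    moreover have "ent (ide r) 0 0 = 1" using r by (simp add: ent_sh)
    ultimately show False by simp
  qed
  have "ide r * (tp sc * sc) = tp sc * sc" by (simp add: rws2)
  \<comment> \<open>The least eigenvalue of \<open>tp sc * sc\<close> on columns of length
    \<open>r\<close> belongs to a right singular vector \<open>x\<close> for the smallest singular
    value \<open>t\<close>.\<close>
  from min_eigenvector[OF cm_ide ide_idem tp_ide ide0 _ this]
  obtain x \<mu> where x: "cm r 1 x" "ide r * x = x" "norm x = 1" "tp sc * sc * x = \<mu> *\<^sub>R x"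
    and low: "\<And>v. ide r * v = v \<Longrightarrow> \<mu> * (norm v)\<^sup>2 \<le> inner v (tp sc * sc * v)" by auto
  define y where "y = sc * x"
  define t where "t = norm y"
  have "\<mu> = t\<^sup>2"
  proof -
    have "inner x (tp sc * sc * x) = t\<^sup>2" by (simp add: t_def y_def mult.assoc inner_gram)
    moreover have "inner x (\<mu> *\<^sub>R x) = \<mu>" using x(3) by (simp flip: power2_norm_eq_inner)
    ultimately show ?thesis using x(4) by simp
  qed
  have Uc1: "opn Uc \<le> 1" "opn Vc \<le> 1" "opn (tp U1) \<le> 1" "opn (tp V1) \<le> 1"
    using opn_tp_le1[OF Uc_iso] opn_tp_le1[OF Vc_iso] opn_tp_le1[OF U11] opn_tp_le1[OF V11] by auto
  have eq1: "Sg * (W' * x) = W * y + tp U1 * H * Vc * x"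
  proof -
    have "tp U1 * (tp S * R) * Vc = Sg * W'" by (simp add: rws2 V1_Vc)
    moreover have "tp U1 * (tp St * Rt) * Vc = W * sc" 
      by (simp add: mult.assoc sc' U1_Uc[THEN mult_extend])
    ultimately show ?thesis by (simp add: H_def y_def right_diff_distrib left_diff_distrib mult.assoc)
  qed
  have eq2: "Sg * (W * y) = t\<^sup>2 *\<^sub>R (W' * x) + tp V1 * tp H * Uc * y"
  proof -
    have 1: "tp V1 * (tp R * S) * Uc = Sg * W" by (simp add: rws2 U1_Uc)
    have 2: "tp V1 * (tp Rt * St) * Uc = W' * tp sc"
      by (simp add: mult.assoc sc' V1_Vc[THEN mult_extend])
    have 3: "W' * tp sc * y = t\<^sup>2 *\<^sub>R (W' * x)" 
      using x(4) by (simp add: y_def mult.assoc \<open>\<mu> = t\<^sup>2\<close>)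
    have "tp V1 * tp H * Uc * y = tp V1 * (tp R * S) * Uc * y - tp V1 * (tp Rt * St) * Uc * y"
      by (simp add: H_def right_diff_distrib left_diff_distrib mult.assoc)
    then show ?thesis unfolding 1 2 3 by (simp add: mult.assoc)
  qed
  define p q where "p = norm (W' * x)" and "q = norm (W * y)"
  have y_id: "ide r * y = y" by (simp add: y_def rws2)
  have p: "2 / 3 \<le> p"
    unfolding p_def using cos_factor_bounds(3)[OF Z'(3-7) Z'(1,2) gh(2) x(2)] x(3) by simp
  have q: "2 / 3 * t \<le> q"
    unfolding q_def t_def by (rule cos_factor_bounds(3)[OF Z(3-7) Z(1,2) gh(1) y_id])
  have t0: "0 \<le> t" by (simp add: t_def)
  have e1: "s * p \<le> q + \<epsilon>"
  proof -
    have "s * p \<le> norm (Sg * (W' * x))" unfolding p_def by (rule norm_Sg_ge) (simp add: rws2)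
    also have "\<dots> \<le> q + norm (tp U1 * H * Vc * x)" unfolding eq1 q_def by (rule norm_triangle_ineq)
    also have "norm (tp U1 * H * Vc * x) \<le> opn (tp U1 * H * Vc) * norm x" by (rule norm_mult_opn)
    also have "opn (tp U1 * H * Vc) \<le> 1 * \<epsilon> * 1" by (intro opn_mult_le Uc1 H)
    finally show ?thesis using x(3) by simp
  qed
  have e2: "s * q \<le> t\<^sup>2 * p + \<epsilon> * t"
  proof -
    have "s * q \<le> norm (Sg * (W * y))" unfolding q_def by (rule norm_Sg_ge) (simp add: rws2)
    also have "\<dots> \<le> t\<^sup>2 * p + norm (tp V1 * tp H * Uc * y)"
      unfolding eq2 p_def by (rule order_trans[OF norm_triangle_ineq]) simp
    also have "norm (tp V1 * tp H * Uc * y) \<le> opn (tp V1 * tp H * Uc) * norm y" by (rule norm_mult_opn)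
    also have "opn (tp V1 * tp H * Uc) \<le> 1 * \<epsilon> * 1" by (intro opn_mult_le Uc1) (simp add: H)
    finally show ?thesis by (simp add: t_def mult_right_mono)
  qed
  have "s - 3 / 2 * \<epsilon> \<le> t"
  proof (cases "t = 0")
    case True
    then have "s * p \<le> \<epsilon>" using e1 by (simp add: q_def t_def)
    moreover have "s * (2 / 3) \<le> s * p" using p s_pos by (intro mult_left_mono) auto
    ultimately show ?thesis using True by simp
  next
    case False
    then have t: "t > 0" using t0 by simp
    \<comment> \<open>The left singular vector is \<open>y / t\<close>; so \<open>q'\<close> is the
      norm that enters the inequalities announced above.\<close>
    define q' where "q' = q / t"
    have q': "q = q' * t" "2 / 3 \<le> q'" using t q by (auto simp: q'_def field_simps)
    have "s * q' \<le> t * p + \<epsilon>" using e2 t by (simp add: q'(1) power2_eq_square) (metis distrib_right mult.assoc mult.commute mult_le_cancel_right_pos)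
    then have sum: "(s - t) * (p + q') \<le> 2 * \<epsilon>" using e1 by (simp add: q'(1) algebra_simps)
    show ?thesis
    proof (cases "t < s")
      case True
      then have "(s - t) * (4 / 3) \<le> (s - t) * (p + q')" using p q' by (intro mult_left_mono) auto
      then show ?thesis using sum by simp
    qed (use \<epsilon>_bounds in auto)
  qed
  moreover have "(t * norm v)\<^sup>2 \<le> (norm (sc * v))\<^sup>2"
    using low[OF assms] by (simp add: mult.assoc inner_gram \<open>\<mu> = t\<^sup>2\<close> power_mult_distrib)
  then have "t * norm v \<le> norm (sc * v)" by (rule power2_le_imp_le) simp
  ultimately show ?thesis by (meson mult_right_mono norm_ge_zero order_trans)
qed

end

text \<open>Whatever the left factor, \<open>X1 * tp Y1\<close> is a spectral projector of \<open>P * Q\<close>; the components of the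
  approximate bases off this projector are therefore of second order in \<open>\<epsilon>\<close>, although the angles
  between the singular subspaces are only of first order.\<close>

locale reduced_truncation = perturbed_truncation +
  fixes si :: fmat
  assumes cm_si: "cm r r si" and si: "si * sc = ide r" "sc * si = ide r"
begin

text \<open>By \<open>norm_sc_ge\<close> a lower bound for the singular values of
  \<open>sc\<close>.\<close>

abbreviation w :: real where "w \<equiv> s - 3 / 2 * \<epsilon>"

definition Xt :: fmat where "Xt = St * Uc"
definition Yt :: fmat where "Yt = Rt * Vc * si"
definition ared :: fmat where "ared = tp Yt * a * Xt"
text \<open>\<open>W = tp Y1 * Xt\<close> by \<open>Y1_Xt\<close>. So \<open>Nx\<close> and
  \<open>Ny\<close> are what the projector \<open>X1 * tp Y1\<close> and its transpose leave of
  \<open>Xt\<close> and \<open>Yt\<close>.\<close>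

definition Nx :: fmat where "Nx = Xt - X1 * W"
definition Ny :: fmat where "Ny = Yt - Y1 * (tp X1 * Yt)"
text \<open>The basis change is chosen so that \<open>tp Y1 * Xh = W * Z = ide r\<close>: the
  component of \<open>Xh\<close> along \<open>X1\<close> is then exactly \<open>X1\<close>, and the
  difference is off the projector.\<close>

definition Xh :: fmat where "Xh = Xt * Z"
definition Yh :: fmat where "Yh = Yt * W"

lemma tsi: "tp sc * tp si = ide r" "tp si * tp sc = ide r"
  using si[THEN arg_cong, of tp] by simp_all

lemma w_pos: "0 < w" "s' < w"
  using \<epsilon>_gap \<epsilon>_bounds s' by linarith+

lemma opn_si: "opn si \<le> 1 / w"
proof (rule opn_leI)
  fix x
  have "w * norm (si * x) \<le> norm (sc * (si * x))"
    by (rule norm_sc_ge) (use cm_si in \<open>simp add: cmD\<close>)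
  also have "sc * (si * x) = ide r * x" by (simp add: si[THEN mult_extend])
  also have "norm (ide r * x) \<le> 1 * norm x"
    by (rule order_trans[OF norm_mult_opn]) (intro mult_right_mono opn_ide_le norm_ge_zero)
  finally show "norm (si * x) \<le> 1 / w * norm x" using w_pos by (simp add: field_simps)
qed (use w_pos in simp)

lemma Uc_eq: "Uc = tp St * (Rt * (Vc * si))"
proof -
  have "tp St * (Rt * (Vc * si)) = (tp St * (Rt * Vc)) * si" by (simp add: mult.assoc)
  also have "\<dots> = Uc" using cm_Uc by (simp add: sc' mult.assoc si cmD)
  finally show ?thesis ..
qed

lemma Vc_eq: "Vc = tp Rt * (St * (Uc * tp si))"
proof -
  have "tp Rt * (St * (Uc * tp si)) = (tp Rt * (St * Uc)) * tp si" by (simp add: mult.assoc)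
  also have "\<dots> = Vc" using cm_Vc by (simp add: sc' mult.assoc tsi cmD)
  finally show ?thesis ..
qed

text \<open>\<open>Uc\<close> lies in the range of \<open>tp St * Rt\<close> and hence has no weight
  on the appended coordinates. So the exact factor \<open>S\<close> gives the same basis as
  \<open>St\<close>, which makes the exact singular vectors applicable to it.\<close>

lemma Xt_S: "Xt = S * Uc"
proof -
  have "tp j1 * Uc = 0" unfolding Uc_eq using j(1)[THEN arg_cong, of tp] by (simp add: mult_extend[of _ _ 0])
  then show ?thesis by (simp add: Xt_def S distrib_right mult.assoc)
qed

lemma Yt_R: "Yt = R * (Vc * si)"
proof -
  have "tp j2 * Vc = 0" unfolding Vc_eq using j(2)[THEN arg_cong, of tp] by (simp add: mult_extend[of _ _ 0])
  then have "tp j2 * (Vc * si) = 0" by (simp flip: mult.assoc)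
  then show ?thesis by (simp add: Yt_def R distrib_right mult.assoc)
qed

lemma P_split: "P = St * tp St + E * tp E" and Q_split: "Q = Rt * tp Rt + F * tp F"
proof -
  have 1: "tp j1 * tp St = 0" "tp j2 * tp Rt = 0"
    using j(1)[THEN arg_cong, of tp] j(2)[THEN arg_cong, of tp] by simp_all
  show "P = St * tp St + E * tp E" unfolding PS S using EF(1)
    by (simp add: distrib_left distrib_right mult.assoc 1 j(1)[THEN mult_extend] j(3)[THEN mult_extend] cmD)
  show "Q = Rt * tp Rt + F * tp F" unfolding QR R using EF(2)
    by (simp add: distrib_left distrib_right mult.assoc 1 j(2)[THEN mult_extend] j(4)[THEN mult_extend] cmD)
qed

text \<open>\<open>St * tp St\<close> maps \<open>Yt\<close> exactly to \<open>Xt\<close>; the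
  defect is the part of \<open>P\<close> that the approximation misses.\<close>

lemma P_Yt: "P * Yt = Xt + E * (tp E * Yt)"
  unfolding P_split Yt_def Xt_def
  by (simp add: distrib_right mult.assoc flip: Uc_eq)

lemma Q_Xt: "Q * Xt = Yt * (sc * tp sc) + F * (tp F * Xt)"
proof -
  have "Yt * (sc * tp sc) = Rt * (Vc * tp sc)"
    by (simp add: Yt_def mult.assoc si[THEN mult_extend] cmD(1)[OF cm_tp[OF cm_sc]])
  then show ?thesis
    unfolding Q_split Xt_def by (simp add: distrib_right mult.assoc sc')
qed

lemma Y1_Xt: "tp Y1 * Xt = W"
  by (simp add: Xt_S Y1_def rws2 U1_Uc)

lemma Yt_Xt: "tp Yt * Xt = ide r"
  by (simp add: Yt_def Xt_def mult.assoc)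
     (simp add: sc' Vc_iso[THEN mult_extend] tsi cmD cm_sc cm_tp rws2)

lemma cm_XtYt: "cm n r Xt" "cm n r Yt"
  unfolding Xt_S Yt_R by (rule cm_mult[OF dims(4) cm_Uc] cm_mult[OF dims(5) cm_mult[OF cm_Vc cm_si]])+

text \<open>Apply the complementary projector to \<open>P_Yt\<close>. It passes through
  \<open>P\<close> and becomes the one that defines \<open>Ny\<close>; the source contains
  \<open>E\<close> twice, which makes it of second order.\<close>

lemma Nx_eq: "Nx = P * Ny - (E - X1 * (tp Y1 * E)) * (tp E * Yt)"
proof -
  have "tp X1 * Yt = tp Y1 * (P * Yt)" by (simp add: tp_Y1_P[THEN mult_extend])
  also have "\<dots> = W + tp Y1 * (E * (tp E * Yt))" by (simp add: P_Yt distrib_left Y1_Xt)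
  finally have "P * Ny = Xt + E * (tp E * Yt) - X1 * (W + tp Y1 * (E * (tp E * Yt)))"
    by (simp add: Ny_def right_diff_distrib P_Yt PY1[THEN mult_extend])
  then show ?thesis by (simp add: Nx_def algebra_simps)
qed

lemma Ny_eq: "Ny * (sc * tp sc) = Q * Nx - (F - Y1 * (tp X1 * F)) * (tp F * Xt)"
proof -
  have "tp X1 * (Yt * (sc * tp sc)) = tp X1 * (Q * Xt) - tp X1 * (F * (tp F * Xt))"
    by (simp add: Q_Xt distrib_left)
  also have "tp X1 * (Q * Xt) = Sg * Sg * W"
    by (simp add: tp_X1_Q[THEN mult_extend] mult.assoc Y1_Xt)
  finally have 1: "Ny * (sc * tp sc) = Yt * (sc * tp sc) - Y1 * (Sg * Sg * W - tp X1 * (F * (tp F * Xt)))"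
    by (simp add: Ny_def left_diff_distrib mult.assoc)
  have 2: "Q * Nx = Yt * (sc * tp sc) + F * (tp F * Xt) - Y1 * (Sg * Sg * W)"
    by (simp add: Nx_def right_diff_distrib Q_Xt QX1[THEN mult_extend] mult.assoc)
  show ?thesis unfolding 1 2 by (simp add: algebra_simps)
qed

abbreviation nx :: fmat where "nx \<equiv> tp R * Nx"
abbreviation ny :: fmat where "ny \<equiv> tp S * Ny"

lemma opn_iso: "opn U2 \<le> 1" "opn V2 \<le> 1" "opn (tp U2) \<le> 1" "opn (tp V2) \<le> 1" "opn Uc \<le> 1" "opn Vc \<le> 1"
   "opn U1 \<le> 1" "opn V1 \<le> 1"
  using opn_tp_le1[OF U22] opn_tp_le1[OF V22] opn_tp_le1[OF Uc_iso] opn_tp_le1[OF Vc_iso]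
    opn_tp_le1[OF U11] opn_tp_le1[OF V11] by auto

lemma opn_bases: "opn X1 \<le> \<alpha>" "opn Y1 \<le> \<beta> / s" "opn Xt \<le> \<alpha>" "opn Yt \<le> \<beta> / w"
proof -
  show "opn X1 \<le> \<alpha>" using opn_mult_le[OF opns(1) opn_iso(7)] by (simp add: X1_def)
  show "opn Xt \<le> \<alpha>" using opn_mult_le[OF opns(2) opn_iso(5)] by (simp add: Xt_def)
  show "opn Y1 \<le> \<beta> / s" using opn_mult_le[OF opn_mult_le[OF opns(3) opn_iso(8)] opn_Si] by (simp add: Y1_def)
  show "opn Yt \<le> \<beta> / w" using opn_mult_le[OF opn_mult_le[OF opns(4) opn_iso(6)] opn_si] by (simp add: Yt_def)
qed

lemma EYt: "opn (tp E * Yt) \<le> e1 * (\<beta> / w)" and FXt: "opn (tp F * Xt) \<le> e2 * \<alpha>"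
  by (rule opn_mult_le; use opns opn_bases in simp)+

text \<open>\<open>ny\<close> is orthogonal to the columns of \<open>U1\<close>, so
  \<open>tp R * S\<close> acts on it through \<open>Sg2\<close> alone, with norm at most
  \<open>s'\<close>. The source likewise survives only in the directions \<open>V2\<close>.\<close>

lemma nx_le: "opn nx \<le> s' * opn ny + \<epsilon>\<^sup>2 / w"
proof -
  have U1ny: "tp U1 * ny = 0"
  proof -
    have "tp U1 * ny = tp X1 * Ny" by (simp add: X1_def mult.assoc)
    also have "\<dots> = 0"
      by (simp add: Ny_def right_diff_distrib X1Y1[THEN mult_extend] cmD(3)[OF cm_tp[OF cm_X1]])
    finally show ?thesis .
  qed
  have "nx = (tp R * S) * ny - (tp R * (E - X1 * (tp Y1 * E))) * (tp E * Yt)"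
    by (subst Nx_eq) (simp add: PS right_diff_distrib left_diff_distrib mult.assoc)
  also have "(tp R * S) * ny = V2 * (tp Sg2 * (tp U2 * ny))"
    by (simp only: svd' distrib_right mult.assoc U1ny mult_zero_right add_0_left)
  also have "tp R * (E - X1 * (tp Y1 * E)) = V2 * (tp V2 * (tp R * E))"
  proof -
    have "tp R * E = (V1 * tp V1 + V2 * tp V2) * (tp R * E)" unfolding VV by (simp add: rws)
    then have "tp R * E = V1 * (tp V1 * (tp R * E)) + V2 * (tp V2 * (tp R * E))"
      by (simp add: distrib_right mult.assoc)
    moreover have "tp R * (X1 * (tp Y1 * E)) = V1 * (tp V1 * (tp R * E))"
      by (simp add: X1_def Y1_def rws)
    ultimately show ?thesis unfolding right_diff_distrib by (metis add_diff_cancel_left')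
  qed
  finally have eq: "nx = V2 * (tp Sg2 * (tp U2 * ny)) - V2 * (tp V2 * (tp R * E)) * (tp E * Yt)" .
  have "opn (V2 * (tp Sg2 * (tp U2 * ny))) \<le> 1 * (s' * (1 * opn ny))"
    by (intro opn_mult_le) (simp_all add: opn_iso opn_Sg2 del: opn_tp, simp_all add: opn_Sg2)
  moreover have "opn (V2 * (tp V2 * (tp R * E)) * (tp E * Yt)) \<le> (1 * (1 * (\<beta> * e1))) * (e1 * (\<beta> / w))"
    by (intro opn_mult_le EYt) (use opns opn_iso in auto)
  ultimately have "opn nx \<le> 1 * (s' * (1 * opn ny)) + (1 * (1 * (\<beta> * e1))) * (e1 * (\<beta> / w))"
    unfolding eq by (rule opn_diff_le)
  also have "\<dots> = s' * opn ny + (\<beta> * e1)\<^sup>2 / w" by (simp add: power2_eq_square)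
  also have "\<dots> \<le> s' * opn ny + \<epsilon>\<^sup>2 / w"
    using e_nonneg \<epsilon>_bounds w_pos by (intro add_left_mono divide_right_mono power_mono) auto
  finally show ?thesis .
qed

lemma mult_si: "cm k r x \<Longrightarrow> x * (sc * tp sc) * (tp si * si) = x"
proof -
  assume x: "cm k r x"
  have "x * (sc * tp sc) * (tp si * si) = x * (sc * (tp sc * tp si) * si)" by (simp add: mult.assoc)
  also have "\<dots> = x * ide r" using cm_sc by (simp add: tsi si cmD mult.assoc)
  finally show ?thesis using x by (simp add: cmD)
qed

lemma opn_si2: "opn (tp si * si) \<le> 1 / w\<^sup>2"
  using opn_mult_le[of "tp si" "1 / w" si "1 / w"] opn_si by (simp add: power2_eq_square)

text \<open>The counterpart with \<open>V1\<close> and \<open>nx\<close>; in addition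
  \<open>sc * tp sc\<close> has to be inverted, which costs 1 / w^2.\<close>

lemma ny_le: "opn ny \<le> (s' * opn nx + \<epsilon>\<^sup>2) / w\<^sup>2"
proof -
  have V1nx: "tp V1 * nx = 0"
  proof -
    have "tp V1 * nx = Sg * (tp Y1 * Nx)" by (simp add: Y1_def rws)
    also have "tp Y1 * Nx = 0" 
      by (simp add: Nx_def right_diff_distrib Y1_Xt Y1X1[THEN mult_extend] rws2)
    finally show ?thesis by simp
  qed
  have cm_ny: "cm m1 r ny"
    unfolding Ny_def
    by (rule cm_mult[OF cm_tp[OF dims(4)] cm_diff[OF cm_XtYt(2) cm_mult[OF cm_Y1 cm_mult[OF cm_tp[OF cm_X1] cm_XtYt(2)]]]])
  have "ny * (sc * tp sc) = tp S * (Ny * (sc * tp sc))" by (simp add: mult.assoc)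
  also have "\<dots> = (tp S * R) * nx - (tp S * (F - Y1 * (tp X1 * F))) * (tp F * Xt)"
    unfolding Ny_eq by (simp add: QR right_diff_distrib left_diff_distrib mult.assoc)
  also have "(tp S * R) * nx = U2 * (Sg2 * (tp V2 * nx))"
    by (simp only: svd distrib_right mult.assoc V1nx mult_zero_right add_0_left)
  also have "tp S * (F - Y1 * (tp X1 * F)) = U2 * (tp U2 * (tp S * F))"
  proof -
    have "tp S * F = (U1 * tp U1 + U2 * tp U2) * (tp S * F)" unfolding UU by (simp add: rws)
    then have "tp S * F = U1 * (tp U1 * (tp S * F)) + U2 * (tp U2 * (tp S * F))"
      by (simp add: distrib_right mult.assoc)
    moreover have "tp S * (Y1 * (tp X1 * F)) = U1 * (tp U1 * (tp S * F))"
      by (simp add: X1_def Y1_def rws)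
    ultimately show ?thesis unfolding right_diff_distrib by (metis add_diff_cancel_left')
  qed
  finally have eq: "ny * (sc * tp sc) = U2 * (Sg2 * (tp V2 * nx)) - U2 * (tp U2 * (tp S * F)) * (tp F * Xt)" .
  have "opn (U2 * (Sg2 * (tp V2 * nx))) \<le> 1 * (s' * (1 * opn nx))"
    by (intro opn_mult_le opn_iso opn_Sg2 order_refl)
  moreover have "opn (U2 * (tp U2 * (tp S * F)) * (tp F * Xt)) \<le> (1 * (1 * (\<alpha> * e2))) * (e2 * \<alpha>)"
    by (intro opn_mult_le FXt) (use opns opn_iso in auto)
  ultimately have "opn (ny * (sc * tp sc)) \<le> 1 * (s' * (1 * opn nx)) + (1 * (1 * (\<alpha> * e2))) * (e2 * \<alpha>)"
    unfolding eq by (rule opn_diff_le)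
  also have "\<dots> = s' * opn nx + (\<alpha> * e2)\<^sup>2" by (simp add: power2_eq_square)
  also have "\<dots> \<le> s' * opn nx + \<epsilon>\<^sup>2"
    using e_nonneg \<epsilon>_bounds by (intro add_left_mono power_mono) auto
  finally have "opn (ny * (sc * tp sc) * (tp si * si)) \<le> (s' * opn nx + \<epsilon>\<^sup>2) * (1 / w\<^sup>2)"
    by (rule opn_mult_le[OF _ opn_si2])
  then show ?thesis unfolding mult_si[OF cm_ny] by simp
qed

lemma ny_bound: "opn ny \<le> \<epsilon>\<^sup>2 / (w * (w - s'))"
  and nx_bound: "opn nx \<le> \<epsilon>\<^sup>2 / (w - s')"
proof -
  have "w\<^sup>2 * opn ny \<le> s' * opn nx + \<epsilon>\<^sup>2"
    using ny_le w_pos by (simp add: pos_le_divide_eq mult.commute)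
  from coupled_bounds[OF s' w_pos(2) nx_le this]
  show "opn ny \<le> \<epsilon>\<^sup>2 / (w * (w - s'))" "opn nx \<le> \<epsilon>\<^sup>2 / (w - s')" by auto
qed

text \<open>Compares \<open>e1\<close> with \<alpha> \<epsilon> / s and \<open>e2\<close> with
  \<beta> \<epsilon> / s below, since \<beta> e1 and \<alpha> e2 are at most \<epsilon>.\<close>

lemma s_le: "s \<le> \<alpha> * \<beta>"
proof -
  have ide0: "norm (ide r) > 0" using norm_ide[of r] r by (metis of_nat_0_less_iff zero_less_power2 norm_ge_zero less_le)
  have "Sg = tp U1 * (tp S * R) * V1" by (simp add: rws)
  then have "opn Sg \<le> 1 * (\<alpha> * \<beta>) * 1"
    by simp (intro opn_mult_le[of _ "1 * (\<alpha> * \<beta>)" _ 1, simplified] opn_mult_le[of _ 1 _ "\<alpha> * \<beta>", simplified]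
        opn_mult_le opn_iso; simp add: opns opn_iso)
  moreover have "s * norm (ide r) \<le> norm (Sg * ide r)" by (rule norm_Sg_ge) simp
  moreover have "norm (Sg * ide r) \<le> opn Sg * norm (ide r)" by (rule norm_mult_opn)
  ultimately have "s * norm (ide r) \<le> (\<alpha> * \<beta>) * norm (ide r)"
    by (smt (verit) mult_right_mono norm_ge_zero)
  then show ?thesis using ide0 by (simp add: mult_le_cancel_right)
qed

lemma opn_off_E: "opn (E - X1 * (tp Y1 * E)) \<le> 2 * \<alpha> * \<epsilon> / s"
proof -
  have "opn (E - X1 * (tp Y1 * E)) \<le> e1 + \<alpha> * (\<beta> / s * e1)"
    by (intro opn_diff_le opn_mult_le opns opn_bases) (simp add: opn_bases)
  moreover have "e1 \<le> \<alpha> * \<epsilon> / s"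
  proof -
    have "e1 * s \<le> e1 * (\<alpha> * \<beta>)" by (intro mult_left_mono s_le e_nonneg)
    also have "\<dots> = \<alpha> * (\<beta> * e1)" by simp
    also have "\<dots> \<le> \<alpha> * \<epsilon>" by (intro mult_left_mono \<epsilon>_bounds e_nonneg)
    finally show ?thesis using s_pos by (simp add: field_simps)
  qed
  moreover have "\<alpha> * (\<beta> / s * e1) \<le> \<alpha> * \<epsilon> / s"
    using mult_left_mono[OF \<epsilon>_bounds(2) e_nonneg(3)] s_pos by (simp add: divide_right_mono)
  ultimately show ?thesis by simp
qed

lemma opn_off_F: "opn (F - Y1 * (tp X1 * F)) \<le> 2 * \<beta> * \<epsilon> / s"
proof -
  have "opn (F - Y1 * (tp X1 * F)) \<le> e2 + \<beta> / s * (\<alpha> * e2)"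
    by (intro opn_diff_le opn_mult_le opns opn_bases) (simp add: opn_bases)
  moreover have "e2 \<le> \<beta> * \<epsilon> / s"
  proof -
    have "e2 * s \<le> e2 * (\<alpha> * \<beta>)" by (intro mult_left_mono s_le e_nonneg)
    also have "\<dots> = \<beta> * (\<alpha> * e2)" by simp
    also have "\<dots> \<le> \<beta> * \<epsilon>" by (intro mult_left_mono \<epsilon>_bounds e_nonneg)
    finally show ?thesis using s_pos by (simp add: field_simps)
  qed
  moreover have "\<beta> / s * (\<alpha> * e2) \<le> \<beta> * \<epsilon> / s"
    using mult_left_mono[OF \<epsilon>_bounds(1) e_nonneg(4)] s_pos by (simp add: divide_right_mono)
  ultimately show ?thesis by simp
qed

text \<open>The constant 3 is 1 for the homogeneous part plus 2 for the source, whose factor off the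
  projector has two summands.\<close>

lemma Nx_bound: "opn Nx \<le> 3 * \<alpha> * \<epsilon>\<^sup>2 / (w * (w - s'))"
proof -
  have "Nx = S * ny - (E - X1 * (tp Y1 * E)) * (tp E * Yt)"
    by (subst Nx_eq) (simp add: PS mult.assoc)
  also have "opn \<dots> \<le> \<alpha> * (\<epsilon>\<^sup>2 / (w * (w - s'))) + (2 * \<alpha> * \<epsilon> / s) * (e1 * (\<beta> / w))"
    by (intro opn_diff_le opn_mult_le[OF opns(1) ny_bound] opn_mult_le[OF opn_off_E EYt])
  also have "(2 * \<alpha> * \<epsilon> / s) * (e1 * (\<beta> / w)) \<le> (2 * \<alpha> * \<epsilon> / (w - s')) * (\<epsilon> / w)"
    using e_nonneg \<epsilon>_bounds w_pos s_pos s'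
    by (intro mult_mono divide_left_mono mult_nonneg_nonneg)
       (auto simp: mult.commute[of e1] divide_right_mono)
  finally show ?thesis by (simp add: power2_eq_square mult_ac)
qed

lemma Ny_bound: "opn Ny \<le> 3 * \<beta> * \<epsilon>\<^sup>2 / (w\<^sup>2 * (w - s'))"
proof -
  have cm_Ny: "cm n r Ny"
    unfolding Ny_def by (rule cm_diff[OF cm_XtYt(2) cm_mult[OF cm_Y1 cm_mult[OF cm_tp[OF cm_X1] cm_XtYt(2)]]])
  have "Ny * (sc * tp sc) = R * nx - (F - Y1 * (tp X1 * F)) * (tp F * Xt)"
    by (subst Ny_eq) (simp add: QR mult.assoc)
  also have "opn \<dots> \<le> \<beta> * (\<epsilon>\<^sup>2 / (w - s')) + (2 * \<beta> * \<epsilon> / s) * (e2 * \<alpha>)"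
    by (intro opn_diff_le opn_mult_le[OF opns(3) nx_bound] opn_mult_le[OF opn_off_F FXt])
  also have "(2 * \<beta> * \<epsilon> / s) * (e2 * \<alpha>) \<le> (2 * \<beta> * \<epsilon> / (w - s')) * \<epsilon>"
    using e_nonneg \<epsilon>_bounds w_pos s_pos s'
    by (intro mult_mono divide_left_mono mult_nonneg_nonneg) (auto simp: mult.commute[of e2])
  finally have "opn (Ny * (sc * tp sc)) \<le> 3 * \<beta> * \<epsilon>\<^sup>2 / (w - s')" by (simp add: power2_eq_square mult_ac)
  from opn_mult_le[OF this opn_si2] show ?thesis unfolding mult_si[OF cm_Ny] by (simp add: mult.commute)
qed

lemma Xh_eq: "Xh - X1 = Nx * Z"
  using cm_X1 by (simp add: Xh_def Nx_def left_diff_distrib mult.assoc Z cmD)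

text \<open>Unlike \<open>Xh\<close>, the basis \<open>Yh\<close> also deviates along
  \<open>Y1\<close>. Biorthogonality of \<open>Xt\<close> and \<open>Yt\<close> determines this
  deviation: it is \<open>tp g\<close> times a compression of \<open>ny\<close>, so it is small like
  \<open>ny\<close> as well.\<close>

lemma Yh_eq: "Yh - Y1 = Ny * W + Y1 * (tp g * (tp U2 * (ny * W)))"
proof -
  have Nx': "Nx = - (S * (U2 * (g * W)))"
    by (simp add: Nx_def Xt_S X1_def Uc_expand right_diff_distrib mult.assoc)
  have "Xt = Nx + X1 * W" by (simp add: Nx_def)
  then have "tp Yt * (Nx + X1 * W) * Z = Z"
    using Yt_Xt Z(1) by (simp add: cmD)
  then have "tp Yt * X1 = Z - tp Yt * (Nx * Z)"
    using cm_X1 by (simp add: distrib_left distrib_right mult.assoc Z cmD algebra_simps)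
  from arg_cong[OF this, of tp] have "tp X1 * Yt = Z - Z * (tp Nx * Yt)"
    by (simp add: Z mult.assoc)
  also have "Z * (tp Nx * Yt) = - (tp g * (tp U2 * (tp S * Yt)))"
    unfolding Nx' by (simp add: mult.assoc Z(3) Z(6)[THEN mult_extend] cmD(3)[OF cm_tp[OF gh(3)]])
  also have "tp U2 * (tp S * Yt) = tp U2 * ny"
    by (simp add: Ny_def right_diff_distrib) (simp add: Y1_def rws)
  finally have XY: "tp X1 * Yt = Z + tp g * (tp U2 * ny)" by simp
  have "Yh = (Ny + Y1 * (tp X1 * Yt)) * W" by (simp add: Yh_def Ny_def)
  also have "\<dots> = Ny * W + Y1 * (Z * W + tp g * (tp U2 * ny) * W)"
    by (simp add: XY distrib_left distrib_right mult.assoc)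
  finally show ?thesis using cm_Y1 by (simp add: Z cmD distrib_left mult.assoc)
qed

lemma opn_WZ: "opn W \<le> 1" "opn Z \<le> 3 / 2"
  by (rule cos_factor_bounds[OF Z(3-7) Z(1,2) gh(1)])+

lemma opn_hat: "opn Xh \<le> 3 / 2 * \<alpha>" "opn Yh \<le> \<beta> / w"
  using opn_mult_le[OF opn_bases(3) opn_WZ(2)] opn_mult_le[OF opn_bases(4) opn_WZ(1)]
  by (simp_all add: Xh_def Yh_def mult.commute)

abbreviation d :: real where "d \<equiv> s - s' - 2 * \<epsilon>"

lemma Xh_X1: "opn (Xh - X1) \<le> 9 / 2 * \<alpha> * \<epsilon>\<^sup>2 / (w * (w - s'))"
proof -
  have "9 / 2 * \<alpha> * \<epsilon>\<^sup>2 / K = 3 * \<alpha> * \<epsilon>\<^sup>2 / K * (3 / 2)" for K by simp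
  then show ?thesis unfolding Xh_eq using opn_mult_le[OF Nx_bound opn_WZ(2)] by (simp only:)
qed

text \<open>The constant is 3 from \<open>Ny_bound\<close> plus 1 from the deviation along
  \<open>Y1\<close>.\<close>

lemma Yh_Y1: "opn (Yh - Y1) \<le> 4 * \<beta> * \<epsilon>\<^sup>2 / (w\<^sup>2 * (w - s'))"
proof -
  have "opn (Yh - Y1) \<le> 3 * \<beta> * \<epsilon>\<^sup>2 / (w\<^sup>2 * (w - s')) * 1
      + \<beta> / s * (1 * (1 * (\<epsilon>\<^sup>2 / (w * (w - s')) * 1)))"
    unfolding Yh_eq
    by (intro opn_add_le opn_mult_le Ny_bound opn_WZ opn_bases ny_bound) (simp_all add: gh opn_iso del: opn_tp, simp_all add: gh)
  also have "\<beta> / s * (1 * (1 * (\<epsilon>\<^sup>2 / (w * (w - s')) * 1))) \<le> \<beta> / w * (1 * (1 * (\<epsilon>\<^sup>2 / (w * (w - s')) * 1)))"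
    using w_pos s_pos e_nonneg \<epsilon>_bounds by (intro mult_right_mono divide_left_mono) auto
  finally show ?thesis by (simp add: power2_eq_square mult_ac)
qed

lemma Xh_X1': "opn (Xh - X1) \<le> 8 / 5 * \<alpha> * (\<epsilon> / d)"
proof -
  have "9 / 2 * \<alpha> * \<epsilon>\<^sup>2 / (w * (w - s')) = (\<alpha> * \<epsilon>) * (9 / 2 * \<epsilon> / (w * (w - s')))"
    by (simp add: power2_eq_square)
  also have "\<dots> \<le> (\<alpha> * \<epsilon>) * (8 / 5 / d)"
    using base_scalar_bound[OF \<epsilon>_bounds(3) s' _ refl refl, of s] \<epsilon>_gap e_nonneg \<epsilon>_bounds
    by (intro mult_left_mono) auto
  finally show ?thesis using Xh_X1 by simp
qed

text \<open>The second order is kept here, unlike in \<open>Xh_X1'\<close>: compared with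
  \<open>6 * (\<beta> / s) * (\<epsilon> / d) \<le> ey\<close> a factor \<epsilon> / d is left over,
  and this is the gain on the controllability side.\<close>

lemma Yh_Y1': "opn (Yh - Y1) \<le> 9 / 2 * (\<epsilon> / d)\<^sup>2 * (\<beta> / s)"
proof -
  have "4 * \<beta> * \<epsilon>\<^sup>2 / (w\<^sup>2 * (w - s')) = (\<beta> * \<epsilon>\<^sup>2) * (4 / (w\<^sup>2 * (w - s')))" by simp
  also have "\<dots> \<le> (\<beta> * \<epsilon>\<^sup>2) * (9 / 2 / (d\<^sup>2 * s))"
    using left_base_scalar_bound[OF \<epsilon>_bounds(3) s' _ refl refl, of s] \<epsilon>_gap e_nonneg
    by (intro mult_left_mono) auto
  finally show ?thesis using Yh_Y1 by (simp add: power_divide mult_ac)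
qed

text \<open>The last factor is the lower bound for \<epsilon>a from
  \<open>error_constants_lower\<close>, so the difference is at most \<epsilon> / d times
  \<open>opn a\<close> times \<epsilon>a. The 17/2 inside is 9/2 for the right basis plus 4 for the
  left one.\<close>

lemma reduced_A_diff:
  "opn (tp Yh * a * Xh - tp Y1 * a * X1) \<le>
    opn a * (\<epsilon> / d) * (\<alpha> * (\<beta> / s) * (4 + (2 * \<epsilon> + d / 2) / (s - \<epsilon>)) * (2 * (\<epsilon> / d)))"
proof -
  have "tp Yh * a * Xh - tp Y1 * a * X1 = tp Yh * a * (Xh - X1) + tp (Yh - Y1) * a * X1"
    by (simp add: algebra_simps)
  also have "opn \<dots> \<le> \<beta> / w * opn a * (9 / 2 * \<alpha> * \<epsilon>\<^sup>2 / (w * (w - s')))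
      + 4 * \<beta> * \<epsilon>\<^sup>2 / (w\<^sup>2 * (w - s')) * opn a * \<alpha>"
    by (intro opn_add_le opn_mult_le Xh_X1 opn_bases order_refl)
       (simp_all only: opn_tp opn_hat Yh_Y1)
  also have "\<dots> = (opn a * \<alpha> * \<beta> * \<epsilon>\<^sup>2) * (17 / 2 / (w\<^sup>2 * (w - s')))"
    by (simp add: power2_eq_square mult_ac)
  also have "\<dots> \<le> (opn a * \<alpha> * \<beta> * \<epsilon>\<^sup>2) * ((4 + (2 * \<epsilon> + d / 2) / (s - \<epsilon>)) * 2 / (s * d\<^sup>2))"
    using product_scalar_bound[OF \<epsilon>_bounds(3) s' _ refl refl, of s] \<epsilon>_gap e_nonneg
    by (intro mult_left_mono mult_nonneg_nonneg) auto
  finally show ?thesis by (simp add: power2_eq_square mult_ac)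
qed

end

section \<open>Gramians of the error system\<close>

lemma ide_tp_sh: "ide b * tp (sh a b) = tp (sh a b)"
  by (rule fmat_eqI) (auto simp: ent_ide_mult ent_sh)

lemma cm_corner: "cm (r + r) (r + r) P \<Longrightarrow> cm r r W \<Longrightarrow> cm r r (ide r * P * sh r r * W)"
proof -
  assume "cm (r + r) (r + r) P" and W: "cm r r W"
  moreover have "cm r (r + r) (ide r)" by (simp add: cm_def ide_ide)
  moreover have "cm (r + r) r (sh r r)" by (rule cm_sh) simp
  ultimately show ?thesis by (meson cm_mult)
qed

lemma em_mat_integral:
  assumes e: "expdecay n a \<Phi>" and f: "\<And>t. f t \<in> carrier_mat n n" "\<And>t. em (f t) = \<Phi> t * tp (\<Phi> t)"
  shows "cm n n (em (mat_integral n n f))"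
    "a * em (mat_integral n n f) + em (mat_integral n n f) * tp a + ide n = 0"
proof -
  obtain X where X: "cm n n X" "a * X + X * tp a + ide n = 0"
    and int: "\<And>i j. ((\<lambda>t. ent (\<Phi> t * ide n * tp (\<Phi> t)) i j) has_integral ent X i j) {0..}"
    using lyapunov_solution[OF e cm_ide] by blast
  have cm\<Phi>: "cm n n (\<Phi> t)" for t using e by (simp add: expdecay_def)
  have "em (mat_integral n n f) = X"
  proof (rule fmat_eqI)
    fix i j
    show "ent (em (mat_integral n n f)) i j = ent X i j"
    proof (cases "i < n \<and> j < n")
      case True
      have "ent (\<Phi> t * ide n * tp (\<Phi> t)) i j = f t $$ (i, j)" for t
        using arg_cong[OF f(2), of "\<lambda>x. ent x i j" t] f(1)[of t] True cm\<Phi>[of t] by (simp add: ent_em cmD)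
      then show ?thesis using int[of i j] True by (simp add: ent_em mat_integral_def integral_unique)
    next
      case False
      then show ?thesis using X(1) by (auto simp: ent_em mat_integral_def cm_iff)
    qed
  qed
  then show "cm n n (em (mat_integral n n f))"
    "a * em (mat_integral n n f) + em (mat_integral n n f) * tp a + ide n = 0"
    using X by simp_all
qed

text \<open>For an off-diagonal block of the error Gramian, where one side has the exact and the
  other the perturbed matrix. The difference solves an equation for \<open>A\<close> whose source
  contains \<open>X\<close>; bounding \<open>X\<close> by the difference plus \<sigma> gives an
  inequality that can be solved for the difference.\<close>

lemma lyapunov_compare_cross:
  assumes e: "expdecay r A \<Phi>" and K: "A * K + K * tp A + ide r = 0" "cm r r K"
    and X0: "A * X0 + X0 * tp A + B * tp B = 0" "cm r r X0" "opn X0 \<le> \<sigma>"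
    and X: "A * X + X * tp (A + D) + B * tp B' = 0" "cm r r X"
    and D: "opn D \<le> \<tau>" and small: "opn K * \<tau> < 1"
  shows "opn (X - X0) \<le> opn K / (1 - opn K * \<tau>) * (opn B * opn (B' - B) + \<sigma> * \<tau>)"
proof -
  have "A * (X - X0) + (X - X0) * tp A + (X * tp D + B * tp (B' - B))
      = (A * X + X * tp (A + D) + B * tp B') - (A * X0 + X0 * tp A + B * tp B)"
    by (simp add: algebra_simps)
  also have "\<dots> = 0" by (simp only: X X0 diff_self)
  finally have "opn (X - X0) \<le> opn K * opn (X * tp D + B * tp (B' - B))"
    by (rule lyapunov_opn_le[OF e K]) (use X X0 in auto)
  also have "opn (X * tp D + B * tp (B' - B)) \<le> (opn (X - X0) + \<sigma>) * \<tau> + opn B * opn (B' - B)"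
  proof -
    have "opn X \<le> opn (X - X0) + \<sigma>" using opn_add_le[OF order_refl X0(3), of "X - X0"] by simp
    then show ?thesis
      by (intro opn_add_le opn_mult_le order_refl) (simp_all only: opn_tp D order_refl)
  qed
  finally have "opn (X - X0) \<le> opn K * ((opn (X - X0) + \<sigma>) * \<tau> + opn B * opn (B' - B))"
    by (simp add: mult_left_mono)
  then have "(1 - opn K * \<tau>) * opn (X - X0) \<le> opn K * (opn B * opn (B' - B) + \<sigma> * \<tau>)"
    by (simp add: algebra_simps)
  then show ?thesis using small by (simp add: field_simps)
qed

text \<open>For the lower right block: here both sides are perturbed, whence the factor 2.\<close>

lemma lyapunov_compare_full:
  assumes e: "expdecay r A \<Phi>" and K: "A * K + K * tp A + ide r = 0" "cm r r K"
    and X0: "A * X0 + X0 * tp A + B * tp B = 0" "cm r r X0" "opn X0 \<le> \<sigma>"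
    and X: "(A + D) * X + X * tp (A + D) + B' * tp B' = 0" "cm r r X"
    and D: "opn D \<le> \<tau>" and small: "2 * (opn K * \<tau>) < 1"
  shows "opn (X - X0) \<le> opn K / (1 - 2 * (opn K * \<tau>)) * (opn (B' * tp B' - B * tp B) + 2 * (\<sigma> * \<tau>))"
proof -
  let ?b = "opn (B' * tp B' - B * tp B)"
  have "A * (X - X0) + (X - X0) * tp A + (D * X + X * tp D + (B' * tp B' - B * tp B))
      = ((A + D) * X + X * tp (A + D) + B' * tp B') - (A * X0 + X0 * tp A + B * tp B)"
    by (simp add: algebra_simps)
  also have "\<dots> = 0" by (simp only: X X0 diff_self)
  finally have "opn (X - X0) \<le> opn K * opn (D * X + X * tp D + (B' * tp B' - B * tp B))"
    by (rule lyapunov_opn_le[OF e K]) (use X X0 in auto)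
  also have "opn (D * X + X * tp D + (B' * tp B' - B * tp B)) \<le> \<tau> * (opn (X - X0) + \<sigma>) + (opn (X - X0) + \<sigma>) * \<tau> + ?b"
  proof -
    have "opn X \<le> opn (X - X0) + \<sigma>" using opn_add_le[OF order_refl X0(3), of "X - X0"] by simp
    then show ?thesis
      by (intro opn_add_le opn_mult_le order_refl) (simp_all only: opn_tp D order_refl)
  qed
  finally have "opn (X - X0) \<le> opn K * (\<tau> * (opn (X - X0) + \<sigma>) + (opn (X - X0) + \<sigma>) * \<tau> + ?b)"
    by (simp add: mult_left_mono)
  then have "(1 - 2 * (opn K * \<tau>)) * opn (X - X0) \<le> opn K * (?b + 2 * (\<sigma> * \<tau>))"
    by (simp add: algebra_simps)
  then show ?thesis using small by (simp add: field_simps)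
qed

lemma lyapunov_solution_psd:
  assumes e: "expdecay n a \<Phi>" and X: "a * X + X * tp a + b * tp b = 0" "cm n n X"
  shows "psd X"
proof -
  have "a * tp X + tp X * tp a + b * tp b = tp (a * X + X * tp a + b * tp b)"
    by (simp add: algebra_simps)
  then have "tp X = X" using lyapunov_unique[OF e _ _ X, of "tp X"] X by auto
  moreover have "0 \<le> inner x (X * x)" for x
    by (rule lyapunov_nonneg[OF e X]) (simp add: mult.assoc inner_gram[of _ "tp b", simplified])
  ultimately show ?thesis by (simp add: psd_def)
qed

text \<open>The Lyapunov function \<open>K\<close> of \<open>ah\<close>, pulled back by the basis
  change, serves for \<open>A\<close>. In the coordinates \<open>y = W * x\<close> its derivative is
  minus half the squared norm plus a term bounded by \<open>opn K * opn D\<close>.\<close>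

lemma lyapunov_perturbed_stable:
  assumes e: "expdecay r (tp ah) \<Psi>" and K: "tp ah * K + K * ah + ide r = 0" "cm r r K"
    and A: "A \<in> carrier_mat r r" and W: "cm r r W" "tp W = W" "Z * W = ide r" "W * em A * Z = ah + D"
    and small: "2 * (opn K * opn D) < 1"
  shows "stable_mat A"
proof (rule stable_matI[OF A])
  have "psd K"
  proof -
    have "cm r r (ide r)" "tp ah * K + K * tp (tp ah) + ide r * tp (ide r) = 0" using K by auto
    then show ?thesis using lyapunov_solution_psd[OF e _ K(2)] by blast
  qed
  then show "tp (W * K * W) = W * K * W" by (simp add: psd_def W mult.assoc)
  show "0 \<le> inner x (W * K * W * x)" for x
  proof -
    have "inner x (W * K * W * x) = inner (W * x) (K * (W * x))"
      using inner_mult_left[of W x "K * (W * x)"] W(2) by (simp add: mult.assoc)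
    then show ?thesis using \<open>psd K\<close> by (simp add: psd_def)
  qed
  fix x assume x: "cm r 1 x" "x \<noteq> 0"
  define y where "y = W * x"
  have xy: "x = Z * y" using x by (simp add: y_def W(3)[THEN mult_extend] cmD)
  then have y0: "y \<noteq> 0" using x(2) by auto
  have y: "ide r * y = y" using W(1) by (simp add: y_def cmD)
  have "inner x (W * K * W * (em A * x)) = inner y (K * (W * (em A * x)))"
    using inner_mult_left[of W x "K * (W * (em A * x))"] W(2) by (simp add: y_def mult.assoc)
  also have "W * (em A * x) = (W * em A * Z) * y" by (simp add: mult.assoc flip: xy)
  also have "\<dots> = ah * y + D * y" by (simp add: W(4) distrib_right)
  also have "inner y (K * (ah * y + D * y)) = inner y (K * (ah * y)) + inner y (K * D * y)"
    by (simp add: distrib_left inner_add_right mult.assoc)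
  also have "inner y (K * (ah * y)) = - (norm y)\<^sup>2 / 2"
  proof -
    have "inner y ((tp ah * K + K * ah + ide r) * y) = 0" by (simp add: K)
    moreover have "inner y (tp ah * (K * y)) = inner y (K * (ah * y))"
      using \<open>psd K\<close> by (metis inner_commute inner_mult_left psd_def)
    ultimately show ?thesis
      by (simp add: distrib_right inner_add_right mult.assoc y power2_norm_eq_inner)
  qed
  also have "inner y (K * D * y) \<le> opn K * opn D * (norm y)\<^sup>2"
  proof -
    have "inner y (K * D * y) \<le> opn (K * D) * (norm y * norm y)"
      using abs_inner_opn[of y "K * D" y] by (simp add: mult.assoc)
    also have "\<dots> \<le> opn K * opn D * (norm y * norm y)" by (intro mult_right_mono opn_mult) auto
    finally show ?thesis by (simp add: power2_eq_square)
  qed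
  finally have "inner x (W * K * W * (em A * x)) \<le> (opn K * opn D - 1 / 2) * (norm y)\<^sup>2"
    by (simp add: algebra_simps)
  also have "\<dots> < 0" using small y0 by (intro mult_neg_pos) auto
  finally show "inner x (W * K * W * (em A * x)) < 0" .
qed

text \<open>The two coordinate subspaces are interchanged, so the images of the two parts of
  \<open>x\<close> are orthogonal and no factor 2 arises.\<close>

lemma opn_off_diagonal:
  assumes D: "cm r r D"
  shows "opn (D * tp (sh r r) + sh r r * tp D) \<le> opn D"
proof (rule opn_leI)
  fix x
  define j where "j = sh r r"
  have j: "tp j * j = ide r" "ide r * j = 0" "tp j * ide r = 0"
    using tp_sh_sh[of r r] tp_sh_sh_0[of 0 r r r] tp_sh_sh_0'[of 0 r r r] by (simp_all add: j_def)
  have orth: "inner (ide r * y) (j * z) = 0" for y z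
    by (simp add: inner_mult_left j(2)[THEN mult_extend])
  have iso: "norm (j * z) = norm (ide r * z)" for z
  proof -
    have "(norm (j * z))\<^sup>2 = inner z (ide r * ide r * z)"
      using inner_gram[of z j] by (simp add: j flip: mult.assoc)
    also have "\<dots> = (norm (ide r * z))\<^sup>2" using inner_gram[of z "ide r"] by (simp add: ide_idem[THEN mult_extend])
    finally show ?thesis by simp
  qed
  have "(norm ((D * tp j + j * tp D) * x))\<^sup>2 = (norm (D * (tp j * x)))\<^sup>2 + (norm (tp D * x))\<^sup>2"
  proof -
    have "(D * tp j + j * tp D) * x = ide r * (D * (tp j * x)) + j * (tp D * x)"
      using D by (simp add: distrib_right mult.assoc cmD)
    then have "(norm ((D * tp j + j * tp D) * x))\<^sup>2 = (norm (ide r * (D * (tp j * x))))\<^sup>2 + (norm (j * (tp D * x)))\<^sup>2"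
      by (simp add: power2_norm_eq_inner inner_add_left inner_add_right orth inner_commute[of "j * _" "ide r * _"])
    then show ?thesis using D cm_tp[OF D] by (simp add: iso cmD)
  qed
  also have "\<dots> \<le> (opn D * norm (tp j * x))\<^sup>2 + (opn D * norm (ide r * x))\<^sup>2"
  proof (intro add_mono power_mono)
    show "norm (D * (tp j * x)) \<le> opn D * norm (tp j * x)" by (rule norm_mult_opn)
    have "tp D * x = tp D * (ide r * x)" using cm_tp[OF D] by (simp add: cmD)
    then show "norm (tp D * x) \<le> opn D * norm (ide r * x)" using norm_mult_opn[of "tp D" "ide r * x"] by simp
  qed auto
  also have "\<dots> = (opn D)\<^sup>2 * ((norm (tp j * x))\<^sup>2 + (norm (ide r * x))\<^sup>2)"
    by (simp add: power_mult_distrib distrib_left)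
  also have "(norm (tp j * x))\<^sup>2 + (norm (ide r * x))\<^sup>2 \<le> (norm x)\<^sup>2"
  proof -
    have "(norm (tp j * x))\<^sup>2 + (norm (ide r * x))\<^sup>2 = inner x (ide (r + r) * x)"
      using inner_gram[of x "tp j"] inner_gram[of x "ide r"]
      by (simp add: ide_split j_def distrib_right inner_add_right ide_idem[THEN mult_extend] mult.assoc)
    also have "\<dots> \<le> opn (ide (r + r)) * (norm x * norm x)"
      using abs_inner_opn[of x "ide (r + r)" x] by (simp add: mult.assoc)
    also have "\<dots> \<le> 1 * (norm x * norm x)" by (intro mult_right_mono opn_ide_le) auto
    finally show ?thesis by (simp add: power2_eq_square)
  qed
  finally have "(norm ((D * tp j + j * tp D) * x))\<^sup>2 \<le> (opn D * norm x)\<^sup>2"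
    by (simp add: power_mult_distrib mult_left_mono)
  then show "norm ((D * tp (sh r r) + sh r r * tp D) * x) \<le> opn D * norm x"
    unfolding j_def by (rule power2_le_imp_le) simp
qed simp

lemma opn_scaled_isometry:
  assumes "tp f * f = (2::real) *\<^sub>R ide r"
  shows "opn f \<le> sqrt 2"
proof (rule opn_leI)
  fix x
  have "(norm (f * x))\<^sup>2 = 2 * inner x (ide r * x)"
    using inner_gram[of x f] by (simp add: assms flip: mult.assoc)
  also have "\<dots> \<le> 2 * (1 * (norm x * norm x))"
    using abs_inner_opn[of x "ide r" x] mult_right_mono[OF opn_ide_le, of "norm x * norm x" r]
    by (simp add: mult.assoc)
  also have "\<dots> = (sqrt 2 * norm x)\<^sup>2" by (simp add: power_mult_distrib power2_eq_square)
  finally show "norm (f * x) \<le> sqrt 2 * norm x" by (rule power2_le_imp_le) simp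
qed simp

text \<open>\<open>T\<close> rescales the second block; this turns \<open>P * Q\<close> into the
  similar matrix \<open>P' * Q'\<close>, where \<open>P'\<close> is near \<open>e * tp e\<close> and
  \<open>Q'\<close> near \<open>f * M * tp f\<close>. Since \<open>tp e * f = 0\<close>, only
  products with an error factor remain, and \<open>e\<close> and \<open>f\<close> have norm at most
  the square root of 2.\<close>

lemma error_gramian_product_bound:
  assumes W: "cm r r W" "cm r r Z" "tp W = W" "tp Z = Z" "W * Z = ide r" "Z * W = ide r"
    and P: "cm (r + r) (r + r) P" "tp P = P" "ide r * P * ide r = ide r"
    and Q: "cm (r + r) (r + r) Q" "tp Q = Q" "ide r * Q * ide r = M"
    and M: "opn M \<le> \<sigma>" "cm r r M"
    and P1: "opn (ide r * P * sh r r * W - ide r) \<le> x1" and P2: "opn (W * (tp (sh r r) * P * sh r r) * W - ide r) \<le> x2"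
    and Q1: "opn (- (ide r * Q * sh r r * Z) - M) \<le> z1" and Q2: "opn (Z * (tp (sh r r) * Q * sh r r) * Z - M) \<le> z2"
    and v: "P * (Q * v) = l *\<^sub>R v" "ide (r + r) * v = v" "v \<noteq> 0"
  shows "l \<le> 2 * \<sigma> * (x1 + x2) + 2 * (z1 + z2) + (x1 + x2) * (z1 + z2)"
proof -
  define j where "j = sh r r"
  have j: "tp j * j = ide r" "ide r * j = 0" "tp j * ide r = 0" "j * ide r = j" "ide r * tp j = tp j"
    using tp_sh_sh[of r r] tp_sh_sh_0[of 0 r r r] tp_sh_sh_0'[of 0 r r r] sh_ide[of r r]
    by (simp_all add: j_def ide_tp_sh)
  have ij: "ide (r + r) = ide r + j * tp j" by (simp add: ide_split j_def)
  note rw = mult.assoc distrib_left distrib_right j j[THEN mult_extend] ide_idem[THEN mult_extend]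
    W(5,6) W(5,6)[THEN mult_extend] W(1,2)[THEN cmD(1)] W(1,2)[THEN cmD(2)] W(1,2)[THEN cmD(3)] W(1,2)[THEN cmD(4)]
  define T where "T = ide r + j * W * tp j"
  define T' where "T' = ide r + j * Z * tp j"
  have T'T: "T' * T = ide (r + r)" unfolding ij by (simp add: T_def T'_def rw)
  have TT': "T * T' = ide (r + r)" unfolding ij by (simp add: T_def T'_def rw)
  define D1 where "D1 = ide r * P * j * W - ide r"
  define D2 where "D2 = W * (tp j * P * j) * W - ide r"
  define E1 where "E1 = - (ide r * Q * j * Z) - M"
  define E2 where "E2 = Z * (tp j * Q * j) * Z - M"
  define e f where "e = ide r + j" and "f = ide r - j"
  have M': "ide r * M = M" "M * ide r = M" "ide r * (M * y) = M * y" "M * (ide r * y) = M * y" for y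
    using M(2) by (simp_all add: cmD)
  define P' where "P' = T * P * T"
  define Q' where "Q' = T' * Q * T'"
  \<comment> \<open>The upper left blocks are exact, so the errors consist of an off-diagonal pair
    and a lower right block.\<close>
  define DP where "DP = D1 * tp j + j * tp D1 + j * D2 * tp j"
  define DQ where "DQ = - (E1 * tp j + j * tp E1) + j * E2 * tp j"
  have iPi: "ide r * (P * ide r) = ide r" "ide r * (P * (ide r * y)) = ide r * y" for y
    using P(3) by (simp_all add: mult.assoc) (metis P(3) mult.assoc)
  have iQi: "ide r * (Q * ide r) = M" "ide r * (Q * (ide r * y)) = M * y" for y
    using Q(3) by (simp_all add: mult.assoc) (metis Q(3) mult.assoc)
  have P': "P' = e * tp e + DP"
    unfolding P'_def T_def e_def DP_def D1_def D2_def
    by (simp add: rw iPi P(2) W(3) right_diff_distrib left_diff_distrib)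
  have tM: "tp M = M" using Q(2,3) by (metis mult.assoc tp_ide tp_mult)
  have Q': "Q' = f * M * tp f + DQ"
    unfolding Q'_def T'_def f_def DQ_def E1_def E2_def
    by (simp add: rw iQi Q(2) W(4) tM M' right_diff_distrib left_diff_distrib)
  have ef: "tp e * f = 0" by (simp add: e_def f_def rw right_diff_distrib)
  have prod: "P' * Q' = e * tp e * DQ + DP * (f * M * tp f) + DP * DQ"
    unfolding P' Q' by (simp add: distrib_left distrib_right mult.assoc ef[THEN mult_extend])
  have ide_j: "opn j \<le> 1" "opn (tp j) \<le> 1" using opn_isometry_le[OF j(1)] by simp_all
  have cmj: "cm (r + r) r j" unfolding j_def by (rule cm_sh) simp
  have cm_D1: "cm r r D1" "cm r r E1"
    unfolding D1_def E1_def using cmj by (intro cm_diff cm_uminus cm_corner P Q W M cm_ide; simp add: j_def)+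
  have x: "opn DP \<le> x1 + x2"
  proof -
    have "opn (D1 * tp j + j * tp D1) \<le> x1"
      using opn_off_diagonal[OF cm_D1(1)] P1 unfolding D1_def j_def by linarith
    moreover have "opn (j * D2 * tp j) \<le> 1 * x2 * 1"
      by (intro opn_mult_le ide_j) (use P2 in \<open>simp add: D2_def j_def\<close>)
    ultimately show ?thesis unfolding DP_def by (intro opn_add_le) auto
  qed
  have z: "opn DQ \<le> z1 + z2"
  proof -
    have "opn (- (E1 * tp j + j * tp E1)) \<le> z1"
      using opn_off_diagonal[OF cm_D1(2)] Q1 unfolding E1_def j_def opn_minus by linarith
    moreover have "opn (j * E2 * tp j) \<le> 1 * z2 * 1"
      by (intro opn_mult_le ide_j) (use Q2 in \<open>simp add: E2_def j_def\<close>)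
    ultimately show ?thesis unfolding DQ_def by (intro opn_add_le) auto
  qed
  have oe: "opn e \<le> sqrt 2" "opn f \<le> sqrt 2"
    by (rule opn_scaled_isometry, simp add: e_def f_def rw right_diff_distrib left_diff_distrib scaleR_2)+
  have "opn (P' * Q') \<le> sqrt 2 * sqrt 2 * (z1 + z2) + (x1 + x2) * (sqrt 2 * \<sigma> * sqrt 2) + (x1 + x2) * (z1 + z2)"
    unfolding prod
    by (intro opn_add_le opn_mult_le x z oe M) (simp_all add: oe)
  then have bound: "opn (P' * Q') \<le> 2 * \<sigma> * (x1 + x2) + 2 * (z1 + z2) + (x1 + x2) * (z1 + z2)"
    by (simp add: mult_ac)
  define u where "u = T * v"
  have u0: "u \<noteq> 0"
  proof
    assume "u = 0"
    then have "T' * u = 0" by simp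
    then show False using v by (simp add: u_def T'T[THEN mult_extend])
  qed
  have "P' * Q' * u = T * (P * ((T * T') * (Q * ((T' * T) * v))))" by (simp add: P'_def Q'_def u_def mult.assoc)
  also have "\<dots> = T * (P * (Q * v))" unfolding T'T TT' using v(2) Q(1) by (simp add: cmD)
  also have "\<dots> = l *\<^sub>R u" by (simp add: v(1) u_def)
  finally have "\<bar>l\<bar> * norm u = norm (P' * Q' * u)" by simp
  also have "\<dots> \<le> opn (P' * Q') * norm u" by (rule norm_mult_opn)
  finally have "\<bar>l\<bar> \<le> opn (P' * Q')" using u0 by simp
  then show ?thesis using bound by linarith
qed

text \<open>By cyclicity the trace can be taken over \<open>m\<close> or over \<open>r\<close>
  coordinates; the smaller number counts.\<close>

lemma abs_trace_le:
  assumes "cm r m u" "cm r m v" "cm r r M"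
  shows "\<bar>inner (ide m) (tp u * (M * v))\<bar> \<le> real (min r m) * (opn u * opn M * opn v)"
proof -
  have o: "opn (tp u * (M * v)) \<le> opn u * opn M * opn v"
    using opn_mult_le[of "tp u" "opn u" "M * v" "opn M * opn v"] opn_mult[of M v] by (simp add: mult.assoc)
  have o': "opn (M * (v * tp u)) \<le> opn u * opn M * opn v"
    using opn_mult_le[of M "opn M" "v * tp u" "opn v * opn u"] opn_mult[of v "tp u"] by (simp add: mult_ac)
  have 1: "\<bar>inner (ide m) (tp u * (M * v))\<bar> \<le> m * (opn u * opn M * opn v)"
    by (rule order_trans[OF abs_inner_ide]) (intro mult_left_mono o, simp)
  have "inner (ide m) (tp u * (M * v)) = inner u (M * v)"
    using assms(1) inner_mult_left[of u "ide m" "M * v"] by (simp add: cmD)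
  also have "\<dots> = inner (ide r * u) (M * v)" using assms by (simp add: cmD)
  also have "\<dots> = inner (ide r) (M * (v * tp u))"
    by (simp add: inner_mult_right[of "ide r" "M * v" "tp u", simplified] flip: mult.assoc)
  finally have "\<bar>inner (ide m) (tp u * (M * v))\<bar> \<le> r * (opn u * opn M * opn v)"
    using order_trans[OF abs_inner_ide mult_left_mono[OF o']] by simp
  with 1 show ?thesis by (cases "r \<le> m") auto
qed

text \<open>With \<open>b' = W * bt\<close> the leading parts of the four blocks of the
  observability Gramian are \<open>M\<close> with signs + - - +, and combine to the quadratic term
  in \<open>b' - bh\<close>. The rest is linear in the block errors.\<close>

lemma error_trace_bound:
  assumes W: "cm r r W" "cm r r Z" "tp W = W" "tp Z = Z" "W * Z = ide r" "Z * W = ide r"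
    and Q: "cm (r + r) (r + r) Q" "tp Q = Q" "ide r * Q * ide r = M"
    and M: "opn M \<le> \<sigma>" "cm r r M"
    and Q1: "opn (- (ide r * Q * sh r r * Z) - M) \<le> z1" and Q2: "opn (Z * (tp (sh r r) * Q * sh r r) * Z - M) \<le> z2"
    and b: "cm r m bh" "cm r m bt"
  shows "inner (ide m) (tp (bh + sh r r * bt) * Q * (bh + sh r r * bt)) \<le>
    real (min r m) * (\<sigma> * (opn (W * bt - bh))\<^sup>2 + 2 * opn bh * opn (W * bt) * z1 + (opn (W * bt))\<^sup>2 * z2)"
proof -
  define j where "j = sh r r"
  define X where "X = - (ide r * Q * j * Z)"
  define Y where "Y = Z * (tp j * Q * j) * Z"
  define b' where "b' = W * bt"
  have cmb': "cm r m b'" unfolding b'_def using W b by auto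
  have tM: "tp M = M" using Q(2,3) by (metis mult.assoc tp_ide tp_mult)
  have Zb: "Z * b' = bt" using b by (simp add: b'_def W(6)[THEN mult_extend] cmD)
  have bh: "ide r * bh = bh" "tp bh * (ide r * y) = tp bh * y" for y using b cm_tp[OF b(1)] by (simp_all add: cmD)
  have iQi: "ide r * (Q * (ide r * y)) = M * y" for y using Q(3) by (metis mult.assoc)
  have a1: "tp bh * (Q * bh) = tp bh * (M * bh)"
    using iQi[of bh] bh by metis
  have a2: "tp bh * (Q * (j * bt)) = - (tp bh * (X * b'))"
    by (simp add: X_def mult.assoc Zb bh)
  have a3: "tp bt * (tp j * (Q * bh)) = - (tp b' * (tp X * bh))"
    using arg_cong[OF a2, of tp] by (simp add: Q(2) mult.assoc)
  have Ztp: "tp b' * (Z * y) = tp bt * y" for y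
    using arg_cong[OF Zb, of tp] by (simp add: W(4) flip: mult.assoc)
  have a4: "tp bt * (tp j * (Q * (j * bt))) = tp b' * (Y * b')"
    by (simp add: Y_def mult.assoc Zb Ztp)
  have "tp (bh + j * bt) * Q * (bh + j * bt) =
      tp (b' - bh) * (M * (b' - bh)) - tp bh * ((X - M) * b') - tp b' * (tp (X - M) * bh) + tp b' * ((Y - M) * b')"
    by (simp add: distrib_left distrib_right mult.assoc a1 a2 a3 a4)
       (simp add: algebra_simps tM)
  then have "inner (ide m) (tp (bh + j * bt) * Q * (bh + j * bt)) =
      inner (ide m) (tp (b' - bh) * (M * (b' - bh))) - inner (ide m) (tp bh * ((X - M) * b'))
      - inner (ide m) (tp b' * (tp (X - M) * bh)) + inner (ide m) (tp b' * ((Y - M) * b'))"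
    by (simp only: inner_add_right inner_diff_right)
  also have "\<dots> \<le> real (min r m) * (opn (b' - bh) * opn M * opn (b' - bh)) + real (min r m) * (opn bh * opn (X - M) * opn b')
      + real (min r m) * (opn b' * opn (X - M) * opn bh) + real (min r m) * (opn b' * opn (Y - M) * opn b')"
  proof -
    have XMc: "cm r r (X - M)" "cm r r (Y - M)"
    proof -
      have "cm r r X" unfolding X_def j_def by (intro cm_uminus cm_corner Q W)
      moreover have "cm r r Y"
        unfolding Y_def j_def
        by (rule cm_mult[OF cm_mult[OF W(2) cm_mult[OF cm_mult[OF cm_tp[OF cm_sh] Q(1)] cm_sh]] W(2)]) simp_all
      ultimately have "cm r r X" "cm r r Y" .
      then show "cm r r (X - M)" "cm r r (Y - M)" using M by auto
    qed
    have "cm r m (b' - bh)" using cmb' b by auto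
    from abs_trace_le[OF this this M(2)] abs_trace_le[OF b(1) cmb' XMc(1)]
      abs_trace_le[OF cmb' b(1) cm_tp[OF XMc(1)]] abs_trace_le[OF cmb' cmb' XMc(2)]
    show ?thesis unfolding opn_tp by linarith
  qed
  also have "\<dots> = real (min r m) * (opn M * (opn (b' - bh))\<^sup>2 + 2 * (opn bh * opn b') * opn (X - M) + (opn b')\<^sup>2 * opn (Y - M))"
    by (simp add: algebra_simps power2_eq_square)
  also have "\<dots> \<le> real (min r m) * (\<sigma> * (opn (b' - bh))\<^sup>2 + 2 * (opn bh * opn b') * z1 + (opn b')\<^sup>2 * z2)"
    using M(1) Q1 Q2 by (intro mult_left_mono add_mono mult_right_mono) (auto simp: X_def Y_def j_def)
  finally show ?thesis by (simp add: j_def b'_def mult.assoc)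
qed

section \<open>Norms and transfer function of the error system\<close>

text \<open>Makes the set in \<open>hankel_norm\<close> nonempty, so that its \<open>Max\<close> is
  meaningful. At a non-real eigenvalue the form of \<open>Q\<close> would vanish on the real and
  imaginary parts of the eigenvector; then \<open>Q\<close> and so the product would annihilate
  them.\<close>

lemma real_eigenvalue_psd_product:
  assumes P: "P \<in> carrier_mat N N" "psd (em P)" and Q: "Q \<in> carrier_mat N N" "psd (em Q)" and N: "N > 0"
  shows "\<exists>l. eigenvalue (P * Q) l"
proof -
  have PQ: "P * Q \<in> carrier_mat N N" using P Q by simp
  have ePQ: "em (P * Q) = em P * em Q" using P Q by (simp add: em_mult)
  have "cmat (P * Q) \<in> carrier_mat N N" using PQ by simp
  from spectrum_non_empty[OF this N] obtain \<mu> where "eigenvalue (cmat (P * Q)) \<mu>"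
    unfolding spectrum_def by blast
  then obtain x y where xy: "cm N 1 x" "cm N 1 y" "x \<noteq> 0 \<or> y \<noteq> 0"
    and ex: "em P * (em Q * x) = Re \<mu> *\<^sub>R x - Im \<mu> *\<^sub>R y"
    and ey: "em P * (em Q * y) = Im \<mu> *\<^sub>R x + Re \<mu> *\<^sub>R y"
    using eigenvalue_cmat_pair[OF PQ] unfolding ePQ mult.assoc by metis
  have tP: "tp (em P) = em P" and tQ: "tp (em Q) = em Q" using P Q by (auto simp: psd_def)
  have Im0: "Im \<mu> = 0"
  proof (rule ccontr)
    assume im: "Im \<mu> \<noteq> 0"
    have sP: "inner (em Q * x) (em P * (em Q * y)) = inner (em Q * y) (em P * (em Q * x))"
      by (metis inner_commute inner_mult_left tP)
    have sQ: "inner (em Q * x) y = inner (em Q * y) x" by (metis inner_commute inner_mult_left tQ)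
    have sQ': "inner y (em Q * x) = inner x (em Q * y)" by (metis inner_commute inner_mult_left tQ)
    have "Im \<mu> * (inner x (em Q * x) + inner y (em Q * y)) = 0"
      using sP unfolding ex ey by (simp add: inner_add_right inner_diff_right sQ sQ' inner_commute[of "em Q * _" ] algebra_simps)
    then have "inner x (em Q * x) + inner y (em Q * y) = 0" using im by simp
    moreover have "0 \<le> inner x (em Q * x)" "0 \<le> inner y (em Q * y)" using Q by (auto simp: psd_def)
    ultimately have "inner x (em Q * x) = 0" "inner y (em Q * y) = 0" by linarith+
    then have "em Q * x = 0" "em Q * y = 0" using psd_null[OF Q(2)] by auto
    then have "Re \<mu> *\<^sub>R x = Im \<mu> *\<^sub>R y" "Im \<mu> *\<^sub>R x = - (Re \<mu> *\<^sub>R y)"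
      using ex ey by (simp_all add: add_eq_0_iff)
    then have "Im \<mu> *\<^sub>R (Im \<mu> *\<^sub>R y) = - (Re \<mu> *\<^sub>R (Re \<mu> *\<^sub>R y))"
      by (metis scaleR_left_commute scaleR_minus_right)
    then have "((Im \<mu>)\<^sup>2 + (Re \<mu>)\<^sup>2) *\<^sub>R y = 0" by (simp add: power2_eq_square scaleR_add_left)
    then have "y = 0" using im by (simp add: sum_power2_eq_zero_iff)
    then have "x = 0" using \<open>Im \<mu> *\<^sub>R x = - (Re \<mu> *\<^sub>R y)\<close> im by simp
    then show False using xy(3) \<open>y = 0\<close> by simp
  qed
  have "\<exists>z. cm N 1 z \<and> z \<noteq> 0 \<and> em P * (em Q * z) = Re \<mu> *\<^sub>R z"
    using xy ex ey Im0 by (cases "x = 0") auto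
  then obtain z where z: "cm N 1 z" "z \<noteq> 0" "em P * (em Q * z) = Re \<mu> *\<^sub>R z" by blast
  define v where "v = vec N (\<lambda>i. ent z i 0)"
  have v: "v \<in> carrier_vec N" and evv: "ev v = z"
    using z(1) by (auto simp: v_def ent_ev cm_iff not_less intro!: fmat_eqI)
  have "v \<noteq> 0\<^sub>v N"
  proof
    assume "v = 0\<^sub>v N"
    then have "ev v = 0" by (intro fmat_eqI) (simp add: ent_ev)
    then show False using z(2) evv by simp
  qed
  moreover have "(P * Q) *\<^sub>v v = Re \<mu> \<cdot>\<^sub>v v"
  proof (rule eq_vecI)
    fix i assume "i < dim_vec (Re \<mu> \<cdot>\<^sub>v v)"
    then have i: "i < N" using v by simp
    have "ev ((P * Q) *\<^sub>v v) = Re \<mu> *\<^sub>R z"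
      using v PQ z(3) by (subst ev_mult) (auto simp: ePQ evv mult.assoc)
    from arg_cong[OF this, of "\<lambda>w. ent w i 0"] show "((P * Q) *\<^sub>v v) $ i = (Re \<mu> \<cdot>\<^sub>v v) $ i"
      using i v PQ P(1) by (simp add: ent_ev v_def)
  qed (use v P in auto)
  ultimately have "eigenvalue (P * Q) (Re \<mu>)"
    using v PQ P(1) unfolding eigenvalue_def eigenvector_def by auto
  then show ?thesis by blast
qed

lemma ctrl_gramian_correct:
  assumes A: "A \<in> carrier_mat n n" "stable_mat A" and B: "B \<in> carrier_mat n m"
  shows "ctrl_gramian A B \<in> carrier_mat n n" "psd (em (ctrl_gramian A B))"
    "em A * em (ctrl_gramian A B) + em (ctrl_gramian A B) * tp (em A) + em B * tp (em B) = 0"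
proof -
  note e = stable_mat_expdecay[OF A]
  have iff: "is_ctrl_gramian A B P \<longleftrightarrow> P \<in> carrier_mat n n \<and>
      em A * em P + em P * tp (em A) + em B * tp (em B) = 0" for P
  proof (cases "P \<in> carrier_mat n n")
    case True
    have "em (A * P + P * A\<^sup>T + B * B\<^sup>T) = em A * em P + em P * tp (em A) + em B * tp (em B)"
      using True A B by (simp add: em_add em_mult em_transpose)
    then have "em A * em P + em P * tp (em A) + em B * tp (em B) = 0 \<longleftrightarrow> A * P + P * A\<^sup>T + B * B\<^sup>T = 0\<^sub>m n n"
      using True A B em_inject[of "A * P + P * A\<^sup>T + B * B\<^sup>T" n n "0\<^sub>m n n"] by auto
    then show ?thesis using True A B by (simp add: is_ctrl_gramian_def)
  qed (use A in \<open>auto simp: is_ctrl_gramian_def\<close>)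
  have cw: "cm n n (em B * tp (em B))" using cm_em[OF B] by auto
  obtain X where X: "cm n n X" "em A * X + X * tp (em A) + em B * tp (em B) = 0"
    using lyapunov_solution[OF e cw] by blast
  have "\<exists>!P. is_ctrl_gramian A B P"
  proof (rule ex1I[of _ "fm n n X"])
    show "is_ctrl_gramian A B (fm n n X)" unfolding iff using X by (simp add: em_fm)
    fix P assume "is_ctrl_gramian A B P"
    then have P: "P \<in> carrier_mat n n" "em A * em P + em P * tp (em A) + em B * tp (em B) = 0"
      unfolding iff by auto
    have "em P = X" by (rule lyapunov_unique[OF e P(2) cm_em[OF P(1)] X(2,1)])
    then show "P = fm n n X" by (intro em_inject[OF P(1) fm_carrier]) (simp add: em_fm X)
  qed
  from theI'[OF this] have *: "is_ctrl_gramian A B (ctrl_gramian A B)" by (simp add: ctrl_gramian_def)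
  then show c: "ctrl_gramian A B \<in> carrier_mat n n"
    and eq: "em A * em (ctrl_gramian A B) + em (ctrl_gramian A B) * tp (em A) + em B * tp (em B) = 0"
    unfolding iff by auto
  show "psd (em (ctrl_gramian A B))" by (rule lyapunov_solution_psd[OF e eq cm_em[OF c]])
qed

lemma obs_gramian_correct:
  assumes A: "A \<in> carrier_mat n n" "stable_mat A" and C: "C \<in> carrier_mat n p"
  shows "obs_gramian A C \<in> carrier_mat n n" "psd (em (obs_gramian A C))"
    "tp (em A) * em (obs_gramian A C) + em (obs_gramian A C) * em A + em C * tp (em C) = 0"
proof -
  note e = expdecay_tp[OF stable_mat_expdecay[OF A]]
  have iff: "is_obs_gramian A C P \<longleftrightarrow> P \<in> carrier_mat n n \<and>
      tp (em A) * em P + em P * em A + em C * tp (em C) = 0" for P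
  proof (cases "P \<in> carrier_mat n n")
    case True
    have "em (A\<^sup>T * P + P * A + C * C\<^sup>T) = tp (em A) * em P + em P * em A + em C * tp (em C)"
      using True A C by (simp add: em_add em_mult em_transpose)
    then have "tp (em A) * em P + em P * em A + em C * tp (em C) = 0 \<longleftrightarrow> A\<^sup>T * P + P * A + C * C\<^sup>T = 0\<^sub>m n n"
      using True A C em_inject[of "A\<^sup>T * P + P * A + C * C\<^sup>T" n n "0\<^sub>m n n"] by auto
    then show ?thesis using True A C by (simp add: is_obs_gramian_def)
  qed (use A in \<open>auto simp: is_obs_gramian_def\<close>)
  have cw: "cm n n (em C * tp (em C))" using cm_em[OF C] by auto
  obtain X where X: "cm n n X" "tp (em A) * X + X * tp (tp (em A)) + em C * tp (em C) = 0"
    using lyapunov_solution[OF e cw] by blast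
  have "\<exists>!P. is_obs_gramian A C P"
  proof (rule ex1I[of _ "fm n n X"])
    show "is_obs_gramian A C (fm n n X)" unfolding iff using X by (simp add: em_fm)
    fix P assume "is_obs_gramian A C P"
    then have P: "P \<in> carrier_mat n n" "tp (em A) * em P + em P * tp (tp (em A)) + em C * tp (em C) = 0"
      unfolding iff by auto
    have "em P = X" by (rule lyapunov_unique[OF e P(2) cm_em[OF P(1)] X(2,1)])
    then show "P = fm n n X" by (intro em_inject[OF P(1) fm_carrier]) (simp add: em_fm X)
  qed
  from theI'[OF this] have *: "is_obs_gramian A C (obs_gramian A C)" by (simp add: obs_gramian_def)
  then show c: "obs_gramian A C \<in> carrier_mat n n"
    and eq: "tp (em A) * em (obs_gramian A C) + em (obs_gramian A C) * em A + em C * tp (em C) = 0"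
    unfolding iff by auto
  show "psd (em (obs_gramian A C))" 
    by (rule lyapunov_solution_psd[OF e _ cm_em[OF c]]) (use eq in simp)
qed

lemma hankel_norm_leI:
  assumes A: "A \<in> carrier_mat n n" "stable_mat A" and B: "B \<in> carrier_mat n m" and C: "C \<in> carrier_mat n p"
    and n: "n > 0"
    and bound: "\<And>l v. em (ctrl_gramian A B) * (em (obs_gramian A C) * v) = l *\<^sub>R v \<Longrightarrow>
      ide n * v = v \<Longrightarrow> v \<noteq> 0 \<Longrightarrow> l \<le> \<beta>"
  shows "hankel_norm A B C \<le> sqrt \<beta>"
proof -
  let ?P = "ctrl_gramian A B" and ?Q = "obs_gramian A C"
  note P = ctrl_gramian_correct[OF A B] and Q = obs_gramian_correct[OF A C]
  have PQ: "?P * ?Q \<in> carrier_mat n n" using P Q by simp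
  have fin: "finite {l. eigenvalue (?P * ?Q) l}"
    using card_finite_spectrum(1)[OF PQ] by (simp add: spectrum_def)
  have ne: "{l. eigenvalue (?P * ?Q) l} \<noteq> {}"
    using real_eigenvalue_psd_product[OF P(1,2) Q(1,2) n] by blast
  have "l \<le> \<beta>" if l: "eigenvalue (?P * ?Q) l" for l
  proof -
    obtain v where "eigenvector (?P * ?Q) v l" using l unfolding eigenvalue_def by blast
    then have v: "v \<in> carrier_vec n" "v \<noteq> 0\<^sub>v n" "(?P * ?Q) *\<^sub>v v = l \<cdot>\<^sub>v v"
      using P(1) by (auto simp: eigenvector_def)
    have "em (?P * ?Q) * ev v = ev (l \<cdot>\<^sub>v v)" using v PQ by (subst ev_mult[symmetric]) auto
    also have "\<dots> = l *\<^sub>R ev v" by (rule fmat_eqI) (auto simp: ent_ev)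
    finally have "em ?P * (em ?Q * ev v) = l *\<^sub>R ev v" using P(1) Q(1) by (simp add: em_mult mult.assoc)
    moreover have "ev v \<noteq> 0"
    proof
      assume ev0: "ev v = 0"
      have "v $ i = 0" if "i < n" for i
      proof -
        have "v $ i = ent (ev v) i 0" using that v(1) by (auto simp: ent_ev)
        then show ?thesis by (simp add: ev0)
      qed
      then show False using v by auto
    qed
    ultimately show ?thesis using bound cm_ev[OF v(1)] by (simp add: cmD)
  qed
  then show ?thesis unfolding hankel_norm_def using fin ne by (intro real_sqrt_le_mono) simp
qed

lemma h2_norm_em:
  assumes A: "A \<in> carrier_mat n n" "stable_mat A" and B: "B \<in> carrier_mat n m" and C: "C \<in> carrier_mat n p"
  shows "h2_norm A B C = sqrt (inner (ide m) (tp (em B) * em (obs_gramian A C) * em B))"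
proof -
  note Q = obs_gramian_correct(1)[OF A C]
  have "B\<^sup>T * obs_gramian A C * B \<in> carrier_mat m m" using B Q by simp
  from mat_trace_em[OF this] show ?thesis using B Q by (simp add: h2_norm_def em_mult em_transpose mult.assoc)
qed

lemma mat_inv_eqI:
  fixes M :: "'a::field mat"
  assumes M: "M \<in> carrier_mat n n" and N: "N \<in> carrier_mat n n" and eq: "M * N = 1\<^sub>m n"
  shows "mat_inv M = N"
proof -
  have "det M * det N = 1" using det_mult[OF M N] eq by simp
  then have "det M \<noteq> 0" by auto
  note inv = mat_inv_correct[OF M this]
  have "mat_inv M = mat_inv M * (M * N)" using inv(1) by (simp add: eq)
  also have "\<dots> = mat_inv M * M * N" by (rule assoc_mult_mat[symmetric, OF inv(1) M N])
  also have "\<dots> = N" using N by (simp add: inv)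
  finally show ?thesis .
qed

lemma resolvent_inverse:
  fixes X :: "'a::field mat"
  assumes X: "X \<in> carrier_mat n n" and s: "\<not> eigenvalue X s"
  defines "M \<equiv> s \<cdot>\<^sub>m 1\<^sub>m n - X"
  shows "M \<in> carrier_mat n n" "mat_inv M \<in> carrier_mat n n" "M * mat_inv M = 1\<^sub>m n"
proof -
  show M: "M \<in> carrier_mat n n" unfolding M_def using X by (metis minus_carrier_mat)
  have "char_matrix X s = (- 1) \<cdot>\<^sub>m M"
    unfolding M_def char_matrix_def using X by (intro eq_matI) auto
  then have "det (char_matrix X s) = (- 1) ^ n * det M" using M by simp
  then have "det M \<noteq> 0" using s eigenvalue_det[OF X] by auto
  note inv = mat_inv_correct[OF M this]
  show "mat_inv M \<in> carrier_mat n n" "M * mat_inv M = 1\<^sub>m n" by (rule inv)+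
qed

lemma eigenvalue_block_diag:
  fixes X Y :: "complex mat"
  assumes X: "X \<in> carrier_mat n n" and Y: "Y \<in> carrier_mat m m"
  shows "eigenvalue (four_block_mat X (0\<^sub>m n m) (0\<^sub>m m n) Y) s \<longleftrightarrow> eigenvalue X s \<or> eigenvalue Y s"
proof -
  have "char_poly (four_block_mat X (0\<^sub>m n m) (0\<^sub>m m n) Y) = char_poly X * char_poly Y"
    by (rule char_poly_0_block[OF refl _ _ X _ Y]) (use char_poly_factorized[OF X] char_poly_factorized[OF Y] in auto)
  moreover have "four_block_mat X (0\<^sub>m n m) (0\<^sub>m m n) Y \<in> carrier_mat (n + m) (n + m)" using X Y by simp
  ultimately show ?thesis
    by (simp add: eigenvalue_root_char_poly[OF X] eigenvalue_root_char_poly[OF Y] eigenvalue_root_char_poly)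
qed

lemma cmat_block_diag:
  assumes "A1 \<in> carrier_mat n n" "A2 \<in> carrier_mat m m"
  shows "cmat (four_block_mat A1 (0\<^sub>m n m) (0\<^sub>m m n) A2) = four_block_mat (cmat A1) (0\<^sub>m n m) (0\<^sub>m m n) (cmat A2)"
  using assms by (intro eq_matI) auto

lemma stable_mat_block_diag:
  assumes "A1 \<in> carrier_mat n n" "A2 \<in> carrier_mat m m" "stable_mat A1" "stable_mat A2"
  shows "stable_mat (four_block_mat A1 (0\<^sub>m n m) (0\<^sub>m m n) A2)"
  using assms eigenvalue_block_diag[of "cmat A1" n "cmat A2" m]
  by (auto simp: stable_mat_def cmat_block_diag)

lemma four_block_no_cols_rows:
  assumes "X \<in> carrier_mat a b" "Y \<in> carrier_mat a 0" "Z \<in> carrier_mat 0 b" "W \<in> carrier_mat 0 0"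
  shows "four_block_mat X Y Z W = X"
  using assms by (intro eq_matI) auto

text \<open>The resolvent of a block diagonal matrix is block diagonal, and the sign in the second
  output block yields the difference. The blocks with no rows or columns stem from
  \<open>append_rows\<close>.\<close>

lemma transfer_function_diff:
  assumes A1: "A1 \<in> carrier_mat r r" and A2: "A2 \<in> carrier_mat r r"
    and B1: "B1 \<in> carrier_mat r m" and B2: "B2 \<in> carrier_mat r m"
    and C1: "C1 \<in> carrier_mat r p" and C2: "C2 \<in> carrier_mat r p"
  defines "A \<equiv> four_block_mat A1 (0\<^sub>m r r) (0\<^sub>m r r) A2"
  assumes s: "\<not> eigenvalue (cmat A) s"
  shows "transfer_function A1 B1 C1 s - transfer_function A2 B2 C2 s
    = transfer_function A (B1 @\<^sub>r B2) (C1 @\<^sub>r (- C2)) s"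
proof -
  have cA: "cmat A1 \<in> carrier_mat r r" "cmat A2 \<in> carrier_mat r r" using A1 A2 by auto
  have Ac: "A \<in> carrier_mat (r + r) (r + r)" using A1 A2 by (simp add: A_def)
  have ev: "\<not> eigenvalue (cmat A1) s" "\<not> eigenvalue (cmat A2) s"
    using s eigenvalue_block_diag[OF cA] by (auto simp: A_def cmat_block_diag[OF A1 A2])
  define M1 M2 where "M1 = s \<cdot>\<^sub>m 1\<^sub>m r - cmat A1" and "M2 = s \<cdot>\<^sub>m 1\<^sub>m r - cmat A2"
  note i1 = resolvent_inverse[OF cA(1) ev(1), folded M1_def] and i2 = resolvent_inverse[OF cA(2) ev(2), folded M2_def]
  define R1 R2 where "R1 = mat_inv M1" and "R2 = mat_inv M2"
  define R where "R = four_block_mat R1 (0\<^sub>m r r) (0\<^sub>m r r) R2"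
  have R12: "R1 \<in> carrier_mat r r" "R2 \<in> carrier_mat r r" using i1 i2 by (auto simp: R1_def R2_def)
  have M: "s \<cdot>\<^sub>m 1\<^sub>m (r + r) - cmat A = four_block_mat M1 (0\<^sub>m r r) (0\<^sub>m r r) M2"
    unfolding A_def cmat_block_diag[OF A1 A2] M1_def M2_def using A1 A2 by (intro eq_matI) auto
  have "four_block_mat M1 (0\<^sub>m r r) (0\<^sub>m r r) M2 * R
      = four_block_mat (M1 * R1 + 0\<^sub>m r r * 0\<^sub>m r r) (M1 * 0\<^sub>m r r + 0\<^sub>m r r * R2)
          (0\<^sub>m r r * R1 + M2 * 0\<^sub>m r r) (0\<^sub>m r r * 0\<^sub>m r r + M2 * R2)"
    unfolding R_def by (rule mult_four_block_mat) (use i1 i2 R12 in auto)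
  also have "\<dots> = four_block_mat (1\<^sub>m r) (0\<^sub>m r r) (0\<^sub>m r r) (1\<^sub>m r)"
    using i1 i2 R12 by (simp add: R1_def R2_def)
  also have "\<dots> = 1\<^sub>m (r + r)" by (intro eq_matI) auto
  finally have inv: "mat_inv (s \<cdot>\<^sub>m 1\<^sub>m (r + r) - cmat A) = R"
    unfolding M by (intro mat_inv_eqI[of _ "r + r"]) (use i1 i2 R12 in \<open>auto simp: R_def\<close>)
  let ?z = "0\<^sub>m 0 r :: complex mat" and ?b = "0\<^sub>m r 0 :: complex mat"
  have CT: "cmat (C1 @\<^sub>r (- C2))\<^sup>T = four_block_mat (cmat C1\<^sup>T) (- cmat C2\<^sup>T) ?z ?z"
    using C1 C2 by (intro eq_matI) (auto simp: append_rows_def)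
  have BB: "cmat (B1 @\<^sub>r B2) = four_block_mat (cmat B1) ?b (cmat B2) ?b"
    using B1 B2 by (intro eq_matI) (auto simp: append_rows_def)
  have "four_block_mat (cmat C1\<^sup>T) (- cmat C2\<^sup>T) ?z ?z * R
      = four_block_mat (cmat C1\<^sup>T * R1 + - cmat C2\<^sup>T * 0\<^sub>m r r) (cmat C1\<^sup>T * 0\<^sub>m r r + - cmat C2\<^sup>T * R2)
          (?z * R1 + ?z * 0\<^sub>m r r) (?z * 0\<^sub>m r r + ?z * R2)"
    unfolding R_def by (rule mult_four_block_mat) (use C1 C2 R12 in auto)
  also have "\<dots> = four_block_mat (cmat C1\<^sup>T * R1) (- (cmat C2\<^sup>T * R2)) ?z ?z"
  proof -
    have "cmat C1\<^sup>T * R1 + - cmat C2\<^sup>T * 0\<^sub>m r r = cmat C1\<^sup>T * R1"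
      using C1 C2 R12 by (subst right_mult_zero_mat[of _ p r]) auto
    moreover have "cmat C1\<^sup>T * 0\<^sub>m r r + - cmat C2\<^sup>T * R2 = - (cmat C2\<^sup>T * R2)"
      using C1 C2 R12 by (subst right_mult_zero_mat[of _ p r]) auto
    moreover have "?z * R1 + ?z * 0\<^sub>m r r = ?z" "?z * 0\<^sub>m r r + ?z * R2 = ?z"
      using R12 by auto
    ultimately show ?thesis by simp
  qed
  finally have CR: "four_block_mat (cmat C1\<^sup>T) (- cmat C2\<^sup>T) ?z ?z * R
      = four_block_mat (cmat C1\<^sup>T * R1) (- (cmat C2\<^sup>T * R2)) ?z ?z" .
  have "four_block_mat (cmat C1\<^sup>T * R1) (- (cmat C2\<^sup>T * R2)) ?z ?z * four_block_mat (cmat B1) ?b (cmat B2) ?b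
      = four_block_mat (cmat C1\<^sup>T * R1 * cmat B1 + - (cmat C2\<^sup>T * R2) * cmat B2)
         (cmat C1\<^sup>T * R1 * ?b + - (cmat C2\<^sup>T * R2) * ?b) (?z * cmat B1 + ?z * cmat B2) (?z * ?b + ?z * ?b)"
    by (rule mult_four_block_mat) (use C1 C2 B1 B2 R12 in auto)
  also have "\<dots> = cmat C1\<^sup>T * R1 * cmat B1 + - (cmat C2\<^sup>T * R2) * cmat B2"
    by (rule four_block_no_cols_rows) (use C1 C2 B1 B2 R12 in auto)
  also have "\<dots> = cmat C1\<^sup>T * R1 * cmat B1 - cmat C2\<^sup>T * R2 * cmat B2"
    using C1 C2 B1 B2 R12 by (intro eq_matI) auto
  finally have prod: "cmat (C1 @\<^sub>r (- C2))\<^sup>T * R * cmat (B1 @\<^sub>r B2)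
      = cmat C1\<^sup>T * R1 * cmat B1 - cmat C2\<^sup>T * R2 * cmat B2"
    unfolding CT BB CR .
  show ?thesis
    unfolding transfer_function_def using A1 A2 Ac
    by (simp add: inv prod flip: M1_def M2_def R1_def R2_def)
qed

section \<open>Rectangular diagonal matrices and partitioned orthogonal matrices\<close>

lemma ent_rect_diag: "ent (em (rect_diag k l f)) i j = (if i = j \<and> i < k \<and> j < l then f (i + 1) else 0)"
  by (auto simp: ent_em rect_diag_def)

lemma ent_rect_diag_mult:
  "ent (em (rect_diag k l f) * x) i j = (if i < k \<and> i < l then f (i + 1) * ent x i j else 0)"
proof -
  have "ent (em (rect_diag k l f) * x) i j = (\<Sum>t<l. ent (em (rect_diag k l f)) i t * ent x t j)"
    by (rule ent_times) (auto simp: ent_rect_diag)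
  also have "\<dots> = (\<Sum>t<l. if t = i then (if i < k then f (i + 1) * ent x i j else 0) else 0)"
    by (intro sum.cong) (auto simp: ent_rect_diag)
  finally show ?thesis by auto
qed

lemma opn_rect_diag:
  assumes c: "0 \<le> c" and f: "\<And>i. i < k \<Longrightarrow> i < l \<Longrightarrow> \<bar>f (i + 1)\<bar> \<le> c"
  shows "opn (em (rect_diag k l f)) \<le> c"
proof (rule opn_leI[OF c])
  fix x
  obtain N where N: "fbound (em (rect_diag k l f) * x) N \<and> fbound x N" using fbound_ex2 by blast
  have "(norm (em (rect_diag k l f) * x))\<^sup>2 \<le> (\<Sum>i<N. \<Sum>j<N. c\<^sup>2 * (ent x i j)\<^sup>2)"
    unfolding power2_norm_eq_inner inner_fbound[OF conjunct1[OF N]]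
  proof (intro sum_mono)
    fix i j
    have "(f (i + 1))\<^sup>2 \<le> c\<^sup>2" if "i < k" "i < l" using f[OF that] by (simp add: abs_le_square_iff[symmetric] c)
    then show "ent (em (rect_diag k l f) * x) i j * ent (em (rect_diag k l f) * x) i j \<le> c\<^sup>2 * (ent x i j)\<^sup>2"
      unfolding ent_rect_diag_mult
      by (auto simp: power_mult_distrib mult_right_mono simp flip: power2_eq_square)
  qed
  also have "\<dots> = (c * norm x)\<^sup>2"
    unfolding power_mult_distrib power2_norm_eq_inner inner_fbound[OF conjunct2[OF N]]
    by (simp add: sum_distrib_left power2_eq_square)
  finally show "norm (em (rect_diag k l f) * x) \<le> c * norm x"
    by (rule power2_le_imp_le) (use c in simp)
qed

lemma norm_rect_diag_ge:
  assumes c: "0 \<le> c" and f: "\<And>i. i < r \<Longrightarrow> c \<le> f (i + 1)" and x: "ide r * x = x"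
  shows "c * norm x \<le> norm (em (rect_diag r r f) * x)"
proof (rule power2_le_imp_le)
  obtain N where N: "fbound (em (rect_diag r r f) * x) N \<and> fbound x N" using fbound_ex2 by blast
  have x0: "ent x i j = 0" if "\<not> i < r" for i j using ent_ide_mult[of r x i j] x that by simp
  have "(c * norm x)\<^sup>2 = (\<Sum>i<N. \<Sum>j<N. c\<^sup>2 * (ent x i j)\<^sup>2)"
    unfolding power_mult_distrib power2_norm_eq_inner inner_fbound[OF conjunct2[OF N]]
    by (simp add: sum_distrib_left power2_eq_square)
  also have "\<dots> \<le> (norm (em (rect_diag r r f) * x))\<^sup>2"
    unfolding power2_norm_eq_inner inner_fbound[OF conjunct1[OF N]]
  proof (intro sum_mono)
    fix i j
    have "c\<^sup>2 \<le> (f (i + 1))\<^sup>2" if "i < r" using f[OF that] c by (simp add: power_mono)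
    then show "c\<^sup>2 * (ent x i j)\<^sup>2 \<le> ent (em (rect_diag r r f) * x) i j * ent (em (rect_diag r r f) * x) i j"
      unfolding ent_rect_diag_mult
      by (auto simp: power_mult_distrib mult_right_mono x0 simp flip: power2_eq_square)
  qed
  finally show "(c * norm x)\<^sup>2 \<le> (norm (em (rect_diag r r f) * x))\<^sup>2" .
qed simp

lemma rect_diag_split:
  assumes "r \<le> k" "r \<le> l"
  shows "em (rect_diag k l f) = em (rect_diag r r f)
    + sh r (k - r) * em (rect_diag (k - r) (l - r) (\<lambda>i. f (i + r))) * tp (sh r (l - r))"
proof (rule fmat_eqI)
  fix i j
  show "ent (em (rect_diag k l f)) i j = ent (em (rect_diag r r f)
    + sh r (k - r) * em (rect_diag (k - r) (l - r) (\<lambda>i. f (i + r))) * tp (sh r (l - r))) i j"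
    using assms by (auto simp: ent_sh_mult ent_mult_tp_sh ent_rect_diag add.commute)
qed

text \<open>The blocks are the orthogonal matrix times the two injections \<open>ide r\<close> and
  \<open>sh r (m - r)\<close>. The completeness relation needs the product in the other order, which
  squareness provides.\<close>

lemma orthogonal_blocks:
  assumes U: "U1 \<in> carrier_mat m r" "U2 \<in> carrier_mat m (m - r)" "(U1 @\<^sub>c U2)\<^sup>T * (U1 @\<^sub>c U2) = 1\<^sub>m m" and r: "r \<le> m"
  shows "tp (em U1) * em U1 = ide r" "tp (em U1) * em U2 = 0" "tp (em U2) * em U2 = ide (m - r)"
    "em U1 * tp (em U1) + em U2 * tp (em U2) = ide m"
proof -
  define V where "V = U1 @\<^sub>c U2"
  have V: "V \<in> carrier_mat m m" "em V = em U1 + em U2 * tp (sh r (m - r))"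
    using em_append_cols[OF U(1,2)] r by (simp_all add: V_def)
  have VV: "tp (em V) * em V = ide m"
    using arg_cong[OF U(3), of em] V(1) by (simp add: em_mult em_transpose flip: V_def)
  have "V * V\<^sup>T = 1\<^sub>m m" by (rule mat_mult_left_right_inverse[of "V\<^sup>T" m V]) (use V U(3) in \<open>auto simp: V_def\<close>)
  from arg_cong[OF this, of em] have VV': "em V * tp (em V) = ide m" using V(1) by (simp add: em_mult em_transpose)
  note o = tp_sh_sh_0'[of 0 r r "m - r"] tp_sh_sh_0[of 0 r r "m - r"] tp_sh_sh[of r "m - r"]
  have o': "tp (sh r (m - r)) * ide r = 0" "ide r * sh r (m - r) = 0" using o by simp_all
  note cU = cm_em[OF U(1)] cm_em[OF U(2)]
  have U1: "em U1 = em V * ide r" and U2: "em U2 = em V * sh r (m - r)"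
    using cU cmD(4)[OF cU(1), of "sh r (m - r)"]
    by (simp_all add: V(2) distrib_right mult.assoc o o' cmD)
  have i: "ide m * ide r = ide r" "ide m * sh r (m - r) = sh r (m - r)" using r by (simp_all add: ide_ide ide_sh)
  show "tp (em U1) * em U1 = ide r" "tp (em U1) * em U2 = 0" "tp (em U2) * em U2 = ide (m - r)"
    unfolding U1 U2 by (simp_all add: mult.assoc VV[THEN mult_extend] i o o')
  have c: "em U1 * (sh r (m - r) * y) = 0" for y
    using cmD(4)[OF cU(1), of "sh r (m - r) * y"] by (simp add: o'[THEN mult_extend])
  have c2: "tp (sh r (m - r)) * (tp (em U1) * y) = 0" for y
  proof -
    have "tp (sh r (m - r)) * (tp (em U1) * y) = tp (sh r (m - r)) * (ide r * (tp (em U1) * y))"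
      using cm_tp[OF cU(1)] by (simp add: cmD)
    then show ?thesis by (simp add: o'[THEN mult_extend])
  qed
  have c3: "tp (sh r (m - r)) * tp (em U1) = 0"
  proof -
    have "tp (sh r (m - r)) * tp (em U1) = tp (sh r (m - r)) * (ide r * tp (em U1))"
      using cm_tp[OF cU(1)] by (simp add: cmD)
    then show ?thesis by (simp add: o'[THEN mult_extend])
  qed
  show "em U1 * tp (em U1) + em U2 * tp (em U2) = ide m"
    using VV' cU cm_tp[OF cU(2)] unfolding V(2)
    by (simp add: distrib_left distrib_right mult.assoc c c2 c3 o(3)[THEN mult_extend] cmD)
qed

section \<open>Error bounds\<close>

text \<open>The block diagonal equation decouples under compression by the two injections
  \<open>ide r\<close> and \<open>j\<close>.\<close>

lemma block_lyapunov:
  fixes P :: fmat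
  assumes A: "cm r r A1" "cm r r A2" and B: "cm r m B1" "cm r m B2" and P: "cm (r + r) (r + r) P"
  defines "j \<equiv> sh r r"
  assumes eq: "(A1 + j * A2 * tp j) * P + P * tp (A1 + j * A2 * tp j) + (B1 + j * B2) * tp (B1 + j * B2) = 0"
  shows "A1 * (ide r * P * ide r) + (ide r * P * ide r) * tp A1 + B1 * tp B1 = 0"
    "A1 * (ide r * P * j) + (ide r * P * j) * tp A2 + B1 * tp B2 = 0"
    "A2 * (tp j * P * j) + (tp j * P * j) * tp A2 + B2 * tp B2 = 0"
    "cm r r (ide r * P * ide r)" "cm r r (ide r * P * j)" "cm r r (tp j * P * j)"
proof -
  have j: "tp j * j = ide r" "ide r * j = 0" "tp j * ide r = 0" "j * ide r = j" "ide r * tp j = tp j"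
    using tp_sh_sh[of r r] tp_sh_sh_0[of 0 r r r] tp_sh_sh_0'[of 0 r r r] sh_ide[of r r]
    by (simp_all add: j_def ide_tp_sh)
  have z: "x * (j * y) = 0" "x * j = 0" if "x * ide r = x" for x y
  proof -
    have "x * j = x * ide r * j" using that by simp
    also have "\<dots> = 0" by (simp add: mult.assoc j)
    finally show "x * j = 0" .
    then show "x * (j * y) = 0" by (simp flip: mult.assoc)
  qed
  have z': "tp j * (x * y) = 0" "tp j * x = 0" if "ide r * x = x" for x y
  proof -
    have "tp j * x = tp j * (ide r * x)" using that by simp
    also have "\<dots> = 0" by (simp add: j flip: mult.assoc)
    finally show "tp j * x = 0" .
    then show "tp j * (x * y) = 0" by (simp flip: mult.assoc)
  qed
  note c = A[THEN cmD(1)] A[THEN cmD(2)] A[THEN cmD(3)] A[THEN cmD(4)] 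
    A[THEN cm_tp, THEN cmD(1)] A[THEN cm_tp, THEN cmD(2)] A[THEN cm_tp, THEN cmD(3)] A[THEN cm_tp, THEN cmD(4)]
    B[THEN cmD(1)] B[THEN cmD(3)] B[THEN cm_tp, THEN cmD(2)] B[THEN cm_tp, THEN cmD(4)]
  note zz = z(1)[OF A(1)[THEN cmD(2)]] z(2)[OF A(1)[THEN cmD(2)]] 
    z(1)[OF A(1)[THEN cm_tp, THEN cmD(2)]] z(2)[OF A(1)[THEN cm_tp, THEN cmD(2)]]
    z(1)[OF B(1)[THEN cm_tp, THEN cmD(2)]] z(2)[OF B(1)[THEN cm_tp, THEN cmD(2)]]
    z'(1)[OF A(1)[THEN cmD(1)]] z'(2)[OF A(1)[THEN cmD(1)]]
    z'(1)[OF B(1)[THEN cmD(1)]] z'(2)[OF B(1)[THEN cmD(1)]]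
  note rw = mult.assoc distrib_left distrib_right j j[THEN mult_extend] ide_idem[THEN mult_extend] c zz
  have "ide r * ((A1 + j * A2 * tp j) * P + P * tp (A1 + j * A2 * tp j) + (B1 + j * B2) * tp (B1 + j * B2)) * ide r = 0"
    unfolding eq by simp
  then show "A1 * (ide r * P * ide r) + (ide r * P * ide r) * tp A1 + B1 * tp B1 = 0"
    by (simp add: rw)
  have "ide r * ((A1 + j * A2 * tp j) * P + P * tp (A1 + j * A2 * tp j) + (B1 + j * B2) * tp (B1 + j * B2)) * j = 0"
    unfolding eq by simp
  then show "A1 * (ide r * P * j) + (ide r * P * j) * tp A2 + B1 * tp B2 = 0"
    by (simp add: rw)
  have "tp j * ((A1 + j * A2 * tp j) * P + P * tp (A1 + j * A2 * tp j) + (B1 + j * B2) * tp (B1 + j * B2)) * j = 0"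
    unfolding eq by simp
  then show "A2 * (tp j * P * j) + (tp j * P * j) * tp A2 + B2 * tp B2 = 0"
    by (simp add: rw)
  show "cm r r (ide r * P * ide r)" "cm r r (ide r * P * j)" "cm r r (tp j * P * j)"
    by (simp_all add: cm_def mult.assoc j j[THEN mult_extend] ide_idem[THEN mult_extend])
qed

text \<open>Here k a is an \<eta> below 1/2, so k \<tau> \<le> \<phi> / 2 \<le> 1/4 and 1 - k \<tau>
  \<ge> 3/4. The first claim is for the observability side, where \<sigma> is
  \<open>s1\<^sup>2\<close> and the excess 2/3 \<phi> \<sigma> is split off. The second is for the
  controllability side with 1 in place of \<sigma>, where the whole bound shrinks by \<phi>.\<close>

lemma cross_gain_le:
  fixes k \<tau> \<phi> a c \<sigma> :: real
  assumes "0 \<le> k" "0 \<le> a" "k * a < 1 / 2" "0 \<le> \<phi>" "\<phi> \<le> 1 / 2" "\<tau> = \<phi> * a" "0 \<le> c" "0 \<le> \<sigma>"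
  shows "k / (1 - k * \<tau>) * (c + \<sigma> * \<tau>) \<le> k / (1 - k * a) * (c + a) + 2 / 3 * \<phi> * \<sigma>"
    "c' \<le> \<phi> * c \<Longrightarrow> k / (1 - k * \<tau>) * (c' + 1 * \<tau>) \<le> \<phi> * (k / (1 - k * a) * (c + a))"
    "k * \<tau> < 1"
proof -
  have ka: "0 \<le> k * a" using assms by simp
  have kt: "k * \<tau> = \<phi> * (k * a)" using assms by simp
  have le1: "k * \<tau> \<le> \<phi> / 2" unfolding kt using assms mult_left_mono[of "k * a" "1/2" \<phi>] by simp
  have le2: "k * \<tau> \<le> k * a" unfolding kt using assms ka mult_right_mono[of \<phi> 1 "k * a"] by simp
  have le0: "0 \<le> k * \<tau>" unfolding kt using assms ka by simp
  show "k * \<tau> < 1" using le2 assms by simp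
  have g: "k / (1 - k * \<tau>) \<le> k / (1 - k * a)" using assms le2 by (intro divide_left_mono mult_pos_pos) auto
  have "k / (1 - k * \<tau>) * (\<sigma> * \<tau>) = \<sigma> * (k * \<tau>) / (1 - k * \<tau>)" by simp
  also have "\<dots> \<le> \<sigma> * (\<phi> / 2) / (3 / 4)"
    using le1 le0 assms by (intro frac_le mult_left_mono mult_nonneg_nonneg) auto
  also have "\<dots> = 2 / 3 * \<phi> * \<sigma>" by simp
  finally have 1: "k / (1 - k * \<tau>) * (\<sigma> * \<tau>) \<le> 2 / 3 * \<phi> * \<sigma>" .
  have 2: "k / (1 - k * \<tau>) * c \<le> k / (1 - k * a) * c" using g assms by (intro mult_right_mono) auto
  have 3: "0 \<le> k / (1 - k * a) * a" using assms by simp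
  show "k / (1 - k * \<tau>) * (c + \<sigma> * \<tau>) \<le> k / (1 - k * a) * (c + a) + 2 / 3 * \<phi> * \<sigma>"
    using 1 2 3 unfolding distrib_left by linarith
  assume c': "c' \<le> \<phi> * c"
  have "k / (1 - k * \<tau>) * (c' + 1 * \<tau>) \<le> k / (1 - k * \<tau>) * (\<phi> * (c + a))"
    using c' assms le2 by (intro mult_left_mono) (auto simp: distrib_left)
  also have "\<dots> \<le> k / (1 - k * a) * (\<phi> * (c + a))" using g assms by (intro mult_right_mono) auto
  finally show "k / (1 - k * \<tau>) * (c' + 1 * \<tau>) \<le> \<phi> * (k / (1 - k * a) * (c + a))" by (simp add: mult_ac)
qed

text \<open>As for the cross blocks, but now 2 k \<tau> \<le> \<phi> \<le> 1/2; dividing by 1/2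
  gives the excess 2 \<phi> \<sigma>.\<close>

lemma full_gain_le:
  fixes k \<tau> \<phi> a c \<sigma> :: real
  assumes "0 \<le> k" "0 \<le> a" "k * a < 1 / 2" "0 \<le> \<phi>" "\<phi> \<le> 1 / 2" "\<tau> = \<phi> * a" "0 \<le> c" "0 \<le> \<sigma>"
  shows "k / (1 - 2 * (k * \<tau>)) * (c + 2 * (\<sigma> * \<tau>)) \<le> k / (1 - 2 * (k * a)) * (c + 2 * a) + 2 * \<phi> * \<sigma>"
    "c' \<le> \<phi> * c \<Longrightarrow> k / (1 - 2 * (k * \<tau>)) * (c' + 2 * (1 * \<tau>)) \<le> \<phi> * (k / (1 - 2 * (k * a)) * (c + 2 * a))"
    "2 * (k * \<tau>) < 1"
proof -
  have ka: "0 \<le> k * a" using assms by simp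
  have kt: "k * \<tau> = \<phi> * (k * a)" using assms by simp
  have le1: "2 * (k * \<tau>) \<le> \<phi>" unfolding kt using assms mult_left_mono[of "k * a" "1/2" \<phi>] by simp
  have le2: "k * \<tau> \<le> k * a" unfolding kt using assms ka mult_right_mono[of \<phi> 1 "k * a"] by simp
  have le0: "0 \<le> k * \<tau>" unfolding kt using assms ka by simp
  show "2 * (k * \<tau>) < 1" using le2 assms by simp
  have g: "k / (1 - 2 * (k * \<tau>)) \<le> k / (1 - 2 * (k * a))"
    using assms le2 by (intro divide_left_mono mult_pos_pos) auto
  have "k / (1 - 2 * (k * \<tau>)) * (2 * (\<sigma> * \<tau>)) = \<sigma> * (2 * (k * \<tau>)) / (1 - 2 * (k * \<tau>))" by simp
  also have "\<dots> \<le> \<sigma> * \<phi> / (1 / 2)"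
    using le1 le0 assms by (intro frac_le mult_left_mono mult_nonneg_nonneg) auto
  also have "\<dots> = 2 * \<phi> * \<sigma>" by simp
  finally have 1: "k / (1 - 2 * (k * \<tau>)) * (2 * (\<sigma> * \<tau>)) \<le> 2 * \<phi> * \<sigma>" .
  have 2: "k / (1 - 2 * (k * \<tau>)) * c \<le> k / (1 - 2 * (k * a)) * c" using g assms by (intro mult_right_mono) auto
  have 3: "0 \<le> k / (1 - 2 * (k * a)) * (2 * a)" using assms by simp
  show "k / (1 - 2 * (k * \<tau>)) * (c + 2 * (\<sigma> * \<tau>)) \<le> k / (1 - 2 * (k * a)) * (c + 2 * a) + 2 * \<phi> * \<sigma>"
    using 1 2 3 unfolding distrib_left by linarith
  assume c': "c' \<le> \<phi> * c"
  have "k / (1 - 2 * (k * \<tau>)) * (c' + 2 * (1 * \<tau>)) \<le> k / (1 - 2 * (k * \<tau>)) * (\<phi> * (c + 2 * a))"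
    using c' assms le2 by (intro mult_left_mono) (auto simp: distrib_left)
  also have "\<dots> \<le> k / (1 - 2 * (k * a)) * (\<phi> * (c + 2 * a))" using g assms by (intro mult_right_mono) auto
  finally show "k / (1 - 2 * (k * \<tau>)) * (c' + 2 * (1 * \<tau>)) \<le> \<phi> * (k / (1 - 2 * (k * a)) * (c + 2 * a))"
    by (simp add: mult_ac)
qed

text \<open>8/3 is the total excess 2/3 + 2. The coefficient of \<sigma> on the left is at most 1 +
  16/54 + 2/3 times \<xi>, which is below 2; this is where 18 \<phi> \<le> \<xi> pays for the
  excess.\<close>

lemma hankel_radicand_le:
  fixes \<sigma> \<phi> \<xi> \<zeta> :: real
  assumes "0 \<le> \<sigma>" "0 \<le> \<phi>" "\<phi> \<le> 1 / 2" "18 * \<phi> \<le> \<xi>" "0 \<le> \<zeta>"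
  shows "2 * \<sigma> * (\<phi> * \<xi>) + 2 * (\<zeta> + 8 / 3 * \<phi> * \<sigma>) + (\<phi> * \<xi>) * (\<zeta> + 8 / 3 * \<phi> * \<sigma>)
    \<le> 2 * \<sigma> * \<xi> + 2 * \<zeta> + \<xi> * \<zeta>"
proof -
  have \<xi>: "0 \<le> \<xi>" using assms by linarith
  have 1: "\<phi> * \<xi> \<le> 1 / 2 * \<xi>" using assms \<xi> by (intro mult_right_mono) auto
  have 2: "\<phi> * (\<phi> * \<xi>) \<le> 1 / 2 * (1 / 2 * \<xi>)" using assms \<xi> 1 by (intro mult_mono) auto
  have "2 * (\<phi> * \<xi>) + 16 / 3 * \<phi> + 8 / 3 * (\<phi> * (\<phi> * \<xi>)) \<le> 2 * \<xi>" using 1 2 assms by linarith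
  then have "\<sigma> * (2 * (\<phi> * \<xi>) + 16 / 3 * \<phi> + 8 / 3 * (\<phi> * (\<phi> * \<xi>))) \<le> \<sigma> * (2 * \<xi>)"
    using assms by (intro mult_left_mono) auto
  moreover have "\<phi> * (\<xi> * \<zeta>) \<le> 1 * (\<xi> * \<zeta>)" using assms \<xi> by (intro mult_right_mono) auto
  ultimately show ?thesis by (simp add: algebra_simps)
qed

text \<open>\<open>y\<close> is split into 3/8 for the square of the input error, where \<phi> \<le>
  1/2 halves the factor 3/4, and 5/8 for the excess on the observability side, where 16/5 times 5/8
  is 2.\<close>

lemma h2_radicand_le:
  fixes \<sigma> \<phi> bh b' bt y db z1 z2 :: real
  assumes \<sigma>: "0 \<le> \<sigma>" and \<phi>: "0 \<le> \<phi>" "\<phi> \<le> 1 / 2" and b: "0 \<le> bh" "0 \<le> b'" "b' \<le> bt"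
    and db: "0 \<le> db" "db \<le> bh + b'" "db \<le> 3 / 4 * \<phi> * y" and y: "16 / 5 * (\<phi> * bt) \<le> y" and z: "0 \<le> z1" "0 \<le> z2"
  shows "\<sigma> * db\<^sup>2 + 2 * bh * b' * (z1 + 2 / 3 * \<phi> * \<sigma>) + b'\<^sup>2 * (z2 + 2 * \<phi> * \<sigma>)
    \<le> \<sigma> * (bh + bt) * y + (2 * bh * bt * z1 + bt\<^sup>2 * z2)"
proof -
  have y0: "0 \<le> y" using y \<phi> b by (meson mult_nonneg_nonneg order_trans zero_le_divide_iff zero_le_numeral)
  have db': "db \<le> 3 / 8 * y" using db(3) \<phi> y0 mult_right_mono[of \<phi> "1/2" y] by simp
  have "db\<^sup>2 \<le> (bh + bt) * (3 / 8 * y)"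
    unfolding power2_eq_square using db db' b by (intro mult_mono) auto
  moreover have "4 / 3 * \<phi> * (bh * b') + 2 * \<phi> * (b' * b') \<le> (bh + bt) * (5 / 8 * y)"
  proof -
    have "4 / 3 * \<phi> * (bh * b') \<le> 2 * \<phi> * (bh * bt)" "2 * \<phi> * (b' * b') \<le> 2 * \<phi> * (bt * bt)"
      using b \<phi> by (intro mult_mono; simp)+
    then have "4 / 3 * \<phi> * (bh * b') + 2 * \<phi> * (b' * b') \<le> (bh + bt) * (2 * (\<phi> * bt))" by (simp add: algebra_simps)
    also have "\<dots> \<le> (bh + bt) * (5 / 8 * y)" using y b by (intro mult_left_mono) auto
    finally show ?thesis .
  qed
  ultimately have "db\<^sup>2 + (4 / 3 * \<phi> * (bh * b') + 2 * \<phi> * (b' * b')) \<le> (bh + bt) * y" by (simp add: algebra_simps)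
  then have "\<sigma> * (db\<^sup>2 + (4 / 3 * \<phi> * (bh * b') + 2 * \<phi> * (b' * b'))) \<le> \<sigma> * ((bh + bt) * y)" by (rule mult_left_mono) (rule \<sigma>)
  moreover have "2 * bh * b' * z1 \<le> 2 * bh * bt * z1" using b z by (intro mult_right_mono mult_left_mono) auto
  moreover have "b'\<^sup>2 * z2 \<le> bt\<^sup>2 * z2" using b z by (intro mult_right_mono power_mono) auto
  ultimately show ?thesis by (simp add: algebra_simps power2_eq_square)
qed

text \<open>The terms with \<open>e1\<close> and \<open>e2\<close> are dropped, and s \<le> s1 turns
  2 s1 / (s - \<epsilon>) into 2 + 2 \<epsilon> / (s - \<epsilon>). With the summand 1 this makes 3,
  doubled to 6 by 2 \<epsilon> / d; the term with \<open>ex\<close> raises 3 to 4 in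
  \<open>ea\<close>.\<close>

lemma error_constants_lower:
  fixes \<alpha> \<beta> e1 e2 \<epsilon> s d s1 ex ey ea :: real
  assumes nonneg: "0 \<le> \<alpha>" "0 \<le> \<beta>" "0 \<le> e1" "0 \<le> e2" "0 \<le> \<epsilon>" and d: "0 < d" and s: "\<epsilon> < s" "s \<le> s1"
    and ex: "ex = e1 + \<alpha> * (2 * \<epsilon> / d)"
    and ey: "ey = e2 / s + \<beta> / s * (1 + d / (2 * (s - \<epsilon>)) + 2 * s1 / (s - \<epsilon>)) * (2 * \<epsilon> / d)"
    and ea: "ea = \<alpha> * ey + \<beta> / s * ex"
  shows "2 * \<alpha> * (\<epsilon> / d) \<le> ex" "6 * (\<beta> / s) * (\<epsilon> / d) \<le> ey"
    "\<alpha> * (\<beta> / s) * (4 + (2 * \<epsilon> + d / 2) / (s - \<epsilon>)) * (2 * (\<epsilon> / d)) \<le> ea"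
proof -
  define \<phi> where "\<phi> = \<epsilon> / d"
  have \<phi>: "0 \<le> \<phi>" "2 * \<epsilon> / d = 2 * \<phi>" using nonneg d by (auto simp: \<phi>_def)
  have sp: "0 < s" "0 < s - \<epsilon>" using s nonneg by auto
  have frac: "2 + 2 * \<epsilon> / (s - \<epsilon>) \<le> 2 * s1 / (s - \<epsilon>)"
  proof -
    have "2 + 2 * \<epsilon> / (s - \<epsilon>) = 2 * s / (s - \<epsilon>)" using sp by (simp add: field_simps)
    also have "\<dots> \<le> 2 * s1 / (s - \<epsilon>)" using s sp by (intro divide_right_mono) auto
    finally show ?thesis .
  qed
  have bs: "0 \<le> \<beta> / s" using nonneg sp by simp
  have q: "0 \<le> 2 * \<epsilon> / (s - \<epsilon>)" "0 \<le> d / (2 * (s - \<epsilon>))" using nonneg sp d by auto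
  show ex': "2 * \<alpha> * (\<epsilon> / d) \<le> ex" using nonneg unfolding ex \<phi> by (simp add: \<phi>_def mult_ac)
  have ey': "\<beta> / s * (3 + d / (2 * (s - \<epsilon>)) + 2 * \<epsilon> / (s - \<epsilon>)) * (2 * \<phi>) \<le> ey"
  proof -
    have "\<beta> / s * (3 + d / (2 * (s - \<epsilon>)) + 2 * \<epsilon> / (s - \<epsilon>)) * (2 * \<phi>) \<le>
        \<beta> / s * (1 + d / (2 * (s - \<epsilon>)) + 2 * s1 / (s - \<epsilon>)) * (2 * \<phi>)"
      using frac bs \<phi> by (intro mult_right_mono mult_left_mono) auto
    moreover have "0 \<le> e2 / s" using nonneg sp by simp
    ultimately show ?thesis unfolding ey \<phi> by linarith
  qed
  have "\<beta> / s * 3 * (2 * \<phi>) \<le> \<beta> / s * (3 + d / (2 * (s - \<epsilon>)) + 2 * \<epsilon> / (s - \<epsilon>)) * (2 * \<phi>)"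
    using bs q \<phi> by (intro mult_right_mono mult_left_mono) auto
  then show "6 * (\<beta> / s) * (\<epsilon> / d) \<le> ey" using ey' by (simp add: \<phi>_def)
  have frac2: "(2 * \<epsilon> + d / 2) / (s - \<epsilon>) = d / (2 * (s - \<epsilon>)) + 2 * \<epsilon> / (s - \<epsilon>)"
    by (simp add: add_divide_distrib)
  have expand: "a * b * (4 + (u + v)) * (2 * f) = a * (b * (3 + u + v) * (2 * f)) + b * (2 * a * f)" for a b u v f :: real
    by (simp add: algebra_simps)
  have "\<alpha> * (\<beta> / s) * (4 + (2 * \<epsilon> + d / 2) / (s - \<epsilon>)) * (2 * (\<epsilon> / d)) =
      \<alpha> * (\<beta> / s * (3 + d / (2 * (s - \<epsilon>)) + 2 * \<epsilon> / (s - \<epsilon>)) * (2 * \<phi>)) + \<beta> / s * (2 * \<alpha> * (\<epsilon> / d))"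
    unfolding \<phi>_def frac2 by (rule expand)
  also have "\<dots> \<le> ea" unfolding ea using ey' ex' nonneg bs by (intro add_mono mult_left_mono) auto
  finally show "\<alpha> * (\<beta> / s) * (4 + (2 * \<epsilon> + d / 2) / (s - \<epsilon>)) * (2 * (\<epsilon> / d)) \<le> ea" .
qed

context reduced_truncation
begin

abbreviation br :: fmat where "br \<equiv> tp Yt * b"
abbreviation cr :: fmat where "cr \<equiv> tp Xt * c"
abbreviation Dr :: fmat where "Dr \<equiv> W * ared * Z - ah"

lemma cm_reduced: "cm r r ared" "cm r m br" "cm r p cr"
  unfolding ared_def
  by (rule cm_mult[OF cm_mult[OF cm_tp[OF cm_XtYt(2)] dims(1)] cm_XtYt(1)]
      cm_mult[OF cm_tp[OF cm_XtYt(2)] dims(2)] cm_mult[OF cm_tp[OF cm_XtYt(1)] dims(3)])+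

lemma Dr_eq: "Dr = tp Yh * a * Xh - tp Y1 * a * X1"
  by (simp add: Xh_def Yh_def ared_def ah_def Z mult.assoc)

lemma hat_eq: "W * br = tp Yh * b" "Z * cr = tp Xh * c"
  by (simp_all add: Xh_def Yh_def Z mult.assoc)

lemma reduced_stable:
  assumes e: "expdecay r (tp ah) \<Psi>" and K: "tp ah * K + K * ah + ide r = 0" "cm r r K"
    and A: "A \<in> carrier_mat r r" "em A = ared" and small: "2 * (opn K * opn Dr) < 1"
  shows "stable_mat A"
  by (rule lyapunov_perturbed_stable[OF e K A(1) Z(2,3,6) _ small]) (simp add: A(2))

text \<open>The claims concern arbitrary symmetric solutions \<open>P\<close> and \<open>Q\<close>
  of the error system's Lyapunov equations; the Gramians are inserted only after stability, the
  first claim, is available.\<close>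

lemma error_system_bounds:
  fixes ex ey ea eb2 ec2 :: real
  assumes e: "expdecay r ah \<Phi>"
    and K1: "ah * K1 + K1 * tp ah + ide r = 0" "cm r r K1" and K2: "tp ah * K2 + K2 * ah + ide r = 0" "cm r r K2"
    and ex: "2 * \<alpha> * (\<epsilon> / d) \<le> ex" and ey: "6 * (\<beta> / s) * (\<epsilon> / d) \<le> ey"
    and ea: "\<alpha> * (\<beta> / s) * (4 + (2 * \<epsilon> + d / 2) / (s - \<epsilon>)) * (2 * (\<epsilon> / d)) \<le> ea"
    and eb2: "eb2 = \<beta> * (1 / (s - \<epsilon>) + 1 / s) * ey" and ec2: "ec2 = 2 * \<alpha> * ex"
    and \<eta>: "\<eta>1 = opn K1 * (opn a * ea)" "\<eta>2 = opn K2 * (opn a * ea)" "\<eta>1 < 1 / 2" "\<eta>2 < 1 / 2"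
    and \<xi>1: "\<xi>1 = opn K1 / (1 - \<eta>1) * (opn bh * opn b * ey + opn a * ea)"
    and \<xi>2: "\<xi>2 = opn K1 / (1 - 2 * \<eta>1) * (opn (b * tp b) * eb2 + 2 * (opn a * ea))"
    and \<zeta>1: "\<zeta>1 = opn K2 / (1 - \<eta>2) * (opn ch * opn c * ex + opn a * ea)"
    and \<zeta>2: "\<zeta>2 = opn K2 / (1 - 2 * \<eta>2) * (opn (c * tp c) * ec2 + 2 * (opn a * ea))"
  defines "j \<equiv> sh r r"
  defines "A \<equiv> ah + j * ared * tp j" and "B \<equiv> bh + j * br" and "C \<equiv> ch + j * (- cr)"
  shows "\<And>A. A \<in> carrier_mat r r \<Longrightarrow> em A = ared \<Longrightarrow> stable_mat A"
    and "\<And>P Q l v. cm (r + r) (r + r) P \<Longrightarrow> tp P = P \<Longrightarrow> A * P + P * tp A + B * tp B = 0 \<Longrightarrow>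
      cm (r + r) (r + r) Q \<Longrightarrow> tp Q = Q \<Longrightarrow> tp A * Q + Q * A + C * tp C = 0 \<Longrightarrow>
      P * (Q * v) = l *\<^sub>R v \<Longrightarrow> ide (r + r) * v = v \<Longrightarrow> v \<noteq> 0 \<Longrightarrow>
      l \<le> 2 * s1\<^sup>2 * (\<xi>1 + \<xi>2) + 2 * (\<zeta>1 + \<zeta>2) + (\<xi>1 + \<xi>2) * (\<zeta>1 + \<zeta>2)"
    and "\<And>Q. cm (r + r) (r + r) Q \<Longrightarrow> tp Q = Q \<Longrightarrow> tp A * Q + Q * A + C * tp C = 0 \<Longrightarrow>
      inner (ide m) (tp B * Q * B) \<le> real (min r m) *
        (s1\<^sup>2 * (opn bh + opn br) * opn b * ey + (2 * opn bh * opn br * \<zeta>1 + (opn br)\<^sup>2 * \<zeta>2))"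
proof -
  define \<phi> where "\<phi> = \<epsilon> / d"
  have d: "0 < d" "2 * \<epsilon> < d" using \<epsilon>_gap \<epsilon>_bounds by linarith+
  have \<phi>: "0 \<le> \<phi>" "\<phi> \<le> 1 / 2" using d \<epsilon>_bounds by (auto simp: \<phi>_def)
  have bs: "0 \<le> \<beta> / s" using e_nonneg s_pos by simp
  have s\<epsilon>: "0 < s - \<epsilon>" using \<epsilon>_gap \<epsilon>_bounds s' by linarith
  have \<phi>': "\<epsilon> / d = \<phi>" by (simp add: \<phi>_def)
  note ex\<phi> = ex[unfolded \<phi>'] and ey\<phi> = ey[unfolded \<phi>']
  have ex0: "0 \<le> ex" by (rule order_trans[OF _ ex], unfold \<phi>') (use e_nonneg \<phi> in simp)
  have ey0: "0 \<le> ey" by (rule order_trans[OF _ ey], unfold \<phi>') (use bs \<phi> in \<open>intro mult_nonneg_nonneg; simp\<close>)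
  have "0 \<le> (2 * \<epsilon> + d / 2) / (s - \<epsilon>)" using d s\<epsilon> \<epsilon>_bounds by (intro divide_nonneg_nonneg) auto
  then have ea0: "0 \<le> ea"
    by (intro order_trans[OF _ ea], unfold \<phi>') (use bs \<phi> e_nonneg in \<open>intro mult_nonneg_nonneg add_nonneg_nonneg; simp\<close>)
  define a' where "a' = opn a * ea"
  \<comment> \<open>The bound on the perturbation of \<open>ah\<close> carries the extra factor
    \<phi> that \<open>reduced_A_diff\<close> provides.\<close>
  define \<tau> where "\<tau> = \<phi> * a'"
  have a'0: "0 \<le> a'" using ea0 by (simp add: a'_def)
  have Dr: "opn Dr \<le> \<tau>"
  proof -
    have "opn Dr \<le> opn a * (\<epsilon> / d) * ea"
      unfolding Dr_eq by (rule order_trans[OF reduced_A_diff]) (intro mult_left_mono ea mult_nonneg_nonneg, use \<phi> \<phi>_def in auto)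
    then show ?thesis by (simp add: \<tau>_def a'_def \<phi>_def mult_ac)
  qed
  have k1: "opn K1 * a' < 1 / 2" "opn K2 * a' < 1 / 2" using \<eta> by (simp_all add: a'_def)
  note e' = expdecay_tp[OF e]
  have K2': "tp ah * K2 + K2 * tp (tp ah) + ide r = 0" using K2 by simp
  show stable: "stable_mat A" if "A \<in> carrier_mat r r" "em A = ared" for A
  proof (rule reduced_stable[OF e' K2 that])
    have "opn K2 * opn Dr \<le> opn K2 * \<tau>" by (intro mult_left_mono Dr) simp
    also have "\<dots> = \<phi> * (opn K2 * a')" by (simp add: \<tau>_def)
    also have "\<dots> \<le> 1 / 2 * (opn K2 * a')" using \<phi> a'0 by (intro mult_right_mono) auto
    finally show "2 * (opn K2 * opn Dr) < 1" using k1 by simp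
  qed
  define b' c' where "b' = W * br" and "c' = Z * cr"
  have b'b: "b' - bh = tp (Yh - Y1) * b" and c'c: "c' - ch = tp (Xh - X1) * c"
    by (simp_all add: b'_def c'_def hat_eq bh_def ch_def left_diff_distrib)
  \<comment> \<open>9/2 = 3/4 times 6, and 6 is the constant in the lower bound of
    \<open>ey\<close>; one factor \<phi> stays visible.\<close>
  have dY: "opn (Yh - Y1) \<le> 3 / 4 * \<phi> * ey"
  proof -
    have "opn (Yh - Y1) \<le> 3 / 4 * \<phi> * (6 * (\<beta> / s) * \<phi>)"
      using Yh_Y1' unfolding \<phi>' by (simp add: power2_eq_square mult_ac)
    also have "\<dots> \<le> 3 / 4 * \<phi> * ey" using ey\<phi> \<phi> by (intro mult_left_mono) auto
    finally show ?thesis .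
  qed
  have dX: "opn (Xh - X1) \<le> 4 / 5 * ex" using Xh_X1'[unfolded \<phi>'] ex\<phi> by simp
  have ybt: "opn b' \<le> opn br" "opn b' \<le> \<beta> / w * opn b"
    using opn_mult_le[OF opn_WZ(1) order_refl, of br] opn_mult_le[of "tp Yh" "\<beta> / w" b, OF _ order_refl] opn_hat
    by (simp_all add: b'_def hat_eq)
  have bhb: "opn bh \<le> \<beta> / s * opn b"
    unfolding bh_def by (rule opn_mult_le) (simp_all add: opn_bases)
  have brb: "opn br \<le> \<beta> / w * opn b" by (rule opn_mult_le) (simp_all only: opn_tp opn_bases order_refl)
  have db: "opn (b' - bh) \<le> 3 / 4 * \<phi> * (opn b * ey)"
  proof -
    have "opn (b' - bh) \<le> 3 / 4 * \<phi> * ey * opn b"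
      unfolding b'b by (rule opn_mult_le) (simp_all only: opn_tp dY order_refl)
    then show ?thesis by (simp add: mult_ac)
  qed
  have dc: "opn (c' - ch) \<le> opn c * ex"
  proof -
    have "opn (c' - ch) \<le> 4 / 5 * ex * opn c"
      unfolding c'c by (rule opn_mult_le) (simp_all only: opn_tp dX order_refl)
    also have "\<dots> \<le> 1 * ex * opn c" using ex0 by (intro mult_right_mono) auto
    finally show ?thesis by (simp add: mult_ac)
  qed
  have bb: "opn (b' * tp b' - bh * tp bh) \<le> \<phi> * (opn (b * tp b) * eb2)"
  proof -
    have "b' * tp b' - bh * tp bh = tp Yh * (b * tp b) * (Yh - Y1) + tp (Yh - Y1) * (b * tp b) * Y1"
      by (simp add: b'_def hat_eq bh_def algebra_simps)
    also have "opn \<dots> \<le> \<beta> / w * opn (b * tp b) * (3 / 4 * \<phi> * ey) + 3 / 4 * \<phi> * ey * opn (b * tp b) * (\<beta> / s)"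
      by (intro opn_add_le opn_mult_le dY opn_bases order_refl) (simp_all only: opn_tp opn_hat dY)
    also have "\<dots> = (\<phi> * ey * opn (b * tp b) * \<beta>) * (3 / 4 * (1 / w + 1 / s))" by (simp add: algebra_simps)
    also have "\<dots> \<le> (\<phi> * ey * opn (b * tp b) * \<beta>) * (1 / (s - \<epsilon>) + 1 / s)"
    proof (intro mult_left_mono mult_nonneg_nonneg)
      have "3 / 4 * (s - \<epsilon>) \<le> w" using \<epsilon>_gap s' \<epsilon>_bounds by simp
      then have "3 / 4 * (1 / w) \<le> 1 / (s - \<epsilon>)" using w_pos s\<epsilon> by (simp add: field_simps)
      moreover have "3 / 4 * (1 / s) \<le> 1 / s" using s_pos by (intro mult_left_le_one_le) auto
      ultimately show "3 / 4 * (1 / w + 1 / s) \<le> 1 / (s - \<epsilon>) + 1 / s" by (simp add: distrib_left)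
    qed (use \<phi> ey0 e_nonneg in auto)
    finally show ?thesis by (simp add: eb2 mult_ac)
  qed
  have cc: "opn (c' * tp c' - ch * tp ch) \<le> opn (c * tp c) * ec2"
  proof -
    have "c' * tp c' - ch * tp ch = tp Xh * (c * tp c) * (Xh - X1) + tp (Xh - X1) * (c * tp c) * X1"
      by (simp add: c'_def hat_eq ch_def algebra_simps)
    \<comment> \<open>3/2 times 4/5 plus 4/5 is 2, the constant in \<open>ec2\<close>.\<close>
    also have "opn \<dots> \<le> 3 / 2 * \<alpha> * opn (c * tp c) * (4 / 5 * ex) + 4 / 5 * ex * opn (c * tp c) * \<alpha>"
      by (intro opn_add_le opn_mult_le dX opn_bases order_refl) (simp_all only: opn_tp opn_hat dX)
    also have "\<dots> = opn (c * tp c) * (2 * \<alpha> * ex)" by (simp add: algebra_simps)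
    finally show ?thesis by (simp add: ec2)
  qed
  have sum: "ah + Dr = W * ared * Z" by simp
  have opn_SS: "opn (Sg * Sg) \<le> s1\<^sup>2" using opn_mult_le[OF opn_Sg opn_Sg] by (simp add: power2_eq_square)
  have cmSS: "cm r r (Sg * Sg)" using dims(10) by auto
  have \<xi>0: "0 \<le> \<xi>1" "0 \<le> \<xi>2" "0 \<le> \<zeta>1" "0 \<le> \<zeta>2"
  proof -
    have "0 \<le> eb2" "0 \<le> ec2" using ey0 ex0 e_nonneg s\<epsilon> s_pos by (auto simp: eb2 ec2)
    then show "0 \<le> \<xi>1" "0 \<le> \<xi>2" "0 \<le> \<zeta>1" "0 \<le> \<zeta>2"
      using \<eta>(3,4) ey0 ex0 ea0 unfolding \<xi>1 \<xi>2 \<zeta>1 \<zeta>2 by auto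
  qed
  have ctrl0: "ah * ide r + ide r * tp ah + bh * tp bh = 0"
    using lyap_red_ctrl cm_ah cm_tp[OF cm_ah] by (simp add: cmD)
  have obs0: "tp ah * (Sg * Sg) + (Sg * Sg) * tp (tp ah) + ch * tp ch = 0"
    using lyap_red_obs by simp
  \<comment> \<open>Each factor \<open>Y1\<close> in \<open>bh * tp bh\<close> has norm at most
    \<beta> / s. Extracting one of them and using ey \<ge> 6 \<phi> \<beta> / s gives 6 \<phi> \<le>
    \<xi>1; extracting both and using eb2 \<ge> 2 (\<beta> / s) ey gives 12 \<phi> \<le>
    \<xi>2.\<close>
  have \<xi>_ge: "18 * \<phi> \<le> \<xi>1 + \<xi>2"
  proof -
    have one: "1 \<le> opn K1 * opn (bh * tp bh)"
    proof -
      have "norm (ide r) \<le> opn (ide r) * norm (ide r)" using norm_mult_opn[of "ide r" "ide r"] by simp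
      moreover have "norm (ide r) > 0" using norm_ide[of r] r by (metis of_nat_0_less_iff zero_less_power2 norm_ge_zero less_le)
      ultimately have "1 \<le> opn (ide r)" by simp
      then show ?thesis using lyapunov_opn_le[OF e K1 ctrl0 cm_ide] by linarith
    qed
    have 1: "1 \<le> opn K1 * (opn bh * (\<beta> / s * opn b))"
    proof -
      have "opn (bh * tp bh) \<le> opn bh * (\<beta> / s * opn b)" by (rule opn_mult_le) (simp_all add: bhb[simplified])
      then show ?thesis using one by (meson mult_left_mono opn_nonneg order_trans)
    qed
    have 2: "1 \<le> opn K1 * (\<beta> / s * opn (b * tp b) * (\<beta> / s))"
    proof -
      have "bh * tp bh = tp Y1 * (b * tp b) * Y1" by (simp add: bh_def mult.assoc)
      then have "opn (bh * tp bh) \<le> \<beta> / s * opn (b * tp b) * (\<beta> / s)"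
        by (simp only:) (intro opn_mult_le order_refl; simp only: opn_tp opn_bases)
      then show ?thesis using one by (meson mult_left_mono opn_nonneg order_trans)
    qed
    have y6: "6 * \<phi> * (\<beta> / s) \<le> ey" using ey\<phi> by (simp add: mult_ac)
    have "6 * \<phi> * 1 \<le> 6 * \<phi> * (opn K1 * (opn bh * (\<beta> / s * opn b)))"
      using 1 \<phi> by (intro mult_left_mono) auto
    also have "\<dots> = opn K1 * (opn bh * opn b * (6 * \<phi> * (\<beta> / s)))" by simp
    also have "\<dots> \<le> opn K1 * (opn bh * opn b * ey)" by (intro mult_left_mono y6) auto
    also have "\<dots> \<le> \<xi>1"
    proof -
      have "opn K1 * (opn bh * opn b * ey) \<le> opn K1 * (opn bh * opn b * ey + opn a * ea)"
        using ea0 by (intro mult_left_mono) auto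
      also have "\<dots> \<le> opn K1 / (1 - \<eta>1) * (opn bh * opn b * ey + opn a * ea)"
      proof (intro mult_right_mono)
        have "0 \<le> \<eta>1" using ea0 by (simp add: \<eta>)
        then show "opn K1 \<le> opn K1 / (1 - \<eta>1)" using \<eta>(3) by (simp add: pos_le_divide_eq mult_left_le)
      qed (use ea0 ey0 in auto)
      finally show ?thesis by (simp only: \<xi>1)
    qed
    finally have l1: "6 * \<phi> \<le> \<xi>1" by simp
    have "12 * \<phi> * 1 \<le> 12 * \<phi> * (opn K1 * (\<beta> / s * opn (b * tp b) * (\<beta> / s)))"
      using 2 \<phi> by (intro mult_left_mono) auto
    also have "\<dots> = opn K1 * (opn (b * tp b) * (2 * (\<beta> / s) * (6 * \<phi> * (\<beta> / s))))" by simp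
    also have "\<dots> \<le> opn K1 * (opn (b * tp b) * eb2)"
    proof (intro mult_left_mono)
      have "2 * (\<beta> / s) \<le> \<beta> * (1 / (s - \<epsilon>) + 1 / s)"
      proof -
        have "1 / s \<le> 1 / (s - \<epsilon>)" using s\<epsilon> \<epsilon>_bounds by (intro divide_left_mono) auto
        then have "\<beta> * (1 / s + 1 / s) \<le> \<beta> * (1 / (s - \<epsilon>) + 1 / s)" using e_nonneg by (intro mult_left_mono) auto
        then show ?thesis by simp
      qed
      then show "2 * (\<beta> / s) * (6 * \<phi> * (\<beta> / s)) \<le> eb2"
        unfolding eb2 by (rule mult_mono[OF _ y6]) (use bs \<phi> s\<epsilon> s_pos e_nonneg in \<open>intro mult_nonneg_nonneg add_nonneg_nonneg; simp\<close>)+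
    qed auto
    also have "\<dots> \<le> \<xi>2"
    proof -
      have eb20: "0 \<le> eb2" using ey0 e_nonneg s\<epsilon> s_pos by (simp add: eb2)
      have "opn K1 * (opn (b * tp b) * eb2) \<le> opn K1 * (opn (b * tp b) * eb2 + 2 * (opn a * ea))"
        using ea0 by (intro mult_left_mono) auto
      also have "\<dots> \<le> opn K1 / (1 - 2 * \<eta>1) * (opn (b * tp b) * eb2 + 2 * (opn a * ea))"
      proof (intro mult_right_mono)
        have "0 \<le> \<eta>1" using ea0 by (simp add: \<eta>)
        then show "opn K1 \<le> opn K1 / (1 - 2 * \<eta>1)" using \<eta>(3) by (simp add: pos_le_divide_eq mult_left_le)
      qed (use ea0 eb20 in auto)
      finally show ?thesis by (simp only: \<xi>2)
    qed
    finally have l2: "12 * \<phi> \<le> \<xi>2" by simp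
    show ?thesis using l1 l2 by simp
  qed
  have obs: "opn (- (ide r * Q * j * Z) - Sg * Sg) \<le> \<zeta>1 + 2 / 3 * \<phi> * s1\<^sup>2"
      "opn (Z * (tp j * Q * j) * Z - Sg * Sg) \<le> \<zeta>2 + 2 * \<phi> * s1\<^sup>2" "ide r * Q * ide r = Sg * Sg"
    if Q: "cm (r + r) (r + r) Q" and eq: "tp A * Q + Q * A + C * tp C = 0" for Q
  proof -
    have tA: "tp A = tp ah + j * tp ared * tp j" by (simp add: A_def mult.assoc)
    have eq': "(tp ah + j * tp ared * tp j) * Q + Q * tp (tp ah + j * tp ared * tp j) + (ch + j * (- cr)) * tp (ch + j * (- cr)) = 0"
      using eq unfolding tA[symmetric] C_def[symmetric] by simp
    have cmcr: "cm r p (- cr)" using cm_reduced(3) by auto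
    note L = block_lyapunov[OF cm_tp[OF cm_ah] cm_tp[OF cm_reduced(1)] cm_ch cmcr Q eq'[unfolded j_def], folded j_def]
    show "ide r * Q * ide r = Sg * Sg"
      by (rule lyapunov_unique[OF e' L(1) L(4) obs0 cmSS])
    \<comment> \<open>The second output block is \<open>- cr\<close>, so the cross block of
      \<open>Q\<close> approximates the negative of \<open>Sg * Sg\<close>; the sign makes it
      comparable.\<close>
    define X where "X = - (ide r * Q * j * Z)"
    define Y where "Y = Z * (tp j * Q * j) * Z"
    have cmX: "cm r r X" unfolding X_def using L(5) Z(1) by auto
    have cmY: "cm r r Y" unfolding Y_def using L(6) Z(1) by auto
    have tpD: "tp (tp ah + tp Dr) = W * ared * Z" by simp
    have X: "tp ah * X + X * tp (tp ah + tp Dr) + ch * tp c' = 0"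
    proof -
      have "tp ah * X + X * (W * ared * Z) + ch * tp c' =
          - ((tp ah * (ide r * Q * j) + (ide r * Q * j) * tp (tp ared) + ch * tp (- cr)) * Z)"
        using cm_reduced(1) L(5)
        by (simp add: X_def c'_def Z mult.assoc distrib_right distrib_left Z(6)[THEN mult_extend] cmD
            cmD(3)[OF cm_reduced(1)]) (simp add: algebra_simps)
      then show ?thesis unfolding tpD L(2) by simp
    qed
    have Y: "(tp ah + tp Dr) * Y + Y * tp (tp ah + tp Dr) + c' * tp c' = 0"
    proof -
      have tpD': "tp ah + tp Dr = Z * tp ared * W" using arg_cong[OF tpD, of tp] by (simp add: Z mult.assoc)
      have "(Z * tp ared * W) * Y + Y * (W * ared * Z) + c' * tp c' =
          Z * (tp ared * (tp j * Q * j) + (tp j * Q * j) * tp (tp ared) + (- cr) * tp (- cr)) * Z"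
        using L(6) cm_tp[OF cm_reduced(1)]
        by (simp add: Y_def c'_def Z mult.assoc distrib_right distrib_left Z(6,7)[THEN mult_extend] 
            cmD(3)[OF cm_reduced(1)] cmD(4)[OF cm_tp[OF cm_reduced(1)]])
      then show ?thesis unfolding tpD unfolding tpD' L(3) by simp
    qed
    have tDr: "opn (tp Dr) \<le> \<tau>" using Dr by (simp only: opn_tp)
    note c1 = cross_gain_le[OF _ a'0 k1(2) \<phi> \<tau>_def] and c2 = full_gain_le[OF _ a'0 k1(2) \<phi> \<tau>_def]
    have "opn (X - Sg * Sg) \<le> opn K2 / (1 - opn K2 * \<tau>) * (opn ch * opn (c' - ch) + s1\<^sup>2 * \<tau>)"
      by (rule lyapunov_compare_cross[OF e' K2' K2(2) obs0 cmSS opn_SS X cmX tDr c1(3)[of 0 0]]) auto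
    also have "\<dots> \<le> opn K2 / (1 - opn K2 * \<tau>) * (opn ch * (opn c * ex) + s1\<^sup>2 * \<tau>)"
      using c1(3)[of 0 0] by (intro mult_left_mono add_right_mono dc) auto
    also have "\<dots> \<le> opn K2 / (1 - opn K2 * a') * (opn ch * (opn c * ex) + a') + 2 / 3 * \<phi> * s1\<^sup>2"
      by (rule c1(1)) (use ex0 in auto)
    finally show "opn (- (ide r * Q * j * Z) - Sg * Sg) \<le> \<zeta>1 + 2 / 3 * \<phi> * s1\<^sup>2"
      by (simp add: X_def \<zeta>1 \<eta> a'_def mult.assoc)
    have "opn (Y - Sg * Sg) \<le> opn K2 / (1 - 2 * (opn K2 * \<tau>)) * (opn (c' * tp c' - ch * tp ch) + 2 * (s1\<^sup>2 * \<tau>))"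
      by (rule lyapunov_compare_full[OF e' K2' K2(2) obs0 cmSS opn_SS Y cmY tDr c2(3)[of 0 0]]) auto
    also have "\<dots> \<le> opn K2 / (1 - 2 * (opn K2 * \<tau>)) * (opn (c * tp c) * ec2 + 2 * (s1\<^sup>2 * \<tau>))"
      using c2(3)[of 0 0] by (intro mult_left_mono add_right_mono cc) auto
    also have "\<dots> \<le> opn K2 / (1 - 2 * (opn K2 * a')) * (opn (c * tp c) * ec2 + 2 * a') + 2 * \<phi> * s1\<^sup>2"
      by (rule c2(1)) (use ex0 e_nonneg in \<open>auto simp: ec2\<close>)
    finally show "opn (Z * (tp j * Q * j) * Z - Sg * Sg) \<le> \<zeta>2 + 2 * \<phi> * s1\<^sup>2"
      by (simp add: Y_def \<zeta>2 \<eta> a'_def)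
  qed
  have ctrl: "opn (ide r * P * j * W - ide r) \<le> \<phi> * \<xi>1"
      "opn (W * (tp j * P * j) * W - ide r) \<le> \<phi> * \<xi>2" "ide r * P * ide r = ide r"
    if P: "cm (r + r) (r + r) P" and eq: "A * P + P * tp A + B * tp B = 0" for P
  proof -
    note L = block_lyapunov[OF cm_ah cm_reduced(1) cm_bh cm_reduced(2) P eq[unfolded A_def B_def j_def], folded j_def]
    show "ide r * P * ide r = ide r"
      by (rule lyapunov_unique[OF e L(1) L(4) ctrl0 cm_ide])
    define X where "X = ide r * P * j * W"
    define Y where "Y = W * (tp j * P * j) * W"
    have cmX: "cm r r X" unfolding X_def using L(5) Z(2) by auto
    have cmY: "cm r r Y" unfolding Y_def using L(6) Z(2) by auto
    have tpD: "tp (ah + Dr) = Z * tp ared * W" by (simp add: Z mult.assoc)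
    have X: "ah * X + X * tp (ah + Dr) + bh * tp b' = 0"
    proof -
      have "ah * X + X * (Z * tp ared * W) + bh * tp b' =
          (ah * (ide r * P * j) + (ide r * P * j) * tp ared + bh * tp br) * W"
        by (simp add: X_def b'_def Z mult.assoc distrib_right distrib_left Z(7)[THEN mult_extend]
            cmD(3)[OF cm_tp[OF cm_reduced(1)]])
      then show ?thesis unfolding tpD L(2) by simp
    qed
    have Y: "(ah + Dr) * Y + Y * tp (ah + Dr) + b' * tp b' = 0"
    proof -
      have "(W * ared * Z) * Y + Y * (Z * tp ared * W) + b' * tp b' =
          W * (ared * (tp j * P * j) + (tp j * P * j) * tp ared + br * tp br) * W"
        by (simp add: Y_def b'_def Z mult.assoc distrib_right distrib_left Z(6,7)[THEN mult_extend]
            cmD(4)[OF cm_reduced(1)] cmD(3)[OF cm_tp[OF cm_reduced(1)]])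
      then show ?thesis unfolding L(3) sum tpD[unfolded sum] by simp
    qed
    have one: "opn (ide r) \<le> 1" by (rule opn_ide_le)
    note c1 = cross_gain_le[OF _ a'0 k1(1) \<phi> \<tau>_def] and c2 = full_gain_le[OF _ a'0 k1(1) \<phi> \<tau>_def]
    have "opn (X - ide r) \<le> opn K1 / (1 - opn K1 * \<tau>) * (opn bh * opn (b' - bh) + 1 * \<tau>)"
      by (rule lyapunov_compare_cross[OF e K1 ctrl0 cm_ide one X cmX Dr c1(3)[of 0 0]]) auto
    also have "\<dots> \<le> \<phi> * (opn K1 / (1 - opn K1 * a') * (opn bh * (opn b * ey) + a'))"
    proof (rule c1(2))
      have "opn bh * opn (b' - bh) \<le> opn bh * (3 / 4 * \<phi> * (opn b * ey))" by (intro mult_left_mono db) simp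
      also have "\<dots> \<le> \<phi> * (opn bh * (opn b * ey))" using \<phi> ey0 by (simp add: mult_ac mult_left_mono)
      finally show "opn bh * opn (b' - bh) \<le> \<phi> * (opn bh * (opn b * ey))" .
    qed (use ey0 in auto)
    finally show "opn (ide r * P * j * W - ide r) \<le> \<phi> * \<xi>1"
      by (simp add: X_def \<xi>1 \<eta> a'_def mult.assoc)
    have "opn (Y - ide r) \<le> opn K1 / (1 - 2 * (opn K1 * \<tau>)) * (opn (b' * tp b' - bh * tp bh) + 2 * (1 * \<tau>))"
      by (rule lyapunov_compare_full[OF e K1 ctrl0 cm_ide one Y cmY Dr c2(3)[of 0 0]]) auto
    also have "\<dots> \<le> \<phi> * (opn K1 / (1 - 2 * (opn K1 * a')) * (opn (b * tp b) * eb2 + 2 * a'))"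
      by (rule c2(2)[OF _ _ _ bb]) (use ey0 e_nonneg s\<epsilon> s_pos in \<open>auto simp: eb2\<close>)
    finally show "opn (W * (tp j * P * j) * W - ide r) \<le> \<phi> * \<xi>2"
      by (simp add: Y_def \<xi>2 \<eta> a'_def)
  qed
  \<comment> \<open>A controllability Gramian is rescaled by \<open>W\<close>, an observability
    Gramian inversely by \<open>Z\<close>.\<close>
  note WZ = Z(2,1,3,4,7,6)
  show "l \<le> 2 * s1\<^sup>2 * (\<xi>1 + \<xi>2) + 2 * (\<zeta>1 + \<zeta>2) + (\<xi>1 + \<xi>2) * (\<zeta>1 + \<zeta>2)"
    if P: "cm (r + r) (r + r) P" "tp P = P" "A * P + P * tp A + B * tp B = 0"
      and Q: "cm (r + r) (r + r) Q" "tp Q = Q" "tp A * Q + Q * A + C * tp C = 0"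
      and v: "P * (Q * v) = l *\<^sub>R v" "ide (r + r) * v = v" "v \<noteq> 0" for P Q l v
  proof -
    note p = ctrl[OF P(1,3)] and q = obs[OF Q(1,3)]
    have "l \<le> 2 * s1\<^sup>2 * (\<phi> * \<xi>1 + \<phi> * \<xi>2) + 2 * (\<zeta>1 + 2 / 3 * \<phi> * s1\<^sup>2 + (\<zeta>2 + 2 * \<phi> * s1\<^sup>2))
        + (\<phi> * \<xi>1 + \<phi> * \<xi>2) * (\<zeta>1 + 2 / 3 * \<phi> * s1\<^sup>2 + (\<zeta>2 + 2 * \<phi> * s1\<^sup>2))"
      by (rule error_gramian_product_bound[OF WZ P(1,2) p(3) Q(1,2) q(3) opn_SS cmSS
            p(1,2)[unfolded j_def] q(1,2)[unfolded j_def] v])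
    also have "\<dots> = 2 * s1\<^sup>2 * (\<phi> * (\<xi>1 + \<xi>2)) + 2 * ((\<zeta>1 + \<zeta>2) + 8 / 3 * \<phi> * s1\<^sup>2)
        + (\<phi> * (\<xi>1 + \<xi>2)) * ((\<zeta>1 + \<zeta>2) + 8 / 3 * \<phi> * s1\<^sup>2)" by (simp add: algebra_simps)
    also have "\<dots> \<le> 2 * s1\<^sup>2 * (\<xi>1 + \<xi>2) + 2 * (\<zeta>1 + \<zeta>2) + (\<xi>1 + \<xi>2) * (\<zeta>1 + \<zeta>2)"
      by (rule hankel_radicand_le) (use \<phi> \<xi>_ge \<xi>0 in auto)
    finally show ?thesis .
  qed
  show "inner (ide m) (tp B * Q * B) \<le> real (min r m) *
        (s1\<^sup>2 * (opn bh + opn br) * opn b * ey + (2 * opn bh * opn br * \<zeta>1 + (opn br)\<^sup>2 * \<zeta>2))"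
    if Q: "cm (r + r) (r + r) Q" "tp Q = Q" "tp A * Q + Q * A + C * tp C = 0" for Q
  proof -
    note q = obs[OF Q(1,3)]
    have "inner (ide m) (tp B * Q * B) \<le> real (min r m) * (s1\<^sup>2 * (opn (b' - bh))\<^sup>2
        + 2 * opn bh * opn b' * (\<zeta>1 + 2 / 3 * \<phi> * s1\<^sup>2) + (opn b')\<^sup>2 * (\<zeta>2 + 2 * \<phi> * s1\<^sup>2))"
      unfolding B_def j_def b'_def
      by (rule error_trace_bound[OF WZ Q(1,2) q(3) opn_SS cmSS q(1,2)[unfolded j_def] cm_bh cm_reduced(2)])
    also have "\<dots> \<le> real (min r m) * (s1\<^sup>2 * (opn bh + opn br) * (opn b * ey) + (2 * opn bh * opn br * \<zeta>1 + (opn br)\<^sup>2 * \<zeta>2))"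
    proof (intro mult_left_mono h2_radicand_le)
      show "opn (b' - bh) \<le> opn bh + opn b'" using opn_diff[of b' bh] by simp
      show "opn (b' - bh) \<le> 3 / 4 * \<phi> * (opn b * ey)" by (rule db)
      \<comment> \<open>From 4 \<epsilon> < s. Then 16/5 times 8/5 is 128/25, below the 6 in the
        lower bound of \<open>ey\<close>.\<close>
      have "5 / 8 * s \<le> w" using \<epsilon>_gap s' by simp
      then have "\<beta> / w \<le> \<beta> / (5 / 8 * s)" using e_nonneg s_pos w_pos by (intro divide_left_mono) auto
      then have "opn br \<le> 8 / 5 * (\<beta> / s) * opn b"
        using order_trans[OF brb mult_right_mono[OF _ opn_nonneg]] by fastforce
      then have "16 / 5 * (\<phi> * opn br) \<le> 16 / 5 * (\<phi> * (8 / 5 * (\<beta> / s) * opn b))"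
        using \<phi> by (intro mult_left_mono) auto
      also have "\<dots> = 128 / 25 * (opn b * (\<phi> * (\<beta> / s)))" by simp
      also have "\<dots> \<le> 6 * (opn b * (\<phi> * (\<beta> / s)))" using \<phi> bs by (intro mult_right_mono mult_nonneg_nonneg) auto
      also have "\<dots> = opn b * (6 * (\<beta> / s) * \<phi>)" by simp
      also have "\<dots> \<le> opn b * ey" using ey\<phi> by (intro mult_left_mono) auto
      finally show "16 / 5 * (\<phi> * opn br) \<le> opn b * ey" .
    qed (use \<phi> ybt \<xi>0 in auto)
    finally show ?thesis by (simp add: mult.assoc)
  qed
qed

end

section \<open>Partitioned singular value decompositions\<close>

text \<open>Applied to \<open>S\<close>, \<open>St\<close> and \<open>E\<close> with
  \<open>p\<close> equal to \<open>P\<close>, \<open>P\<close> and \<open>P - Pt\<close>, and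
  likewise on the side of \<open>Q\<close>.\<close>

lemma opn_factor_le:
  assumes "psd (p - a * tp a)"
  shows "opn a \<le> sqrt (opn p)"
proof -
  have "opn a \<le> sqrt \<bar>opn p\<bar>"
  proof (rule opn_sqrtI)
    fix x
    have "0 \<le> inner x ((p - a * tp a) * x)" using assms by (simp add: psd_def)
    then have "inner x (a * tp a * x) \<le> inner x (p * x)" by (simp add: left_diff_distrib inner_diff_right)
    also have "\<dots> \<le> norm x * norm (p * x)" by (rule norm_cauchy_schwarz)
    also have "\<dots> \<le> norm x * (opn p * norm x)" by (intro mult_left_mono norm_mult_opn) simp
    finally show "inner x (a * tp a * x) \<le> opn p * (norm x)\<^sup>2" by (simp add: power2_eq_square mult_ac)
  qed
  then show ?thesis by simp
qed

lemma opn_right_inverse_le: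
  assumes "0 < c" "a * b = ide r" "cm r k b" and ge: "\<And>x. ide r * x = x \<Longrightarrow> c * norm x \<le> norm (a * x)"
  shows "opn b \<le> 1 / c"
proof (rule opn_leI)
  fix x
  have "c * norm (b * x) \<le> norm (a * (b * x))"
    by (rule ge) (use assms(3) in \<open>simp add: cmD\<close>)
  also have "a * (b * x) = ide r * x" by (rule mult_extend) fact
  also have "norm (ide r * x) \<le> 1 * norm x"
    by (rule order_trans[OF norm_mult_opn]) (intro mult_right_mono opn_ide_le norm_ge_zero)
  finally show "norm (b * x) \<le> 1 / c * norm x" using assms(1) by (simp add: field_simps)
qed (use assms(1) in simp)

lemma cm_mult_sh:
  assumes "cm n r x"
  shows "x * sh r k = 0" "x * (sh r k * y) = 0" "tp (sh r k) * tp x = 0" "tp (sh r k) * (tp x * y) = 0"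
proof -
  have "x * sh r k = x * (ide r * sh r k)" using assms by (simp add: cmD)
  also have "ide r * sh r k = 0" using tp_sh_sh_0[of 0 r r k] by simp
  finally show *: "x * sh r k = 0" by simp
  from arg_cong[OF this, of tp] show **: "tp (sh r k) * tp x = 0" by simp
  show "x * (sh r k * y) = 0" "tp (sh r k) * (tp x * y) = 0" for y
    using *[THEN mult_extend] **[THEN mult_extend] by simp_all
qed

lemma append_gram:
  assumes x: "cm n k x" and y: "cm n l y"
  shows "(x + y * tp (sh k l)) * tp (x + y * tp (sh k l)) = x * tp x + y * tp y"
  by (simp add: distrib_left distrib_right mult.assoc cm_mult_sh[OF x] tp_sh_sh[THEN mult_extend] cmD[OF cm_tp[OF y]])

lemma block_product:
  assumes u: "cm m1 r u1" and v: "cm m2 r v1" "cm m2 l v2" and x: "cm r r x" and y: "cm k l y"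
  shows "(u1 + u2 * tp (sh r k)) * (x + sh r k * y * tp (sh r l)) * tp (v1 + v2 * tp (sh r l))
    = u1 * x * tp v1 + u2 * y * tp v2"
proof -
  have "tp (sh r k) * x = 0" "tp (sh r k) * (x * z) = 0" for z using cm_mult_sh(3,4)[OF cm_tp[OF x]] by simp_all
  then show ?thesis
    by (simp add: distrib_left distrib_right mult.assoc cm_mult_sh[OF u] cm_mult_sh[OF v(1)] cm_mult_sh[OF x]
        tp_sh_sh[THEN mult_extend] cmD[OF y] cmD[OF cm_tp[OF v(2)]] cmD[OF v(2)])
qed

text \<open>The Gram matrix of \<open>V1 + V2 * h\<close> is \<open>ide r + tp h * h\<close>, which
  \<open>W\<close> normalizes; the complement is rotated by the negative transpose of
  \<open>h\<close>, so the cross terms cancel.\<close>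

lemma rotated_basis:
  assumes V: "tp V1 * V1 = ide r" "tp V1 * V2 = 0" "tp V2 * V2 = ide k" and h: "cm k r h"
    and W: "tp W = W" "Z * Z = ide r + tp h * h" "Z * W = ide r" "W * Z = ide r" "cm r r W"
  shows "tp ((V1 + V2 * h) * W) * ((V1 + V2 * h) * W) = ide r"
    "tp ((- (V1 * tp h) + V2) * W') * ((V1 + V2 * h) * W) = 0"
proof -
  have V21: "tp V2 * V1 = 0" using arg_cong[OF V(2), of tp] by simp
  note rw = distrib_left distrib_right mult.assoc V V21 V[THEN mult_extend] V21[THEN mult_extend] W(1) cmD[OF h] cmD[OF W(5)]
  have "tp ((V1 + V2 * h) * W) * ((V1 + V2 * h) * W) = W * ((ide r + tp h * h) * W)"
    by (simp add: rw)
  also have "\<dots> = ide r" unfolding W(2)[symmetric] by (simp add: mult.assoc W(3,4) W(4)[THEN mult_extend] cmD[OF W(5)])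
  finally show "tp ((V1 + V2 * h) * W) * ((V1 + V2 * h) * W) = ide r" .
  show "tp ((- (V1 * tp h) + V2) * W') * ((V1 + V2 * h) * W) = 0"
    by (simp add: rw left_diff_distrib)
qed

text \<open>Extracts the two invariance relations of the leading pair from the given decomposition;
  these are what the locale asks of \<open>sc\<close>.\<close>

lemma svd_factor_intertwines:
  assumes G: "G = u1 * x * tp v1 + u2 * y * tp v2" and x: "cm r r x"
    and u: "tp u1 * u1 = ide r" "tp u2 * u1 = 0" and v: "tp v1 * v1 = ide r" "tp v2 * v1 = 0"
  shows "G * v1 = u1 * x" "tp G * u1 = v1 * tp x"
  using cmD[OF x] cmD[OF cm_tp[OF x]] by (simp_all add: G distrib_right mult.assoc u v)

theorem theorem4p3:
  fixes n m p r rt1 rt2 p1 p2 m1 m2 :: nat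
    and A B C P Q St Rt Pt Qt E F S R G Gt :: "real mat"
    and U U1 U2 V V1 V2 \<Sigma> \<Sigma>1 :: "real mat"
    and \<sigma> :: "nat \<Rightarrow> real"
    and \<Omega> \<Gamma> Uc1 Uc2 Vc1 Vc2 \<Sigma>c1 \<Sigma>c2 :: "real mat"
    and X1 Y1 Xt1 Yt1 Ah Bh Ch At Bt Ct K1 K2 :: "real mat"
    and Hbt Htbt Hd :: "complex \<Rightarrow> complex mat"
    and \<epsilon>1 \<epsilon>2 \<epsilon> \<delta> \<delta>_low \<sigma>r_low \<epsilon>x \<epsilon>y \<epsilon>a \<epsilon>b \<epsilon>c \<epsilon>b2 \<epsilon>c2 :: real
    and \<eta>1 \<eta>2 \<xi>1 \<xi>2 \<zeta>1 \<zeta>2 :: real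
  (* the system and its Gramians *)
  assumes A: "A \<in> carrier_mat n n" and B: "B \<in> carrier_mat n m" and C: "C \<in> carrier_mat n p"
    and "stable_mat A" and "controllable A B" and "observable A C"
    and "pos_def n P" and "is_ctrl_gramian A B P"
    and "pos_def n Q" and "is_obs_gramian A C Q"
  (* approximate Gramians *)
    and "St \<in> carrier_mat n rt1" and "Rt \<in> carrier_mat n rt2"
    and "Pt = St * transpose_mat St" and "Qt = Rt * transpose_mat Rt"
    and "pos_semidef n Pt" and "pos_semidef n (P - Pt)"
    and "pos_semidef n Qt" and "pos_semidef n (Q - Qt)"
    and "spec_norm (P - Pt) \<le> \<epsilon>1" and "spec_norm (Q - Qt) \<le> \<epsilon>2"
    and "E \<in> carrier_mat n p1" and "F \<in> carrier_mat n p2"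
    and "P = Pt + E * transpose_mat E" and "Q = Qt + F * transpose_mat F"
    and "S = St @\<^sub>c E" and "R = Rt @\<^sub>c F"
    and "m1 = rt1 + p1" and "m2 = rt2 + p2" and "m1 \<ge> m2"
    and "1 \<le> r" and "r \<le> n" and "rt1 \<ge> r" and "rt2 \<ge> r"
    and "G = transpose_mat S * R"
    and "Gt = four_block_mat (transpose_mat St * Rt) (0\<^sub>m rt1 p2) (0\<^sub>m p1 rt2) (0\<^sub>m p1 p2)"
  (* singular value decomposition of G *)
    and "U1 \<in> carrier_mat m1 r" and "U2 \<in> carrier_mat m1 (m1 - r)" and "U = U1 @\<^sub>c U2"
    and "V1 \<in> carrier_mat m2 r" and "V2 \<in> carrier_mat m2 (m2 - r)" and "V = V1 @\<^sub>c V2"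
    and "transpose_mat U * U = 1\<^sub>m m1" and "transpose_mat V * V = 1\<^sub>m m2"
    and "\<And>i j. 1 \<le> i \<Longrightarrow> i \<le> j \<Longrightarrow> j \<le> m2 \<Longrightarrow> \<sigma> j \<le> \<sigma> i"
    and "\<And>i. 1 \<le> i \<Longrightarrow> i \<le> m2 \<Longrightarrow> 0 \<le> \<sigma> i" and "\<And>i. m2 < i \<Longrightarrow> \<sigma> i = 0"
    and "\<Sigma> = rect_diag m1 m2 \<sigma>" and "\<Sigma>1 = rect_diag r r \<sigma>"
    and "G = U * \<Sigma> * transpose_mat V"
  (* quantities and standing assumption *)
    and "\<epsilon> = max (sqrt (spec_norm P * \<epsilon>2)) (sqrt (spec_norm Q * \<epsilon>1)) + sqrt (\<epsilon>1 * \<epsilon>2)"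
    and "\<delta> = \<sigma> r - \<sigma> (r + 1)" and "\<delta>_low = \<delta> - 2 * \<epsilon>" and "\<sigma>r_low = \<sigma> r - \<epsilon>"
    and "\<delta>_low > 0" and "\<epsilon> / \<delta>_low < 1 / 2"
  (* decomposition of the approximation of G *)
    and "\<Omega> \<in> carrier_mat (m2 - r) r" and "\<Gamma> \<in> carrier_mat (m1 - r) r"
    and "max (spec_norm \<Omega>) (spec_norm \<Gamma>) \<le> 2 * \<epsilon> / \<delta>_low"
    and "Uc1 = (U1 - U2 * \<Gamma>) * mat_inv (mat_sqrt (1\<^sub>m r + transpose_mat \<Gamma> * \<Gamma>))"
    and "Uc2 = (U1 * transpose_mat \<Gamma> + U2) * mat_inv (mat_sqrt (1\<^sub>m (m1 - r) + \<Gamma> * transpose_mat \<Gamma>))"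
    and "Vc1 = (V1 + V2 * \<Omega>) * mat_inv (mat_sqrt (1\<^sub>m r + transpose_mat \<Omega> * \<Omega>))"
    and "Vc2 = (- (V1 * transpose_mat \<Omega>) + V2) * mat_inv (mat_sqrt (1\<^sub>m (m2 - r) + \<Omega> * transpose_mat \<Omega>))"
    and "\<Sigma>c1 \<in> carrier_mat r r" and "\<Sigma>c2 \<in> carrier_mat (m1 - r) (m2 - r)"
    and "Gt = (Uc1 @\<^sub>c Uc2) * four_block_mat \<Sigma>c1 (0\<^sub>m r (m2 - r)) (0\<^sub>m (m1 - r) r) \<Sigma>c2
                * transpose_mat (Vc1 @\<^sub>c Vc2)"
  (* reduced models *)
    and "X1 = S * U1" and "Y1 = R * V1 * mat_inv \<Sigma>1"
    and "Xt1 = (St @\<^sub>c 0\<^sub>m n (m1 - rt1)) * Uc1"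
    and "Yt1 = (Rt @\<^sub>c 0\<^sub>m n (m2 - rt2)) * Vc1 * mat_inv \<Sigma>c1"
    and "Ah = transpose_mat Y1 * A * X1" and "Bh = transpose_mat Y1 * B"
    and "Ch = transpose_mat X1 * C"
    and "At = transpose_mat Yt1 * A * Xt1" and "Bt = transpose_mat Yt1 * B"
    and "Ct = transpose_mat Xt1 * C"
    and "Hbt = transfer_function Ah Bh Ch" and "Htbt = transfer_function At Bt Ct"
    and "Hd = (\<lambda>s. Hbt s - Htbt s)"
  (* error constants *)
    and "\<epsilon>x = sqrt \<epsilon>1 + sqrt (spec_norm P) * (2 * \<epsilon> / \<delta>_low)"
    and "\<epsilon>y = sqrt \<epsilon>2 / \<sigma> r
              + sqrt (spec_norm Q) / \<sigma> r
                * (1 + \<delta>_low / (2 * \<sigma>r_low) + 2 * \<sigma> 1 / \<sigma>r_low) * (2 * \<epsilon> / \<delta>_low)"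
    and "\<epsilon>a = sqrt (spec_norm P) * \<epsilon>y + sqrt (spec_norm Q) / \<sigma> r * \<epsilon>x"
    and "\<epsilon>b = \<epsilon>y" and "\<epsilon>c = \<epsilon>x"
    and "\<epsilon>b2 = sqrt (spec_norm Q) * (1 / \<sigma>r_low + 1 / \<sigma> r) * \<epsilon>y"
    and "\<epsilon>c2 = 2 * sqrt (spec_norm P) * \<epsilon>x"
    and "K1 = mat_integral r r (\<lambda>t. mat_exp (t \<cdot>\<^sub>m Ah) * mat_exp (t \<cdot>\<^sub>m transpose_mat Ah))"
    and "K2 = mat_integral r r (\<lambda>t. mat_exp (t \<cdot>\<^sub>m transpose_mat Ah) * mat_exp (t \<cdot>\<^sub>m Ah))"
    and "\<eta>1 = spec_norm A * spec_norm K1 * \<epsilon>a" and "\<eta>2 = spec_norm A * spec_norm K2 * \<epsilon>a"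
    and "\<xi>1 = spec_norm K1 / (1 - \<eta>1) * (spec_norm Bh * spec_norm B * \<epsilon>b + spec_norm A * \<epsilon>a)"
    and "\<xi>2 = spec_norm K1 / (1 - 2 * \<eta>1)
              * (spec_norm (B * transpose_mat B) * \<epsilon>b2 + 2 * spec_norm A * \<epsilon>a)"
    and "\<zeta>1 = spec_norm K2 / (1 - \<eta>2) * (spec_norm Ch * spec_norm C * \<epsilon>c + spec_norm A * \<epsilon>a)"
    and "\<zeta>2 = spec_norm K2 / (1 - 2 * \<eta>2)
              * (spec_norm (C * transpose_mat C) * \<epsilon>c2 + 2 * spec_norm A * \<epsilon>a)"
    and "\<eta>1 < 1 / 2" and "\<eta>2 < 1 / 2"
  shows "let Ad = four_block_mat Ah (0\<^sub>m r r) (0\<^sub>m r r) At;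
             Bd = Bh @\<^sub>r Bt;
             Cd = Ch @\<^sub>r (- Ct)
         in stable_realization Ad Bd Cd Hd \<and>
            hankel_norm Ad Bd Cd
              \<le> sqrt (2 * (\<sigma> 1)\<^sup>2 * (\<xi>1 + \<xi>2) + 2 * (\<zeta>1 + \<zeta>2) + (\<xi>1 + \<xi>2) * (\<zeta>1 + \<zeta>2)) \<and>
            h2_norm Ad Bd Cd
              \<le> sqrt (real (min r m))
                 * sqrt ((\<sigma> 1)\<^sup>2 * (spec_norm Bh + spec_norm Bt) * spec_norm B * \<epsilon>b
                         + (2 * spec_norm (transpose_mat Bh) * spec_norm Bt * \<zeta>1
                            + (spec_norm (transpose_mat Bt))\<^sup>2 * \<zeta>2))"
proof -
  note A = \<open>A \<in> carrier_mat n n\<close> and B = \<open>B \<in> carrier_mat n m\<close> and C = \<open>C \<in> carrier_mat n p\<close>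
  note St = \<open>St \<in> carrier_mat n rt1\<close> and Rt = \<open>Rt \<in> carrier_mat n rt2\<close>
    and E = \<open>E \<in> carrier_mat n p1\<close> and F = \<open>F \<in> carrier_mat n p2\<close>
    and U1 = \<open>U1 \<in> carrier_mat m1 r\<close> and U2 = \<open>U2 \<in> carrier_mat m1 (m1 - r)\<close>
    and V1 = \<open>V1 \<in> carrier_mat m2 r\<close> and V2 = \<open>V2 \<in> carrier_mat m2 (m2 - r)\<close>
    and \<Omega> = \<open>\<Omega> \<in> carrier_mat (m2 - r) r\<close> and \<Gamma> = \<open>\<Gamma> \<in> carrier_mat (m1 - r) r\<close>
    and \<Sigma>c1 = \<open>\<Sigma>c1 \<in> carrier_mat r r\<close> and \<Sigma>c2 = \<open>\<Sigma>c2 \<in> carrier_mat (m1 - r) (m2 - r)\<close>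
  have r: "0 < r" "r \<le> m1" "r \<le> m2"
    using \<open>1 \<le> r\<close> \<open>rt1 \<ge> r\<close> \<open>rt2 \<ge> r\<close> \<open>m1 = rt1 + p1\<close> \<open>m2 = rt2 + p2\<close> by auto
  have P: "P \<in> carrier_mat n n" and Q: "Q \<in> carrier_mat n n"
    using \<open>pos_def n P\<close> \<open>pos_def n Q\<close> by (simp_all add: pos_def_def)
  have Pt: "Pt \<in> carrier_mat n n" and Qt: "Qt \<in> carrier_mat n n"
    using \<open>Pt = _\<close> \<open>Qt = _\<close> St Rt by auto
  have S: "S \<in> carrier_mat n m1" and emS: "em S = em St + em E * tp (sh rt1 p1)"
    and R: "R \<in> carrier_mat n m2" and emR: "em R = em Rt + em F * tp (sh rt2 p2)"
    using em_append_cols[OF St E] em_append_cols[OF Rt F]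
      \<open>S = _\<close> \<open>R = _\<close> \<open>m1 = _\<close> \<open>m2 = _\<close> by auto
  have emPt: "em Pt = em St * tp (em St)" and emQt: "em Qt = em Rt * tp (em Rt)"
    using \<open>Pt = _\<close> \<open>Qt = _\<close> by (simp_all add: em_mult em_transpose)
  have emP: "em P = em Pt + em E * tp (em E)"
    unfolding \<open>P = _\<close> using Pt E by (simp add: em_add em_mult em_transpose)
  have emQ: "em Q = em Qt + em F * tp (em F)"
    unfolding \<open>Q = _\<close> using Qt F by (simp add: em_add em_mult em_transpose)
  have PS: "em P = em S * tp (em S)" and QR: "em Q = em R * tp (em R)"
    unfolding emS emR append_gram[OF cm_em[OF St] cm_em[OF E]] append_gram[OF cm_em[OF Rt] cm_em[OF F]]
    by (simp_all only: emP emQ emPt emQt)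
  define \<alpha> \<beta> e1 e2 where "\<alpha> = sqrt (spec_norm P)" and "\<beta> = sqrt (spec_norm Q)"
    and "e1 = sqrt \<epsilon>1" and "e2 = sqrt \<epsilon>2"
  have emdP: "em (P - Pt) = em P - em Pt" and emdQ: "em (Q - Qt) = em Q - em Qt"
    using P Q Pt Qt by (simp_all add: em_diff)
  have psd0: "psd 0" by (simp add: psd_def)
  have opnS: "opn (em S) \<le> \<alpha>" and opnR: "opn (em R) \<le> \<beta>"
    unfolding \<alpha>_def \<beta>_def spec_norm_em by (rule opn_factor_le; simp add: PS QR psd0)+
  have opnSt: "opn (em St) \<le> \<alpha>" and opnRt: "opn (em Rt) \<le> \<beta>"
    unfolding \<alpha>_def \<beta>_def spec_norm_em
    using opn_factor_le[of "em P" "em St"] opn_factor_le[of "em Q" "em Rt"]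
      pos_semidef_psd[OF \<open>pos_semidef n (P - Pt)\<close>] pos_semidef_psd[OF \<open>pos_semidef n (Q - Qt)\<close>]
    unfolding emdP emdQ emPt emQt by auto
  have "opn (em E) \<le> sqrt (opn (em (P - Pt)))" "opn (em F) \<le> sqrt (opn (em (Q - Qt)))"
    by (rule opn_factor_le; simp add: emdP emdQ emP emQ psd0)+
  then have opnE: "opn (em E) \<le> e1" and opnF: "opn (em F) \<le> e2"
    using \<open>spec_norm (P - Pt) \<le> \<epsilon>1\<close> \<open>spec_norm (Q - Qt) \<le> \<epsilon>2\<close>
    unfolding e1_def e2_def spec_norm_em by (meson order_trans real_sqrt_le_mono)+
  have nonneg: "0 \<le> \<alpha>" "0 \<le> \<beta>" "0 \<le> e1" "0 \<le> e2"
    using opnS opnR opnE opnF by (meson opn_nonneg order_trans)+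
  have \<epsilon>: "\<epsilon> = max (\<alpha> * e2) (\<beta> * e1) + e1 * e2"
    using \<open>\<epsilon> = _\<close> by (simp add: \<alpha>_def \<beta>_def e1_def e2_def real_sqrt_mult)
  have \<epsilon>0: "0 \<le> \<epsilon>" unfolding \<epsilon> using nonneg by (simp add: le_max_iff_disj)
  define d where "d = \<sigma> r - \<sigma> (r + 1) - 2 * \<epsilon>"
  have \<delta>_low: "\<delta>_low = d" using \<open>\<delta>_low = _\<close> \<open>\<delta> = _\<close> by (simp add: d_def)
  have d: "0 < d" "2 * \<epsilon> < d"
    using \<open>\<delta>_low > 0\<close> \<open>\<epsilon> / \<delta>_low < 1 / 2\<close> unfolding \<delta>_low by (simp_all add: field_simps)
  have \<epsilon>_gap: "4 * \<epsilon> < \<sigma> r - \<sigma> (r + 1)" using d by (simp add: d_def)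
  \<comment> \<open>If \<open>r = m2\<close>, the index \<open>r + 1\<close> lies beyond the
    singular values and the convention makes this entry 0.\<close>
  have s': "0 \<le> \<sigma> (r + 1)"
    using \<open>\<And>i. 1 \<le> i \<Longrightarrow> i \<le> m2 \<Longrightarrow> 0 \<le> \<sigma> i\<close>[of "r + 1"] \<open>\<And>i. m2 < i \<Longrightarrow> \<sigma> i = 0\<close>[of "r + 1"] by force
  have s: "0 < \<sigma> r" "\<epsilon> < \<sigma> r" "\<sigma> (r + 1) < \<sigma> r" using \<epsilon>_gap \<epsilon>0 s' by linarith+
  note \<sigma>_mono = \<open>\<And>i j. 1 \<le> i \<Longrightarrow> i \<le> j \<Longrightarrow> j \<le> m2 \<Longrightarrow> \<sigma> j \<le> \<sigma> i\<close>
    and \<sigma>_nonneg = \<open>\<And>i. 1 \<le> i \<Longrightarrow> i \<le> m2 \<Longrightarrow> 0 \<le> \<sigma> i\<close>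
  have s1: "\<sigma> r \<le> \<sigma> 1" using \<sigma>_mono[of 1 r] r by simp
  define \<Sigma>2 where "\<Sigma>2 = rect_diag (m1 - r) (m2 - r) (\<lambda>i. \<sigma> (i + r))"
  have \<Sigma>1: "\<Sigma>1 \<in> carrier_mat r r" and \<Sigma>2: "\<Sigma>2 \<in> carrier_mat (m1 - r) (m2 - r)" and \<Sigma>: "\<Sigma> \<in> carrier_mat m1 m2"
    using \<open>\<Sigma>1 = _\<close> \<open>\<Sigma> = _\<close> by (simp_all add: \<Sigma>2_def rect_diag_def)
  have \<Sigma>1_ge: "\<sigma> r * norm x \<le> norm (em \<Sigma>1 * x)" if "ide r * x = x" for x
    unfolding \<open>\<Sigma>1 = _\<close>
    by (rule norm_rect_diag_ge) (use s r \<sigma>_mono[of _ r] that in auto)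
  have "x = 0" if "cm r 1 x" "em \<Sigma>1 * x = 0" for x
    using \<Sigma>1_ge[of x] that s by (auto simp: cmD mult_le_0_iff)
  then have \<Sigma>1_inv: "mat_inv \<Sigma>1 \<in> carrier_mat r r" "em \<Sigma>1 * em (mat_inv \<Sigma>1) = ide r" "em (mat_inv \<Sigma>1) * em \<Sigma>1 = ide r"
    by (intro em_mat_inv[OF \<Sigma>1]; blast)+
  have opnSi: "opn (em (mat_inv \<Sigma>1)) \<le> 1 / \<sigma> r"
    by (rule opn_right_inverse_le[OF s(1) \<Sigma>1_inv(2) cm_em[OF \<Sigma>1_inv(1)] \<Sigma>1_ge])
  have opnSg: "opn (em \<Sigma>1) \<le> \<sigma> 1"
    unfolding \<open>\<Sigma>1 = _\<close> by (rule opn_rect_diag) (use r s s1 \<sigma>_mono[of 1] \<sigma>_nonneg in auto)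
  have opnSg2: "opn (em \<Sigma>2) \<le> \<sigma> (r + 1)"
    unfolding \<Sigma>2_def by (rule opn_rect_diag) (use r s' \<sigma>_mono[of "r + 1"] \<sigma>_nonneg in auto)
  have tSg: "tp (em \<Sigma>1) = em \<Sigma>1" and Sg_diag: "\<And>i j. i \<noteq> j \<Longrightarrow> ent (em \<Sigma>1) i j = 0"
    unfolding \<open>\<Sigma>1 = _\<close> by (auto intro!: fmat_eqI simp: ent_em rect_diag_def)
  have Sg_ge: "\<And>i. i < r \<Longrightarrow> \<sigma> r \<le> ent (em \<Sigma>1) i i"
    unfolding \<open>\<Sigma>1 = _\<close> using r \<sigma>_mono[of _ r] by (auto simp: ent_em rect_diag_def)
  have U: "U \<in> carrier_mat m1 m1" "em U = em U1 + em U2 * tp (sh r (m1 - r))"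
    and V: "V \<in> carrier_mat m2 m2" "em V = em V1 + em V2 * tp (sh r (m2 - r))"
    using em_append_cols[OF U1 U2] em_append_cols[OF V1 V2] r \<open>U = _\<close> \<open>V = _\<close> by auto
  note oU = orthogonal_blocks[OF U1 U2 \<open>transpose_mat U * U = 1\<^sub>m m1\<close>[unfolded \<open>U = _\<close>] r(2)]
  note oV = orthogonal_blocks[OF V1 V2 \<open>transpose_mat V * V = 1\<^sub>m m2\<close>[unfolded \<open>V = _\<close>] r(3)]
  have em\<Sigma>: "em \<Sigma> = em \<Sigma>1 + sh r (m1 - r) * em \<Sigma>2 * tp (sh r (m2 - r))"
    unfolding \<open>\<Sigma> = _\<close> \<open>\<Sigma>1 = _\<close> \<Sigma>2_def by (rule rect_diag_split[OF r(2,3)])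
  have svd: "tp (em S) * em R = em U1 * em \<Sigma>1 * tp (em V1) + em U2 * em \<Sigma>2 * tp (em V2)"
  proof -
    have "tp (em S) * em R = em U * em \<Sigma> * tp (em V)"
      using arg_cong[OF \<open>G = U * \<Sigma> * transpose_mat V\<close>, of em] S R U V \<Sigma>
      unfolding \<open>G = transpose_mat S * R\<close> by (simp add: em_mult em_transpose mult.assoc)
    then show ?thesis
      unfolding U(2) V(2) em\<Sigma> block_product[OF cm_em[OF U1] cm_em[OF V1] cm_em[OF V2] cm_em[OF \<Sigma>1] cm_em[OF \<Sigma>2]] .
  qed
  define ZU ZV where "ZU = mat_sqrt (1\<^sub>m r + transpose_mat \<Gamma> * \<Gamma>)" and "ZV = mat_sqrt (1\<^sub>m r + transpose_mat \<Omega> * \<Omega>)"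
  note fU = cos_factor[OF \<Gamma>, folded ZU_def] and fV = cos_factor[OF \<Omega>, folded ZV_def]
  define wU wV where "wU = mat_inv (mat_sqrt (1\<^sub>m (m1 - r) + \<Gamma> * transpose_mat \<Gamma>))"
    and "wV = mat_inv (mat_sqrt (1\<^sub>m (m2 - r) + \<Omega> * transpose_mat \<Omega>))"
  have wU: "wU \<in> carrier_mat (m1 - r) (m1 - r)" and wV: "wV \<in> carrier_mat (m2 - r) (m2 - r)"
    using cos_factor(2)[of "transpose_mat \<Gamma>" r "m1 - r"] cos_factor(2)[of "transpose_mat \<Omega>" r "m2 - r"] \<Gamma> \<Omega>
    by (simp_all add: wU_def wV_def)
  have Uc1: "Uc1 \<in> carrier_mat m1 r" "em Uc1 = (em U1 - em U2 * em \<Gamma>) * em (mat_inv ZU)"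
    using U1 U2 \<Gamma> fU(2) unfolding \<open>Uc1 = _\<close> ZU_def[symmetric] by (auto simp: em_mult em_diff)
  have Vc1: "Vc1 \<in> carrier_mat m2 r" "em Vc1 = (em V1 + em V2 * em \<Omega>) * em (mat_inv ZV)"
    using V1 V2 \<Omega> fV(2) unfolding \<open>Vc1 = _\<close> ZV_def[symmetric] by (auto simp: em_mult em_add)
  \<comment> \<open>Written with \<open>- em \<Gamma>\<close>, so that \<open>rotated_basis\<close>
    covers the left basis, whose sign convention is opposite to the right one.\<close>
  have Uc2: "Uc2 \<in> carrier_mat m1 (m1 - r)" "em Uc2 = (- (em U1 * tp (- em \<Gamma>)) + em U2) * em wU"
    using U1 U2 \<Gamma> wU unfolding \<open>Uc2 = _\<close> wU_def[symmetric] by (auto simp: em_mult em_add em_transpose)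
  have Vc2: "Vc2 \<in> carrier_mat m2 (m2 - r)" "em Vc2 = (- (em V1 * tp (em \<Omega>)) + em V2) * em wV"
    using V1 V2 \<Omega> wV unfolding \<open>Vc2 = _\<close> wV_def[symmetric] by (auto simp: em_mult em_add em_transpose em_uminus)
  have emGt: "tp (em St) * em Rt = em Uc1 * em \<Sigma>c1 * tp (em Vc1) + em Uc2 * em \<Sigma>c2 * tp (em Vc2)"
  proof -
    have "tp (em St) * em Rt = em Gt"
      using St Rt em_four_block[of "transpose_mat St * Rt" rt1 rt2 "0\<^sub>m rt1 p2" p2 "0\<^sub>m p1 rt2" p1 "0\<^sub>m p1 p2"]
      unfolding \<open>Gt = four_block_mat _ _ _ _\<close> by (simp add: em_mult em_transpose)
    also have "\<dots> = em (Uc1 @\<^sub>c Uc2) * em (four_block_mat \<Sigma>c1 (0\<^sub>m r (m2 - r)) (0\<^sub>m (m1 - r) r) \<Sigma>c2)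
        * tp (em (Vc1 @\<^sub>c Vc2))"
      using em_append_cols(2)[OF Uc1(1) Uc2(1)] em_append_cols(2)[OF Vc1(1) Vc2(1)] \<Sigma>c1 \<Sigma>c2 r
      unfolding \<open>Gt = _ * transpose_mat (Vc1 @\<^sub>c Vc2)\<close> by (simp add: em_mult em_transpose)
    also have "em (four_block_mat \<Sigma>c1 (0\<^sub>m r (m2 - r)) (0\<^sub>m (m1 - r) r) \<Sigma>c2)
        = em \<Sigma>c1 + sh r (m1 - r) * em \<Sigma>c2 * tp (sh r (m2 - r))"
      using \<Sigma>c1 \<Sigma>c2 by (simp add: em_four_block[of _ r r _ "m2 - r" _ "m1 - r"])
    finally show ?thesis
      unfolding em_append_cols(1)[OF Uc1(1) Uc2(1)] em_append_cols(1)[OF Vc1(1) Vc2(1)]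
        block_product[OF cm_em[OF Uc1(1)] cm_em[OF Vc1(1)] cm_em[OF Vc2(1)] cm_em[OF \<Sigma>c1] cm_em[OF \<Sigma>c2]] .
  qed
  have "tp (em Uc1) * em Uc1 = ide r" "tp (em Uc2) * em Uc1 = 0"
    using rotated_basis(1)[OF oU(1-3) cm_uminus[OF cm_em[OF \<Gamma>]] fU(4) _ fU(6,7) cm_em[OF fU(2)]]
      rotated_basis(2)[OF oU(1-3) cm_uminus[OF cm_em[OF \<Gamma>]] fU(4) _ fU(6,7) cm_em[OF fU(2)], of "em wU"] fU(5)
    unfolding Uc1(2) Uc2(2) by simp_all
  moreover have "tp (em Vc1) * em Vc1 = ide r" "tp (em Vc2) * em Vc1 = 0"
    using rotated_basis(1)[OF oV(1-3) cm_em[OF \<Omega>] fV(4,5,6,7) cm_em[OF fV(2)]]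
      rotated_basis(2)[OF oV(1-3) cm_em[OF \<Omega>] fV(4,5,6,7) cm_em[OF fV(2)], of "em wV"]
    unfolding Vc1(2) Vc2(2) by simp_all
  ultimately have sc: "tp (em St) * em Rt * ((em V1 + em V2 * em \<Omega>) * em (mat_inv ZV))
      = (em U1 - em U2 * em \<Gamma>) * em (mat_inv ZU) * em \<Sigma>c1"
    "tp (em Rt) * em St * ((em U1 - em U2 * em \<Gamma>) * em (mat_inv ZU))
      = (em V1 + em V2 * em \<Omega>) * em (mat_inv ZV) * tp (em \<Sigma>c1)"
    using svd_factor_intertwines[OF emGt cm_em[OF \<Sigma>c1]] unfolding Uc1(2) Vc1(2) by simp_all
  \<comment> \<open>The standing assumption makes the tangents of the principal angles at most
    1.\<close>
  have "2 * \<epsilon> / \<delta>_low \<le> 1" using d unfolding \<delta>_low by simp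
  then have opngh: "opn (em \<Gamma>) \<le> 1" "opn (em \<Omega>) \<le> 1"
    using \<open>max (spec_norm \<Omega>) (spec_norm \<Gamma>) \<le> 2 * \<epsilon> / \<delta>_low\<close> unfolding spec_norm_em by linarith+
  have lyap_P: "em A * em P + em P * tp (em A) + em B * tp (em B) = 0"
    using \<open>is_ctrl_gramian A B P\<close>[unfolded is_ctrl_gramian_def, THEN conjunct2, THEN arg_cong, of em] A B P
    by (simp add: em_add em_mult em_transpose)
  have lyap_Q: "tp (em A) * em Q + em Q * em A + em C * tp (em C) = 0"
    using \<open>is_obs_gramian A C Q\<close>[unfolded is_obs_gramian_def, THEN conjunct2, THEN arg_cong, of em] A C Q
    by (simp add: em_add em_mult em_transpose)
  have j: "em St * sh rt1 p1 = 0" "em Rt * sh rt2 p2 = 0"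
    using cm_mult_sh(1) cm_em St Rt by blast+
  note tsh = tp_sh_sh[of rt1 p1] tp_sh_sh[of rt2 p2]
  have jc: "cm m1 p1 (sh rt1 p1)" "cm m2 p2 (sh rt2 p2)" using \<open>m1 = _\<close> \<open>m2 = _\<close> by (simp_all add: cm_sh)
  note cms = A[THEN cm_em] B[THEN cm_em] C[THEN cm_em] S[THEN cm_em] R[THEN cm_em] U1[THEN cm_em] U2[THEN cm_em]
    V1[THEN cm_em] V2[THEN cm_em] \<Sigma>1[THEN cm_em] \<Sigma>1_inv(1)[THEN cm_em] \<Sigma>2[THEN cm_em]
    E[THEN cm_em] F[THEN cm_em] \<Gamma>[THEN cm_em] \<Omega>[THEN cm_em] \<Sigma>c1[THEN cm_em]
    fU(1,2)[THEN cm_em] fV(1,2)[THEN cm_em]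
  interpret t: perturbed_truncation n m p m1 m2 "m1 - r" "m2 - r" r "em A" "em B" "em C" "em P" "em Q" "em S" "em R"
    "em U1" "em U2" "em V1" "em V2" "em \<Sigma>1" "em (mat_inv \<Sigma>1)" "em \<Sigma>2" "\<sigma> r" "\<sigma> (r + 1)" "\<sigma> 1"
    "em St" "em Rt" "em E" "em F" "sh rt1 p1" "sh rt2 p2" "em \<Gamma>" "em \<Omega>" "em (mat_inv ZU)" "em ZU" "em (mat_inv ZV)" "em ZV"
    "em \<Sigma>c1" p1 p2 \<alpha> \<beta> e1 e2 \<epsilon>
    by unfold_locales (fact cms PS QR lyap_P lyap_Q svd oU oV tSg \<Sigma>1_inv Sg_diag Sg_ge opnSi opnSg opnSg2 s' s emS emR j tsh jc
      opnS opnSt opnR opnRt opnE opnF \<epsilon> \<epsilon>_gap r opngh fU fV sc)+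
  \<comment> \<open>Nonsingularity of \<open>\<Sigma>c1\<close> follows from the lower bound on its
    singular values proved in the first locale; only then can its inverse be supplied to the
    second.\<close>
  have "x = 0" if "cm r 1 x" "em \<Sigma>c1 * x = 0" for x
    using t.norm_sc_ge[of x] that \<epsilon>_gap \<epsilon>0 s' by (auto simp: cmD mult_le_0_iff)
  then have \<Sigma>c1_inv: "mat_inv \<Sigma>c1 \<in> carrier_mat r r" "em \<Sigma>c1 * em (mat_inv \<Sigma>c1) = ide r" "em (mat_inv \<Sigma>c1) * em \<Sigma>c1 = ide r"
    by (intro em_mat_inv[OF \<Sigma>c1]; blast)+
  interpret t: reduced_truncation n m p m1 m2 "m1 - r" "m2 - r" r "em A" "em B" "em C" "em P" "em Q" "em S" "em R"
    "em U1" "em U2" "em V1" "em V2" "em \<Sigma>1" "em (mat_inv \<Sigma>1)" "em \<Sigma>2" "\<sigma> r" "\<sigma> (r + 1)" "\<sigma> 1"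
    "em St" "em Rt" "em E" "em F" "sh rt1 p1" "sh rt2 p2" "em \<Gamma>" "em \<Omega>" "em (mat_inv ZU)" "em ZU" "em (mat_inv ZV)" "em ZV"
    "em \<Sigma>c1" p1 p2 \<alpha> \<beta> e1 e2 \<epsilon> "em (mat_inv \<Sigma>c1)"
    by unfold_locales (fact \<Sigma>c1_inv cm_em[OF \<Sigma>c1_inv(1)])+
  have X1: "X1 \<in> carrier_mat n r" "em X1 = t.X1"
    using S U1 unfolding \<open>X1 = _\<close> by (auto simp: em_mult t.X1_def)
  have Y1: "Y1 \<in> carrier_mat n r" "em Y1 = t.Y1"
    using R V1 \<Sigma>1_inv(1) unfolding \<open>Y1 = _\<close> by (auto simp: em_mult t.Y1_def mult.assoc)
  have Ah: "Ah \<in> carrier_mat r r" "em Ah = t.ah"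
    using X1 Y1 A unfolding \<open>Ah = _\<close> by (auto simp: em_mult em_transpose t.ah_def mult.assoc)
  have Bh: "Bh \<in> carrier_mat r m" "em Bh = t.bh"
    using Y1 B unfolding \<open>Bh = _\<close> by (auto simp: em_mult em_transpose t.bh_def)
  have Ch: "Ch \<in> carrier_mat r p" "em Ch = t.ch"
    using X1 C unfolding \<open>Ch = _\<close> by (auto simp: em_mult em_transpose t.ch_def)
  \<comment> \<open>The added zero columns are invisible after embedding, so the padded factors are
    \<open>St\<close> and \<open>Rt\<close> themselves.\<close>
  have pad: "St @\<^sub>c 0\<^sub>m n (m1 - rt1) \<in> carrier_mat n m1" "em (St @\<^sub>c 0\<^sub>m n (m1 - rt1)) = em St"
    "Rt @\<^sub>c 0\<^sub>m n (m2 - rt2) \<in> carrier_mat n m2" "em (Rt @\<^sub>c 0\<^sub>m n (m2 - rt2)) = em Rt"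
    using em_append_cols[OF St zero_carrier_mat, of "m1 - rt1"] em_append_cols[OF Rt zero_carrier_mat, of "m2 - rt2"]
      \<open>m1 = _\<close> \<open>m2 = _\<close> by simp_all
  have Xt1: "Xt1 \<in> carrier_mat n r" "em Xt1 = t.Xt"
    using pad Uc1 unfolding \<open>Xt1 = _\<close> by (auto simp: em_mult t.Xt_def t.Uc_def)
  have Yt1: "Yt1 \<in> carrier_mat n r" "em Yt1 = t.Yt"
    using pad Vc1 \<Sigma>c1_inv(1) unfolding \<open>Yt1 = _\<close> by (auto simp: em_mult t.Yt_def t.Vc_def mult.assoc)
  have At: "At \<in> carrier_mat r r" "em At = t.ared"
    using Xt1 Yt1 A unfolding \<open>At = _\<close> by (auto simp: em_mult em_transpose t.ared_def mult.assoc)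
  have Bt: "Bt \<in> carrier_mat r m" "em Bt = t.br"
    using Yt1 B unfolding \<open>Bt = _\<close> by (auto simp: em_mult em_transpose)
  have Ct: "Ct \<in> carrier_mat r p" "em Ct = t.cr"
    using Xt1 C unfolding \<open>Ct = _\<close> by (auto simp: em_mult em_transpose)
  have "stable_mat Ah" by (rule t.truncation_stable[OF refl A \<open>stable_mat A\<close> Ah(2,1)])
  from stable_mat_expdecay[OF Ah(1) this] have e: "expdecay r t.ah (\<lambda>t. em (mat_exp (t \<cdot>\<^sub>m Ah)))"
    by (simp only: Ah(2))
  have AhT: "transpose_mat Ah \<in> carrier_mat r r" using Ah by simp
  note ce = mat_exp_carrier[OF Ah(1)] mat_exp_carrier[OF AhT]
  have K1: "t.ah * em K1 + em K1 * tp t.ah + ide r = 0" "cm r r (em K1)"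
  proof -
    have g: "em (mat_exp (t \<cdot>\<^sub>m Ah) * mat_exp (t \<cdot>\<^sub>m transpose_mat Ah))
        = em (mat_exp (t \<cdot>\<^sub>m Ah)) * tp (em (mat_exp (t \<cdot>\<^sub>m Ah)))" for t
      using ce[of t] Ah by (simp add: em_mult em_mat_exp_transpose)
    show "t.ah * em K1 + em K1 * tp t.ah + ide r = 0" "cm r r (em K1)"
      unfolding \<open>K1 = _\<close> using em_mat_integral[OF e mult_carrier_mat[OF ce] g] by simp_all
  qed
  have K2: "tp t.ah * em K2 + em K2 * t.ah + ide r = 0" "cm r r (em K2)"
  proof -
    have g: "em (mat_exp (t \<cdot>\<^sub>m transpose_mat Ah) * mat_exp (t \<cdot>\<^sub>m Ah))
        = tp (em (mat_exp (t \<cdot>\<^sub>m Ah))) * tp (tp (em (mat_exp (t \<cdot>\<^sub>m Ah))))" for t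
      using ce[of t] Ah by (simp add: em_mult em_mat_exp_transpose)
    show "tp t.ah * em K2 + em K2 * t.ah + ide r = 0" "cm r r (em K2)"
      unfolding \<open>K2 = _\<close> using em_mat_integral[OF expdecay_tp[OF e] mult_carrier_mat[OF ce(2,1)] g] by simp_all
  qed
  have ec: "2 * \<alpha> * (\<epsilon> / d) \<le> \<epsilon>x" "6 * (\<beta> / \<sigma> r) * (\<epsilon> / d) \<le> \<epsilon>y"
    "\<alpha> * (\<beta> / \<sigma> r) * (4 + (2 * \<epsilon> + d / 2) / (\<sigma> r - \<epsilon>)) * (2 * (\<epsilon> / d)) \<le> \<epsilon>a"
    by (rule error_constants_lower[OF nonneg \<epsilon>0 d(1) s(2) s1];
        simp only: \<open>\<epsilon>x = _\<close> \<open>\<epsilon>y = _\<close> \<open>\<epsilon>a = _\<close> \<alpha>_def \<beta>_def e1_def e2_def \<delta>_low \<open>\<sigma>r_low = _\<close>)+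
  note sn = spec_norm_em Ah(2) Bh(2) Ch(2) At(2) Bt(2) Ct(2) \<open>\<epsilon>b = _\<close> \<open>\<epsilon>c = _\<close>
  have emBB: "em (B * transpose_mat B) = em B * tp (em B)" "em (C * transpose_mat C) = em C * tp (em C)"
    by (simp_all add: em_mult em_transpose)
  have \<eta>: "\<eta>1 = opn (em K1) * (opn (em A) * \<epsilon>a)" "\<eta>2 = opn (em K2) * (opn (em A) * \<epsilon>a)"
    using \<open>\<eta>1 = _\<close> \<open>\<eta>2 = _\<close> by (simp_all add: spec_norm_em)
  have \<xi>1: "\<xi>1 = opn (em K1) / (1 - \<eta>1) * (opn t.bh * opn (em B) * \<epsilon>y + opn (em A) * \<epsilon>a)"
    using \<open>\<xi>1 = _\<close> by (simp only: sn)
  have \<xi>2: "\<xi>2 = opn (em K1) / (1 - 2 * \<eta>1) * (opn (em B * tp (em B)) * \<epsilon>b2 + 2 * (opn (em A) * \<epsilon>a))"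
    using \<open>\<xi>2 = _\<close> by (simp only: sn emBB mult.assoc)
  have \<zeta>1: "\<zeta>1 = opn (em K2) / (1 - \<eta>2) * (opn t.ch * opn (em C) * \<epsilon>x + opn (em A) * \<epsilon>a)"
    using \<open>\<zeta>1 = _\<close> by (simp only: sn)
  have \<zeta>2: "\<zeta>2 = opn (em K2) / (1 - 2 * \<eta>2) * (opn (em C * tp (em C)) * \<epsilon>c2 + 2 * (opn (em A) * \<epsilon>a))"
    using \<open>\<zeta>2 = _\<close> by (simp only: sn emBB mult.assoc)
  have \<epsilon>2': "\<epsilon>b2 = \<beta> * (1 / (\<sigma> r - \<epsilon>) + 1 / \<sigma> r) * \<epsilon>y" "\<epsilon>c2 = 2 * \<alpha> * \<epsilon>x"
    using \<open>\<epsilon>b2 = _\<close> \<open>\<epsilon>c2 = _\<close> \<open>\<sigma>r_low = _\<close> by (simp_all add: \<alpha>_def \<beta>_def)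
  note bounds = t.error_system_bounds[OF e K1 K2 ec[unfolded d_def] \<epsilon>2' \<eta> \<open>\<eta>1 < 1 / 2\<close> \<open>\<eta>2 < 1 / 2\<close> \<xi>1 \<xi>2 \<zeta>1 \<zeta>2]
  define Ad Bd Cd where "Ad = four_block_mat Ah (0\<^sub>m r r) (0\<^sub>m r r) At" and "Bd = Bh @\<^sub>r Bt" and "Cd = Ch @\<^sub>r (- Ct)"
  have stable: "stable_mat Ad"
    unfolding Ad_def by (rule stable_mat_block_diag[OF Ah(1) At(1) \<open>stable_mat Ah\<close> bounds(1)[OF At]])
  have Ad: "Ad \<in> carrier_mat (r + r) (r + r)" "em Ad = t.ah + sh r r * t.ared * tp (sh r r)"
    using Ah At em_four_block[OF Ah(1) zero_carrier_mat zero_carrier_mat At(1)] by (auto simp: Ad_def)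
  have mCt: "- Ct \<in> carrier_mat r p" using Ct by simp
  have Bd: "Bd \<in> carrier_mat (r + r) m" "em Bd = t.bh + sh r r * t.br"
    and Cd: "Cd \<in> carrier_mat (r + r) p" "em Cd = t.ch + sh r r * (- t.cr)"
    using em_append_rows[OF Bh(1) Bt(1)] em_append_rows[OF Ch(1) mCt] Bh Bt Ch Ct
    by (simp_all add: Bd_def Cd_def em_uminus)
  note gP = ctrl_gramian_correct[OF Ad(1) stable Bd(1)] and gQ = obs_gramian_correct[OF Ad(1) stable Cd(1)]
  have tps: "tp (em (ctrl_gramian Ad Bd)) = em (ctrl_gramian Ad Bd)" "tp (em (obs_gramian Ad Cd)) = em (obs_gramian Ad Cd)"
    using gP(2) gQ(2) by (simp_all add: psd_def)
  have "stable_realization Ad Bd Cd Hd"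
    using stable transfer_function_diff[OF Ah(1) At(1) Bh(1) Bt(1) Ch(1) Ct(1)]
    unfolding stable_realization_def \<open>Hd = _\<close> \<open>Hbt = _\<close> \<open>Htbt = _\<close> Ad_def Bd_def Cd_def by blast
  moreover have "hankel_norm Ad Bd Cd
      \<le> sqrt (2 * (\<sigma> 1)\<^sup>2 * (\<xi>1 + \<xi>2) + 2 * (\<zeta>1 + \<zeta>2) + (\<xi>1 + \<xi>2) * (\<zeta>1 + \<zeta>2))"
    by (rule hankel_norm_leI[OF Ad(1) stable Bd(1) Cd(1)], use r in simp)
       (rule bounds(2)[OF cm_em[OF gP(1)] tps(1) gP(3)[unfolded Ad Bd] cm_em[OF gQ(1)] tps(2) gQ(3)[unfolded Ad Cd]])
  moreover have "h2_norm Ad Bd Cd \<le> sqrt (real (min r m))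
      * sqrt ((\<sigma> 1)\<^sup>2 * (spec_norm Bh + spec_norm Bt) * spec_norm B * \<epsilon>b
        + (2 * spec_norm (transpose_mat Bh) * spec_norm Bt * \<zeta>1 + (spec_norm (transpose_mat Bt))\<^sup>2 * \<zeta>2))"
  proof -
    have tn: "spec_norm (transpose_mat Bh) = opn t.bh" "spec_norm (transpose_mat Bt) = opn t.br"
      unfolding spec_norm_em em_transpose opn_tp Bh(2) Bt(2) by (rule refl)+
    show ?thesis
      unfolding h2_norm_em[OF Ad(1) stable Bd(1) Cd(1)] tn
      unfolding sn Bd(2)
      unfolding real_sqrt_mult[symmetric]
      by (rule real_sqrt_le_mono) (rule bounds(3)[OF cm_em[OF gQ(1)] tps(2) gQ(3)[unfolded Ad Cd]])
  qed
  ultimately show ?thesis unfolding Let_def Ad_def Bd_def Cd_def by blast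
qed

end
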